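(* Let $\Omega$ be a doubly periodic domain with periodic cell $\varpi$, satisfying assumption $(\mathcal{A})$ (both as defined in the context), and let $a\in L^\infty(\Omega)$ satisfy $a(z)=a(z+1)=a(z+i)$ for almost all $z\in\Omega$. Then the essential spectrum of the Toeplitz operator $T_a:A^2(\Omega)\to A^2(\Omega)$ is given by $$\sigma_{\mathrm{ess}}(T_a)=\bigcup_{\eta\in\mathbf{Q}}\sigma(T_{a,\eta}),$$ where $\sigma(T_{a,\eta})$ is the spectrum of $T_{a,\eta}$ as an operator in $A^2_\eta(\varpi)$. Moreover, $\sigma(T_a)=\sigma_{\mathrm{ess}}(T_a)$.
   Context: Notation: $\Lambda=\{m\in\mathbb{C}: \mathrm{Re}\,m\in\mathbb{Z},\ \mathrm{Im}\,m\in\mathbb{Z}\}$. $Q=(0,1)\times(0,1)\subset\mathbb{R}^2\cong\mathbb{C}$; $\mathbf{Q}=[-\pi,\pi]^2$, with elements $\eta=(\eta_1,\eta_2)$. $\mathrm{cl}$ denotes closure. $L^2(D)$ is with respect to area measure, and $A^2(D)$ is the closed subspace of $L^2(D)$ consisting of analytic functions. Doubly periodic domain: the periodic cell $\varpi$ is a domain in $\mathbb{C}$ such that (i) $\varpi\subset Q$; (ii) $\partial\varpi\supset\partial Q$; (iii) $Q\setminus\mathrm{cl}(\varpi)$ contains a nonempty open set. Put $\varpi_m=\varpi+m$ for $m\in\Lambda$. The doubly periodic domain $\Omega$ is the interior of $\bigcup_{m\in\Lambda}\mathrm{cl}(\varpi_m)$. Assumption $(\mathcal{A})$: there is an elliptic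 function $\varphi$ (meromorphic in $\mathbb{C}$ with $\varphi(z)=\varphi(z+1)=\varphi(z+i)$) all of whose zeros lie in $\mathbb{C}\setminus\mathrm{cl}(\Omega)$, and which has a representation $\varphi(z)=\sum_{m\in\Lambda}\phi(z-m)$ for some function $\phi$ meromorphic in $\mathbb{C}$ with only finitely many poles, all situated in $Q$, and such that $\sup_{z\in\Omega\setminus\mathrm{cl}(Q)}(1+|z|)^b|\phi(z)|<\infty$ for some constant $b>2$. For $\eta\in\mathbf{Q}$, $A^2_{\eta,\mathrm{ext}}(\varpi)$ is the subspace of $A^2(\varpi)$ consisting of functions $f$ which can be extended as analytic functions to a neighborhood of $\mathrm{cl}(\varpi)\cap\Omega$ in $\Omega$ and satisfy $f(1+iy)=e^{i\eta_1}f(iy)$ and $f(x+i)=e^{i\eta_2}f(x)$ for all $x,y\in(0,1)$. $A^2_\eta(\varpi)$ is the closure of $A^2_{\eta,\mathrm{ext}}(\varpi)$ in $A^2(\varpi)$. $P_\Omega$ is the orthogonal projection of $L^2(\Omega)$ onto $A^2(\Omega)$, and $P_\eta$ is the orthogonal projection of $L^2(\varpi)$ onto $A^2_\eta(\varpi)$. The Toeplitz operator is $T_a:A^2(\Omega)\to A^2(\Omega)$, $T_af=P_\Omega(af)$. For $\eta\in\mathbf{Q}$, $T_{a,\eta}:A^2_\eta(\varpi)\to A^2_\eta(\varpi)$, $T_{a,\eta}f=P_\eta(a|_\varpi f)$. $\sigma(T)$ and $\sigma_{\mathrm{ess}}(T)$ denote the spectrum and the essential spectrum of a bounded operator $T$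 on a Hilbert space; $\sigma_{\mathrm{ess}}(T)$ is the set of $\lambda\in\mathbb{C}$ for which $T-\lambda I$ is not Fredholm.
   Formalization: The formal theorem additionally assumes that the part of the boundary of the cell ϖ lying inside Ω has zero area; without it the claim fails, e.g. when a positive-area totally disconnected compact set K is removed from the cell and a is the indicator of K+Λ. *)

theory Defs
  imports "HOL-Complex_Analysis.Complex_Analysis"
begin

section \<open>Doubly periodic domains\<close>

definition lattice :: "complex set" where
  "lattice = {m. Re m \<in> \<int> \<and> Im m \<in> \<int>}"

definition unit_cell :: "complex set" where
  "unit_cell = {z. 0 < Re z \<and> Re z < 1 \<and> 0 < Im z \<and> Im z < 1}"

definition periodic_cell :: "complex set \<Rightarrow> bool" where
  "periodic_cell W \<longleftrightarrow>
     open W \<and> connected W \<and> W \<noteq> {} \<and>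
     W \<subseteq> unit_cell \<and>
     frontier unit_cell \<subseteq> frontier W \<and>
     (\<exists>U. open U \<and> U \<noteq> {} \<and> U \<subseteq> unit_cell - closure W)"

definition periodic_domain :: "complex set \<Rightarrow> complex set" where
  "periodic_domain W = interior (\<Union>m\<in>lattice. closure ((+) m ` W))"

text \<open>Meromorphic functions are normalised by \<open>nicely_meromorphic_on\<close>: removable singularities
  are removed and the value at a pole is \<open>0\<close>.  The periodicity equations can therefore be stated at
  every point, while a zero is a point with value \<open>0\<close> that is not a pole.  The sum over the lattice is
  an unordered one and is required wherever none of its terms has a pole.\<close>

definition assumption_A :: "complex set \<Rightarrow> bool" where
  "assumption_A W \<longleftrightarrow>
     (\<exists>(\<phi> :: complex \<Rightarrow> complex) (\<psi> :: complex \<Rightarrow> complex) (b :: real).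
        \<phi> nicely_meromorphic_on UNIV \<and>
        (\<forall>z. \<phi> (z + 1) = \<phi> z \<and> \<phi> (z + \<i>) = \<phi> z) \<and>
        {z. \<phi> z = 0 \<and> \<not> is_pole \<phi> z} \<subseteq> - closure (periodic_domain W) \<and>
        \<psi> nicely_meromorphic_on UNIV \<and>
        finite {z. is_pole \<psi> z} \<and> {z. is_pole \<psi> z} \<subseteq> unit_cell \<and>
        (\<forall>z. (\<forall>m\<in>lattice. \<not> is_pole \<psi> (z - m)) \<longrightarrow>
             ((\<lambda>m. \<psi> (z - m)) has_sum \<phi> z) lattice) \<and>
        b > 2 \<and>
        bdd_above ((\<lambda>z. (1 + cmod z) powr b * cmod (\<psi> z)) `
                     (periodic_domain W - closure unit_cell)))"

section \<open>Function spaces\<close>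

text \<open>Elements of \<open>L2\<close> and \<open>Linfty\<close> are functions rather than classes modulo null sets; values
  outside \<open>D\<close> play no role.\<close>

definition L2 :: "complex set \<Rightarrow> (complex \<Rightarrow> complex) set" where
  "L2 D = {f. f \<in> borel_measurable (lebesgue_on D) \<and>
              integrable (lebesgue_on D) (\<lambda>z. (cmod (f z))\<^sup>2)}"

definition L2_inner :: "complex set \<Rightarrow> (complex \<Rightarrow> complex) \<Rightarrow> (complex \<Rightarrow> complex) \<Rightarrow> complex" where
  "L2_inner D f g = (LINT z|lebesgue_on D. f z * cnj (g z))"

definition L2_norm :: "complex set \<Rightarrow> (complex \<Rightarrow> complex) \<Rightarrow> real" where
  "L2_norm D f = sqrt (LINT z|lebesgue_on D. (cmod (f z))\<^sup>2)"

definition Linfty :: "complex set \<Rightarrow> (complex \<Rightarrow> complex) set" where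
  "Linfty D = {f. f \<in> borel_measurable (lebesgue_on D) \<and>
                  (\<exists>C. AE z in lebesgue_on D. cmod (f z) \<le> C)}"

text \<open>A class in \<open>A\<^sup>2(D)\<close> is represented by its unique holomorphic representative, extended by
  \<open>0\<close> outside the open set \<open>D\<close>, so that equality in the Bergman space is equality of functions.\<close>

definition bergman :: "complex set \<Rightarrow> (complex \<Rightarrow> complex) set" where
  "bergman D = {f \<in> L2 D. f holomorphic_on D \<and> (\<forall>z. z \<notin> D \<longrightarrow> f z = 0)}"

text \<open>The boundary conditions are imposed on the extension \<open>g\<close>.  They have content only at boundary
  points of the unit cell that lie in the periodic domain (the set of these is periodic, and contained
  in \<open>U\<close>); elsewhere the values of \<open>g\<close> are irrelevant and can be chosen to be \<open>0\<close>.\<close>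

definition bergman_ext :: "complex set \<Rightarrow> real \<times> real \<Rightarrow> (complex \<Rightarrow> complex) set" where
  "bergman_ext W \<eta> = {f \<in> bergman W. \<exists>U g.
     open U \<and> closure W \<inter> periodic_domain W \<subseteq> U \<and> U \<subseteq> periodic_domain W \<and>
     g holomorphic_on U \<and> (\<forall>z\<in>W. g z = f z) \<and>
     (\<forall>y\<in>{0<..<1}. g (Complex 1 y) = exp (\<i> * complex_of_real (fst \<eta>)) * g (Complex 0 y)) \<and>
     (\<forall>x\<in>{0<..<1}. g (Complex x 1) = exp (\<i> * complex_of_real (snd \<eta>)) * g (Complex x 0))}"

definition bergman_eta :: "complex set \<Rightarrow> real \<times> real \<Rightarrow> (complex \<Rightarrow> complex) set" where
  "bergman_eta W \<eta> = {f \<in> bergman W. \<forall>\<epsilon>>0. \<exists>g\<in>bergman_ext W \<eta>. L2_norm W (\<lambda>z. f z - g z) < \<epsilon>}"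

section \<open>Operators on a space of functions\<close>

text \<open>In this section \<open>H\<close> is a space of complex functions (a complex linear space under the pointwise
  operations) with norm \<open>N\<close>; operators on \<open>H\<close> are considered on \<open>H\<close> only.\<close>

definition bounded_operator_on ::
  "(complex \<Rightarrow> complex) set \<Rightarrow> ((complex \<Rightarrow> complex) \<Rightarrow> real)
     \<Rightarrow> ((complex \<Rightarrow> complex) \<Rightarrow> (complex \<Rightarrow> complex)) \<Rightarrow> bool" where
  "bounded_operator_on H N S \<longleftrightarrow>
     S ` H \<subseteq> H \<and>
     (\<forall>f\<in>H. \<forall>g\<in>H. S (\<lambda>z. f z + g z) = (\<lambda>z. S f z + S g z)) \<and>
     (\<forall>c. \<forall>f\<in>H. S (\<lambda>z. c * f z) = (\<lambda>z. c * S f z)) \<and>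
     (\<exists>C. \<forall>f\<in>H. N (S f) \<le> C * N f)"

definition shifted ::
  "((complex \<Rightarrow> complex) \<Rightarrow> (complex \<Rightarrow> complex)) \<Rightarrow> complex
     \<Rightarrow> (complex \<Rightarrow> complex) \<Rightarrow> (complex \<Rightarrow> complex)" where
  "shifted T \<mu> f = (\<lambda>z. T f z - \<mu> * f z)"

definition spectrum_on ::
  "(complex \<Rightarrow> complex) set \<Rightarrow> ((complex \<Rightarrow> complex) \<Rightarrow> real)
     \<Rightarrow> ((complex \<Rightarrow> complex) \<Rightarrow> (complex \<Rightarrow> complex)) \<Rightarrow> complex set" where
  "spectrum_on H N T =
     {\<mu>. \<not> (\<exists>S. bounded_operator_on H N S \<and>
                (\<forall>f\<in>H. S (shifted T \<mu> f) = f \<and> shifted T \<mu> (S f) = f))}"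

definition fredholm_on ::
  "(complex \<Rightarrow> complex) set \<Rightarrow> ((complex \<Rightarrow> complex) \<Rightarrow> real)
     \<Rightarrow> ((complex \<Rightarrow> complex) \<Rightarrow> (complex \<Rightarrow> complex)) \<Rightarrow> bool" where
  "fredholm_on H N T \<longleftrightarrow>
     \<comment> \<open>finite-dimensional kernel\<close>
     (\<exists>B. finite B \<and> B \<subseteq> H \<and>
        (\<forall>f\<in>H. T f = (\<lambda>z. 0) \<longrightarrow> (\<exists>c. f = (\<lambda>z. \<Sum>e\<in>B. c e * e z)))) \<and>
     \<comment> \<open>closed range\<close>
     (\<forall>h\<in>H. (\<forall>\<epsilon>>0. \<exists>f\<in>H. N (\<lambda>z. T f z - h z) < \<epsilon>) \<longrightarrow> h \<in> T ` H) \<and>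
     \<comment> \<open>range of finite codimension\<close>
     (\<exists>B. finite B \<and> B \<subseteq> H \<and>
        (\<forall>h\<in>H. \<exists>f\<in>H. \<exists>c. h = (\<lambda>z. T f z + (\<Sum>e\<in>B. c e * e z))))"

definition ess_spectrum_on ::
  "(complex \<Rightarrow> complex) set \<Rightarrow> ((complex \<Rightarrow> complex) \<Rightarrow> real)
     \<Rightarrow> ((complex \<Rightarrow> complex) \<Rightarrow> (complex \<Rightarrow> complex)) \<Rightarrow> complex set" where
  "ess_spectrum_on H N T = {\<mu>. \<not> fredholm_on H N (shifted T \<mu>)}"

section \<open>Toeplitz operators\<close>

definition orth_proj ::
  "complex set \<Rightarrow> (complex \<Rightarrow> complex) set \<Rightarrow> (complex \<Rightarrow> complex) \<Rightarrow> (complex \<Rightarrow> complex)" where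
  "orth_proj D H h = (THE g. g \<in> H \<and> (\<forall>k\<in>H. L2_inner D (\<lambda>z. h z - g z) k = 0))"

definition toeplitz ::
  "complex set \<Rightarrow> (complex \<Rightarrow> complex) set \<Rightarrow> (complex \<Rightarrow> complex)
     \<Rightarrow> (complex \<Rightarrow> complex) \<Rightarrow> (complex \<Rightarrow> complex)" where
  "toeplitz D H a f = orth_proj D H (\<lambda>z. a z * f z)"

definition toeplitz_spectrum :: "complex set \<Rightarrow> (complex \<Rightarrow> complex) \<Rightarrow> complex set" where
  "toeplitz_spectrum D a =
     spectrum_on (bergman D) (L2_norm D) (toeplitz D (bergman D) a)"

definition toeplitz_ess_spectrum :: "complex set \<Rightarrow> (complex \<Rightarrow> complex) \<Rightarrow> complex set" where
  "toeplitz_ess_spectrum D a =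
     ess_spectrum_on (bergman D) (L2_norm D) (toeplitz D (bergman D) a)"

definition toeplitz_eta_spectrum ::
  "complex set \<Rightarrow> real \<times> real \<Rightarrow> (complex \<Rightarrow> complex) \<Rightarrow> complex set" where
  "toeplitz_eta_spectrum W \<eta> a =
     spectrum_on (bergman_eta W \<eta>) (L2_norm W) (toeplitz W (bergman_eta W \<eta>) a)"

end

theory Submission
  imports Defs
begin

text \<open>Dividing \<open>\<psi>\<close> by \<open>\<phi>\<close> gives an analytic function \<open>\<theta>\<close> on \<open>\<Omega>\<close> that decays and whose lattice translates
  sum to \<open>1\<close>.  It takes the place of a smooth cutoff without leaving the Bergman spaces: multiplying a
  quasi-periodic function by sums of translates of \<open>\<theta>\<close> localizes it to \<open>\<Omega>\<close>, and twisted lattice sums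
  of \<open>\<theta> g\<close> make a function \<open>g\<close> on \<open>\<Omega>\<close> quasi-periodic.

  As the adjoint of \<open>T\<^sub>a\<close> has the conjugate symbol, \<open>T\<^sub>a - \<mu>\<close> is invertible iff it and the operator with
  conjugate data are bounded below, and similarly on the cell.  If the operator on \<open>\<Omega>\<close> is bounded below,
  so is each operator on the cell: spread a function on the cell over a large square of the lattice.
  Conversely, if it is not bounded below on \<open>\<Omega>\<close>, then finite Fourier sums of translates and the
  compactness of the square of quasi-momenta yield approximate null functions which are at the same time
  approximate eigenfunctions of both unit translations, with eigenvalues given by a single \<open>\<eta>\<close>; their
  quasi-periodic versions contradict a lower bound for that \<open>\<eta>\<close>.

  Finally, a Fredholm \<open>T\<^sub>a - \<mu>\<close> is invertible: its kernel and cokernel are finite-dimensional and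
  translation invariant, and a square summable sequence satisfying a linear recurrence with constant
  coefficients vanishes.\<close>

section \<open>Square integrable functions\<close>

text \<open>The obstacle is locality: multiplying a quasi-periodic function by an ordinary cutoff
  destroys analyticity, and projecting the product back would spread it out in an uncontrolled way.
  The decay exponent \<open>b > 2\<close> exceeds the rank of the lattice, so the translates of
  \<open>\<theta>\<close> are summable, and a sum of translates over a finite set \<open>B\<close>
  differs from the indicator of \<open>B\<close> by an error whose square sum is small against
  \<open>card B\<close> when \<open>B\<close> is a large square. The function
  \<open>\<theta>\<close> is complex valued, so such a window is not a symmetric multiplier; the
  difference from its conjugate is absorbed by the same error.

  The lower bounds on the cell may depend on \<open>\<eta>\<close>. The argument therefore works at
  one limiting \<open>\<eta>\<close> instead of using a direct integral over all of them. Parseval's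
  identity for finite Fourier sums and a pigeonhole argument select a frequency at which the
  quotient of \<open>V f\<close> by \<open>f\<close> stays small while the translation defect
  becomes small. The resulting functions need not be concentrated anywhere: all estimates are made
  cell by cell with the weights \<open>h\<close> and then summed over all translates.\<close>

lemma L2_measurable [measurable_dest]: "f \<in> L2 D \<Longrightarrow> f \<in> borel_measurable (lebesgue_on D)"
  by (simp add: L2_def)

lemma L2_integrable: "f \<in> L2 D \<Longrightarrow> integrable (lebesgue_on D) (\<lambda>z. (cmod (f z))\<^sup>2)"
  by (simp add: L2_def)

lemma L2_bound:
  assumes "f \<in> L2 D" "g \<in> borel_measurable (lebesgue_on D)" "\<And>z. cmod (g z) \<le> c * cmod (f z)"
  shows "g \<in> L2 D"
proof -
  have "integrable (lebesgue_on D) (\<lambda>z. (cmod (g z))\<^sup>2)"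
  proof (rule Bochner_Integration.integrable_bound)
    show "integrable (lebesgue_on D) (\<lambda>z. c\<^sup>2 * (cmod (f z))\<^sup>2)"
      using L2_integrable[OF assms(1)] by simp
    show "AE z in lebesgue_on D. norm ((cmod (g z))\<^sup>2) \<le> norm (c\<^sup>2 * (cmod (f z))\<^sup>2)"
      using power_mono[OF assms(3) norm_ge_zero, of _ 2]
      by (intro AE_I2) (simp add: power_mult_distrib)
  qed (use assms(2) in measurable)
  with assms(2) show ?thesis by (simp add: L2_def)
qed

lemma L2_zero [simp]: "(\<lambda>z. 0) \<in> L2 D"
  by (simp add: L2_def)

lemma L2_scale: "f \<in> L2 D \<Longrightarrow> (\<lambda>z. c * f z) \<in> L2 D"
  by (rule L2_bound[where c = "cmod c"]) (auto simp: norm_mult L2_def)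

lemma L2_mult_bounded:
  assumes "f \<in> L2 D" "a \<in> borel_measurable (lebesgue_on D)" "\<And>z. cmod (a z) \<le> \<beta>"
  shows "(\<lambda>z. a z * f z) \<in> L2 D"
  using assms by (intro L2_bound[OF assms(1), where c = \<beta>])
    (auto simp: norm_mult L2_def intro!: mult_right_mono borel_measurable_times)

lemma cmod_add_sq_le: "(cmod (x + y))\<^sup>2 \<le> 2 * (cmod x)\<^sup>2 + 2 * (cmod y)\<^sup>2"
proof -
  have "(cmod (x + y))\<^sup>2 \<le> (cmod x + cmod y)\<^sup>2"
    by (simp add: norm_triangle_ineq power_mono)
  also have "\<dots> \<le> 2 * (cmod x)\<^sup>2 + 2 * (cmod y)\<^sup>2"
    using zero_le_power2[of "cmod x - cmod y"] by (simp add: power2_eq_square algebra_simps)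
  finally show ?thesis .
qed

lemma L2_add:
  assumes "f \<in> L2 D" "g \<in> L2 D"
  shows "(\<lambda>z. f z + g z) \<in> L2 D"
proof -
  have "integrable (lebesgue_on D) (\<lambda>z. (cmod (f z + g z))\<^sup>2)"
  proof (rule Bochner_Integration.integrable_bound)
    show "integrable (lebesgue_on D) (\<lambda>z. 2 * (cmod (f z))\<^sup>2 + 2 * (cmod (g z))\<^sup>2)"
      using L2_integrable[OF assms(1)] L2_integrable[OF assms(2)] by simp
    show "AE z in lebesgue_on D. norm ((cmod (f z + g z))\<^sup>2) \<le> norm (2 * (cmod (f z))\<^sup>2 + 2 * (cmod (g z))\<^sup>2)"
      using cmod_add_sq_le by (intro AE_I2) simp
  qed (use assms in \<open>auto simp: L2_def\<close>)
  then show ?thesis using assms by (auto simp: L2_def)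
qed

lemma L2_diff: "f \<in> L2 D \<Longrightarrow> g \<in> L2 D \<Longrightarrow> (\<lambda>z. f z - g z) \<in> L2 D"
  using L2_add[OF _ L2_scale[of g D "-1"], of f] by simp

lemma L2_inner_integrable:
  assumes "f \<in> L2 D" "g \<in> L2 D"
  shows "integrable (lebesgue_on D) (\<lambda>z. f z * cnj (g z))"
proof (rule Bochner_Integration.integrable_bound)
  show "integrable (lebesgue_on D) (\<lambda>z. (cmod (f z))\<^sup>2 + (cmod (g z))\<^sup>2)"
    using L2_integrable[OF assms(1)] L2_integrable[OF assms(2)] by simp
  have "cmod x * cmod y \<le> (cmod x)\<^sup>2 + (cmod y)\<^sup>2" for x y
  proof -
    have "0 \<le> (cmod x - cmod y)\<^sup>2 + ((cmod x)\<^sup>2 + (cmod y)\<^sup>2)" by simp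
    then show ?thesis by (simp add: power2_eq_square algebra_simps)
  qed
  then show "AE z in lebesgue_on D. norm (f z * cnj (g z)) \<le> norm ((cmod (f z))\<^sup>2 + (cmod (g z))\<^sup>2)"
    by (intro AE_I2) (simp add: norm_mult)
  have "cnj \<in> borel_measurable borel"
    by (intro borel_measurable_continuous_onI continuous_intros)
  then have "(\<lambda>z. cnj (g z)) \<in> borel_measurable (lebesgue_on D)"
    using measurable_compose[OF L2_measurable[OF assms(2)]] by blast
  then show "(\<lambda>z. f z * cnj (g z)) \<in> borel_measurable (lebesgue_on D)"
    using L2_measurable[OF assms(1)] by measurable
qed

lemma L2_inner_add_left:
  "f \<in> L2 D \<Longrightarrow> g \<in> L2 D \<Longrightarrow> k \<in> L2 D \<Longrightarrow>
   L2_inner D (\<lambda>z. f z + g z) k = L2_inner D f k + L2_inner D g k"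
  by (simp add: L2_inner_def distrib_right L2_inner_integrable)

lemma L2_inner_diff_left:
  "f \<in> L2 D \<Longrightarrow> g \<in> L2 D \<Longrightarrow> k \<in> L2 D \<Longrightarrow>
   L2_inner D (\<lambda>z. f z - g z) k = L2_inner D f k - L2_inner D g k"
  by (simp add: L2_inner_def left_diff_distrib L2_inner_integrable)

lemma L2_inner_scale_left:
  "L2_inner D (\<lambda>z. c * f z) k = c * L2_inner D f k"
  by (simp add: L2_inner_def mult.assoc)

lemma L2_inner_commute: "L2_inner D g f = cnj (L2_inner D f g)"
  unfolding L2_inner_def by (subst Bochner_Integration.integral_cnj[symmetric]) (simp add: mult.commute)

lemma L2_inner_add_right:
  "f \<in> L2 D \<Longrightarrow> g \<in> L2 D \<Longrightarrow> k \<in> L2 D \<Longrightarrow>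
   L2_inner D k (\<lambda>z. f z + g z) = L2_inner D k f + L2_inner D k g"
  by (simp add: L2_inner_commute[of D k] L2_inner_add_left)

lemma L2_inner_diff_right:
  "f \<in> L2 D \<Longrightarrow> g \<in> L2 D \<Longrightarrow> k \<in> L2 D \<Longrightarrow>
   L2_inner D k (\<lambda>z. f z - g z) = L2_inner D k f - L2_inner D k g"
  by (simp add: L2_inner_commute[of D k] L2_inner_diff_left)

lemma L2_inner_scale_right:
  "L2_inner D k (\<lambda>z. c * f z) = cnj c * L2_inner D k f"
  by (simp add: L2_inner_commute[of D k] L2_inner_scale_left)

lemma L2_norm_nonneg [simp]: "0 \<le> L2_norm D f"
  by (simp add: L2_norm_def)

lemma L2_norm_sq: "(L2_norm D f)\<^sup>2 = (LINT z|lebesgue_on D. (cmod (f z))\<^sup>2)"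
  by (simp add: L2_norm_def)

lemma L2_inner_self: "L2_inner D f f = of_real ((L2_norm D f)\<^sup>2)"
  by (simp only: L2_norm_sq L2_inner_def complex_norm_square[symmetric] integral_complex_of_real)

lemma L2_norm_zero [simp]: "L2_norm D (\<lambda>z. 0) = 0"
  by (simp add: L2_norm_def)

lemma L2_norm_scale: "L2_norm D (\<lambda>z. c * f z) = cmod c * L2_norm D f"
  by (simp add: L2_norm_def norm_mult power_mult_distrib real_sqrt_mult)

lemma L2_norm_minus: "L2_norm D (\<lambda>z. f z - g z) = L2_norm D (\<lambda>z. g z - f z)"
  by (simp add: L2_norm_def norm_minus_commute)

lemma L2_norm_add_sq:
  assumes "f \<in> L2 D" "g \<in> L2 D"
  shows "(L2_norm D (\<lambda>z. f z + g z))\<^sup>2 = (L2_norm D f)\<^sup>2 + (L2_norm D g)\<^sup>2 + 2 * Re (L2_inner D f g)"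
proof -
  have "complex_of_real ((L2_norm D (\<lambda>z. f z + g z))\<^sup>2) =
        L2_inner D f f + L2_inner D g g + (L2_inner D f g + L2_inner D g f)"
    unfolding L2_inner_self[symmetric]
    by (simp add: L2_inner_add_left L2_inner_add_right L2_add assms)
  also have "L2_inner D f g + L2_inner D g f = of_real (2 * Re (L2_inner D f g))"
    by (simp add: L2_inner_commute[of D g f] complex_eq_iff)
  finally show ?thesis
    unfolding L2_inner_self of_real_add[symmetric] of_real_eq_iff by simp
qed

lemma L2_norm_diff_sq:
  assumes "f \<in> L2 D" "g \<in> L2 D"
  shows "(L2_norm D (\<lambda>z. f z - g z))\<^sup>2 = (L2_norm D f)\<^sup>2 + (L2_norm D g)\<^sup>2 - 2 * Re (L2_inner D f g)"
  using L2_norm_add_sq[OF assms(1) L2_scale[OF assms(2), of "-1"]]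
  by (simp add: L2_inner_scale_right[of D f "-1" g, simplified] L2_norm_scale[of D "-1", simplified])

text \<open>The squared norm of \<open>f - t c g\<close> with \<open>c = L2_inner D f g\<close> is a
  quadratic polynomial in the real number \<open>t\<close>, minimal at \<open>t = 1 / B\<close>.
  Since \<open>L2_norm\<close> is only a seminorm on functions, \<open>B = 0\<close> is possible for
  \<open>g\<close> different from zero and is a case of its own.\<close>

lemma L2_Cauchy_Schwarz:
  assumes "f \<in> L2 D" "g \<in> L2 D"
  shows "cmod (L2_inner D f g) \<le> L2_norm D f * L2_norm D g"
proof -
  define A B c where "A = (L2_norm D f)\<^sup>2" and "B = (L2_norm D g)\<^sup>2" and "c = L2_inner D f g"
  have key: "0 \<le> A + t\<^sup>2 * (cmod c)\<^sup>2 * B - 2 * t * (cmod c)\<^sup>2" for t :: real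
  proof -
    have g': "(\<lambda>z. (of_real t * c) * g z) \<in> L2 D" by (rule L2_scale[OF assms(2)])
    have "0 \<le> (L2_norm D (\<lambda>z. f z - (of_real t * c) * g z))\<^sup>2" by simp
    also have "\<dots> = A + t\<^sup>2 * (cmod c)\<^sup>2 * B - 2 * Re (of_real t * cnj c * c)"
      unfolding L2_norm_diff_sq[OF assms(1) g'] L2_norm_scale L2_inner_scale_right
      by (simp add: A_def B_def c_def norm_mult power_mult_distrib)
    also have "Re (of_real t * cnj c * c) = t * (cmod c)\<^sup>2"
      by (simp add: cmod_power2) (simp add: power2_eq_square algebra_simps)
    finally show ?thesis by simp
  qed
  have "(cmod c)\<^sup>2 \<le> A * B"
  proof (cases "B = 0")
    case True
    show ?thesis
    proof (rule ccontr)
      assume "\<not> ?thesis"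
      then have c0: "(cmod c)\<^sup>2 > 0" using True by auto
      have "A \<ge> 0" by (simp add: A_def)
      \<comment> \<open>For \<open>B = 0\<close> the bound \<open>key\<close> is linear in
        \<open>t\<close>; the value \<open>(A + 1) / (cmod c)\<^sup>2\<close> turns its right-hand
        side into \<open>- A - 2\<close>.\<close>
      then show False
        using key[of "(A + 1) / (cmod c)\<^sup>2"] True c0 by simp
    qed
  next
    case False
    then have "B > 0" by (simp add: B_def)
    then show ?thesis using key[of "1 / B"]
      by (simp add: field_simps power2_eq_square)
  qed
  then have "(cmod c)\<^sup>2 \<le> (L2_norm D f * L2_norm D g)\<^sup>2"
    by (simp add: A_def B_def power_mult_distrib)
  then show ?thesis unfolding c_def by (rule power2_le_imp_le) simp
qed

lemma L2_norm_triangle: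
  assumes "f \<in> L2 D" "g \<in> L2 D"
  shows "L2_norm D (\<lambda>z. f z + g z) \<le> L2_norm D f + L2_norm D g"
proof (rule power2_le_imp_le)
  have "Re (L2_inner D f g) \<le> L2_norm D f * L2_norm D g"
    using L2_Cauchy_Schwarz[OF assms] complex_Re_le_cmod order_trans by blast
  then show "(L2_norm D (\<lambda>z. f z + g z))\<^sup>2 \<le> (L2_norm D f + L2_norm D g)\<^sup>2"
    unfolding L2_norm_add_sq[OF assms] by (simp add: power2_sum)
qed simp

lemma L2_norm_triangle_diff:
  assumes "f \<in> L2 D" "g \<in> L2 D" "k \<in> L2 D"
  shows "L2_norm D (\<lambda>z. f z - k z) \<le> L2_norm D (\<lambda>z. f z - g z) + L2_norm D (\<lambda>z. g z - k z)"
  using L2_norm_triangle[OF L2_diff[OF assms(1,2)] L2_diff[OF assms(2,3)]] by simp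

lemma L2_norm_le_add_diff:
  assumes "f \<in> L2 D" "g \<in> L2 D"
  shows "L2_norm D f \<le> L2_norm D g + L2_norm D (\<lambda>z. f z - g z)"
  using L2_norm_triangle[OF assms(2) L2_diff[OF assms]] by simp

lemma L2_norm_mult_bounded:
  assumes "f \<in> L2 D" "a \<in> borel_measurable (lebesgue_on D)" "\<And>z. cmod (a z) \<le> \<beta>"
  shows "L2_norm D (\<lambda>z. a z * f z) \<le> \<beta> * L2_norm D f"
proof (rule power2_le_imp_le)
  have b: "0 \<le> \<beta>" using order_trans[OF norm_ge_zero assms(3)] .
  have "(LINT z|lebesgue_on D. (cmod (a z * f z))\<^sup>2) \<le> (LINT z|lebesgue_on D. \<beta>\<^sup>2 * (cmod (f z))\<^sup>2)"
  proof (rule integral_mono)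
    show "(cmod (a z * f z))\<^sup>2 \<le> \<beta>\<^sup>2 * (cmod (f z))\<^sup>2" for z
      unfolding norm_mult power_mult_distrib
      by (rule mult_right_mono[OF power_mono[OF assms(3) norm_ge_zero] zero_le_power2])
  qed (use L2_integrable[OF L2_mult_bounded[OF assms]] L2_integrable[OF assms(1)] in auto)
  then show "(L2_norm D (\<lambda>z. a z * f z))\<^sup>2 \<le> (\<beta> * L2_norm D f)\<^sup>2"
    by (simp add: L2_norm_sq power_mult_distrib)
  show "0 \<le> \<beta> * L2_norm D f" using b by simp
qed

section \<open>Hilbert spaces of functions\<close>

text \<open>Subspaces of \<open>L2 D\<close> in which every class has a single representative:
  \<open>definite\<close> turns the seminorm into a norm. Instances are the Bergman space of an open
  set, the spaces \<open>bergman_eta\<close>, and closed ranges of operators.\<close>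

locale hilbert_fun =
  fixes D :: "complex set" and H :: "(complex \<Rightarrow> complex) set"
  assumes sub: "H \<subseteq> L2 D"
    and zero: "(\<lambda>z. 0) \<in> H"
    and add: "f \<in> H \<Longrightarrow> g \<in> H \<Longrightarrow> (\<lambda>z. f z + g z) \<in> H"
    and scale: "f \<in> H \<Longrightarrow> (\<lambda>z. c * f z) \<in> H"
    and definite: "f \<in> H \<Longrightarrow> L2_norm D f = 0 \<Longrightarrow> f = (\<lambda>z. 0)"
    and complete: "(\<And>n::nat. X n \<in> H) \<Longrightarrow>
      (\<And>e. e > 0 \<Longrightarrow> \<exists>N. \<forall>m\<ge>N. \<forall>n\<ge>N. L2_norm D (\<lambda>z. X m z - X n z) < e) \<Longrightarrow>
      \<exists>x\<in>H. (\<lambda>n. L2_norm D (\<lambda>z. X n z - x z)) \<longlonglongrightarrow> 0"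
begin

lemma in_L2 [simp]: "f \<in> H \<Longrightarrow> f \<in> L2 D"
  using sub by blast

lemma diff: "f \<in> H \<Longrightarrow> g \<in> H \<Longrightarrow> (\<lambda>z. f z - g z) \<in> H"
  using add[OF _ scale[of g "-1"], of f] by simp

lemma sum_in: "(\<And>i. i \<in> I \<Longrightarrow> F i \<in> H) \<Longrightarrow> (\<lambda>z. \<Sum>i\<in>I. c i * F i z) \<in> H"
proof (induction I rule: infinite_finite_induct)
  case (insert x I)
  have "(\<lambda>z. c x * F x z + (\<Sum>i\<in>I. c i * F i z)) \<in> H"
    by (rule add[OF scale]) (use insert in auto)
  then show ?case using insert(1,2) by simp
qed (auto simp: zero)

lemma eqI:
  assumes "f \<in> H" "g \<in> H" "L2_norm D (\<lambda>z. f z - g z) = 0"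
  shows "f = g"
  using definite[OF diff[OF assms(1,2)] assms(3)] by (auto simp: fun_eq_iff)

text \<open>A minimizing sequence for the distance from \<open>h\<close> to \<open>H\<close> is
  Cauchy by the parallelogram law, and the first variation at its limit vanishes in every direction
  \<open>k\<close>.\<close>

lemma projection_exists:
  assumes h: "h \<in> L2 D"
  shows "\<exists>g\<in>H. \<forall>k\<in>H. L2_inner D (\<lambda>z. h z - g z) k = 0"
proof -
  define d where "d = Inf ((\<lambda>g. (L2_norm D (\<lambda>z. h z - g z))\<^sup>2) ` H)"
  have bdd: "bdd_below ((\<lambda>g. (L2_norm D (\<lambda>z. h z - g z))\<^sup>2) ` H)"
    by (rule bdd_belowI[of _ 0]) auto
  have dle: "d \<le> (L2_norm D (\<lambda>z. h z - g z))\<^sup>2" if "g \<in> H" for g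
    unfolding d_def by (rule cInf_lower[OF _ bdd]) (use that in auto)
  have "\<exists>g\<in>H. (L2_norm D (\<lambda>z. h z - g z))\<^sup>2 < d + 1 / real (Suc n)" for n
  proof -
    have "Inf ((\<lambda>g. (L2_norm D (\<lambda>z. h z - g z))\<^sup>2) ` H) < d + 1 / real (Suc n)"
      unfolding d_def by simp
    then show ?thesis using cInf_less_iff[OF _ bdd] zero by auto
  qed
  then obtain X where X: "\<And>n. X n \<in> H" "\<And>n. (L2_norm D (\<lambda>z. h z - X n z))\<^sup>2 < d + 1 / real (Suc n)"
    by metis
  have para: "(L2_norm D (\<lambda>z. X m z - X n z))\<^sup>2 \<le>
      2 * (L2_norm D (\<lambda>z. h z - X m z))\<^sup>2 + 2 * (L2_norm D (\<lambda>z. h z - X n z))\<^sup>2 - 4 * d" for m n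
  proof -
    define u v where "u = (\<lambda>z. h z - X m z)" and "v = (\<lambda>z. h z - X n z)"
    have uv: "u \<in> L2 D" "v \<in> L2 D" using h X(1) by (auto simp: u_def v_def intro: L2_diff)
    define w where "w = (\<lambda>z. (1/2) * (X m z + X n z))"
    have w: "w \<in> H" unfolding w_def using X(1) by (intro scale add)
    have "(\<lambda>z. u z + v z) = (\<lambda>z. 2 * (h z - w z))"
      by (auto simp: u_def v_def w_def fun_eq_iff field_simps)
    then have "(L2_norm D (\<lambda>z. u z + v z))\<^sup>2 = 4 * (L2_norm D (\<lambda>z. h z - w z))\<^sup>2"
      by (simp only: L2_norm_scale power_mult_distrib) simp
    then have "(L2_norm D (\<lambda>z. u z + v z))\<^sup>2 \<ge> 4 * d" using dle[OF w] by linarith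
    moreover have "(L2_norm D (\<lambda>z. u z + v z))\<^sup>2 + (L2_norm D (\<lambda>z. v z - u z))\<^sup>2
        = 2 * (L2_norm D u)\<^sup>2 + 2 * (L2_norm D v)\<^sup>2"
      using L2_norm_add_sq[OF uv] L2_norm_diff_sq[OF uv] unfolding L2_norm_minus[of D u v] by linarith
    moreover have "(\<lambda>z. v z - u z) = (\<lambda>z. X m z - X n z)"
      by (auto simp: u_def v_def)
    ultimately show ?thesis unfolding u_def v_def by simp
  qed
  have "\<exists>N. \<forall>m\<ge>N. \<forall>n\<ge>N. L2_norm D (\<lambda>z. X m z - X n z) < e" if e: "e > 0" for e
  proof -
    \<comment> \<open>Each of the first two terms in \<open>para\<close> exceeds
      \<open>2 * d\<close> by less than \<open>2 / N\<close>, so the squared distance is below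
      \<open>4 / N\<close>.\<close>
    obtain N :: nat where N: "4 / e\<^sup>2 < real N" using reals_Archimedean2 by blast
    have "L2_norm D (\<lambda>z. X m z - X n z) < e" if "m \<ge> N" "n \<ge> N" for m n
    proof -
      have N0: "real N > 0" using N e by (smt (verit) divide_pos_pos zero_less_power)
      have *: "1 / real (Suc k) \<le> 1 / real N" if "k \<ge> N" for k
        using that N0 by (intro divide_left_mono) auto
      have "(L2_norm D (\<lambda>z. X m z - X n z))\<^sup>2 < 4 * (1 / real N)"
        using para[of m n] X(2)[of m] X(2)[of n] *[OF that(1)] *[OF that(2)] by linarith
      also have "\<dots> < e\<^sup>2" using N N0 e by (simp add: field_simps)
      finally show ?thesis using e by (simp add: power_less_imp_less_base)
    qed
    then show ?thesis by blast
  qed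
  from complete[OF X(1) this] obtain g where g: "g \<in> H" "(\<lambda>n. L2_norm D (\<lambda>z. X n z - g z)) \<longlonglongrightarrow> 0"
    by blast
  have "L2_norm D (\<lambda>z. h z - g z) \<le> sqrt d"
  proof (rule LIMSEQ_le_const)
    have "(\<lambda>n. sqrt (d + inverse (real (Suc n))) + L2_norm D (\<lambda>z. X n z - g z)) \<longlonglongrightarrow> sqrt (d + 0) + 0"
      by (intro tendsto_intros g LIMSEQ_inverse_real_of_nat)
    then show "(\<lambda>n. sqrt (d + inverse (real (Suc n))) + L2_norm D (\<lambda>z. X n z - g z)) \<longlonglongrightarrow> sqrt d"
      by simp
    have "L2_norm D (\<lambda>z. h z - g z) \<le> sqrt (d + inverse (real (Suc n))) + L2_norm D (\<lambda>z. X n z - g z)" for n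
    proof -
      have "L2_norm D (\<lambda>z. h z - X n z) \<le> sqrt (d + inverse (real (Suc n)))"
        using X(2)[of n] by (intro real_le_rsqrt) (simp add: inverse_eq_divide)
      then show ?thesis using L2_norm_triangle_diff[OF h in_L2[OF X(1)[of n]] in_L2[OF g(1)]] by linarith
    qed
    then show "\<exists>N. \<forall>n\<ge>N. L2_norm D (\<lambda>z. h z - g z) \<le> sqrt (d + inverse (real (Suc n))) + L2_norm D (\<lambda>z. X n z - g z)"
      by blast
  qed
  moreover have d0: "d \<ge> 0" unfolding d_def using zero by (intro cInf_greatest) auto
  ultimately have gd: "(L2_norm D (\<lambda>z. h z - g z))\<^sup>2 \<le> d"
    by (metis L2_norm_nonneg power_mono real_sqrt_pow2)
  have "L2_inner D (\<lambda>z. h z - g z) k = 0" if k: "k \<in> H" for k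
  proof (rule ccontr)
    define u where "u = (\<lambda>z. h z - g z)"
    define c where "c = L2_inner D u k"
    assume "\<not> ?thesis"
    then have c0: "(cmod c)\<^sup>2 > 0" by (simp add: c_def u_def)
    have uL: "u \<in> L2 D" using h g(1) by (auto simp: u_def intro: L2_diff)
    have key: "2 * t * (cmod c)\<^sup>2 \<le> t\<^sup>2 * (cmod c)\<^sup>2 * (L2_norm D k)\<^sup>2" for t
    proof -
      have tk: "(\<lambda>z. (of_real t * c) * k z) \<in> H" using k by (rule scale)
      have "(\<lambda>z. h z - (g z + (of_real t * c) * k z)) = (\<lambda>z. u z - (of_real t * c) * k z)"
        by (auto simp: u_def)
      then have "d \<le> (L2_norm D (\<lambda>z. u z - (of_real t * c) * k z))\<^sup>2"
        using dle[OF add[OF g(1) tk]] by simp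
      also have "\<dots> = (L2_norm D u)\<^sup>2 + t\<^sup>2 * (cmod c)\<^sup>2 * (L2_norm D k)\<^sup>2 - 2 * Re (of_real t * cnj c * c)"
        unfolding L2_norm_diff_sq[OF uL in_L2[OF tk]] L2_norm_scale L2_inner_scale_right
        by (simp add: c_def norm_mult power_mult_distrib)
      also have "Re (of_real t * cnj c * c) = t * (cmod c)\<^sup>2"
        by (simp add: cmod_power2) (simp add: power2_eq_square algebra_simps)
      finally show ?thesis using gd unfolding u_def by linarith
    qed
    have "2 * t \<le> t\<^sup>2 * (L2_norm D k)\<^sup>2" for t
      using key[of t] c0 by (simp add: mult.commute mult.left_commute)
    note le = this
    \<comment> \<open>The value \<open>p\<close> is positive with \<open>p * q < 1\<close>, so the
      quadratic term at \<open>t = p\<close> is below \<open>p\<close> and cannot dominate the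
      linear term \<open>2 * p\<close>.\<close>
    define q p where "q = (L2_norm D k)\<^sup>2" and "p = 1 / (q + 1)"
    have "q \<ge> 0" by (simp add: q_def)
    then have p: "p > 0" "p * q < 1" by (auto simp: p_def)
    then have "p * (p * q) < p * 1" by (intro mult_strict_left_mono)
    then show False using le[of p] p(1) by (simp add: q_def power2_eq_square mult.assoc)
  qed
  with g(1) show ?thesis by blast
qed

lemma orthogonal_imp_zero:
  assumes "g \<in> H" "\<And>k. k \<in> H \<Longrightarrow> L2_inner D g k = 0"
  shows "g = (\<lambda>z. 0)"
proof -
  have "L2_norm D g = 0" using assms(2)[OF assms(1)] by (simp add: L2_inner_self)
  then show ?thesis using definite assms(1) by blast
qed

lemma inner_eqI:
  assumes "f \<in> H" "g \<in> H" "\<And>k. k \<in> H \<Longrightarrow> L2_inner D f k = L2_inner D g k"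
  shows "f = g"
proof -
  have "(\<lambda>z. f z - g z) = (\<lambda>z. 0)"
    by (rule orthogonal_imp_zero[OF diff[OF assms(1,2)]]) (use assms in \<open>auto simp: L2_inner_diff_left\<close>)
  then show ?thesis by (auto simp: fun_eq_iff)
qed

lemma orth_proj_eqI:
  assumes h: "h \<in> L2 D" and g: "g \<in> H" "\<And>k. k \<in> H \<Longrightarrow> L2_inner D g k = L2_inner D h k"
  shows "orth_proj D H h = g"
  unfolding orth_proj_def
proof (rule the_equality)
  show "g \<in> H \<and> (\<forall>k\<in>H. L2_inner D (\<lambda>z. h z - g z) k = 0)"
    using assms by (auto simp: L2_inner_diff_left)
next
  fix g' assume g': "g' \<in> H \<and> (\<forall>k\<in>H. L2_inner D (\<lambda>z. h z - g' z) k = 0)"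
  show "g' = g"
    by (rule inner_eqI) (use assms g' in \<open>auto simp: L2_inner_diff_left\<close>)
qed

lemma
  assumes h: "h \<in> L2 D"
  shows orth_proj_in: "orth_proj D H h \<in> H"
    and orth_proj_inner: "k \<in> H \<Longrightarrow> L2_inner D (orth_proj D H h) k = L2_inner D h k"
proof -
  obtain g where g: "g \<in> H" "\<forall>k\<in>H. L2_inner D (\<lambda>z. h z - g z) k = 0"
    using projection_exists[OF h] by blast
  then have *: "\<And>k. k \<in> H \<Longrightarrow> L2_inner D g k = L2_inner D h k"
    using h by (auto simp: L2_inner_diff_left)
  have "orth_proj D H h = g" by (rule orth_proj_eqI[OF h g(1) *])
  then show "orth_proj D H h \<in> H" "k \<in> H \<Longrightarrow> L2_inner D (orth_proj D H h) k = L2_inner D h k"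
    using g(1) * by auto
qed

lemma closed_subspace:
  assumes R: "R \<subseteq> H" "(\<lambda>z. 0) \<in> R" "\<And>f g. f \<in> R \<Longrightarrow> g \<in> R \<Longrightarrow> (\<lambda>z. f z + g z) \<in> R"
    "\<And>c f. f \<in> R \<Longrightarrow> (\<lambda>z. c * f z) \<in> R"
    and closed: "\<And>h. h \<in> H \<Longrightarrow> (\<And>e. e > 0 \<Longrightarrow> \<exists>f\<in>R. L2_norm D (\<lambda>z. f z - h z) < e) \<Longrightarrow> h \<in> R"
  shows "hilbert_fun D R"
proof
  fix X :: "nat \<Rightarrow> complex \<Rightarrow> complex"
  assume X: "\<And>n. X n \<in> R" "\<And>e. e > 0 \<Longrightarrow> \<exists>N. \<forall>m\<ge>N. \<forall>n\<ge>N. L2_norm D (\<lambda>z. X m z - X n z) < e"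
  obtain x where x: "x \<in> H" "(\<lambda>n. L2_norm D (\<lambda>z. X n z - x z)) \<longlonglongrightarrow> 0"
    using complete[of X] X R(1) by blast
  have "x \<in> R"
  proof (rule closed[OF x(1)])
    fix e :: real assume "e > 0"
    then have "\<forall>\<^sub>F n in sequentially. L2_norm D (\<lambda>z. X n z - x z) < e"
      using order_tendstoD(2)[OF x(2)] by blast
    then show "\<exists>f\<in>R. L2_norm D (\<lambda>z. f z - x z) < e"
      using X(1) eventually_sequentially by auto
  qed
  with x show "\<exists>x\<in>R. (\<lambda>n. L2_norm D (\<lambda>z. X n z - x z)) \<longlonglongrightarrow> 0" by blast
qed (use R definite in_L2 in blast)+

text \<open>The residual of the projection onto \<open>R\<close> is orthogonal to \<open>R\<close>,
  hence zero.\<close>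

lemma dense_closed_eq:
  assumes "R \<subseteq> H" "hilbert_fun D R"
    "\<And>k. k \<in> H \<Longrightarrow> (\<And>f. f \<in> R \<Longrightarrow> L2_inner D f k = 0) \<Longrightarrow> k = (\<lambda>z. 0)"
  shows "R = H"
proof (intro equalityI assms(1) subsetI)
  interpret R: hilbert_fun D R by fact
  fix h assume h: "h \<in> H"
  obtain g where g: "g \<in> R" "\<forall>k\<in>R. L2_inner D (\<lambda>z. h z - g z) k = 0"
    using R.projection_exists[OF in_L2[OF h]] by blast
  then have gH: "g \<in> H" using assms(1) by blast
  have "L2_inner D f (\<lambda>z. h z - g z) = 0" if "f \<in> R" for f
    using g(2) that L2_inner_commute[of D f "\<lambda>z. h z - g z"] by simp
  then have "(\<lambda>z. h z - g z) = (\<lambda>z. 0)" using assms(3)[OF diff[OF h gH]] by blast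
  then have "h = g" by (auto simp: fun_eq_iff)
  then show "h \<in> R" using g(1) by simp
qed

end

section \<open>Uniform boundedness for families of inner product functionals\<close>

context hilbert_fun
begin

text \<open>The gliding hump argument.\<close>

lemma uniform_boundedness:
  assumes A: "A \<subseteq> H" and bd: "\<And>x. x \<in> H \<Longrightarrow> \<exists>C. \<forall>w\<in>A. cmod (L2_inner D x w) \<le> C"
  shows "\<exists>C. \<forall>w\<in>A. L2_norm D w \<le> C"
proof (rule ccontr)
  assume neg: "\<not> ?thesis"
  \<comment> \<open>The growth \<open>3 ^ n\<close> compensates for the step length
    \<open>(1/3)^n\<close> used below, and the factor \<open>4\<close> leaves
    \<open>2 * real n\<close> after half of the gain is lost to the later steps.\<close>
  have "\<forall>n. \<exists>w\<in>A. L2_norm D w > 4 * real n * 3 ^ n"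
    using neg by (meson not_le)
  then obtain w where w: "\<And>n. w n \<in> A" "\<And>n. L2_norm D (w n) > 4 * real n * 3 ^ n" by metis
  have wH: "w n \<in> H" for n using w(1) A by blast
  have wpos: "L2_norm D (w n) > 0" for n
    using w(2)[of n] by (smt (verit) of_nat_0_le_iff zero_le_mult_iff zero_le_power)
  define step where "step n x s = (\<lambda>z. x z + of_real (s * (1/3)^n / L2_norm D (w n)) * w n z)"
    for n :: nat and x :: "complex \<Rightarrow> complex" and s :: real
  have stepH: "step n x s \<in> H" if "x \<in> H" for n x s
    unfolding step_def by (rule add[OF that scale[OF wH]])
  \<comment> \<open>The values for the two signs differ by twice
    \<open>(1/3)^n * L2_norm D (w n)\<close>, so they cannot both be smaller than this in modulus,
    whatever the previous steps were.\<close>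
  have ex: "\<exists>s\<in>{1, -1}. cmod (L2_inner D (step n x s) (w n)) \<ge> (1/3)^n * L2_norm D (w n)" if x: "x \<in> H" for n x
  proof (rule ccontr)
    assume "\<not> ?thesis"
    then have 1: "cmod (L2_inner D (step n x 1) (w n)) < (1/3)^n * L2_norm D (w n)"
      and 2: "cmod (L2_inner D (step n x (-1)) (w n)) < (1/3)^n * L2_norm D (w n)" by auto
    have val: "L2_inner D (step n x s) (w n) = L2_inner D x (w n) + of_real (s * (1/3)^n * L2_norm D (w n))" for s
      unfolding step_def L2_inner_add_left[OF in_L2[OF x] in_L2[OF scale[OF wH]] in_L2[OF wH]]
        L2_inner_scale_left L2_inner_self
      using wpos[of n] by (simp add: power2_eq_square)
    have "cmod (of_real (2 * ((1/3)^n * L2_norm D (w n)))) =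
        cmod (L2_inner D (step n x 1) (w n) - L2_inner D (step n x (-1)) (w n))"
      unfolding val by (simp add: mult.commute)
    also have "\<dots> \<le> cmod (L2_inner D (step n x 1) (w n)) + cmod (L2_inner D (step n x (-1)) (w n))"
      by (rule norm_triangle_ineq4)
    finally show False using 1 2 wpos[of n] by (simp add: norm_mult norm_power norm_divide)
  qed
  define sg where "sg n x = (SOME s. s \<in> {1, -1} \<and> cmod (L2_inner D (step n x s) (w n)) \<ge> (1/3)^n * L2_norm D (w n))"
    for n x
  have sg: "sg n x \<in> {1, -1} \<and> cmod (L2_inner D (step n x (sg n x)) (w n)) \<ge> (1/3)^n * L2_norm D (w n)"
    if "x \<in> H" for n x
    unfolding sg_def by (rule someI_ex) (use ex[OF that, of n] in blast)
  define X where "X = rec_nat (\<lambda>z::complex. 0::complex) (\<lambda>n x. step n x (sg n x))"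
  have X0: "X 0 = (\<lambda>z. 0)" and XS: "X (Suc n) = step n (X n) (sg n (X n))" for n by (auto simp: X_def)
  have XH: "X n \<in> H" for n
    by (induction n) (auto simp: X0 XS zero intro: stepH)
  have Xstep: "\<exists>s\<in>{1, -1}. X (Suc n) = step n (X n) s \<and> cmod (L2_inner D (X (Suc n)) (w n)) \<ge> (1/3)^n * L2_norm D (w n)" for n
    using sg[OF XH[of n], of n] XS[of n] by (intro bexI[of _ "sg n (X n)"]) auto
  have d1: "L2_norm D (\<lambda>z. X (Suc n) z - X n z) = (1/3)^n" for n
  proof -
    obtain s where s: "s \<in> {1, -1}" "X (Suc n) = step n (X n) s" using Xstep by blast
    have "(\<lambda>z. X (Suc n) z - X n z) = (\<lambda>z. of_real (s * (1/3)^n / L2_norm D (w n)) * w n z)"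
      unfolding s(2) step_def by auto
    then show ?thesis
      using wpos[of n] s(1) by (simp only: L2_norm_scale norm_of_real) auto
  qed
  have dist: "L2_norm D (\<lambda>z. X m z - X n z) \<le> 3/2 * ((1/3)^n - (1/3)^m)" if "n \<le> m" for n m
    using that
  proof (induction m rule: dec_induct)
    case (step m)
    then show ?case
      using L2_norm_triangle_diff[OF in_L2[OF XH[of "Suc m"]] in_L2[OF XH[of m]] in_L2[OF XH[of n]]] d1[of m]
      by simp
  qed simp
  have dist': "L2_norm D (\<lambda>z. X m z - X n z) \<le> 3/2 * (1/3)^n" if "n \<le> m" for n m
  proof (rule order_trans[OF dist[OF that]])
    show "3/2 * ((1/3)^n - (1/3)^m) \<le> 3/2 * (1/3::real)^n" by (intro mult_left_mono) auto
  qed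
  have cau: "\<exists>N. \<forall>m\<ge>N. \<forall>n\<ge>N. L2_norm D (\<lambda>z. X m z - X n z) < e" if e: "e > 0" for e
  proof -
    obtain N where N: "(1/3 :: real) ^ N < e / 2" using real_arch_pow_inv[of "e/2" "1/3"] e by auto
    have "L2_norm D (\<lambda>z. X m z - X n z) < e" if "m \<ge> N" "n \<ge> N" for m n
    proof -
      have *: "L2_norm D (\<lambda>z. X m z - X n z) < e" if "n \<le> m" "n \<ge> N" for m n
      proof -
        have "(1/3::real)^n \<le> (1/3)^N" using that by (intro power_decreasing) auto
        then have "L2_norm D (\<lambda>z. X m z - X n z) \<le> 3/2 * (1/3)^N"
          using dist'[OF that(1)] by linarith
        then show ?thesis using N e by simp
      qed
      show ?thesis using *[of n m] *[of m n] that L2_norm_minus[of D "X m" "X n"] by (cases "n \<le> m") auto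
    qed
    then show ?thesis by blast
  qed
  obtain x where x: "x \<in> H" "(\<lambda>n. L2_norm D (\<lambda>z. X n z - x z)) \<longlonglongrightarrow> 0"
    using complete[of X] XH cau by blast
  have lim: "L2_norm D (\<lambda>z. x z - X n z) \<le> 3/2 * (1/3)^n" for n
  proof (rule LIMSEQ_le_const)
    show "(\<lambda>m. L2_norm D (\<lambda>z. X m z - x z) + 3/2 * (1/3)^n) \<longlonglongrightarrow> 3/2 * (1/3)^n"
      using tendsto_add[OF x(2) tendsto_const] by simp
    have "L2_norm D (\<lambda>z. x z - X n z) \<le> L2_norm D (\<lambda>z. X m z - x z) + 3/2 * (1/3)^n" if "m \<ge> n" for m
      using L2_norm_triangle_diff[OF in_L2[OF x(1)] in_L2[OF XH[of m]] in_L2[OF XH[of n]]]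
        dist'[OF that] L2_norm_minus[of D x "X m"] by linarith
    then show "\<exists>N. \<forall>m\<ge>N. L2_norm D (\<lambda>z. x z - X n z) \<le> L2_norm D (\<lambda>z. X m z - x z) + 3/2 * (1/3)^n" by blast
  qed
  have big: "cmod (L2_inner D x (w n)) \<ge> 2 * real n" for n
  proof -
    have "L2_inner D x (w n) = L2_inner D (X (Suc n)) (w n) + L2_inner D (\<lambda>z. x z - X (Suc n) z) (w n)"
      using L2_inner_diff_left[OF in_L2[OF x(1)] in_L2[OF XH] in_L2[OF wH]] by simp
    then have "cmod (L2_inner D x (w n)) \<ge> cmod (L2_inner D (X (Suc n)) (w n)) - cmod (L2_inner D (\<lambda>z. x z - X (Suc n) z) (w n))"
      by (smt (verit) norm_diff_ineq)
    moreover have "cmod (L2_inner D (X (Suc n)) (w n)) \<ge> (1/3)^n * L2_norm D (w n)" using Xstep by blast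
    \<comment> \<open>All later steps together have length at most \<open>3/2 * (1/3)^Suc n\<close>,
      which is half of \<open>(1/3)^n\<close>; half of the gain of step \<open>n\<close>
      survives.\<close>
    moreover have "cmod (L2_inner D (\<lambda>z. x z - X (Suc n) z) (w n)) \<le> (3/2 * (1/3)^Suc n) * L2_norm D (w n)"
      by (rule order_trans[OF L2_Cauchy_Schwarz mult_right_mono[OF lim]])
        (use x XH wH diff in auto)
    ultimately have "cmod (L2_inner D x (w n)) \<ge> 1/2 * ((1/3)^n * L2_norm D (w n))" by simp
    moreover have "(1/3)^n * L2_norm D (w n) \<ge> (1/3)^n * (4 * real n * 3^n)"
      using w(2)[of n] by (intro mult_left_mono) auto
    moreover have "(1/3)^n * (4 * real n * 3^n) = 4 * real n" by (simp add: power_divide)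
    ultimately show ?thesis by linarith
  qed
  obtain C where C: "\<forall>w\<in>A. cmod (L2_inner D x w) \<le> C" using bd[OF x(1)] by blast
  obtain n :: nat where "C < n" using reals_Archimedean2 by blast
  then show False using big[of n] C w(1)[of n] by force
qed

end

section \<open>Invertibility through lower bounds for an operator and its adjoint\<close>

definition bounded_below_on :: "(complex \<Rightarrow> complex) set \<Rightarrow> ((complex \<Rightarrow> complex) \<Rightarrow> real) \<Rightarrow>
    ((complex \<Rightarrow> complex) \<Rightarrow> complex \<Rightarrow> complex) \<Rightarrow> bool" where
  "bounded_below_on H N V \<longleftrightarrow> (\<exists>\<kappa>>0. \<forall>f\<in>H. \<kappa> * N f \<le> N (V f))"

text \<open>The adjoint relation carries linearity: additivity and homogeneity of \<open>V\<close>
  are read off from inner products against \<open>V' k\<close>. It also transfers boundedness to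
  \<open>V'\<close>, so the two maps play symmetric roles (\<open>swap\<close>).\<close>

locale adjoint_pair = hilbert_fun +
  fixes V V' :: "(complex \<Rightarrow> complex) \<Rightarrow> complex \<Rightarrow> complex"
  assumes V_in: "f \<in> H \<Longrightarrow> V f \<in> H" and V'_in: "f \<in> H \<Longrightarrow> V' f \<in> H"
    and adjoint: "f \<in> H \<Longrightarrow> k \<in> H \<Longrightarrow> L2_inner D (V f) k = L2_inner D f (V' k)"
    and bounded: "\<exists>C. \<forall>f\<in>H. L2_norm D (V f) \<le> C * L2_norm D f"
begin

lemma V_add: "f \<in> H \<Longrightarrow> g \<in> H \<Longrightarrow> V (\<lambda>z. f z + g z) = (\<lambda>z. V f z + V g z)"
  by (rule inner_eqI) (auto simp: V_in V'_in add adjoint L2_inner_add_left)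

lemma V_scale: "f \<in> H \<Longrightarrow> V (\<lambda>z. c * f z) = (\<lambda>z. c * V f z)"
  by (rule inner_eqI) (auto simp: V_in V'_in scale adjoint L2_inner_scale_left)

lemma V_zero: "V (\<lambda>z. 0) = (\<lambda>z. 0)"
  using V_scale[OF zero, of 0] by simp

lemma V_diff: "f \<in> H \<Longrightarrow> g \<in> H \<Longrightarrow> V (\<lambda>z. f z - g z) = (\<lambda>z. V f z - V g z)"
  using V_add[OF _ scale[of g "-1"], of f] V_scale[of g "-1"] by simp

lemma swap: "adjoint_pair D H V' V"
proof
  obtain C where C: "\<And>f. f \<in> H \<Longrightarrow> L2_norm D (V f) \<le> C * L2_norm D f" using bounded by blast
  have "L2_norm D (V' k) \<le> C * L2_norm D k" if k: "k \<in> H" for k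
  proof (cases "L2_norm D (V' k) = 0")
    case True
    have "0 \<le> C * L2_norm D k" using C[OF k] L2_norm_nonneg order_trans by blast
    then show ?thesis using True by simp
  next
    case False
    then have pos: "L2_norm D (V' k) > 0" using L2_norm_nonneg[of D "V' k"] by linarith
    have "(L2_norm D (V' k))\<^sup>2 = cmod (L2_inner D (V (V' k)) k)"
      by (simp add: adjoint k V'_in L2_inner_self norm_power)
    also have "\<dots> \<le> L2_norm D (V (V' k)) * L2_norm D k"
      by (rule L2_Cauchy_Schwarz) (auto simp: k V_in V'_in)
    also have "\<dots> \<le> (C * L2_norm D (V' k)) * L2_norm D k"
      by (intro mult_right_mono C V'_in k) simp
    finally show ?thesis using pos by (simp add: power2_eq_square mult_ac)
  qed
  then show "\<exists>C. \<forall>f\<in>H. L2_norm D (V' f) \<le> C * L2_norm D f" by blast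
  fix f k assume "f \<in> H" "k \<in> H"
  then show "L2_inner D (V' f) k = L2_inner D f (V k)"
    using adjoint[of k f] L2_inner_commute[of D "V' f" k] L2_inner_commute[of D f "V k"] by simp
qed (auto simp: V_in V'_in)

lemma hilbert_range:
  assumes "\<And>h. h \<in> H \<Longrightarrow> (\<And>e. e > 0 \<Longrightarrow> \<exists>f\<in>H. L2_norm D (\<lambda>z. V f z - h z) < e) \<Longrightarrow> h \<in> V ` H"
  shows "hilbert_fun D (V ` H)"
proof (rule closed_subspace)
  show "(\<lambda>z. 0) \<in> V ` H" using V_zero zero by (metis image_eqI)
  show "(\<lambda>z. f z + g z) \<in> V ` H" if fg: "f \<in> V ` H" "g \<in> V ` H" for f g
  proof -
    obtain f' g' where "f' \<in> H" "g' \<in> H" "f = V f'" "g = V g'" using fg by blast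
    then show ?thesis using V_add[of f' g'] add[of f' g'] by (metis image_eqI)
  qed
  show "(\<lambda>z. c * f z) \<in> V ` H" if fV: "f \<in> V ` H" for f c
  proof -
    obtain f' where "f' \<in> H" "f = V f'" using fV by blast
    then show ?thesis using V_scale[of f' c] scale[of f' c] by (metis image_eqI)
  qed
qed (use assms V_in in auto)

text \<open>A lower bound pulls a convergent sequence of values back to a Cauchy sequence of
  arguments, and boundedness of \<open>V\<close> identifies the limit.\<close>

lemma bounded_below_closed_range:
  assumes "bounded_below_on H (L2_norm D) V"
  shows "hilbert_fun D (V ` H)"
proof (rule hilbert_range)
  obtain \<kappa> where \<kappa>: "\<kappa> > 0" "\<And>f. f \<in> H \<Longrightarrow> \<kappa> * L2_norm D f \<le> L2_norm D (V f)"
    using assms by (auto simp: bounded_below_on_def)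
  obtain C where C: "\<And>f. f \<in> H \<Longrightarrow> L2_norm D (V f) \<le> C * L2_norm D f" using bounded by blast
  fix h assume h: "h \<in> H" and cl: "\<And>e. e > 0 \<Longrightarrow> \<exists>f\<in>H. L2_norm D (\<lambda>z. V f z - h z) < e"
  have "\<forall>n. \<exists>f\<in>H. L2_norm D (\<lambda>z. V f z - h z) < 1 / real (Suc n)" using cl by simp
  then obtain F where F: "\<And>n. F n \<in> H" "\<And>n. L2_norm D (\<lambda>z. V (F n) z - h z) < 1 / real (Suc n)" by metis
  have lim0: "(\<lambda>n. L2_norm D (\<lambda>z. V (F n) z - h z)) \<longlonglongrightarrow> 0"
    by (rule tendsto_sandwich[OF _ _ tendsto_const LIMSEQ_inverse_real_of_nat])
      (use F(2) in \<open>auto intro!: always_eventually simp: inverse_eq_divide less_imp_le\<close>)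
  have "\<exists>N. \<forall>m\<ge>N. \<forall>n\<ge>N. L2_norm D (\<lambda>z. F m z - F n z) < e" if e: "e > 0" for e
  proof -
    have "\<forall>\<^sub>F n in sequentially. L2_norm D (\<lambda>z. V (F n) z - h z) < \<kappa> * e / 2"
      using order_tendstoD(2)[OF lim0, of "\<kappa> * e / 2"] e \<kappa>(1) by simp
    then obtain N where N: "\<And>n. n \<ge> N \<Longrightarrow> L2_norm D (\<lambda>z. V (F n) z - h z) < \<kappa> * e / 2"
      by (auto simp: eventually_sequentially)
    have "L2_norm D (\<lambda>z. F m z - F n z) < e" if mn: "m \<ge> N" "n \<ge> N" for m n
    proof -
      have "\<kappa> * L2_norm D (\<lambda>z. F m z - F n z) \<le> L2_norm D (\<lambda>z. V (F m) z - V (F n) z)"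
        using \<kappa>(2)[OF diff[OF F(1) F(1)], of m n] V_diff[OF F(1) F(1), of m n] by simp
      also have "\<dots> \<le> L2_norm D (\<lambda>z. V (F m) z - h z) + L2_norm D (\<lambda>z. h z - V (F n) z)"
        by (rule L2_norm_triangle_diff) (use F h V_in in auto)
      also have "\<dots> < \<kappa> * e" using N[OF mn(1)] N[OF mn(2)] L2_norm_minus[of D h "V (F n)"] by simp
      finally show ?thesis using \<kappa>(1) by simp
    qed
    then show ?thesis by blast
  qed
  then obtain f where f: "f \<in> H" "(\<lambda>n. L2_norm D (\<lambda>z. F n z - f z)) \<longlonglongrightarrow> 0"
    using complete[of F] F(1) by blast
  have "L2_norm D (\<lambda>z. V f z - h z) \<le> 0"
  proof (rule LIMSEQ_le_const)
    show "(\<lambda>n. C * L2_norm D (\<lambda>z. F n z - f z) + L2_norm D (\<lambda>z. V (F n) z - h z)) \<longlonglongrightarrow> 0"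
      using tendsto_add[OF tendsto_mult[OF tendsto_const[of C] f(2)] lim0] by simp
    have "L2_norm D (\<lambda>z. V f z - h z) \<le> C * L2_norm D (\<lambda>z. F n z - f z) + L2_norm D (\<lambda>z. V (F n) z - h z)" for n
    proof -
      have "L2_norm D (\<lambda>z. V f z - h z) \<le> L2_norm D (\<lambda>z. V f z - V (F n) z) + L2_norm D (\<lambda>z. V (F n) z - h z)"
        by (rule L2_norm_triangle_diff) (use F h f V_in in auto)
      moreover have "L2_norm D (\<lambda>z. V f z - V (F n) z) = L2_norm D (V (\<lambda>z. F n z - f z))"
        by (simp add: V_diff F f L2_norm_minus[of D "V f"])
      moreover have "\<dots> \<le> C * L2_norm D (\<lambda>z. F n z - f z)" by (rule C[OF diff[OF F(1) f(1)]])
      ultimately show ?thesis by linarith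
    qed
    then show "\<exists>N. \<forall>n\<ge>N. L2_norm D (\<lambda>z. V f z - h z) \<le> C * L2_norm D (\<lambda>z. F n z - f z) + L2_norm D (\<lambda>z. V (F n) z - h z)"
      by blast
  qed
  then have "V f = h"
    by (intro eqI) (use f h V_in in \<open>auto intro: antisym\<close>)
  then show "h \<in> V ` H" using f(1) by blast
qed

lemma bounded_below_inj:
  assumes "bounded_below_on H (L2_norm D) V" "f \<in> H" "V f = (\<lambda>z. 0)"
  shows "f = (\<lambda>z. 0)"
proof -
  obtain \<kappa> where \<kappa>: "\<kappa> > 0" "\<kappa> * L2_norm D f \<le> L2_norm D (V f)"
    using assms by (auto simp: bounded_below_on_def)
  then have "L2_norm D f \<le> 0" using assms(3) by (simp add: mult_le_0_iff)
  then show ?thesis using definite[OF assms(2)] by (simp add: antisym)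
qed

lemma bounded_below_surj:
  assumes "bounded_below_on H (L2_norm D) V" "\<And>k. k \<in> H \<Longrightarrow> V' k = (\<lambda>z. 0) \<Longrightarrow> k = (\<lambda>z. 0)"
  shows "V ` H = H"
proof (rule dense_closed_eq[OF _ bounded_below_closed_range[OF assms(1)]])
  show "V ` H \<subseteq> H" using V_in by blast
  fix k assume k: "k \<in> H" and orth: "\<And>f. f \<in> V ` H \<Longrightarrow> L2_inner D f k = 0"
  have "L2_inner D (V' k) h = 0" if h: "h \<in> H" for h
    using orth[of "V h"] h adjoint[OF h k] L2_inner_commute[of D "V' k" h] by simp
  then show "k = (\<lambda>z. 0)" using assms(2)[OF k] orthogonal_imp_zero[OF V'_in[OF k]] by blast
qed

text \<open>The set of \<open>w\<close> with \<open>L2_norm D (V' w) \<le> 1\<close> is weakly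
  bounded, because every \<open>x\<close> equals some \<open>V y\<close> and the inner product of
  \<open>x\<close> with \<open>w\<close> is that of \<open>y\<close> with \<open>V' w\<close>.
  Uniform boundedness makes it norm bounded, and scaling gives the lower bound. This takes the place
  of the open mapping theorem.\<close>

lemma surj_imp_adjoint_bounded_below:
  assumes surj: "V ` H = H"
  shows "bounded_below_on H (L2_norm D) V'"
proof -
  have "\<exists>C. \<forall>w\<in>{w\<in>H. L2_norm D (V' w) \<le> 1}. L2_norm D w \<le> C"
  proof (rule uniform_boundedness)
    fix x assume "x \<in> H"
    then obtain y where y: "y \<in> H" "x = V y" using surj by blast
    have "cmod (L2_inner D x w) \<le> L2_norm D y" if w: "w \<in> H" "L2_norm D (V' w) \<le> 1" for w
    proof -
      have "cmod (L2_inner D x w) = cmod (L2_inner D y (V' w))" using y adjoint w by simp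
      also have "\<dots> \<le> L2_norm D y * L2_norm D (V' w)"
        by (rule L2_Cauchy_Schwarz) (use y w V'_in in auto)
      also have "\<dots> \<le> L2_norm D y * 1" by (intro mult_left_mono w) simp
      finally show ?thesis by simp
    qed
    then show "\<exists>C. \<forall>w\<in>{w\<in>H. L2_norm D (V' w) \<le> 1}. cmod (L2_inner D x w) \<le> C" by blast
  qed blast
  then obtain C where C: "\<And>w. w \<in> H \<Longrightarrow> L2_norm D (V' w) \<le> 1 \<Longrightarrow> L2_norm D w \<le> C" by blast
  interpret s: adjoint_pair D H V' V by (rule swap)
  define M where "M = max C 1"
  have M: "M \<ge> 1" "\<And>w. w \<in> H \<Longrightarrow> L2_norm D (V' w) \<le> 1 \<Longrightarrow> L2_norm D w \<le> M"
    using C by (auto simp: M_def le_max_iff_disj)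
  have "L2_norm D w \<le> M * L2_norm D (V' w)" if w: "w \<in> H" for w
  proof (cases "L2_norm D (V' w) = 0")
    case True
    have "L2_norm D w = 0"
    proof (rule ccontr)
      assume n: "L2_norm D w \<noteq> 0"
      \<comment> \<open>When \<open>V' w\<close> has norm zero, all multiples of \<open>w\<close>
        belong to the bounded set; this multiple has norm \<open>M + 1\<close>.\<close>
      define t where "t = (M + 1) / L2_norm D w"
      have "L2_norm D (\<lambda>z. of_real t * w z) \<le> M"
        by (rule M(2)[OF scale[OF w]]) (simp add: s.V_scale[OF w] L2_norm_scale True)
      moreover have "L2_norm D (\<lambda>z. of_real t * w z) = M + 1"
        using n M(1) by (simp only: L2_norm_scale norm_of_real) (simp add: t_def)
      ultimately show False by simp
    qed
    then show ?thesis using True by simp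
  next
    case False
    then have pos: "L2_norm D (V' w) > 0" using L2_norm_nonneg[of D "V' w"] by linarith
    have "L2_norm D (\<lambda>z. of_real (1 / L2_norm D (V' w)) * w z) \<le> M"
      by (rule M(2)[OF scale[OF w]]) (use pos in \<open>simp only: s.V_scale[OF w] L2_norm_scale norm_of_real, simp\<close>)
    then show ?thesis using pos unfolding L2_norm_scale norm_of_real by (simp add: field_simps)
  qed
  then have "\<forall>f\<in>H. (1 / M) * L2_norm D f \<le> L2_norm D (V' f)"
    using M(1) by (auto simp: field_simps)
  then show ?thesis using M(1) unfolding bounded_below_on_def by (intro exI[of _ "1 / M"]) auto
qed

text \<open>A lower bound for \<open>V\<close> gives injectivity and closed range; a lower bound for
  \<open>V'\<close> makes \<open>V'\<close> injective, so the closed range of \<open>V\<close> is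
  dense and hence everything. Conversely a bounded inverse gives the lower bound for
  \<open>V\<close> directly and the one for \<open>V'\<close> through surjectivity of
  \<open>V\<close>.\<close>

lemma inverse_iff_bounded_below:
  "(\<exists>S. bounded_operator_on H (L2_norm D) S \<and> (\<forall>f\<in>H. S (V f) = f \<and> V (S f) = f)) \<longleftrightarrow>
   bounded_below_on H (L2_norm D) V \<and> bounded_below_on H (L2_norm D) V'"
proof
  assume "\<exists>S. bounded_operator_on H (L2_norm D) S \<and> (\<forall>f\<in>H. S (V f) = f \<and> V (S f) = f)"
  then obtain S where bS: "bounded_operator_on H (L2_norm D) S" and SV: "\<forall>f\<in>H. S (V f) = f \<and> V (S f) = f"
    by blast
  obtain C where C: "\<forall>f\<in>H. L2_norm D (S f) \<le> C * L2_norm D f"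
    using bS by (auto simp: bounded_operator_on_def)
  have S: "\<And>f. f \<in> H \<Longrightarrow> S f \<in> H" "\<And>f. f \<in> H \<Longrightarrow> S (V f) = f" "\<And>f. f \<in> H \<Longrightarrow> V (S f) = f"
    using bS SV by (auto simp: bounded_operator_on_def)
  define M where "M = max C 1"
  have M: "M \<ge> 1" by (simp add: M_def)
  have CM: "L2_norm D (S f) \<le> M * L2_norm D f" if "f \<in> H" for f
    by (rule order_trans[OF C[rule_format, OF that]]) (simp add: M_def mult_right_mono)
  have "(1 / M) * L2_norm D f \<le> L2_norm D (V f)" if "f \<in> H" for f
    using CM[OF V_in[OF that]] S(2)[OF that] M by (simp add: field_simps)
  then have "bounded_below_on H (L2_norm D) V"
    using M unfolding bounded_below_on_def by (intro exI[of _ "1 / M"]) auto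
  moreover have "V ` H = H"
  proof (intro equalityI subsetI)
    fix h assume h: "h \<in> H"
    show "h \<in> V ` H" by (rule image_eqI[of _ _ "S h"]) (use S h in auto)
  qed (use V_in in auto)
  ultimately show "bounded_below_on H (L2_norm D) V \<and> bounded_below_on H (L2_norm D) V'"
    using surj_imp_adjoint_bounded_below by blast
next
  assume bb: "bounded_below_on H (L2_norm D) V \<and> bounded_below_on H (L2_norm D) V'"
  interpret s: adjoint_pair D H V' V by (rule swap)
  have surj: "V ` H = H" by (rule bounded_below_surj) (use bb s.bounded_below_inj in blast)+
  have inj: "f = g" if "f \<in> H" "g \<in> H" "V f = V g" for f g
  proof -
    have "V (\<lambda>z. f z - g z) = (\<lambda>z. 0)" using that by (simp add: V_diff)
    then have "(\<lambda>z. f z - g z) = (\<lambda>z. 0)" using bounded_below_inj bb diff[OF that(1,2)] by blast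
    then show ?thesis by (auto simp: fun_eq_iff)
  qed
  define S where "S h = (THE f. f \<in> H \<and> V f = h)" for h
  have S1: "S (V f) = f" if "f \<in> H" for f
    unfolding S_def by (rule the_equality) (use that inj in auto)
  have S: "S h \<in> H \<and> V (S h) = h" if h: "h \<in> H" for h
  proof -
    obtain f where "f \<in> H" "h = V f" using h surj by blast
    then show ?thesis using S1 by simp
  qed
  obtain \<kappa> where \<kappa>: "\<kappa> > 0" "\<And>f. f \<in> H \<Longrightarrow> \<kappa> * L2_norm D f \<le> L2_norm D (V f)"
    using bb by (auto simp: bounded_below_on_def)
  have "bounded_operator_on H (L2_norm D) S"
    unfolding bounded_operator_on_def
  proof (intro conjI ballI allI)
    show "S ` H \<subseteq> H" using S by blast
    show "S (\<lambda>z. f z + g z) = (\<lambda>z. S f z + S g z)" if "f \<in> H" "g \<in> H" for f g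
      using S1[OF add, of "S f" "S g"] V_add[of "S f" "S g"] S that by simp
    show "S (\<lambda>z. c * f z) = (\<lambda>z. c * S f z)" if "f \<in> H" for f c
      using S1[OF scale, of "S f" c] V_scale[of "S f" c] S that by simp
    have "L2_norm D (S f) \<le> (1 / \<kappa>) * L2_norm D f" if "f \<in> H" for f
      using \<kappa>(2)[of "S f"] S[OF that] \<kappa>(1) by (simp add: field_simps)
    then show "\<exists>C. \<forall>f\<in>H. L2_norm D (S f) \<le> C * L2_norm D f" by blast
  qed
  with S S1 show "\<exists>S. bounded_operator_on H (L2_norm D) S \<and> (\<forall>f\<in>H. S (V f) = f \<and> V (S f) = f)" by blast
qed

lemma inverse_imp_fredholm:
  assumes "bounded_operator_on H (L2_norm D) S" "\<And>f. f \<in> H \<Longrightarrow> S (V f) = f \<and> V (S f) = f"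
  shows "fredholm_on H (L2_norm D) V"
proof -
  have S: "\<And>f. f \<in> H \<Longrightarrow> S f \<in> H" using assms(1) by (auto simp: bounded_operator_on_def)
  have "f = (\<lambda>z. 0)" if "f \<in> H" "V f = (\<lambda>z. 0)" for f
    using assms(2)[OF that(1)] assms(2)[OF zero] V_zero that(2) by metis
  moreover have "h \<in> V ` H" if "h \<in> H" for h using assms(2)[OF that] S[OF that] by (metis image_eqI)
  ultimately show ?thesis
    unfolding fredholm_on_def by (intro conjI exI[of _ "{}"]) (auto simp: image_iff)
qed

end

section \<open>Fredholm operators that commute with a shift\<close>

lemma underdetermined_system:
  fixes c :: "nat \<Rightarrow> 'b \<Rightarrow> complex"
  assumes "finite B" "card B < n"
  shows "\<exists>x. (\<exists>i<n. x i \<noteq> 0) \<and> (\<forall>e\<in>B. (\<Sum>i<n. x i * c i e) = 0)"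
  using assms
proof (induction B arbitrary: n c rule: finite_induct)
  case empty
  then show ?case by (intro exI[of _ "\<lambda>_. 1"]) auto
next
  case (insert b B)
  then obtain m where m: "n = Suc m" "card B < m" by (cases n) auto
  show ?case
  proof (cases "\<forall>i<n. c i b = 0")
    case True
    have "card B < n" using m by simp
    then obtain x where x: "\<exists>i<n. x i \<noteq> 0" "\<forall>e\<in>B. (\<Sum>i<n. x i * c i e) = 0"
      using insert.IH[of n c] by blast
    then show ?thesis using True by (intro exI[of _ x]) auto
  next
    case False
    \<comment> \<open>Gaussian elimination with the pivot \<open>c p b\<close>: the equation of
      \<open>b\<close> is solved for the unknown with index \<open>p\<close> and substituted into
      the other equations, and \<open>s\<close> enumerates the remaining unknowns.\<close>
    then obtain p where p: "p < n" "c p b \<noteq> 0" by blast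
    define s where "s i = (if i < p then i else Suc i)" for i :: nat
    have bij: "bij_betw s {..<m} ({..<n} - {p})"
    proof (rule bij_betw_byWitness[where f' = "\<lambda>i. if i < p then i else i - 1"])
    qed (use p m in \<open>auto simp: s_def\<close>)
    obtain x where x: "\<exists>i<m. x i \<noteq> 0"
      "\<forall>e\<in>B. (\<Sum>i<m. x i * (c (s i) e - c (s i) b / c p b * c p e)) = 0"
      using insert.IH[OF m(2), of "\<lambda>i e. c (s i) e - c (s i) b / c p b * c p e"] by blast
    define r where "r = the_inv_into {..<m} s"
    have rs: "r (s i) = i" if "i < m" for i
      unfolding r_def using bij that by (intro the_inv_into_f_f) (auto simp: bij_betw_def)
    define xp where "xp = - (\<Sum>i<m. x i * c (s i) b) / c p b"
    define y where "y i = (if i = p then xp else x (r i))" for i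
    have ys: "y (s i) = x i" if "i < m" for i using rs[OF that] by (auto simp: y_def s_def)
    have sum: "(\<Sum>i<n. y i * c i e) = xp * c p e + (\<Sum>i<m. x i * c (s i) e)" for e
    proof -
      have "(\<Sum>i<n. y i * c i e) = y p * c p e + (\<Sum>i\<in>{..<n}-{p}. y i * c i e)"
        using p by (simp add: sum.remove)
      also have "(\<Sum>i\<in>{..<n}-{p}. y i * c i e) = (\<Sum>i<m. y (s i) * c (s i) e)"
        by (rule sum.reindex_bij_betw[OF bij, symmetric])
      finally show ?thesis by (simp add: ys y_def[of p])
    qed
    have "(\<Sum>i<n. y i * c i e) = 0" if "e \<in> insert b B" for e
    proof (cases "e = b")
      case True
      then show ?thesis unfolding sum xp_def using p(2) by simp
    next
      case False
      then have "(\<Sum>i<m. x i * (c (s i) e - c (s i) b / c p b * c p e)) = 0" using x(2) that by blast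
      then have "(\<Sum>i<m. x i * c (s i) e) - (\<Sum>i<m. x i * c (s i) b) / c p b * c p e = 0"
        by (simp add: right_diff_distrib sum_subtractf sum_divide_distrib sum_distrib_right mult.assoc)
      then show ?thesis unfolding sum xp_def by (simp add: algebra_simps)
    qed
    moreover have "\<exists>i<n. y i \<noteq> 0"
      using x(1) ys bij unfolding bij_betw_def by (metis Diff_iff image_eqI lessThan_iff)
    ultimately show ?thesis by blast
  qed
qed

context adjoint_pair
begin

text \<open>For \<open>f\<close> in the kernel, the \<open>card B + 1\<close> functions
  \<open>(U ^^ i) f\<close> lie in a span of \<open>card B\<close> functions, so a nontrivial
  combination vanishes and \<open>free\<close> applies. For \<open>k\<close> in the kernel of
  \<open>V'\<close>, the coefficients are chosen such that the combination \<open>y\<close> of the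
  \<open>(U ^^ i) k\<close> is orthogonal to the set \<open>B\<close> that complements the range of
  \<open>V\<close>. As \<open>y\<close> is also orthogonal to the range itself, it is orthogonal to
  all of \<open>H\<close>, hence zero.\<close>

lemma fredholm_imp_bounded_below:
  assumes fred: "fredholm_on H (L2_norm D) V"
    and U_in: "\<And>f. f \<in> H \<Longrightarrow> U f \<in> H"
    and UV: "\<And>f. f \<in> H \<Longrightarrow> V (U f) = U (V f)" "\<And>f. f \<in> H \<Longrightarrow> V' (U f) = U (V' f)"
    and U0: "U (\<lambda>z. 0) = (\<lambda>z. 0)"
    and free: "\<And>f n x. f \<in> H \<Longrightarrow> \<exists>i<n. x i \<noteq> 0 \<Longrightarrow> (\<lambda>z. \<Sum>i<n. x i * (U ^^ i) f z) = (\<lambda>z. 0) \<Longrightarrow> f = (\<lambda>z. 0)"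
  shows "bounded_below_on H (L2_norm D) V \<and> bounded_below_on H (L2_norm D) V'"
proof -
  interpret s: adjoint_pair D H V' V by (rule swap)
  have Ui: "(U ^^ i) f \<in> H" if "f \<in> H" for i f by (induction i) (use that U_in in auto)
  have ker: "V ((U ^^ i) f) = (\<lambda>z. 0)" if "f \<in> H" "V f = (\<lambda>z. 0)" for i f
    by (induction i) (use that UV(1) U0 Ui in auto)
  have ker': "V' ((U ^^ i) f) = (\<lambda>z. 0)" if "f \<in> H" "V' f = (\<lambda>z. 0)" for i f
    by (induction i) (use that UV(2) U0 Ui in auto)
  have inj: "f = (\<lambda>z. 0)" if f: "f \<in> H" "V f = (\<lambda>z. 0)" for f
  proof -
    obtain B where B: "finite B" "\<And>f. f \<in> H \<Longrightarrow> V f = (\<lambda>z. 0) \<Longrightarrow> \<exists>c. f = (\<lambda>z. \<Sum>e\<in>B. c e * e z)"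
      using fred[unfolded fredholm_on_def, THEN conjunct1] by blast
    have "\<forall>i. \<exists>c. (U ^^ i) f = (\<lambda>z. \<Sum>e\<in>B. c e * e z)" using B(2)[OF Ui ker] f by blast
    then obtain c where c: "\<And>i. (U ^^ i) f = (\<lambda>z. \<Sum>e\<in>B. c i e * e z)" by metis
    obtain x where x: "\<exists>i<Suc (card B). x i \<noteq> 0" "\<forall>e\<in>B. (\<Sum>i<Suc (card B). x i * c i e) = 0"
      using underdetermined_system[OF B(1) lessI, of c] by blast
    have "(\<Sum>i<Suc (card B). x i * (U ^^ i) f z) = 0" for z
    proof -
      have "(\<Sum>i<Suc (card B). x i * (U ^^ i) f z) = (\<Sum>i<Suc (card B). \<Sum>e\<in>B. x i * c i e * e z)"
        unfolding c by (simp add: sum_distrib_left mult.assoc del: sum.lessThan_Suc)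
      also have "\<dots> = (\<Sum>e\<in>B. (\<Sum>i<Suc (card B). x i * c i e) * e z)"
        by (subst sum.swap) (simp add: sum_distrib_right del: sum.lessThan_Suc)
      also have "\<dots> = 0" using x(2) by simp
      finally show ?thesis .
    qed
    then show ?thesis using free[OF f(1) x(1)] by blast
  qed
  have inj': "k = (\<lambda>z. 0)" if k: "k \<in> H" "V' k = (\<lambda>z. 0)" for k
  proof -
    obtain B where B: "finite B" "B \<subseteq> H" "\<And>h. h \<in> H \<Longrightarrow> \<exists>f\<in>H. \<exists>c. h = (\<lambda>z. V f z + (\<Sum>e\<in>B. c e * e z))"
      using fred[unfolded fredholm_on_def, THEN conjunct2, THEN conjunct2] by blast
    obtain x where x: "\<exists>i<Suc (card B). x i \<noteq> 0"
        "\<forall>e\<in>B. (\<Sum>i<Suc (card B). x i * L2_inner D ((U ^^ i) k) e) = 0"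
      using underdetermined_system[OF B(1) lessI, of "\<lambda>i e. L2_inner D ((U ^^ i) k) e"] by blast
    define y where "y = (\<lambda>z. \<Sum>i<Suc (card B). x i * (U ^^ i) k z)"
    have sums: "L2_inner D (\<lambda>z. \<Sum>i<n. x i * (U ^^ i) k z) h = (\<Sum>i<n. x i * L2_inner D ((U ^^ i) k) h)
        \<and> (\<lambda>z. \<Sum>i<n. x i * (U ^^ i) k z) \<in> H" if h: "h \<in> H" for h n
    proof (induction n)
      case 0 show ?case by (simp add: L2_inner_def zero)
    next
      case (Suc n)
      have *: "(\<lambda>z. x n * (U ^^ n) k z) \<in> H" using scale[OF Ui[OF k(1)]] .
      show ?case using Suc L2_inner_add_left[of "\<lambda>z. \<Sum>i<n. x i * (U ^^ i) k z" D "\<lambda>z. x n * (U ^^ n) k z" h] h *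
          add[of "\<lambda>z. \<Sum>i<n. x i * (U ^^ i) k z" "\<lambda>z. x n * (U ^^ n) k z"]
        by (simp add: L2_inner_scale_left)
    qed
    have yH: "y \<in> H" unfolding y_def using sums[OF zero] by blast
    have yB: "L2_inner D y e = 0" if "e \<in> B" for e
      unfolding y_def using sums[of e "Suc (card B)"] x(2) that B(2) by auto
    have yV: "L2_inner D y (V f) = 0" if f: "f \<in> H" for f
    proof -
      have "L2_inner D ((U ^^ i) k) (V f) = 0" for i
        using s.adjoint[OF Ui[OF k(1)] f, of i] ker'[OF k, of i] by (simp add: L2_inner_def)
      then show ?thesis unfolding y_def using sums[OF V_in[OF f]] by (simp del: sum.lessThan_Suc)
    qed
    obtain f c where fc: "f \<in> H" "y = (\<lambda>z. V f z + (\<Sum>e\<in>B. c e * e z))" using B(3)[OF yH] by blast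
    have sB: "L2_inner D y (\<lambda>z. \<Sum>e\<in>B'. c e * e z) = 0 \<and> (\<lambda>z. \<Sum>e\<in>B'. c e * e z) \<in> H" if "B' \<subseteq> B" for B'
      using finite_subset[OF that B(1)] that
    proof (induction B')
      case empty show ?case by (simp add: L2_inner_def zero)
    next
      case (insert b B')
      then have *: "(\<lambda>z. c b * b z) \<in> H" "b \<in> B" using scale B(2) by auto
      show ?case using insert * L2_inner_add_right[of "\<lambda>z. c b * b z" D "\<lambda>z. \<Sum>e\<in>B'. c e * e z" y] yH
          add[of "\<lambda>z. c b * b z" "\<lambda>z. \<Sum>e\<in>B'. c e * e z"] yB[of b]
        by (simp add: L2_inner_scale_right)
    qed
    have "L2_inner D y y = L2_inner D y (V f) + L2_inner D y (\<lambda>z. \<Sum>e\<in>B. c e * e z)"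
      by (subst (2) fc(2), rule L2_inner_add_right) (use sB yH V_in fc(1) in auto)
    then have "L2_norm D y = 0" using yV[OF fc(1)] sB[of B] by (simp add: L2_inner_self)
    then have "y = (\<lambda>z. 0)" by (rule definite[OF yH])
    then show ?thesis using free[OF k(1) x(1)] unfolding y_def by blast
  qed
  have "hilbert_fun D (V ` H)"
    using fred[unfolded fredholm_on_def, THEN conjunct2, THEN conjunct1] by (intro hilbert_range) blast
  then have "V ` H = H"
  proof (rule dense_closed_eq[rotated])
    show "V ` H \<subseteq> H" using V_in by blast
    fix k assume k: "k \<in> H" and orth: "\<And>f. f \<in> V ` H \<Longrightarrow> L2_inner D f k = 0"
    have "L2_inner D (V' k) h = 0" if h: "h \<in> H" for h
      using orth[of "V h"] h adjoint[OF h k] L2_inner_commute[of D "V' k" h] by simp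
    then show "k = (\<lambda>z. 0)" using inj'[OF k] orthogonal_imp_zero[OF V'_in[OF k]] by blast
  qed
  \<comment> \<open>Surjectivity of \<open>V\<close> bounds \<open>V'\<close> below; with the kernel
    of \<open>V\<close> trivial this makes \<open>V'\<close> surjective, which in turn bounds
    \<open>V\<close> below.\<close>
  then have bb': "bounded_below_on H (L2_norm D) V'" by (rule surj_imp_adjoint_bounded_below)
  then have "V' ` H = H" by (rule s.bounded_below_surj) (use inj in blast)
  then show ?thesis using s.surj_imp_adjoint_bounded_below bb' by blast
qed

end

section \<open>Toeplitz operators with bounded symbol on a space of functions\<close>

locale toeplitz_fun = hilbert_fun +
  fixes a :: "complex \<Rightarrow> complex" and \<beta> :: real
  assumes a_meas: "a \<in> borel_measurable (lebesgue_on D)" and a_bound: "\<And>z. cmod (a z) \<le> \<beta>"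
begin

lemma a_mult: "f \<in> H \<Longrightarrow> (\<lambda>z. a z * f z) \<in> L2 D"
  by (rule L2_mult_bounded[OF _ a_meas a_bound]) simp

lemma toeplitz_in: "f \<in> H \<Longrightarrow> toeplitz D H a f \<in> H"
  unfolding toeplitz_def by (rule orth_proj_in[OF a_mult])

lemma toeplitz_inner: "f \<in> H \<Longrightarrow> k \<in> H \<Longrightarrow> L2_inner D (toeplitz D H a f) k = L2_inner D (\<lambda>z. a z * f z) k"
  unfolding toeplitz_def by (rule orth_proj_inner[OF a_mult])

lemma shifted_in: "f \<in> H \<Longrightarrow> shifted (toeplitz D H a) \<mu> f \<in> H"
  unfolding shifted_def by (intro diff toeplitz_in scale)

lemma shifted_inner:
  assumes "f \<in> H" "k \<in> H"
  shows "L2_inner D (shifted (toeplitz D H a) \<mu> f) k = L2_inner D (\<lambda>z. (a z - \<mu>) * f z) k"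
proof -
  have "L2_inner D (shifted (toeplitz D H a) \<mu> f) k = L2_inner D (\<lambda>z. a z * f z) k - \<mu> * L2_inner D f k"
    unfolding shifted_def
    by (simp add: L2_inner_diff_left toeplitz_in toeplitz_inner L2_scale assms L2_inner_scale_left)
  also have "\<dots> = L2_inner D (\<lambda>z. a z * f z - \<mu> * f z) k"
    by (simp add: L2_inner_diff_left a_mult L2_scale assms L2_inner_scale_left)
  finally show ?thesis by (simp add: left_diff_distrib)
qed

lemma adjoint_pair_toeplitz:
  "adjoint_pair D H (shifted (toeplitz D H a) \<mu>) (shifted (toeplitz D H (\<lambda>z. cnj (a z))) (cnj \<mu>))"
proof -
  have "cnj \<in> borel_measurable borel"
    by (intro borel_measurable_continuous_onI continuous_intros)
  from measurable_compose[OF a_meas this]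
  have cm: "(\<lambda>z. cnj (a z)) \<in> borel_measurable (lebesgue_on D)" .
  have "toeplitz_fun_axioms D (\<lambda>z. cnj (a z)) \<beta>"
    by (rule toeplitz_fun_axioms.intro[OF cm]) (simp add: a_bound)
  then interpret c: toeplitz_fun D H "\<lambda>z. cnj (a z)" \<beta>
    by (intro toeplitz_fun.intro hilbert_fun_axioms)
  show ?thesis
  proof
    fix f k assume fk: "f \<in> H" "k \<in> H"
    have "L2_inner D (shifted (toeplitz D H a) \<mu> f) k = L2_inner D (\<lambda>z. (a z - \<mu>) * f z) k"
      by (rule shifted_inner[OF fk])
    also have "\<dots> = cnj (L2_inner D (\<lambda>z. (cnj (a z) - cnj \<mu>) * k z) f)"
      unfolding L2_inner_def by (subst Bochner_Integration.integral_cnj[symmetric]) (simp add: mult_ac)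
    also have "\<dots> = L2_inner D f (shifted (toeplitz D H (\<lambda>z. cnj (a z))) (cnj \<mu>) k)"
      by (simp add: c.shifted_inner[OF fk(2,1), symmetric] L2_inner_commute[of D f])
    finally show "L2_inner D (shifted (toeplitz D H a) \<mu> f) k =
        L2_inner D f (shifted (toeplitz D H (\<lambda>z. cnj (a z))) (cnj \<mu>) k)" .
  next
    have "L2_norm D (shifted (toeplitz D H a) \<mu> f) \<le> (\<beta> + cmod \<mu>) * L2_norm D f" if f: "f \<in> H" for f
    proof (cases "L2_norm D (shifted (toeplitz D H a) \<mu> f) = 0")
      case True
      have "0 \<le> \<beta> + cmod \<mu>" using order_trans[OF norm_ge_zero a_bound[of 0]] by simp
      then show ?thesis using True by simp
    next
      case False
      let ?v = "shifted (toeplitz D H a) \<mu> f"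
      have pos: "L2_norm D ?v > 0" using False L2_norm_nonneg[of D ?v] by linarith
      have m: "(\<lambda>z. a z - \<mu>) \<in> borel_measurable (lebesgue_on D)" using a_meas by measurable
      have b: "cmod (a z - \<mu>) \<le> \<beta> + cmod \<mu>" for z
        using norm_triangle_ineq4[of "a z" \<mu>] a_bound[of z] by linarith
      have "(L2_norm D ?v)\<^sup>2 = cmod (L2_inner D ?v ?v)" by (simp add: L2_inner_self norm_power)
      also have "\<dots> = cmod (L2_inner D (\<lambda>z. (a z - \<mu>) * f z) ?v)"
        by (simp add: shifted_inner f shifted_in)
      also have "\<dots> \<le> L2_norm D (\<lambda>z. (a z - \<mu>) * f z) * L2_norm D ?v"
        by (rule L2_Cauchy_Schwarz[OF L2_mult_bounded[OF in_L2[OF f] m b] in_L2[OF shifted_in[OF f]]])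
      also have "\<dots> \<le> ((\<beta> + cmod \<mu>) * L2_norm D f) * L2_norm D ?v"
        by (intro mult_right_mono L2_norm_mult_bounded[OF in_L2[OF f] m b]) simp
      finally show ?thesis using pos by (simp add: power2_eq_square)
    qed
    then show "\<exists>C. \<forall>f\<in>H. L2_norm D (shifted (toeplitz D H a) \<mu> f) \<le> C * L2_norm D f" by blast
  qed (auto simp: shifted_in c.shifted_in)
qed

text \<open>Through this equivalence the comparison of domain and cell becomes a comparison of lower
  bounds, made once for the given data and once for the conjugate data.\<close>

lemma not_in_spectrum_iff:
  "\<mu> \<notin> spectrum_on H (L2_norm D) (toeplitz D H a) \<longleftrightarrow>
   bounded_below_on H (L2_norm D) (shifted (toeplitz D H a) \<mu>) \<and>
   bounded_below_on H (L2_norm D) (shifted (toeplitz D H (\<lambda>z. cnj (a z))) (cnj \<mu>))"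
  unfolding spectrum_on_def using adjoint_pair.inverse_iff_bounded_below[OF adjoint_pair_toeplitz] by simp

end

section \<open>Bergman spaces\<close>

text \<open>The squared norm with values in \<open>ennreal\<close>: it is meaningful before
  integrability is known and commutes freely with lattice sums, so finiteness can be concluded from
  the estimates themselves.\<close>

definition sqint :: "complex set \<Rightarrow> (complex \<Rightarrow> complex) \<Rightarrow> ennreal" where
  "sqint D f = (\<integral>\<^sup>+z. ennreal ((cmod (f z))\<^sup>2) \<partial>lebesgue_on D)"

lemma sqint_eq_L2_norm: "f \<in> L2 D \<Longrightarrow> sqint D f = ennreal ((L2_norm D f)\<^sup>2)"
  unfolding sqint_def L2_norm_sq by (rule nn_integral_eq_integral) (auto simp: L2_integrable)

lemma L2_iff_sqint: "f \<in> L2 D \<longleftrightarrow> f \<in> borel_measurable (lebesgue_on D) \<and> sqint D f < \<infinity>"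
proof (cases "f \<in> borel_measurable (lebesgue_on D)")
  case True
  then have "(\<lambda>z. (cmod (f z))\<^sup>2) \<in> borel_measurable (lebesgue_on D)" by measurable
  then show ?thesis using True by (auto simp: L2_def sqint_def integrable_iff_bounded)
qed (auto simp: L2_def)

lemma sqint_indicator:
  "D \<in> sets lebesgue \<Longrightarrow> sqint D f = (\<integral>\<^sup>+z. ennreal ((cmod (f z))\<^sup>2) * indicator D z \<partial>lebesgue)"
  unfolding sqint_def by (rule nn_integral_restrict_space) simp

text \<open>Cauchy's formula on the circles of radius \<open>\<rho>\<close> is averaged over their centres, which replaces
  polar coordinates by the translation invariance of the area measure.\<close>

lemma sub_mean_value:
  fixes f :: "complex \<Rightarrow> complex"
  assumes f: "f holomorphic_on D" and D: "open D" "ball z (2 * \<rho>) \<subseteq> D" and \<rho>: "\<rho> > 0"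
  shows "ennreal (cmod (f z)) * emeasure lborel (ball z (\<rho> / 2)) \<le>
         2 * (\<integral>\<^sup>+w. ennreal (cmod (f w)) * indicator D w \<partial>lborel)"
proof -
  define \<gamma> where "\<gamma> t = \<rho> * exp (2 * of_real pi * \<i> * of_real t)" for t :: real
  have n\<gamma>: "cmod (\<gamma> t) = \<rho>" for t
    using \<rho> norm_exp_i_times[of "2 * pi * t"] by (simp add: \<gamma>_def norm_mult mult_ac)
  \<comment> \<open>A circle of radius \<open>\<rho>\<close> whose centre is closer than
    \<open>\<rho> / 2\<close> to \<open>z\<close> encloses \<open>z\<close>, keeps distance at least
    \<open>\<rho> / 2\<close> from it, and stays within distance
    \<open>3 * \<rho> / 2\<close>.\<close>
  have pt: "c + \<gamma> t \<in> ball z (2 * \<rho>)" "cmod (c + \<gamma> t - z) \<ge> \<rho> / 2" if c: "c \<in> ball z (\<rho> / 2)" for c t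
  proof -
    have cz: "cmod (z - c) < \<rho> / 2" using c by (simp add: dist_norm)
    have "cmod (z - (c + \<gamma> t)) \<le> cmod (z - c) + cmod (\<gamma> t)"
      using norm_triangle_ineq4[of "z - c" "\<gamma> t"] by (simp add: algebra_simps)
    then show "c + \<gamma> t \<in> ball z (2 * \<rho>)" using cz n\<gamma>[of t] \<rho> by (simp add: dist_norm)
    have "cmod (c + \<gamma> t - z) \<ge> cmod (\<gamma> t) - cmod (z - c)"
      using norm_triangle_ineq2[of "\<gamma> t" "z - c"] by (simp add: algebra_simps)
    then show "cmod (c + \<gamma> t - z) \<ge> \<rho> / 2" using cz n\<gamma>[of t] by simp
  qed
  \<comment> \<open>Extension by zero, which supplies joint Borel measurability for Fubini's
    theorem; the circles used in \<open>circ\<close> stay inside \<open>D\<close>.\<close>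
  define F where "F w = indicator D w *\<^sub>R f w" for w
  have F_meas [measurable]: "F \<in> borel_measurable borel"
    unfolding F_def by (rule borel_measurable_continuous_on_indicator)
      (use D f holomorphic_on_imp_continuous_on in auto)
  have \<gamma>_meas [measurable]: "\<gamma> \<in> borel_measurable borel"
    unfolding \<gamma>_def by (intro borel_measurable_continuous_onI continuous_intros)
  have circ: "ennreal (cmod (f z)) \<le> 2 * (\<integral>\<^sup>+t. ennreal (cmod (F (c + \<gamma> t))) * indicator {0..1} t \<partial>lborel)"
    if c: "c \<in> ball z (\<rho> / 2)" for c
  proof -
    have cb: "cball c \<rho> \<subseteq> D"
    proof
      fix w assume "w \<in> cball c \<rho>"
      moreover have "dist z w \<le> dist z c + dist c w" by (rule dist_triangle)
      ultimately have "w \<in> ball z (2 * \<rho>)" using c \<rho> by auto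
      then show "w \<in> D" using D by blast
    qed
    have "((\<lambda>u. f u / (u - z)) has_contour_integral (2 * of_real pi * \<i> * f z)) (circlepath c \<rho>)"
      by (rule Cauchy_integral_circlepath_simple)
        (use cb c \<rho> holomorphic_on_subset[OF f] in \<open>auto simp: dist_norm norm_minus_commute\<close>)
    moreover have "vector_derivative (circlepath c \<rho>) (at t) = 2 * of_real pi * \<i> * \<gamma> t" for t
      by (simp add: vector_derivative_circlepath \<gamma>_def)
    moreover have "circlepath c \<rho> t = c + \<gamma> t" for t
      by (simp add: circlepath \<gamma>_def)
    ultimately have hi: "((\<lambda>t. f (c + \<gamma> t) / (c + \<gamma> t - z) * (2 * of_real pi * \<i> * \<gamma> t)) has_integral
        (2 * of_real pi * \<i> * f z)) {0..1}"
      unfolding has_contour_integral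
      by simp
    have cont: "continuous_on {0..1} (\<lambda>t. cmod (f (c + \<gamma> t)))"
    proof (rule continuous_on_norm, rule continuous_on_compose2[OF holomorphic_on_imp_continuous_on[OF f]])
      show "continuous_on {0..1} (\<lambda>t. c + \<gamma> t)" unfolding \<gamma>_def by (intro continuous_intros)
      show "(\<lambda>t. c + \<gamma> t) ` {0..1} \<subseteq> D" using pt[OF c] D by blast
    qed
    then have int: "(\<lambda>t. cmod (f (c + \<gamma> t))) integrable_on {0..1}" by (rule integrable_continuous_real)
    \<comment> \<open>On the circle the Cauchy kernel is at most \<open>2 / \<rho>\<close> in
      modulus, so the integrand is at most \<open>4 * pi\<close> times the modulus of
      \<open>f\<close>; dividing by \<open>2 * pi\<close> leaves the constant
      \<open>2\<close>.\<close>
    have "cmod (2 * of_real pi * \<i> * f z) \<le> integral {0..1} (\<lambda>t. (4 * pi) * cmod (f (c + \<gamma> t)))"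
      unfolding integral_unique[OF hi, symmetric]
    proof (rule Henstock_Kurzweil_Integration.integral_norm_bound_integral)
      show "(\<lambda>t. (4 * pi) * cmod (f (c + \<gamma> t))) integrable_on {0..1}"
        using integrable_on_cmult_left[OF int, of "4 * pi"] by simp
      fix t :: real
      have "cmod (c + \<gamma> t - z) > 0" using pt(2)[OF c, of t] \<rho> by linarith
      then have "\<rho> / cmod (c + \<gamma> t - z) \<le> 2" using pt(2)[OF c, of t]
        by (simp add: pos_divide_le_eq)
      then have "cmod (f (c + \<gamma> t)) * (\<rho> / cmod (c + \<gamma> t - z)) * (2 * pi) \<le> cmod (f (c + \<gamma> t)) * 2 * (2 * pi)"
        by (intro mult_right_mono mult_left_mono) auto
      then show "cmod (f (c + \<gamma> t) / (c + \<gamma> t - z) * (2 * of_real pi * \<i> * \<gamma> t)) \<le> (4 * pi) * cmod (f (c + \<gamma> t))"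
        by (simp add: norm_mult norm_divide n\<gamma> mult_ac)
    qed (use hi in blast)
    then have "cmod (f z) \<le> 2 * integral {0..1} (\<lambda>t. cmod (f (c + \<gamma> t)))"
      by (simp add: norm_mult)
    moreover have "ennreal (integral {0..1} (\<lambda>t. cmod (f (c + \<gamma> t)))) =
        (\<integral>\<^sup>+t. ennreal (cmod (f (c + \<gamma> t))) * indicator {0..1} t \<partial>lborel)"
      by (rule nn_integral_has_integral_lebesgue'[symmetric]) (use int in \<open>auto simp: integrable_integral\<close>)
    moreover have "\<dots> = (\<integral>\<^sup>+t. ennreal (cmod (F (c + \<gamma> t))) * indicator {0..1} t \<partial>lborel)"
      using subsetD[OF D(2) pt(1)[OF c]] by (intro nn_integral_cong) (simp add: F_def)
    moreover have "ennreal (2 * integral {0..1} (\<lambda>t. cmod (f (c + \<gamma> t)))) =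
        2 * ennreal (integral {0..1} (\<lambda>t. cmod (f (c + \<gamma> t))))"
      by (simp add: ennreal_mult' integral_nonneg[OF int])
    ultimately show ?thesis by (metis ennreal_leI)
  qed
  have "ennreal (cmod (f z)) * emeasure lborel (ball z (\<rho> / 2)) =
      (\<integral>\<^sup>+c. ennreal (cmod (f z)) * indicator (ball z (\<rho> / 2)) c \<partial>lborel)"
    by (simp add: nn_integral_cmult_indicator)
  also have "\<dots> \<le> (\<integral>\<^sup>+c. \<integral>\<^sup>+t. 2 * (ennreal (cmod (F (c + \<gamma> t))) * indicator {0..1} t) \<partial>lborel \<partial>lborel)"
    using circ by (intro nn_integral_mono) (auto simp: indicator_def nn_integral_cmult)
  also have "\<dots> = (\<integral>\<^sup>+t. \<integral>\<^sup>+c. 2 * (ennreal (cmod (F (c + \<gamma> t))) * indicator {0..1} t) \<partial>lborel \<partial>lborel)"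
    by (rule lborel_pair.Fubini') measurable
  also have "\<dots> = (\<integral>\<^sup>+t. 2 * (\<integral>\<^sup>+w. ennreal (cmod (f w)) * indicator D w \<partial>lborel) * indicator {0..1::real} t \<partial>lborel)"
  proof (intro nn_integral_cong)
    fix t :: real
    have "(\<integral>\<^sup>+c. 2 * (ennreal (cmod (F (c + \<gamma> t))) * indicator {0..1} t) \<partial>lborel) =
        2 * (\<integral>\<^sup>+c. ennreal (cmod (F (\<gamma> t + c))) \<partial>lborel) * indicator {0..1} t"
      by (simp add: nn_integral_cmult nn_integral_multc add.commute mult.assoc)
    also have "(\<integral>\<^sup>+c. ennreal (cmod (F (\<gamma> t + c))) \<partial>lborel) = (\<integral>\<^sup>+w. ennreal (cmod (F w)) \<partial>distr lborel borel ((+) (\<gamma> t)))"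
      by (rule nn_integral_distr[symmetric]) auto
    also have "\<dots> = (\<integral>\<^sup>+w. ennreal (cmod (f w)) * indicator D w \<partial>lborel)"
      unfolding lborel_distr_plus by (intro nn_integral_cong) (auto simp: F_def indicator_def)
    finally show "(\<integral>\<^sup>+c. 2 * (ennreal (cmod (F (c + \<gamma> t))) * indicator {0..1} t) \<partial>lborel) =
      2 * (\<integral>\<^sup>+w. ennreal (cmod (f w)) * indicator D w \<partial>lborel) * indicator {0..1::real} t" .
  qed
  also have "\<dots> = 2 * (\<integral>\<^sup>+w. ennreal (cmod (f w)) * indicator D w \<partial>lborel)"
    by (subst nn_integral_cmult_indicator) auto
  finally show ?thesis .
qed

text \<open>The mean value estimate is applied to the square of \<open>f\<close>, which is again
  holomorphic and whose modulus integrates to the squared norm.\<close>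

lemma holomorphic_sup_bound:
  assumes f: "f \<in> L2 D" "f holomorphic_on D" and D: "open D" "ball z (2 * \<rho>) \<subseteq> D" and \<rho>: "\<rho> > 0"
  shows "(cmod (f z))\<^sup>2 * measure lborel (ball (0::complex) (\<rho> / 2)) \<le> 2 * (L2_norm D f)\<^sup>2"
proof -
  have "ennreal (cmod ((f z)\<^sup>2)) * emeasure lborel (ball z (\<rho> / 2)) \<le>
        2 * (\<integral>\<^sup>+w. ennreal (cmod ((f w)\<^sup>2)) * indicator D w \<partial>lborel)"
    by (rule sub_mean_value[OF _ D \<rho>]) (intro holomorphic_intros f)
  also have "(\<integral>\<^sup>+w. ennreal (cmod ((f w)\<^sup>2)) * indicator D w \<partial>lborel) = sqint D f"
    using D(1) by (subst sqint_indicator) (auto simp: nn_integral_completion norm_power)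
  also have "2 * \<dots> = ennreal (2 * (L2_norm D f)\<^sup>2)"
    by (simp add: sqint_eq_L2_norm f ennreal_mult')
  also have "emeasure lborel (ball z (\<rho> / 2)) = ennreal (measure lborel (ball z (\<rho> / 2)))"
    by (rule emeasure_eq_ennreal_measure) (use emeasure_bounded_finite[of "ball z (\<rho> / 2)"] in auto)
  also have "measure lborel (ball z (\<rho> / 2)) = measure lborel (ball (0::complex) (\<rho> / 2))"
    using \<rho> by (simp add: content_ball)
  finally show ?thesis
    by (subst (asm) ennreal_mult''[symmetric], simp) (simp add: norm_power)
qed

lemma holomorphic_sup_bound':
  assumes D: "open D" and \<rho>: "\<rho> > 0"
  obtains K where "K > 0"
    "\<And>f z. f \<in> L2 D \<Longrightarrow> f holomorphic_on D \<Longrightarrow> ball z (2 * \<rho>) \<subseteq> D \<Longrightarrow> cmod (f z) \<le> K * L2_norm D f"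
proof -
  define m where "m = measure lborel (ball (0::complex) (\<rho> / 2))"
  have m: "m > 0" unfolding m_def using \<rho> by (simp add: content_ball)
  have "cmod (f z) \<le> sqrt (2 / m) * L2_norm D f"
    if "f \<in> L2 D" "f holomorphic_on D" "ball z (2 * \<rho>) \<subseteq> D" for f z
  proof (rule power2_le_imp_le)
    show "(cmod (f z))\<^sup>2 \<le> (sqrt (2 / m) * L2_norm D f)\<^sup>2"
      using holomorphic_sup_bound[OF that(1,2) D that(3) \<rho>] m
      by (simp add: power_mult_distrib m_def[symmetric] field_simps)
  qed (use m in simp)
  then show ?thesis using that[of "sqrt (2 / m)"] m by simp
qed

lemma holomorphic_imp_measurable_lebesgue_on:
  "open D \<Longrightarrow> f holomorphic_on D \<Longrightarrow> f \<in> borel_measurable (lebesgue_on D)"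
  by (intro continuous_imp_measurable_on_sets_lebesgue holomorphic_on_imp_continuous_on) auto

text \<open>Point evaluations are locally uniformly bounded. This gives definiteness and
  completeness of the Bergman space, and later the local convergence of the lattice sums.\<close>

lemma bergman_bounds:
  assumes "open D" "z \<in> D"
  obtains r K where "r > 0" "K > 0" "cball z r \<subseteq> D"
    "\<And>f w. f \<in> L2 D \<Longrightarrow> f holomorphic_on D \<Longrightarrow> w \<in> cball z r \<Longrightarrow> cmod (f w) \<le> K * L2_norm D f"
proof -
  obtain e where e: "e > 0" "ball z e \<subseteq> D" using assms open_contains_ball by blast
  obtain K where K: "K > 0" "\<And>f w. f \<in> L2 D \<Longrightarrow> f holomorphic_on D \<Longrightarrow> ball w (2 * (e / 4)) \<subseteq> D \<Longrightarrow> cmod (f w) \<le> K * L2_norm D f"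
    using holomorphic_sup_bound'[OF assms(1), of "e / 4"] e(1) by auto
  have sub: "ball w (2 * (e / 4)) \<subseteq> D" if "w \<in> cball z (e / 4)" for w
  proof -
    have "ball w (2 * (e / 4)) \<subseteq> ball z e"
    proof
      fix u assume "u \<in> ball w (2 * (e / 4))"
      then show "u \<in> ball z e" using that dist_triangle[of z u w] e(1) by auto
    qed
    then show ?thesis using e(2) by blast
  qed
  have "cball z (e / 4) \<subseteq> D" using e by (auto simp: subset_iff)
  then show ?thesis using that[of "e / 4" K] e(1) K sub by auto
qed

text \<open>A Cauchy sequence converges locally uniformly by \<open>bergman_bounds\<close>, so its
  pointwise limit is holomorphic; Fatou's lemma upgrades pointwise convergence to convergence in
  norm.\<close>

lemma hilbert_bergman:
  assumes D: "open D"
  shows "hilbert_fun D (bergman D)"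
proof
  show "bergman D \<subseteq> L2 D" by (auto simp: bergman_def)
  show "(\<lambda>z. 0) \<in> bergman D" by (auto simp: bergman_def)
  show "(\<lambda>z. f z + g z) \<in> bergman D" if "f \<in> bergman D" "g \<in> bergman D" for f g
    using that by (auto simp: bergman_def L2_add intro!: holomorphic_intros)
  show "(\<lambda>z. c * f z) \<in> bergman D" if "f \<in> bergman D" for f c
    using that by (auto simp: bergman_def L2_scale intro!: holomorphic_intros)
  show "f = (\<lambda>z. 0)" if f: "f \<in> bergman D" "L2_norm D f = 0" for f
  proof
    fix z show "f z = 0"
    proof (cases "z \<in> D")
      case True
      obtain r K where "r > 0"
        "\<And>f w. f \<in> L2 D \<Longrightarrow> f holomorphic_on D \<Longrightarrow> w \<in> cball z r \<Longrightarrow> cmod (f w) \<le> K * L2_norm D f"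
        using bergman_bounds[OF D True] by metis
      then have "cmod (f z) \<le> K * L2_norm D f" using f(1) by (simp add: bergman_def)
      then show ?thesis using f(2) by simp
    qed (use f in \<open>auto simp: bergman_def\<close>)
  qed
next
  fix X :: "nat \<Rightarrow> complex \<Rightarrow> complex"
  assume X: "\<And>n. X n \<in> bergman D"
    and cau: "\<And>e. e > 0 \<Longrightarrow> \<exists>N. \<forall>m\<ge>N. \<forall>n\<ge>N. L2_norm D (\<lambda>z. X m z - X n z) < e"
  have X_L2: "X n \<in> L2 D" and X_hol: "X n holomorphic_on D" and X_out: "z \<notin> D \<Longrightarrow> X n z = 0" for n z
    using X[of n] by (auto simp: bergman_def)
  define x where "x z = lim (\<lambda>n. X n z)" for z
  have unif: "\<exists>d. 0 < d \<and> cball z d \<subseteq> D \<and> uniform_limit (cball z d) X x sequentially" if z: "z \<in> D" for z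
  proof -
    obtain r K where r: "r > 0" "K > 0" "cball z r \<subseteq> D"
      and K: "\<And>f w. f \<in> L2 D \<Longrightarrow> f holomorphic_on D \<Longrightarrow> w \<in> cball z r \<Longrightarrow> cmod (f w) \<le> K * L2_norm D f"
      using bergman_bounds[OF D z] by metis
    have "uniformly_Cauchy_on (cball z r) X"
      unfolding uniformly_Cauchy_on_def
    proof (intro allI impI)
      fix e :: real assume "e > 0"
      then obtain N where N: "\<forall>m\<ge>N. \<forall>n\<ge>N. L2_norm D (\<lambda>z. X m z - X n z) < e / K"
        using cau[of "e / K"] r(2) by auto
      have "dist (X m w) (X n w) < e" if "w \<in> cball z r" "m \<ge> N" "n \<ge> N" for m n w
      proof -
        have "cmod (X m w - X n w) \<le> K * L2_norm D (\<lambda>z. X m z - X n z)"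
          by (rule K[OF L2_diff[OF X_L2 X_L2] _ that(1)]) (intro holomorphic_intros X_hol)
        also have "\<dots> < K * (e / K)" using N that r(2) by (intro mult_strict_left_mono) auto
        finally show ?thesis using r(2) by (simp add: dist_norm)
      qed
      then show "\<exists>M. \<forall>x\<in>cball z r. \<forall>m\<ge>M. \<forall>n\<ge>M. dist (X m x) (X n x) < e" by blast
    qed
    then have "uniform_limit (cball z r) X x sequentially"
      unfolding x_def using Cauchy_uniformly_convergent uniformly_convergent_uniform_limit_iff by blast
    then show ?thesis using r by blast
  qed
  have x_hol: "x holomorphic_on D" by (rule holomorphic_uniform_sequence[OF D X_hol unif])
  have x_out: "x z = 0" if "z \<notin> D" for z
    unfolding x_def X_out[OF that] by (simp add: lim_const)
  have pt: "(\<lambda>n. X n z) \<longlonglongrightarrow> x z" for z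
  proof (cases "z \<in> D")
    case True
    then obtain d where "d > 0" "uniform_limit (cball z d) X x sequentially" using unif by blast
    then show ?thesis by (intro tendsto_uniform_limitI[where S = "cball z d"]) auto
  qed (simp add: x_out X_out)
  have x_meas: "x \<in> borel_measurable (lebesgue_on D)"
    by (rule holomorphic_imp_measurable_lebesgue_on[OF D x_hol])
  have fatou: "sqint D (\<lambda>z. X n z - x z) \<le> ennreal (e\<^sup>2)"
    if N: "\<forall>m\<ge>N. \<forall>n\<ge>N. L2_norm D (\<lambda>z. X m z - X n z) < e" "n \<ge> N" and e: "e > 0" for n N e
  proof -
    have m: "(\<lambda>z. ennreal ((cmod (X n z - X m z))\<^sup>2)) \<in> borel_measurable (lebesgue_on D)" for m
      using L2_measurable[OF X_L2[of n]] L2_measurable[OF X_L2[of m]] by measurable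
    have "sqint D (\<lambda>z. X n z - x z) = (\<integral>\<^sup>+z. liminf (\<lambda>m. ennreal ((cmod (X n z - X m z))\<^sup>2)) \<partial>lebesgue_on D)"
      unfolding sqint_def
    proof (intro nn_integral_cong)
      fix z
      have "(\<lambda>m. ennreal ((cmod (X n z - X m z))\<^sup>2)) \<longlonglongrightarrow> ennreal ((cmod (X n z - x z))\<^sup>2)"
        by (intro tendsto_intros pt)
      then show "ennreal ((cmod (X n z - x z))\<^sup>2) = liminf (\<lambda>m. ennreal ((cmod (X n z - X m z))\<^sup>2))"
        by (rule lim_imp_Liminf[OF sequentially_bot, symmetric])
    qed
    also have "\<dots> \<le> liminf (\<lambda>m. \<integral>\<^sup>+z. ennreal ((cmod (X n z - X m z))\<^sup>2) \<partial>lebesgue_on D)"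
      by (rule nn_integral_liminf[OF m])
    also have "\<dots> \<le> liminf (\<lambda>m. ennreal (e\<^sup>2))"
    proof (intro Liminf_mono eventually_sequentiallyI[of N])
      fix m assume "m \<ge> N"
      then have "L2_norm D (\<lambda>z. X n z - X m z) < e" using N by blast
      then have "(L2_norm D (\<lambda>z. X n z - X m z))\<^sup>2 \<le> e\<^sup>2" by (simp add: power_mono)
      then show "(\<integral>\<^sup>+z. ennreal ((cmod (X n z - X m z))\<^sup>2) \<partial>lebesgue_on D) \<le> ennreal (e\<^sup>2)"
        unfolding sqint_def[symmetric] sqint_eq_L2_norm[OF L2_diff[OF X_L2 X_L2]] by (rule ennreal_leI)
    qed
    finally show ?thesis by (simp add: Liminf_const)
  qed
  have dL2: "(\<lambda>z. X n z - x z) \<in> L2 D \<and> L2_norm D (\<lambda>z. X n z - x z) \<le> e"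
    if N: "\<forall>m\<ge>N. \<forall>n\<ge>N. L2_norm D (\<lambda>z. X m z - X n z) < e" "n \<ge> N" and e: "e > 0" for n N e
  proof
    have "(\<lambda>z. X n z - x z) \<in> borel_measurable (lebesgue_on D)"
      using L2_measurable[OF X_L2[of n]] x_meas by measurable
    then show L: "(\<lambda>z. X n z - x z) \<in> L2 D"
      unfolding L2_iff_sqint using le_less_trans[OF fatou[OF that]] by simp
    show "L2_norm D (\<lambda>z. X n z - x z) \<le> e"
      using fatou[OF that] e unfolding sqint_eq_L2_norm[OF L]
      by (simp add: ennreal_le_iff)
  qed
  obtain N0 where N0: "\<forall>m\<ge>N0. \<forall>n\<ge>N0. L2_norm D (\<lambda>z. X m z - X n z) < 1" using cau[of 1] by auto
  have "(\<lambda>z. X N0 z - (X N0 z - x z)) \<in> L2 D"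
    by (rule L2_diff[OF X_L2]) (use dL2[OF N0 order_refl] in simp)
  then have "x \<in> bergman D" using x_hol x_out by (simp add: bergman_def)
  moreover have "(\<lambda>n. L2_norm D (\<lambda>z. X n z - x z)) \<longlonglongrightarrow> 0"
  proof (rule LIMSEQ_I)
    fix e :: real assume e: "e > 0"
    then obtain N where N: "\<forall>m\<ge>N. \<forall>n\<ge>N. L2_norm D (\<lambda>z. X m z - X n z) < e / 2" using cau[of "e / 2"] by auto
    show "\<exists>N. \<forall>n\<ge>N. norm (L2_norm D (\<lambda>z. X n z - x z) - 0) < e"
      using dL2[OF N] e by (intro exI[of _ N]) force
  qed
  ultimately show "\<exists>x\<in>bergman D. (\<lambda>n. L2_norm D (\<lambda>z. X n z - x z)) \<longlonglongrightarrow> 0" by blast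
qed

lemma L2_subset:
  assumes "f \<in> L2 D" "E \<subseteq> D" "E \<in> sets lebesgue" "D \<in> sets lebesgue"
  shows "f \<in> L2 E"
  unfolding L2_iff_sqint
proof
  show "f \<in> borel_measurable (lebesgue_on E)"
    using measurable_restrict_mono[OF L2_measurable[OF assms(1)] assms(2)] .
  have "sqint E f \<le> sqint D f"
    unfolding sqint_indicator[OF assms(3)] sqint_indicator[OF assms(4)]
    using assms(2) by (intro nn_integral_mono) (auto simp: indicator_def)
  also have "\<dots> < \<infinity>" using assms(1) L2_iff_sqint by blast
  finally show "sqint E f < \<infinity>" .
qed

section \<open>The lattice and the periodic domain\<close>

lemma distr_lebesgue_translation: "distr lebesgue lebesgue (\<lambda>z. c + z) = (lebesgue :: complex measure)"
  and measurable_lebesgue_translation: "(\<lambda>z::complex. c + z) \<in> lebesgue \<rightarrow>\<^sub>M lebesgue"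
proof -
  have *: "(\<lambda>x. c + (\<Sum>j\<in>Basis. (1 * (x \<bullet> j)) *\<^sub>R j)) = (\<lambda>z. c + z)"
    by (simp add: euclidean_representation)
  show "distr lebesgue lebesgue (\<lambda>z. c + z) = (lebesgue :: complex measure)"
    using lebesgue_affine_euclidean[of "\<lambda>_. 1" c] unfolding * by (simp add: density_1)
  show "(\<lambda>z::complex. c + z) \<in> lebesgue \<rightarrow>\<^sub>M lebesgue"
    using lebesgue_affine_measurable[of "\<lambda>_. 1" c] unfolding * by simp
qed

lemma nn_integral_lebesgue_translation:
  fixes c :: complex
  assumes "f \<in> borel_measurable lebesgue"
  shows "(\<integral>\<^sup>+z. f (c + z) \<partial>lebesgue) = (\<integral>\<^sup>+z. f z \<partial>lebesgue)"
proof -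
  have "(\<integral>\<^sup>+z. f z \<partial>distr lebesgue lebesgue (\<lambda>z. c + z)) = (\<integral>\<^sup>+z. f (c + z) \<partial>lebesgue)"
    by (rule nn_integral_distr) (use assms measurable_lebesgue_translation in auto)
  then show ?thesis by (simp add: distr_lebesgue_translation)
qed

text \<open>Indexing \<open>lattice\<close> by a countable type turns lattice sums into sums and
  integrals over \<open>UNIV\<close>.\<close>

definition lat :: "int \<times> int \<Rightarrow> complex" where
  "lat k = Complex (of_int (fst k)) (of_int (snd k))"

text \<open>The character of the lattice with quasi-momentum \<open>\<eta>\<close>.\<close>

definition phase :: "real \<times> real \<Rightarrow> int \<times> int \<Rightarrow> complex" where
  "phase \<eta> k = cis (fst \<eta> * of_int (fst k) + snd \<eta> * of_int (snd k))"

lemma lat_add: "lat (k + l) = lat k + lat l"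
  and lat_diff: "lat (k - l) = lat k - lat l"
  and lat_minus: "lat (- k) = - lat k"
  and lat_0 [simp]: "lat 0 = 0"
  by (auto simp: lat_def complex_eq_iff)

lemma lat_eq_iff: "lat k = lat l \<longleftrightarrow> k = l"
  by (auto simp: lat_def prod_eq_iff)

lemma lattice_eq: "lattice = range lat"
proof (intro equalityI subsetI)
  fix m assume "m \<in> lattice"
  then obtain i j where "Re m = of_int i" "Im m = of_int j" by (auto simp: lattice_def Ints_def)
  then have "m = lat (i, j)" by (simp add: lat_def complex_eq_iff)
  then show "m \<in> range lat" by blast
qed (auto simp: lattice_def lat_def)

lemma phase_add: "phase \<eta> (k + l) = phase \<eta> k * phase \<eta> l"
  by (simp add: phase_def cis_mult algebra_simps)

lemma phase_0 [simp]: "phase \<eta> 0 = 1"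
  by (simp add: phase_def)

lemma norm_phase [simp]: "cmod (phase \<eta> k) = 1"
  by (simp add: phase_def)

lemma phase_minus: "phase \<eta> (- k) = cnj (phase \<eta> k)"
  by (simp add: phase_def cis_cnj)

lemma phase_cnj_mult [simp]: "phase \<eta> k * cnj (phase \<eta> k) = 1" "cnj (phase \<eta> k) * phase \<eta> k = 1"
  using phase_add[of \<eta> k "- k"] by (simp_all add: phase_minus mult.commute)

lemma unit_cell_box: "unit_cell = box 0 (Complex 1 1)"
  by (auto simp: unit_cell_def in_box_complex_iff)

lemma closure_unit_cell: "closure unit_cell = {z. 0 \<le> Re z \<and> Re z \<le> 1 \<and> 0 \<le> Im z \<and> Im z \<le> 1}"
proof -
  have "box (0::complex) (Complex 1 1) \<noteq> {}"
    by (auto simp: box_ne_empty Basis_complex_def)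
  then show ?thesis unfolding unit_cell_box closure_box by (auto simp: in_cbox_complex_iff)
qed

lemma unit_cell_lat:
  assumes "z \<in> closure unit_cell" "z + lat k \<in> unit_cell"
  shows "k = 0"
proof -
  have "0 \<le> Re z" "Re z \<le> 1" "0 \<le> Im z" "Im z \<le> 1"
    using assms(1) unfolding closure_unit_cell by auto
  moreover have "0 < Re z + of_int (fst k)" "Re z + of_int (fst k) < 1"
    "0 < Im z + of_int (snd k)" "Im z + of_int (snd k) < 1"
    using assms(2) by (auto simp: unit_cell_def lat_def)
  ultimately have "-1 < fst k" "fst k < 1" "-1 < snd k" "snd k < 1" by linarith+
  then show ?thesis by (simp add: prod_eq_iff)
qed

section \<open>Geometry of the periodic domain and folding of integrals\<close>

locale periodic_setting =
  fixes W \<Omega> :: "complex set"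
  assumes cell: "periodic_cell W"
    and \<Omega>_def: "\<Omega> = periodic_domain W"
    and negl: "negligible (frontier W \<inter> \<Omega>)"
begin

lemma open_W [simp]: "open W" and W_cell: "W \<subseteq> unit_cell" and frontier_cell: "frontier unit_cell \<subseteq> frontier W"
  using cell by (auto simp: periodic_cell_def)

lemma open_\<Omega> [simp]: "open \<Omega>"
  by (simp add: \<Omega>_def periodic_domain_def)

lemma W_sub: "W \<subseteq> \<Omega>"
  unfolding \<Omega>_def periodic_domain_def
proof (rule interior_maximal)
  have "(0::complex) \<in> lattice" by (simp add: lattice_def)
  then show "W \<subseteq> (\<Union>m\<in>lattice. closure ((+) m ` W))"
    using UN_upper[of 0 lattice "\<lambda>m. closure ((+) m ` W)"] closure_subset[of W] by simp
qed simp

lemma closure_W_cell: "closure W \<subseteq> closure unit_cell"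
  by (rule closure_mono[OF W_cell])

lemma lat_image_\<Omega>: "(+) (lat k) ` \<Omega> = \<Omega>"
proof -
  have *: "(+) (lat k) ` (\<Union>m\<in>lattice. closure ((+) m ` W)) = (\<Union>m\<in>lattice. closure ((+) m ` W))"
  proof -
    have "(+) (lat k) ` (\<Union>m\<in>lattice. closure ((+) m ` W)) = (\<Union>l. closure ((+) (lat (k + l)) ` W))"
      by (simp add: lattice_eq image_UN closure_translation[symmetric] image_image lat_add add.assoc)
    also have "\<dots> = (\<Union>l. closure ((+) (lat l) ` W))"
    proof -
      have "closure ((+) (lat l) ` W) \<subseteq> (\<Union>l. closure ((+) (lat (k + l)) ` W))" for l
        using UN_upper[of "l - k" UNIV "\<lambda>l. closure ((+) (lat (k + l)) ` W)"] by simp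
      then show ?thesis by blast
    qed
    finally show ?thesis by (simp add: lattice_eq)
  qed
  show ?thesis
    unfolding \<Omega>_def periodic_domain_def by (subst interior_translation[symmetric]) (simp only: *)
qed

lemma \<Omega>_lat [simp]: "z + lat k \<in> \<Omega> \<longleftrightarrow> z \<in> \<Omega>"
proof
  show "z \<in> \<Omega> \<Longrightarrow> z + lat k \<in> \<Omega>" for z k
    using lat_image_\<Omega>[of k] by (metis add.commute image_eqI)
  from this[of "z + lat k" "- k"] show "z + lat k \<in> \<Omega> \<Longrightarrow> z \<in> \<Omega>" by (simp add: lat_minus)
qed

lemma \<Omega>_lat_diff [simp]: "z - lat k \<in> \<Omega> \<longleftrightarrow> z \<in> \<Omega>"
  using \<Omega>_lat[of z "- k"] by (simp add: lat_minus)

lemma \<Omega>_cover: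
  assumes "z \<in> \<Omega>"
  shows "\<exists>k. z - lat k \<in> closure W"
proof -
  have "z \<in> (\<Union>m\<in>lattice. closure ((+) m ` W))"
    using assms interior_subset unfolding \<Omega>_def periodic_domain_def by blast
  then obtain k where "z \<in> (+) (lat k) ` closure W"
    by (auto simp: lattice_eq closure_translation)
  then show ?thesis by (intro exI[of _ k]) auto
qed

lemma W_lat_unique: "z \<in> closure W \<Longrightarrow> z + lat k \<in> W \<Longrightarrow> k = 0"
  using unit_cell_lat closure_W_cell W_cell by blast

text \<open>A point of \<open>\<Omega>\<close> that belongs to no translate of \<open>W\<close> lies
  on a translate of \<open>frontier W \<inter> \<Omega>\<close>, and countably many translates of a
  null set form a null set.\<close>

lemma AE_cell: "AE z in lebesgue. z \<in> \<Omega> \<longrightarrow> (\<exists>k. z - lat k \<in> W)"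
proof -
  have "negligible (\<Union>k. (+) (lat k) ` (frontier W \<inter> \<Omega>))"
    by (intro negligible_countable_Union) (auto simp: negligible_translation negl)
  then have "(\<Union>k. (+) (lat k) ` (frontier W \<inter> \<Omega>)) \<in> null_sets lebesgue"
    by (simp add: negligible_iff_null_sets)
  from AE_not_in[OF this] show ?thesis
  proof eventually_elim
    fix z assume z: "z \<notin> (\<Union>k. (+) (lat k) ` (frontier W \<inter> \<Omega>))"
    show "z \<in> \<Omega> \<longrightarrow> (\<exists>k. z - lat k \<in> W)"
    proof
      assume "z \<in> \<Omega>"
      then obtain k where k: "z - lat k \<in> closure W" using \<Omega>_cover by blast
      have "z - lat k \<notin> frontier W \<inter> \<Omega>"
      proof
        assume "z - lat k \<in> frontier W \<inter> \<Omega>"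
        then have "lat k + (z - lat k) \<in> (+) (lat k) ` (frontier W \<inter> \<Omega>)" by (rule imageI)
        then have "z \<in> (+) (lat k) ` (frontier W \<inter> \<Omega>)" by simp
        then show False using z by blast
      qed
      then have "z - lat k \<in> W" using k \<open>z \<in> \<Omega>\<close> by (simp add: frontier_def interior_open)
      then show "\<exists>k. z - lat k \<in> W" by blast
    qed
  qed
qed

lemma W_sets [measurable]: "W \<in> sets lebesgue" and \<Omega>_sets [measurable]: "\<Omega> \<in> sets lebesgue"
  by auto

lemma measurable_shift_cell: "(\<lambda>z. z + lat k) \<in> lebesgue_on W \<rightarrow>\<^sub>M lebesgue_on \<Omega>"
proof (rule measurable_restrict_space3)
  show "(\<lambda>z. z + lat k) \<in> lebesgue \<rightarrow>\<^sub>M lebesgue"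
    using measurable_lebesgue_translation[of "lat k"] by (simp add: add.commute)
qed (use W_sub in auto)

text \<open>Almost every point of \<open>\<Omega>\<close> lies in exactly one translate of
  \<open>W\<close>, so the integrand equals almost everywhere the lattice sum of its restrictions to
  these translates; the rest is monotone summation and translation invariance.\<close>

lemma nn_fold:
  assumes f: "f \<in> borel_measurable (lebesgue_on \<Omega>)"
  shows "(\<integral>\<^sup>+z. f z \<partial>lebesgue_on \<Omega>) = (\<integral>\<^sup>+k. \<integral>\<^sup>+z. f (z + lat k) \<partial>lebesgue_on W \<partial>count_space UNIV)"
proof -
  define F where "F z = f z * indicator \<Omega> z" for z
  have F [measurable]: "F \<in> borel_measurable lebesgue"
    unfolding F_def using f \<Omega>_sets by (subst (asm) borel_measurable_restrict_space_iff_ennreal) auto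
  have T: "(\<lambda>z. z - lat k) \<in> lebesgue \<rightarrow>\<^sub>M lebesgue" for k
    using measurable_lebesgue_translation[of "- lat k"] by simp
  have ind: "(\<lambda>z. indicator W (z - lat k) :: ennreal) \<in> borel_measurable lebesgue" for k
    by (rule measurable_compose[OF T borel_measurable_indicator]) simp
  have AE: "AE z in lebesgue. F z = (\<integral>\<^sup>+k. F z * indicator W (z - lat k) \<partial>count_space UNIV)"
    using AE_cell
  proof eventually_elim
    fix z assume z: "z \<in> \<Omega> \<longrightarrow> (\<exists>k. z - lat k \<in> W)"
    show "F z = (\<integral>\<^sup>+k. F z * indicator W (z - lat k) \<partial>count_space UNIV)"
    proof (cases "z \<in> \<Omega>")
      case True
      then obtain k where k: "z - lat k \<in> W" using z by blast
      have u: "l = k" if l: "z - lat l \<in> W" for l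
      proof -
        have "(z - lat k) + lat (k - l) \<in> W" using l by (simp add: lat_diff)
        then have "k - l = 0" using W_lat_unique k closure_subset by blast
        then show ?thesis by simp
      qed
      have "indicator W (z - lat l) = (indicator {k} l :: ennreal)" for l
      proof (cases "l = k")
        case False
        then have "z - lat l \<notin> W" using u by blast
        then show ?thesis using False by simp
      qed (use k in simp)
      then have "(\<integral>\<^sup>+l. F z * indicator W (z - lat l) \<partial>count_space UNIV) = (\<integral>\<^sup>+l. F z * indicator {k} l \<partial>count_space UNIV)"
        by simp
      also have "\<dots> = F z" by (subst nn_integral_cmult_indicator) auto
      finally show ?thesis by simp
    qed (simp add: F_def)
  qed
  have "(\<integral>\<^sup>+z. f z \<partial>lebesgue_on \<Omega>) = (\<integral>\<^sup>+z. F z \<partial>lebesgue)"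
    unfolding F_def by (rule nn_integral_restrict_space) simp
  also have "\<dots> = (\<integral>\<^sup>+z. \<integral>\<^sup>+k. F z * indicator W (z - lat k) \<partial>count_space UNIV \<partial>lebesgue)"
    by (rule nn_integral_cong_AE[OF AE])
  also have "\<dots> = (\<integral>\<^sup>+k. \<integral>\<^sup>+z. F z * indicator W (z - lat k) \<partial>lebesgue \<partial>count_space UNIV)"
    by (rule nn_integral_count_space_nn_integral) (use ind in \<open>auto intro!: borel_measurable_times_ennreal\<close>)
  also have "\<dots> = (\<integral>\<^sup>+k. \<integral>\<^sup>+z. f (z + lat k) \<partial>lebesgue_on W \<partial>count_space UNIV)"
  proof (intro nn_integral_cong)
    fix k
    have "(\<integral>\<^sup>+z. F z * indicator W (z - lat k) \<partial>lebesgue) =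
        (\<integral>\<^sup>+z. F (lat k + z) * indicator W (lat k + z - lat k) \<partial>lebesgue)"
      by (rule nn_integral_lebesgue_translation[symmetric])
        (use ind in \<open>auto intro!: borel_measurable_times_ennreal\<close>)
    also have "\<dots> = (\<integral>\<^sup>+z. f (z + lat k) * indicator W z \<partial>lebesgue)"
      using W_sub by (intro nn_integral_cong) (auto simp: F_def indicator_def add.commute[of "lat k"])
    also have "\<dots> = (\<integral>\<^sup>+z. f (z + lat k) \<partial>lebesgue_on W)"
      by (rule nn_integral_restrict_space[symmetric]) simp
    finally show "(\<integral>\<^sup>+z. F z * indicator W (z - lat k) \<partial>lebesgue) = (\<integral>\<^sup>+z. f (z + lat k) \<partial>lebesgue_on W)" .
  qed
  finally show ?thesis .
qed

lemma finite_measure_W: "finite_measure (lebesgue_on W)"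
proof (rule finite_measureI)
  have "bounded W" by (rule bounded_subset[OF bounded_box W_cell[unfolded unit_cell_box]])
  then have "emeasure lebesgue W < \<infinity>" using emeasure_bounded_finite[of W] by simp
  then show "emeasure (lebesgue_on W) (space (lebesgue_on W)) \<noteq> \<infinity>"
    by (simp add: emeasure_restrict_space space_restrict_space)
qed

lemma nn_fold':
  assumes f: "f \<in> borel_measurable (lebesgue_on \<Omega>)"
  shows "(\<integral>\<^sup>+z. f z \<partial>lebesgue_on \<Omega>) = (\<integral>\<^sup>+z. \<integral>\<^sup>+k. f (z + lat k) \<partial>count_space UNIV \<partial>lebesgue_on W)"
  unfolding nn_fold[OF f]
  by (rule nn_integral_count_space_nn_integral[symmetric])
    (auto intro: measurable_compose[OF measurable_shift_cell f])

text \<open>The map \<open>\<tau>\<close> sends the product of Lebesgue measure on \<open>W\<close>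
  and counting measure on the lattice to Lebesgue measure on \<open>\<Omega>\<close>:
  \<open>nn_fold'\<close> identifies the image measure on indicators. The three claims are then
  Fubini's theorem for \<open>F\<close> composed with \<open>\<tau>\<close>.\<close>

lemma
  fixes F :: "complex \<Rightarrow> complex"
  assumes F: "integrable (lebesgue_on \<Omega>) F"
  shows fold_AE_integrable: "AE z in lebesgue_on W. integrable (count_space UNIV) (\<lambda>k. F (z + lat k))"
    and integrable_fold: "integrable (lebesgue_on W) (\<lambda>z. LINT k|count_space UNIV. F (z + lat k))"
    and integral_fold: "(LINT z|lebesgue_on W. LINT k|count_space UNIV. F (z + lat k)) = (LINT z|lebesgue_on \<Omega>. F z)"
proof -
  interpret W: finite_measure "lebesgue_on W" by (rule finite_measure_W)
  interpret C: sigma_finite_measure "count_space (UNIV :: (int \<times> int) set)"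
    by (rule sigma_finite_measure_count_space_countable) simp
  interpret P: pair_sigma_finite "lebesgue_on W" "count_space (UNIV :: (int \<times> int) set)" ..
  let ?M = "lebesgue_on W \<Otimes>\<^sub>M count_space (UNIV :: (int \<times> int) set)"
  define \<tau> where "\<tau> p = fst p + lat (snd p)" for p
  have \<tau>_meas: "\<tau> \<in> ?M \<rightarrow>\<^sub>M lebesgue_on \<Omega>"
  proof -
    have "(\<lambda>p. fst p + lat k) \<in> ?M \<rightarrow>\<^sub>M lebesgue_on \<Omega>" for k
      by (rule measurable_compose[OF measurable_fst measurable_shift_cell])
    then show ?thesis
      unfolding \<tau>_def using measurable_compose_countable'[of UNIV "\<lambda>k p. fst p + lat k" ?M "lebesgue_on \<Omega>" snd]
      by simp
  qed
  have distr: "distr ?M (lebesgue_on \<Omega>) \<tau> = lebesgue_on \<Omega>"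
  proof (rule measure_eqI)
    fix A assume "A \<in> sets (distr ?M (lebesgue_on \<Omega>) \<tau>)"
    then have A: "A \<in> sets (lebesgue_on \<Omega>)" by simp
    have ind: "(indicator A :: complex \<Rightarrow> ennreal) \<in> borel_measurable (lebesgue_on \<Omega>)" using A by simp
    have "emeasure (distr ?M (lebesgue_on \<Omega>) \<tau>) A = (\<integral>\<^sup>+z. indicator A z \<partial>distr ?M (lebesgue_on \<Omega>) \<tau>)"
      using A by simp
    also have "\<dots> = (\<integral>\<^sup>+p. indicator A (\<tau> p) \<partial>?M)"
      by (rule nn_integral_distr[OF \<tau>_meas]) (use ind in simp)
    also have "\<dots> = (\<integral>\<^sup>+z. \<integral>\<^sup>+k. indicator A (\<tau> (z, k)) \<partial>count_space UNIV \<partial>lebesgue_on W)"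
      by (rule C.nn_integral_fst[symmetric]) (rule measurable_compose[OF \<tau>_meas ind])
    also have "\<dots> = (\<integral>\<^sup>+z. indicator A z \<partial>lebesgue_on \<Omega>)"
      unfolding nn_fold'[OF ind] by (simp add: \<tau>_def)
    finally show "emeasure (distr ?M (lebesgue_on \<Omega>) \<tau>) A = emeasure (lebesgue_on \<Omega>) A" using A by simp
  qed simp
  have int: "integrable ?M (\<lambda>p. F (\<tau> p))"
    using F integrable_distr[OF \<tau>_meas, of F] by (simp add: distr)
  show "AE z in lebesgue_on W. integrable (count_space UNIV) (\<lambda>k. F (z + lat k))"
    using P.AE_integrable_fst'[OF int] by (simp add: \<tau>_def)
  show "integrable (lebesgue_on W) (\<lambda>z. LINT k|count_space UNIV. F (z + lat k))"
    using P.integrable_fst'[OF int] by (simp add: \<tau>_def)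
  have "(LINT z|lebesgue_on \<Omega>. F z) = (LINT p|?M. F (\<tau> p))"
    using integral_distr[OF \<tau>_meas, of F] F by (simp add: distr)
  then show "(LINT z|lebesgue_on W. LINT k|count_space UNIV. F (z + lat k)) = (LINT z|lebesgue_on \<Omega>. F z)"
    using P.integral_fst'[OF int] by (simp add: \<tau>_def)
qed

lemma shift_measurable:
  assumes "f \<in> borel_measurable (lebesgue_on \<Omega>)"
  shows "(\<lambda>z. f (z + lat k)) \<in> borel_measurable (lebesgue_on \<Omega>)"
proof (rule measurable_compose[OF _ assms], rule measurable_restrict_space3)
  show "(\<lambda>z. z + lat k) \<in> lebesgue \<rightarrow>\<^sub>M lebesgue"
    using measurable_lebesgue_translation[of "lat k"] by (simp add: add.commute)
qed auto

lemma nn_integral_\<Omega>_shift: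
  assumes "f \<in> borel_measurable (lebesgue_on \<Omega>)"
  shows "(\<integral>\<^sup>+z. f (z + lat k) \<partial>lebesgue_on \<Omega>) = (\<integral>\<^sup>+z. f z \<partial>lebesgue_on \<Omega>)"
proof -
  have "(\<integral>\<^sup>+l. \<integral>\<^sup>+z. f (z + lat l + lat k) \<partial>lebesgue_on W \<partial>count_space UNIV) =
      (\<integral>\<^sup>+l. \<integral>\<^sup>+z. f (z + lat (l + k)) \<partial>lebesgue_on W \<partial>count_space UNIV)"
    by (simp add: lat_add add.assoc)
  also have "\<dots> = (\<integral>\<^sup>+l. \<integral>\<^sup>+z. f (z + lat l) \<partial>lebesgue_on W \<partial>count_space UNIV)"
    by (rule nn_integral_bij_count_space[where g = "\<lambda>l. l + k"])
      (auto intro!: bij_betwI[where g = "\<lambda>l. l - k"])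
  finally show ?thesis
    using nn_fold[OF shift_measurable[OF assms, of k]] nn_fold[OF assms] by simp
qed

end

section \<open>The analytic cutoff function\<close>

lemma summable_on_int_powr:
  assumes "s > (1::real)"
  shows "(\<lambda>i::int. (1 + \<bar>real_of_int i\<bar>) powr (- s)) summable_on UNIV"
proof -
  let ?f = "\<lambda>i::int. (1 + \<bar>real_of_int i\<bar>) powr (- s)"
  have sm: "summable (\<lambda>n::nat. (1 + real n) powr (- s))"
    using assms summable_Suc_iff[of "\<lambda>n. of_nat n powr (- s) :: real"]
    by (simp add: summable_real_powr_iff add.commute)
  then have nat: "(\<lambda>n::nat. (1 + real n) powr (- s)) summable_on UNIV"
    by (subst summable_on_UNIV_nonneg_real_iff) auto
  have "?f summable_on range int"
    by (subst summable_on_reindex) (use nat in \<open>auto simp: o_def inj_on_def\<close>)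
  moreover have "?f summable_on range (\<lambda>n. - int n)"
    by (subst summable_on_reindex) (use nat in \<open>auto simp: o_def inj_on_def\<close>)
  then have "?f summable_on (range (\<lambda>n. - int n) - range int)"
    by (rule summable_on_subset) auto
  ultimately have "?f summable_on (range int \<union> (range (\<lambda>n. - int n) - range int))"
    by (intro summable_on_Un_disjoint) auto
  moreover have "i \<in> range int \<union> (range (\<lambda>n. - int n) - range int)" for i :: int
    by (cases i rule: int_cases2) auto
  then have "range int \<union> (range (\<lambda>n. - int n) - range int) = UNIV" by blast
  ultimately show ?thesis by simp
qed

text \<open>The modulus of \<open>lat k\<close> dominates both coordinates, so the term is bounded
  by a product of two one-dimensional terms of exponent \<open>b / 2\<close>; the condition
  \<open>b > 2\<close> makes both exponents exceed \<open>1\<close>.\<close>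

lemma summable_on_lat_powr:
  assumes "b > (2::real)"
  shows "(\<lambda>k. (1 + cmod (lat k)) powr (- b)) summable_on UNIV"
proof -
  define g where "g i = (1 + \<bar>real_of_int i\<bar>) powr (- (b / 2))" for i :: int
  have g: "g summable_on UNIV" unfolding g_def by (rule summable_on_int_powr) (use assms in simp)
  have "(\<lambda>k. g (fst k) * g (snd k)) summable_on (SIGMA i:UNIV. UNIV)"
  proof (rule summable_on_SigmaI)
    show "((\<lambda>y. g (fst (x, y)) * g (snd (x, y))) has_sum g x * infsum g UNIV) UNIV" for x
      using has_sum_cmult_right[OF has_sum_infsum[OF g], of "g x"] by simp
    show "(\<lambda>x. g x * infsum g UNIV) summable_on UNIV" using g by (rule summable_on_cmult_left)
  qed (simp add: g_def)
  then have "(\<lambda>k. g (fst k) * g (snd k)) summable_on UNIV" by simp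
  then show ?thesis
  proof (rule summable_on_comparison_test)
    fix k
    have "1 + \<bar>real_of_int (fst k)\<bar> \<le> 1 + cmod (lat k)" "1 + \<bar>real_of_int (snd k)\<bar> \<le> 1 + cmod (lat k)"
      using abs_Re_le_cmod[of "lat k"] abs_Im_le_cmod[of "lat k"] by (simp_all add: lat_def)
    then have "(1 + cmod (lat k)) powr (- (b / 2)) \<le> g (fst k)" "(1 + cmod (lat k)) powr (- (b / 2)) \<le> g (snd k)"
      unfolding g_def using assms by (auto intro!: powr_mono2')
    then have "(1 + cmod (lat k)) powr (- (b / 2)) * (1 + cmod (lat k)) powr (- (b / 2)) \<le> g (fst k) * g (snd k)"
      by (intro mult_mono) (auto simp: g_def)
    then show "(1 + cmod (lat k)) powr (- b) \<le> g (fst k) * g (snd k)"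
      by (simp flip: powr_add)
  qed auto
qed

text \<open>Peetre's inequality: \<open>1 + cmod (lat k)\<close> is at most
  \<open>(1 + R) * (1 + cmod (z + lat k))\<close>. It gives one summable majorant for all
  \<open>z\<close> in a disc.\<close>

lemma lat_powr_shift:
  assumes "cmod z \<le> R" "b \<ge> 0"
  shows "(1 + cmod (z + lat k)) powr (- b) \<le> (1 + R) powr b * (1 + cmod (lat k)) powr (- b)"
proof -
  have R: "R \<ge> 0" using assms(1) norm_ge_zero order_trans by blast
  have "cmod (lat k) \<le> cmod (z + lat k) + cmod z"
    using norm_triangle_ineq4[of "z + lat k" z] by simp
  then have "1 + cmod (lat k) \<le> (1 + R) * (1 + cmod (z + lat k))"
    using assms(1) mult_nonneg_nonneg[OF R norm_ge_zero[of "z + lat k"]] by (simp add: algebra_simps)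
  then have "(1 + cmod (lat k)) powr b \<le> ((1 + R) * (1 + cmod (z + lat k))) powr b"
    using assms(2) by (intro powr_mono2) auto
  also have "\<dots> = (1 + R) powr b * (1 + cmod (z + lat k)) powr b"
    using R by (intro powr_mult)
  finally have *: "(1 + cmod (lat k)) powr b \<le> (1 + R) powr b * (1 + cmod (z + lat k)) powr b" .
  have pos: "(1 + cmod (lat k)) powr b > 0" "(1 + cmod (z + lat k)) powr b > 0"
    using norm_ge_zero[of "lat k"] norm_ge_zero[of "z + lat k"] by (smt (verit) powr_gt_zero)+
  show ?thesis unfolding powr_minus using * pos by (simp add: field_simps)
qed

lemma finite_lat_ball: "finite {k. cmod (lat k - z) \<le> R}"
proof (rule finite_subset)
  define N where "N = \<lceil>cmod z + \<bar>R\<bar>\<rceil>"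
  show "{k. cmod (lat k - z) \<le> R} \<subseteq> {-N..N} \<times> {-N..N}"
  proof
    fix k assume "k \<in> {k. cmod (lat k - z) \<le> R}"
    then have "cmod (lat k) \<le> cmod z + \<bar>R\<bar>"
      using norm_triangle_ineq2[of "lat k" z] by auto
    then have "\<bar>real_of_int (fst k)\<bar> \<le> cmod z + \<bar>R\<bar>" "\<bar>real_of_int (snd k)\<bar> \<le> cmod z + \<bar>R\<bar>"
      using abs_Re_le_cmod[of "lat k"] abs_Im_le_cmod[of "lat k"] by (simp_all add: lat_def)
    moreover have "cmod z + \<bar>R\<bar> \<le> real_of_int N" unfolding N_def by linarith
    ultimately have "\<bar>fst k\<bar> \<le> N" "\<bar>snd k\<bar> \<le> N" by linarith+
    then show "k \<in> {-N..N} \<times> {-N..N}" by (auto simp: mem_Times_iff)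
  qed
qed simp

section \<open>Local bounds and behaviour near poles\<close>

lemma eventually_at_notin_finite:
  fixes z :: "'a::t1_space"
  assumes "finite F"
  shows "\<forall>\<^sub>F w in at z. w \<notin> F"
proof -
  have "open (- (F - {z}))" by (intro open_Compl finite_imp_closed finite_Diff assms)
  then have "\<forall>\<^sub>F w in at z. w \<in> - (F - {z})" using eventually_at_topological by blast
  moreover have "\<forall>\<^sub>F w in at z. w \<noteq> z" by (simp add: eventually_at_filter)
  ultimately show ?thesis by eventually_elim auto
qed

text \<open>Local boundedness replaces continuity because the result is also applied to the modulus
  of \<open>\<theta>\<close> set to zero outside \<open>\<Omega>\<close>, which need not be
  continuous at the boundary.\<close>

lemma compact_locally_bounded_above:
  fixes g :: "'a::metric_space \<Rightarrow> real"
  assumes "compact K" "\<And>x. x \<in> K \<Longrightarrow> \<exists>C. \<forall>\<^sub>F y in nhds x. g y \<le> C"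
  obtains C where "\<And>x. x \<in> K \<Longrightarrow> g x \<le> C"
proof -
  have "\<exists>C S. open S \<and> x \<in> S \<and> (\<forall>y\<in>S. g y \<le> C)" if "x \<in> K" for x
    using assms(2)[OF that] unfolding eventually_nhds by blast
  then obtain C S where CS: "\<And>x. x \<in> K \<Longrightarrow> open (S x) \<and> x \<in> S x \<and> (\<forall>y\<in>S x. g y \<le> C x)"
    by metis
  obtain D where D: "D \<subseteq> K" "finite D" "K \<subseteq> (\<Union>x\<in>D. S x)"
    using compactE_image[OF assms(1), of K S] CS by blast
  have "g x \<le> Max (insert 0 (C ` D))" if x: "x \<in> K" for x
  proof -
    obtain y where y: "y \<in> D" "x \<in> S y" using D x by blast
    then have "g x \<le> C y" using CS[of y] D(1) by blast
    also have "\<dots> \<le> Max (insert 0 (C ` D))" using D(2) y by (intro Max_ge) auto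
    finally show ?thesis .
  qed
  then show ?thesis using that by blast
qed

lemma tendsto_eventually_bounded:
  fixes f :: "'a \<Rightarrow> 'b::real_normed_vector"
  assumes "(f \<longlongrightarrow> l) F"
  shows "\<exists>C. \<forall>\<^sub>F z in F. norm (f z) \<le> C"
proof -
  have "\<forall>\<^sub>F z in F. dist (f z) l < 1" using tendstoD[OF assms] by simp
  then have "\<forall>\<^sub>F z in F. norm (f z) \<le> norm l + 1"
  proof eventually_elim
    case (elim z) then show ?case using norm_triangle_sub[of "f z" l] by (simp add: dist_norm)
  qed
  then show ?thesis by blast
qed

text \<open>The difference divided by \<open>\<psi>\<close> tends to zero, so
  \<open>\<phi> / \<psi>\<close> tends to \<open>1\<close>. It is used where a single term of the
  lattice series is singular and the others remain bounded.\<close>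

lemma bounded_difference_of_pole:
  assumes F: "F \<noteq> bot" and \<psi>: "filterlim \<psi> at_infinity F" and d: "\<forall>\<^sub>F z in F. cmod (\<phi> z - \<psi> z) \<le> C"
  shows "filterlim \<phi> at_infinity F" "((\<lambda>z. \<psi> z / \<phi> z) \<longlongrightarrow> 1) F"
proof -
  have "Bfun (\<lambda>z. \<phi> z - \<psi> z) F" using d by (rule BfunI)
  moreover have "((\<lambda>z. inverse (\<psi> z)) \<longlongrightarrow> 0) F"
    by (rule filterlim_compose[OF tendsto_inverse_0 \<psi>])
  ultimately have "((\<lambda>z. inverse (\<psi> z) * (\<phi> z - \<psi> z)) \<longlongrightarrow> 0) F"
    using bounded_bilinear.Zfun_prod_Bfun[OF bounded_bilinear_mult] by (simp add: tendsto_Zfun_iff)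
  then have "((\<lambda>z. 1 + inverse (\<psi> z) * (\<phi> z - \<psi> z)) \<longlongrightarrow> 1 + 0) F" by (intro tendsto_intros)
  moreover have nz: "\<forall>\<^sub>F z in F. \<psi> z \<noteq> 0" using filterlim_at_infinity_imp_eventually_ne[OF \<psi>] .
  then have "\<forall>\<^sub>F z in F. 1 + inverse (\<psi> z) * (\<phi> z - \<psi> z) = \<phi> z / \<psi> z"
    by eventually_elim (simp add: field_simps)
  ultimately have q: "((\<lambda>z. \<phi> z / \<psi> z) \<longlongrightarrow> 1) F" by (simp add: tendsto_cong)
  have "filterlim (\<lambda>z. \<phi> z / \<psi> z * \<psi> z) at_infinity F"
    by (rule tendsto_mult_filterlim_at_infinity[OF q _ \<psi>]) simp
  moreover have "\<forall>\<^sub>F z in F. \<phi> z / \<psi> z * \<psi> z = \<phi> z" using nz by eventually_elim simp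
  ultimately show "filterlim \<phi> at_infinity F" by (simp add: filterlim_cong)
  have "((\<lambda>z. inverse (\<phi> z / \<psi> z)) \<longlongrightarrow> inverse 1) F" by (rule tendsto_inverse[OF q]) simp
  then show "((\<lambda>z. \<psi> z / \<phi> z) \<longlongrightarrow> 1) F" by simp
qed

context periodic_setting
begin

text \<open>The zeros of \<open>\<phi>\<close> avoid \<open>closure \<Omega>\<close>, so
  \<open>inverse \<phi>\<close> is bounded on one closed cell by compactness and on
  \<open>\<Omega>\<close> by periodicity; the quotient inherits the decay of \<open>\<psi>\<close>.
  A pole of \<open>\<psi>\<close> in \<open>\<Omega>\<close> is a pole of \<open>\<phi>\<close> with
  the same leading behaviour, so the quotient extends analytically with value \<open>1\<close>. The
  decay of \<open>\<psi>\<close> is available on \<open>\<Omega>\<close> only, hence the estimates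
  near a point are relative to the filter \<open>at z0 within \<Omega>\<close>.\<close>

lemma analytic_cutoff:
  assumes "assumption_A W"
  obtains \<theta> where "\<theta> holomorphic_on \<Omega>"
    "\<And>R. \<exists>h. (\<forall>k. 0 \<le> h k) \<and> h summable_on UNIV \<and> (\<forall>z\<in>\<Omega>. cmod z \<le> R \<longrightarrow> (\<forall>k. cmod (\<theta> (z + lat k)) \<le> h k))"
    "\<And>z. z \<in> \<Omega> \<Longrightarrow> ((\<lambda>k. \<theta> (z + lat k)) has_sum 1) UNIV"
proof -
  from assms obtain \<phi> \<psi> :: "complex \<Rightarrow> complex" and b :: real where
    \<phi>: "\<phi> nicely_meromorphic_on UNIV" and per: "\<forall>z. \<phi> (z + 1) = \<phi> z \<and> \<phi> (z + \<i>) = \<phi> z"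
    and zeros: "{z. \<phi> z = 0 \<and> \<not> is_pole \<phi> z} \<subseteq> - closure \<Omega>"
    and \<psi>: "\<psi> nicely_meromorphic_on UNIV" and fin: "finite {z. is_pole \<psi> z}" and poles: "{z. is_pole \<psi> z} \<subseteq> unit_cell"
    and sum: "\<And>z. \<forall>m\<in>lattice. \<not> is_pole \<psi> (z - m) \<Longrightarrow> ((\<lambda>m. \<psi> (z - m)) has_sum \<phi> z) lattice"
    and b: "b > 2" and bdd: "bdd_above ((\<lambda>z. (1 + cmod z) powr b * cmod (\<psi> z)) ` (\<Omega> - closure unit_cell))"
    unfolding assumption_A_def \<Omega>_def by blast
  have "\<exists>C0. \<forall>x\<in>\<Omega> - closure unit_cell. (1 + cmod x) powr b * cmod (\<psi> x) \<le> C0"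
    using bdd by (auto simp: bdd_above_def)
  then obtain C0' where C0': "\<And>x. x \<in> \<Omega> - closure unit_cell \<Longrightarrow> (1 + cmod x) powr b * cmod (\<psi> x) \<le> C0'" by blast
  define C0 where "C0 = max C0' 0"
  have C0: "C0 \<ge> 0" by (simp add: C0_def)
  have decay: "cmod (\<psi> z) \<le> C0 * (1 + cmod z) powr (- b)" if "z \<in> \<Omega>" "z \<notin> closure unit_cell" for z
  proof -
    have "(1 + cmod z) powr b * cmod (\<psi> z) \<le> C0" using C0'[of z] that by (simp add: C0_def)
    moreover have "(1 + cmod z) powr b > 0" using norm_ge_zero[of z] by (smt (verit) powr_gt_zero)
    ultimately show ?thesis unfolding powr_minus by (simp add: field_simps)
  qed
  have per1: "\<phi> (z + of_nat n) = \<phi> z" "\<phi> (z + of_nat n * \<i>) = \<phi> z" for n z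
  proof -
    show "\<phi> (z + of_nat n) = \<phi> z"
    proof (induction n)
      case (Suc n) then show ?case using per[rule_format, of "z + of_nat n"] by (simp add: algebra_simps)
    qed simp
    show "\<phi> (z + of_nat n * \<i>) = \<phi> z"
    proof (induction n)
      case (Suc n) then show ?case using per[rule_format, of "z + of_nat n * \<i>"] by (simp add: algebra_simps)
    qed simp
  qed
  have per2: "\<phi> (z + of_int i) = \<phi> z" "\<phi> (z + of_int i * \<i>) = \<phi> z" for i z
  proof -
    show "\<phi> (z + of_int i) = \<phi> z"
    proof (cases i rule: int_cases2)
      case (nonpos n) then show ?thesis using per1(1)[of "z - of_nat n" n] by simp
    qed (simp add: per1)
    show "\<phi> (z + of_int i * \<i>) = \<phi> z"
    proof (cases i rule: int_cases2)
      case (nonpos n) then show ?thesis using per1(2)[of "z - of_nat n * \<i>" n] by simp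
    qed (simp add: per1)
  qed
  have \<phi>_lat: "\<phi> (z + lat k) = \<phi> z" for z k
  proof -
    have "lat k = of_int (fst k) + of_int (snd k) * \<i>" by (simp add: lat_def complex_eq_iff)
    then show ?thesis using per2(2)[of "z + of_int (fst k)" "snd k"] per2(1)[of z "fst k"] by (simp add: add.assoc)
  qed
  have \<phi>_lat': "\<phi> (z - lat k) = \<phi> z" for z k using \<phi>_lat[of z "- k"] by (simp add: lat_minus)
  have cont: "\<psi> \<midarrow>z\<rightarrow> \<psi> z" if "\<not> is_pole \<psi> z" for z
    using \<psi> that unfolding nicely_meromorphic_on_def by blast
  have \<phi>_cases: "is_pole \<phi> z \<and> \<phi> z = 0 \<or> \<not> is_pole \<phi> z \<and> \<phi> \<midarrow>z\<rightarrow> \<phi> z" for z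
    using \<phi> unfolding nicely_meromorphic_on_def
    by (metis UNIV_I at_neq_bot is_pole_def not_tendsto_and_filterlim_at_infinity)
  have sum': "((\<lambda>k. \<psi> (z - lat k)) has_sum \<phi> z) UNIV" if "\<And>k. \<not> is_pole \<psi> (z - lat k)" for z
  proof -
    have "((\<lambda>m. \<psi> (z - m)) has_sum \<phi> z) (range lat)"
      using sum[of z] that by (auto simp: lattice_eq)
    then show ?thesis by (subst (asm) has_sum_reindex) (auto simp: inj_on_def lat_eq_iff o_def)
  qed
  have pole_unique: "k = l" if "is_pole \<psi> (z - lat k)" "is_pole \<psi> (z - lat l)" for z k l
  proof -
    have u: "z - lat k \<in> unit_cell" "z - lat l \<in> unit_cell" using that poles by auto
    then have "(z - lat k) + lat (k - l) \<in> unit_cell" by (simp add: lat_diff)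
    then have "k - l = 0" using unit_cell_lat u(1) closure_subset by blast
    then show ?thesis by simp
  qed
  have cell_norm: "cmod z \<le> 2" if "z \<in> closure unit_cell" for z
    using that cmod_le[of z] by (auto simp: closure_unit_cell)
  \<comment> \<open>Contains each \<open>k\<close> for which \<open>z - lat k\<close> can meet the
    closed cell with \<open>z\<close> in \<open>ball z0 1\<close>: then
    \<open>cmod (lat k - z0)\<close> is less than \<open>2 + 1\<close>.\<close>
  define M where "M z0 = {k. cmod (lat k - z0) \<le> 4}" for z0
  have M_fin: "finite (M z0)" for z0 unfolding M_def by (rule finite_lat_ball)
  have M_far: "z - lat k \<notin> closure unit_cell" if "z \<in> ball z0 1" "k \<notin> M z0" for z z0 k
  proof
    assume "z - lat k \<in> closure unit_cell"
    then have "cmod (z - lat k) \<le> 2" by (rule cell_norm)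
    moreover have "cmod (lat k - z0) \<le> cmod (z - lat k) + cmod (z - z0)"
      by (metis add.commute diff_add_cancel norm_minus_commute norm_triangle_sub add_diff_eq diff_diff_eq2 norm_triangle_ineq4 diff_diff_add)
    ultimately show False using that by (auto simp: M_def dist_norm norm_minus_commute)
  qed
  have ev_nopole: "\<forall>\<^sub>F z in at z0. \<forall>k. \<not> is_pole \<psi> (z - lat k)" for z0
  proof -
    have "\<forall>\<^sub>F z in at z0. z \<notin> (\<Union>k\<in>M z0. (+) (lat k) ` {z. is_pole \<psi> z})"
      by (rule eventually_at_notin_finite) (use M_fin fin in auto)
    moreover have "\<forall>\<^sub>F z in at z0. z \<in> ball z0 1"
      by (rule eventually_at_in_open') auto
    ultimately show ?thesis
    proof eventually_elim
      fix z assume z: "z \<notin> (\<Union>k\<in>M z0. (+) (lat k) ` {z. is_pole \<psi> z})" "z \<in> ball z0 1"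
      show "\<forall>k. \<not> is_pole \<psi> (z - lat k)"
      proof (intro allI notI)
        fix k assume p: "is_pole \<psi> (z - lat k)"
        then have "z - lat k \<in> closure unit_cell" using poles closure_subset by blast
        then have "k \<in> M z0" using M_far[OF z(2)] by blast
        moreover have "z = lat k + (z - lat k)" by simp
        ultimately show False using z(1) p by blast
      qed
    qed
  qed
  \<comment> \<open>For \<open>k\<close> outside the finite set \<open>M z0\<close> the arguments
    \<open>z - lat k\<close> stay off the closed cell, where the decay estimate gives a summable
    majorant independent of \<open>z\<close>.\<close>
  have tail: "\<exists>C. \<forall>\<^sub>F z in at z0 within \<Omega>. cmod (\<phi> z - (\<Sum>k\<in>M z0. \<psi> (z - lat k))) \<le> C" for z0
  proof -
    define R where "R = cmod z0 + 1"
    define H where "H k = C0 * ((1 + R) powr b * (1 + cmod (lat (- k))) powr (- b))" for k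
    have H0: "H k \<ge> 0" for k by (simp add: H_def C0)
    have Hs: "H summable_on UNIV"
    proof -
      have "(\<lambda>k. (1 + cmod (lat (- k))) powr (- b)) summable_on UNIV"
        using summable_on_lat_powr[OF b] by (simp add: lat_minus)
      then show ?thesis unfolding H_def by (intro summable_on_cmult_right)
    qed
    have "\<forall>\<^sub>F z in at z0 within \<Omega>. z \<in> ball z0 1 \<and> z \<in> \<Omega>"
      unfolding eventually_at_topological by (intro exI[of _ "ball z0 1"]) auto
    moreover have "\<forall>\<^sub>F z in at z0 within \<Omega>. \<forall>k. \<not> is_pole \<psi> (z - lat k)"
      using ev_nopole[of z0] at_le[of \<Omega> UNIV z0] unfolding le_filter_def by blast
    ultimately have "\<forall>\<^sub>F z in at z0 within \<Omega>. cmod (\<phi> z - (\<Sum>k\<in>M z0. \<psi> (z - lat k))) \<le> infsum H (UNIV - M z0)"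
    proof eventually_elim
      case (elim z)
      have zR: "cmod z \<le> R"
        using elim(1) norm_triangle_sub[of z z0] by (auto simp: R_def dist_norm norm_minus_commute)
      have le: "cmod (\<psi> (z - lat k)) \<le> H k" if "k \<notin> M z0" for k
      proof -
        have "cmod (\<psi> (z - lat k)) \<le> C0 * (1 + cmod (z + lat (- k))) powr (- b)"
          using decay[of "z - lat k"] M_far[of z z0 k] that elim(1) by (simp add: lat_minus)
        also have "\<dots> \<le> H k"
          unfolding H_def using lat_powr_shift[OF zR, of b "- k"] b C0 by (intro mult_left_mono) auto
        finally show ?thesis .
      qed
      have "((\<lambda>k. \<psi> (z - lat k)) has_sum (\<phi> z - (\<Sum>k\<in>M z0. \<psi> (z - lat k)))) (UNIV - M z0)"
        by (intro has_sum_Diff sum' has_sum_finiteI) (use elim M_fin in auto)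
      moreover have Hs': "H summable_on (UNIV - M z0)" using Hs by (rule summable_on_subset) auto
      moreover have abs: "(\<lambda>k. cmod (\<psi> (z - lat k))) summable_on (UNIV - M z0)"
        by (rule summable_on_comparison_test[OF Hs']) (use le in auto)
      ultimately have "cmod (\<phi> z - (\<Sum>k\<in>M z0. \<psi> (z - lat k))) \<le> infsum (\<lambda>k. cmod (\<psi> (z - lat k))) (UNIV - M z0)"
        by (intro norm_has_sum_bound[OF has_sum_infsum])
      also have "\<dots> \<le> infsum H (UNIV - M z0)"
        by (rule infsum_mono[OF abs Hs']) (use le in auto)
      finally show ?case .
    qed
    then show ?thesis by blast
  qed
  have term_bdd: "\<exists>C. \<forall>\<^sub>F z in at z0 within \<Omega>. cmod (\<Sum>k\<in>L. \<psi> (z - lat k)) \<le> C"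
    if L: "\<And>k. k \<in> L \<Longrightarrow> \<not> is_pole \<psi> (z0 - lat k)" for z0 L
  proof -
    have "((\<lambda>z. \<psi> (z - lat k)) \<longlongrightarrow> \<psi> (z0 - lat k)) (at z0)" if "k \<in> L" for k
      using cont[OF L[OF that]] LIM_offset[of \<psi> _ "z0 - lat k" "- lat k"] by simp
    then have "((\<lambda>z. \<Sum>k\<in>L. \<psi> (z - lat k)) \<longlongrightarrow> (\<Sum>k\<in>L. \<psi> (z0 - lat k))) (at z0)"
      by (intro tendsto_sum)
    then have "((\<lambda>z. \<Sum>k\<in>L. \<psi> (z - lat k)) \<longlongrightarrow> (\<Sum>k\<in>L. \<psi> (z0 - lat k))) (at z0 within \<Omega>)"
      by (rule tendsto_within_subset) simp
    then show ?thesis by (rule tendsto_eventually_bounded)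
  qed
  have regular: "\<exists>C. \<forall>\<^sub>F z in at z0 within \<Omega>. cmod (\<phi> z) \<le> C"
    if np: "\<And>k. \<not> is_pole \<psi> (z0 - lat k)" for z0
  proof -
    obtain C1 C2 where "\<forall>\<^sub>F z in at z0 within \<Omega>. cmod (\<phi> z - (\<Sum>k\<in>M z0. \<psi> (z - lat k))) \<le> C1"
      "\<forall>\<^sub>F z in at z0 within \<Omega>. cmod (\<Sum>k\<in>M z0. \<psi> (z - lat k)) \<le> C2"
      using tail[of z0] term_bdd[OF np, of "M z0"] by blast
    then have "\<forall>\<^sub>F z in at z0 within \<Omega>. cmod (\<phi> z) \<le> C1 + C2"
    proof eventually_elim
      case (elim z) then show ?case
        using norm_triangle_ineq[of "\<phi> z - (\<Sum>k\<in>M z0. \<psi> (z - lat k))" "\<Sum>k\<in>M z0. \<psi> (z - lat k)"] by simp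
    qed
    then show ?thesis by blast
  qed
  \<comment> \<open>The poles of \<open>\<psi>\<close> lie in the open cell, whose lattice
    translates are disjoint, so \<open>k0\<close> is the only index with a singular term at
    \<open>z0\<close>.\<close>
  have singular: "\<exists>C. \<forall>\<^sub>F z in at z0 within \<Omega>. cmod (\<phi> z - \<psi> (z - lat k0)) \<le> C"
    if k0: "is_pole \<psi> (z0 - lat k0)" for z0 k0
  proof -
    have k0M: "k0 \<in> M z0"
      using poles k0 cell_norm[of "z0 - lat k0"] closure_subset[of unit_cell] by (auto simp: M_def norm_minus_commute)
    obtain C1 C2 where "\<forall>\<^sub>F z in at z0 within \<Omega>. cmod (\<phi> z - (\<Sum>k\<in>M z0. \<psi> (z - lat k))) \<le> C1"
      "\<forall>\<^sub>F z in at z0 within \<Omega>. cmod (\<Sum>k\<in>M z0 - {k0}. \<psi> (z - lat k)) \<le> C2"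
      using tail[of z0] term_bdd[of "M z0 - {k0}" z0] pole_unique[OF k0] by blast
    then have "\<forall>\<^sub>F z in at z0 within \<Omega>. cmod (\<phi> z - \<psi> (z - lat k0)) \<le> C1 + C2"
    proof eventually_elim
      case (elim z)
      have "(\<Sum>k\<in>M z0. \<psi> (z - lat k)) = \<psi> (z - lat k0) + (\<Sum>k\<in>M z0 - {k0}. \<psi> (z - lat k))"
        by (rule sum.remove[OF M_fin k0M])
      then show ?case using elim
        norm_triangle_ineq[of "\<phi> z - (\<Sum>k\<in>M z0. \<psi> (z - lat k))" "\<Sum>k\<in>M z0 - {k0}. \<psi> (z - lat k)"] by simp
    qed
    then show ?thesis by blast
  qed
  have at\<Omega>: "at z within \<Omega> = at z" if "z \<in> \<Omega>" for z by (rule at_within_open[OF that open_\<Omega>])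
  have reg_nopole: "\<not> is_pole \<phi> z" if np: "z \<in> \<Omega>" "\<And>k. \<not> is_pole \<psi> (z - lat k)" for z
  proof
    assume "is_pole \<phi> z"
    then have inf: "filterlim \<phi> at_infinity (at z)" by (simp add: is_pole_def)
    obtain C where C: "\<forall>\<^sub>F w in at z. cmod (\<phi> w) \<le> C" using regular[OF np(2)] np(1) by (auto simp: at\<Omega>)
    have "\<forall>\<^sub>F w in at z. \<bar>C\<bar> + 1 \<le> cmod (\<phi> w)"
      using inf[unfolded filterlim_at_infinity[OF order_refl]] by simp
    with C have "\<forall>\<^sub>F w in at z. False" by eventually_elim linarith
    then show False by simp
  qed
  have \<phi>_nz: "\<phi> z \<noteq> 0" if "z \<in> closure \<Omega>" "\<not> is_pole \<phi> z" for z using zeros that by blast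
  have sing_inf: "filterlim (\<lambda>z. \<psi> (z - lat k0)) at_infinity (at z0)" if "is_pole \<psi> (z0 - lat k0)" for z0 k0
  proof -
    have "filterlim (\<lambda>z. \<psi> (z + (- lat k0))) at_infinity (at z0)"
      using that filterlim_shift_iff[of \<psi> "- lat k0" at_infinity "z0 - lat k0"] by (simp add: is_pole_def o_def)
    then show ?thesis by simp
  qed
  have sing_pole: "is_pole \<phi> z0" if p: "z0 \<in> \<Omega>" "is_pole \<psi> (z0 - lat k0)" for z0 k0
  proof -
    obtain C where "\<forall>\<^sub>F z in at z0. cmod (\<phi> z - \<psi> (z - lat k0)) \<le> C" using singular[OF p(2)] p(1) by (auto simp: at\<Omega>)
    then show ?thesis unfolding is_pole_def
      using bounded_difference_of_pole(1)[OF at_neq_bot sing_inf[OF p(2)]] by blast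
  qed
  \<comment> \<open>At a pole of \<open>\<phi>\<close> the reciprocal tends to \<open>0\<close>; at
    any other point of \<open>closure \<Omega>\<close> the value of \<open>\<phi>\<close> is its
    limit and is not zero.\<close>
  have inv_bdd: "\<exists>C. \<forall>\<^sub>F z in nhds z0. cmod (inverse (\<phi> z)) \<le> C" if "z0 \<in> closure \<Omega>" for z0
  proof -
    have "\<exists>l. ((\<lambda>z. inverse (\<phi> z)) \<longlongrightarrow> l) (at z0)"
    proof (cases "is_pole \<phi> z0")
      case True
      then show ?thesis unfolding is_pole_def using filterlim_compose[OF tendsto_inverse_0] by blast
    next
      case False
      then show ?thesis using \<phi>_cases[of z0] \<phi>_nz[OF that] tendsto_inverse by blast
    qed
    then obtain C where C: "\<forall>\<^sub>F z in at z0. cmod (inverse (\<phi> z)) \<le> C" using tendsto_eventually_bounded by blast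
    have "\<forall>\<^sub>F z in nhds z0. z \<noteq> z0 \<longrightarrow> cmod (inverse (\<phi> z)) \<le> C" using C by (simp add: eventually_at_filter)
    then have "\<forall>\<^sub>F z in nhds z0. cmod (inverse (\<phi> z)) \<le> max C (cmod (inverse (\<phi> z0)))"
      by eventually_elim (metis max.coboundedI1 max.cobounded2)
    then show ?thesis by blast
  qed
  have comp: "compact (closure \<Omega> \<inter> closure unit_cell)"
    by (simp add: closed_Int_compact unit_cell_box compact_closure)
  obtain C1 where C1: "\<And>z. z \<in> closure \<Omega> \<inter> closure unit_cell \<Longrightarrow> cmod (inverse (\<phi> z)) \<le> C1"
    using compact_locally_bounded_above[OF comp, of "\<lambda>z. cmod (inverse (\<phi> z))"] inv_bdd by blast
  have inv_\<Omega>: "cmod (inverse (\<phi> z)) \<le> C1" if z: "z \<in> \<Omega>" for z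
  proof -
    obtain k where "z - lat k \<in> closure W" using \<Omega>_cover[OF z] by blast
    then have "z - lat k \<in> closure \<Omega> \<inter> closure unit_cell"
      using closure_W_cell closure_mono[OF W_sub] by blast
    from C1[OF this] show ?thesis by (simp add: \<phi>_lat')
  qed
  \<comment> \<open>At a pole of \<open>\<psi>\<close> in \<open>\<Omega>\<close> the value
    \<open>1\<close> is the limit of the quotient. At a pole of \<open>\<phi>\<close> where
    \<open>\<psi>\<close> is regular, the normalization \<open>\<phi> z = 0\<close> and division by
    zero produce \<open>0\<close>, again the correct limit.\<close>
  define \<theta> where "\<theta> z = (if is_pole \<psi> z then 1 else \<psi> z / \<phi> z)" for z
  have \<theta>_bdd: "\<exists>C. \<forall>\<^sub>F z in nhds z0. (if z \<in> \<Omega> then cmod (\<theta> z) else 0) \<le> C" for z0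
  proof -
    have "\<exists>C. \<forall>\<^sub>F z in at z0 within \<Omega>. cmod (\<theta> z) \<le> C"
    proof (cases "is_pole \<psi> z0")
      case True
      then obtain C where C: "\<forall>\<^sub>F z in at z0 within \<Omega>. cmod (\<phi> z - \<psi> z) \<le> C"
        using singular[of z0 0] by auto
      show ?thesis
      proof (cases "at z0 within \<Omega> = bot")
        case False
        have "filterlim \<psi> at_infinity (at z0 within \<Omega>)"
          using True unfolding is_pole_def by (rule filterlim_mono) (simp_all add: at_le)
        then have "((\<lambda>z. \<psi> z / \<phi> z) \<longlongrightarrow> 1) (at z0 within \<Omega>)"
          using bounded_difference_of_pole(2)[OF False] C by blast
        then obtain C' where "\<forall>\<^sub>F z in at z0 within \<Omega>. cmod (\<psi> z / \<phi> z) \<le> C'"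
          using tendsto_eventually_bounded by blast
        then have "\<forall>\<^sub>F z in at z0 within \<Omega>. cmod (\<theta> z) \<le> max C' 1"
          by eventually_elim (auto simp: \<theta>_def)
        then show ?thesis by blast
      qed simp
    next
      case False
      obtain C where "\<forall>\<^sub>F z in at z0. cmod (\<psi> z) \<le> C"
        using tendsto_eventually_bounded[OF cont[OF False]] by blast
      then have "\<forall>\<^sub>F z in at z0 within \<Omega>. cmod (\<psi> z) \<le> C"
        using at_le[of \<Omega> UNIV z0] unfolding le_filter_def by blast
      moreover have "\<forall>\<^sub>F z in at z0 within \<Omega>. z \<in> \<Omega>"
        unfolding eventually_at_topological by blast
      ultimately have "\<forall>\<^sub>F z in at z0 within \<Omega>. cmod (\<theta> z) \<le> max (C * C1) 1"
      proof eventually_elim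
        case (elim z)
        have "cmod (\<psi> z) * cmod (inverse (\<phi> z)) \<le> C * C1"
          using elim inv_\<Omega>[of z] by (intro mult_mono) (auto intro: order_trans[OF norm_ge_zero])
        then show ?case by (auto simp: \<theta>_def divide_inverse norm_mult)
      qed
      then show ?thesis by blast
    qed
    then obtain C where "\<forall>\<^sub>F z in nhds z0. z \<noteq> z0 \<longrightarrow> z \<in> \<Omega> \<longrightarrow> cmod (\<theta> z) \<le> C"
      by (auto simp: eventually_at_filter)
    then have "\<forall>\<^sub>F z in nhds z0. (if z \<in> \<Omega> then cmod (\<theta> z) else 0) \<le> max (max C 0) (cmod (\<theta> z0))"
      by eventually_elim auto
    then show ?thesis by blast
  qed
  obtain C2 where C2: "\<And>z. z \<in> closure \<Omega> \<inter> closure unit_cell \<Longrightarrow> (if z \<in> \<Omega> then cmod (\<theta> z) else 0) \<le> C2"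
    using compact_locally_bounded_above[OF comp, of "\<lambda>z. if z \<in> \<Omega> then cmod (\<theta> z) else 0"] \<theta>_bdd by blast
  have "\<exists>C\<ge>0. \<forall>z\<in>\<Omega>. cmod (\<theta> z) \<le> C * (1 + cmod z) powr (- b)"
  \<comment> \<open>On the closed cell \<open>1 + cmod z \<le> 3\<close>, so the bound
    \<open>C2\<close> becomes a decay bound at the cost of \<open>3 powr b\<close>; off the cell the
    decay constant \<open>C0\<close> of \<open>\<psi>\<close> is multiplied by the bound
    \<open>C1\<close> for the reciprocal of \<open>\<phi>\<close>.\<close>
  proof (intro exI[of _ "max (\<bar>C2\<bar> * 3 powr b) (C0 * \<bar>C1\<bar>)"] conjI ballI)
    fix z assume z: "z \<in> \<Omega>"
    show "cmod (\<theta> z) \<le> max (\<bar>C2\<bar> * 3 powr b) (C0 * \<bar>C1\<bar>) * (1 + cmod z) powr (- b)"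
    proof (cases "z \<in> closure unit_cell")
      case True
      have "1 + cmod z \<le> 3" using cell_norm[OF True] by simp
      then have "(3::real) powr (- b) \<le> (1 + cmod z) powr (- b)"
        using b by (intro powr_mono2') (auto simp: add_pos_nonneg)
      then have "1 \<le> 3 powr b * (1 + cmod z) powr (- b)"
        by (simp add: powr_minus field_simps)
      then have "\<bar>C2\<bar> * 1 \<le> \<bar>C2\<bar> * (3 powr b * (1 + cmod z) powr (- b))" by (intro mult_left_mono) auto
      moreover have "cmod (\<theta> z) \<le> \<bar>C2\<bar>" using C2[of z] z True closure_subset[of \<Omega>] by auto
      moreover have "\<bar>C2\<bar> * 3 powr b * (1 + cmod z) powr (- b) \<le> max (\<bar>C2\<bar> * 3 powr b) (C0 * \<bar>C1\<bar>) * (1 + cmod z) powr (- b)"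
        by (intro mult_right_mono) auto
      ultimately show ?thesis by (simp add: mult.assoc)
    next
      case False
      then have "\<not> is_pole \<psi> z" using poles closure_subset by blast
      then have "cmod (\<theta> z) = cmod (\<psi> z) * cmod (inverse (\<phi> z))" by (simp add: \<theta>_def divide_inverse norm_mult)
      also have "\<dots> \<le> (C0 * (1 + cmod z) powr (- b)) * \<bar>C1\<bar>"
        using decay[OF z False] inv_\<Omega>[OF z] C0 by (intro mult_mono) auto
      also have "\<dots> = (C0 * \<bar>C1\<bar>) * (1 + cmod z) powr (- b)" by (simp add: mult_ac)
      also have "\<dots> \<le> max (\<bar>C2\<bar> * 3 powr b) (C0 * \<bar>C1\<bar>) * (1 + cmod z) powr (- b)"
        by (intro mult_right_mono) auto
      finally show ?thesis .
    qed
  qed (simp add: le_max_iff_disj)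
  then obtain C where C: "C \<ge> 0" "\<And>z. z \<in> \<Omega> \<Longrightarrow> cmod (\<theta> z) \<le> C * (1 + cmod z) powr (- b)" by blast
  have hol: "\<theta> holomorphic_on \<Omega>"
  proof -
    have "\<theta> analytic_on {z0}" if z0: "z0 \<in> \<Omega>" for z0
    proof -
      have "\<forall>\<^sub>F z in at z0. z \<in> \<Omega> \<and> (\<forall>k. \<not> is_pole \<psi> (z - lat k))"
        using ev_nopole[of z0] eventually_at_in_open'[OF open_\<Omega> z0] by eventually_elim auto
      then obtain r where r: "r > 0" "\<And>z. z \<in> ball z0 r - {z0} \<Longrightarrow> z \<in> \<Omega> \<and> (\<forall>k. \<not> is_pole \<psi> (z - lat k))"
        unfolding eventually_at by (force simp: dist_commute)
      have nice: "\<theta> analytic_on {z}" if "z \<in> \<Omega>" "\<And>k. \<not> is_pole \<psi> (z - lat k)" for z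
      proof -
        have np: "\<not> is_pole \<psi> z" using that(2)[of 0] by simp
        have "\<not> is_pole \<phi> z" using reg_nopole that by blast
        then have an: "\<phi> analytic_on {z}" "\<psi> analytic_on {z}" "\<phi> z \<noteq> 0"
          using nicely_meromorphic_on_imp_analytic_at[OF \<phi>] nicely_meromorphic_on_imp_analytic_at[OF \<psi>] np \<phi>_nz[OF subsetD[OF closure_subset that(1)]] by auto
        then have "(\<lambda>z. \<psi> z / \<phi> z) analytic_on {z}" by (intro analytic_on_divide) auto
        moreover have "\<forall>\<^sub>F w in nhds z. w \<noteq> z \<longrightarrow> (\<forall>k. \<not> is_pole \<psi> (w - lat k))"
          using ev_nopole[of z] by (simp add: eventually_at_filter)
        then have "\<forall>\<^sub>F w in nhds z. \<not> is_pole \<psi> w"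
        proof eventually_elim
          case (elim w) then show ?case using np spec[of "\<lambda>k. \<not> is_pole \<psi> (w - lat k)" 0] by (cases "w = z") auto
        qed
        then have "\<forall>\<^sub>F w in nhds z. \<psi> w / \<phi> w = \<theta> w" by eventually_elim (simp add: \<theta>_def)
        ultimately show ?thesis using analytic_at_cong[of "\<lambda>w. \<psi> w / \<phi> w" \<theta> z z] by simp
      qed
      show ?thesis
      proof (cases "\<exists>k. is_pole \<psi> (z0 - lat k)")
        case False
        then show ?thesis using nice z0 by blast
      next
        case True
        then obtain k where k: "is_pole \<psi> (z0 - lat k)" by blast
        have "\<phi> z0 = 0" "is_pole \<phi> z0" using sing_pole[OF z0 k] \<phi>_cases[of z0] by auto
        have lim: "((\<lambda>z. \<psi> z / \<phi> z) \<longlongrightarrow> \<theta> z0) (at z0)"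
        proof (cases "k = 0")
          case True
          then have "is_pole \<psi> z0" "filterlim \<psi> at_infinity (at z0)" using k by (auto simp: is_pole_def)
          moreover obtain C where "\<forall>\<^sub>F z in at z0. cmod (\<phi> z - \<psi> z) \<le> C"
            using singular[OF k] z0 True by (auto simp: at\<Omega>)
          ultimately show ?thesis using bounded_difference_of_pole(2)[OF at_neq_bot] by (auto simp: \<theta>_def)
        next
          case False
          then have np: "\<not> is_pole \<psi> z0" using pole_unique[OF k, of 0] by auto
          have "((\<lambda>z. \<psi> z * inverse (\<phi> z)) \<longlongrightarrow> \<psi> z0 * 0) (at z0)"
            using \<open>is_pole \<phi> z0\<close> unfolding is_pole_def
            by (intro tendsto_mult cont[OF np] filterlim_compose[OF tendsto_inverse_0])
          then show ?thesis using np \<open>\<phi> z0 = 0\<close> by (simp add: \<theta>_def divide_inverse)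
        qed
        have "\<theta> holomorphic_on ball z0 r"
        proof (rule no_isolated_singularity'[where K = "{z0}"])
          have "\<forall>\<^sub>F z in at z0. \<psi> z / \<phi> z = \<theta> z"
            using ev_nopole[of z0] by eventually_elim (metis \<theta>_def diff_zero lat_0)
          then have "(\<theta> \<longlongrightarrow> \<theta> z0) (at z0)" using lim tendsto_cong[of "\<lambda>z. \<psi> z / \<phi> z" \<theta> "at z0" "\<theta> z0"] by simp
          then have "(\<theta> \<longlongrightarrow> \<theta> z0) (at z0 within ball z0 r)"
            by (rule tendsto_mono[OF at_le[OF subset_UNIV]])
          then show "(\<theta> \<longlongrightarrow> \<theta> z) (at z within ball z0 r)" if "z \<in> {z0}" for z
            using that by simp
          have "\<theta> analytic_on ball z0 r - {z0}"
            using nice r(2) by (subst analytic_on_analytic_at) blast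
          then show "\<theta> holomorphic_on ball z0 r - {z0}" by (rule analytic_imp_holomorphic)
        qed auto
        then show ?thesis using r(1) by (auto simp: analytic_at intro!: exI[of _ "ball z0 r"])
      qed
    qed
    then have "\<theta> analytic_on \<Omega>" by (subst analytic_on_analytic_at) blast
    then show ?thesis by (rule analytic_imp_holomorphic)
  qed
  have dom: "\<exists>h. (\<forall>k. 0 \<le> h k) \<and> h summable_on UNIV \<and> (\<forall>z\<in>\<Omega>. cmod z \<le> R \<longrightarrow> (\<forall>k. cmod (\<theta> (z + lat k)) \<le> h k))" for R
  proof (intro exI conjI allI ballI impI)
    let ?h = "\<lambda>k. C * ((1 + R) powr b * (1 + cmod (lat k)) powr (- b))"
    show "0 \<le> ?h k" for k using C(1) by simp
    show "?h summable_on UNIV" by (intro summable_on_cmult_right summable_on_lat_powr b)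
    fix z k assume "z \<in> \<Omega>" "cmod z \<le> R"
    then show "cmod (\<theta> (z + lat k)) \<le> ?h k"
      by (intro order_trans[OF C(2) mult_left_mono[OF lat_powr_shift]]) (use b C(1) in auto)
  qed
  have one: "((\<lambda>k. \<theta> (z + lat k)) has_sum 1) UNIV" if z: "z \<in> \<Omega>" for z
  proof -
    have "((\<lambda>k. \<theta> (z - lat k)) has_sum 1) UNIV"
    proof (cases "\<exists>k. is_pole \<psi> (z - lat k)")
      case True
      then obtain k where k: "is_pole \<psi> (z - lat k)" by blast
      have "\<phi> z = 0" using sing_pole[OF z k] \<phi>_cases[of z] by auto
      \<comment> \<open>Division by the normalized value \<open>\<phi> z = 0\<close> annihilates all
        terms except the one at the pole, where \<open>\<theta>\<close> is \<open>1\<close> by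
        definition.\<close>
      then have "\<theta> (z - lat l) = 0" if "l \<noteq> k" for l
        using pole_unique[OF k, of l] that by (auto simp: \<theta>_def \<phi>_lat')
      then show ?thesis by (intro has_sum_finite_neutralI[where B = "{k}"]) (use k in \<open>auto simp: \<theta>_def\<close>)
    next
      case False
      then have "\<phi> z \<noteq> 0" using \<phi>_nz reg_nopole z closure_subset by blast
      moreover have "((\<lambda>k. \<psi> (z - lat k) * inverse (\<phi> z)) has_sum (\<phi> z * inverse (\<phi> z))) UNIV"
        by (rule has_sum_cmult_left[OF sum']) (use False in blast)
      moreover have "\<theta> (z - lat k) = \<psi> (z - lat k) * inverse (\<phi> z)" for k
        using False[unfolded not_ex, THEN spec, of k] by (simp add: \<theta>_def \<phi>_lat' divide_inverse)
      ultimately show ?thesis by simp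
    qed
    then have "((\<lambda>k. \<theta> (z - lat k)) has_sum 1) (range uminus)" by simp
    then show ?thesis by (subst (asm) has_sum_reindex) (auto simp: o_def lat_minus)
  qed
  show ?thesis using that[OF hol dom one] .
qed

end

section \<open>Quasi-periodic functions\<close>

lemma islimpt_unit_interval:
  assumes "t \<in> {0..1::real}"
  shows "t islimpt {0<..<1}"
  unfolding islimpt_approachable
proof (intro allI impI)
  fix e :: real assume e: "e > 0"
  show "\<exists>x'\<in>{0<..<1}. x' \<noteq> t \<and> dist x' t < e"
  proof (cases "t < 1")
    case True
    then show ?thesis using e assms by (intro bexI[of _ "t + min e (1 - t) / 2"]) (auto simp: dist_real_def min_def field_simps)
  next
    case False
    then show ?thesis using e assms by (intro bexI[of _ "t - min e 1 / 2"]) (auto simp: dist_real_def min_def field_simps)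
  qed
qed

lemma eventually_nhds_translate:
  fixes z c :: "'a::real_normed_vector"
  shows "(\<forall>\<^sub>F w in nhds (z + c). P w) \<longleftrightarrow> (\<forall>\<^sub>F w in nhds z. P (w + c))"
proof -
  have "nhds (z + c) = filtermap (\<lambda>x. x + c) (nhds z)"
    using filtermap_nhds_shift[of "- c" z] by simp
  then show ?thesis by (simp add: eventually_filtermap)
qed

text \<open>The identity theorem for zeros on a segment. The zeros are known only for interior
  parameters, but the centre may belong to an end point \<open>t\<close>; they still accumulate
  there. This is what reaches the corners of the unit cell.\<close>

lemma vanishing_on_segment:
  fixes h :: "complex \<Rightarrow> complex"
  assumes h: "h holomorphic_on ball z r" and r: "r > 0" and t: "t \<in> {0..1}" and z: "z = \<gamma> t"
    and iso: "\<And>s s'. dist (\<gamma> s) (\<gamma> s') = \<bar>s - s'\<bar>"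
    and zero: "\<And>s. s \<in> {0<..<1} \<Longrightarrow> \<gamma> s \<in> ball z r \<Longrightarrow> h (\<gamma> s) = 0"
    and w: "w \<in> ball z r"
  shows "h w = 0"
proof (rule analytic_continuation[OF h])
  have "\<exists>x'\<in>\<gamma> ` {0<..<1} \<inter> ball z r. x' \<noteq> z \<and> dist x' z < e" if "e > 0" for e
  proof -
    obtain s where s: "s \<in> {0<..<1}" "s \<noteq> t" "dist s t < min e r"
      using islimpt_unit_interval[OF t] r \<open>e > 0\<close> unfolding islimpt_approachable by (metis min_less_iff_conj)
    have "dist (\<gamma> s) z = \<bar>s - t\<bar>" unfolding z by (rule iso)
    then show ?thesis using s by (intro bexI[of _ "\<gamma> s"]) (auto simp: dist_real_def dist_commute)
  qed
  then show "z islimpt (\<gamma> ` {0<..<1} \<inter> ball z r)" unfolding islimpt_approachable by blast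
qed (use zero w r in auto)

context periodic_setting
begin

text \<open>The global description of the elements of \<open>bergman_ext\<close>: functions on all
  of \<open>\<Omega>\<close>, with integrability imposed separately on the cell, since a nonzero
  function of this kind has the same square integral over every translate of
  \<open>W\<close>.\<close>

definition quasi_periodic :: "real \<times> real \<Rightarrow> (complex \<Rightarrow> complex) set" where
  "quasi_periodic \<eta> = {F. F holomorphic_on \<Omega> \<and> (\<forall>z k. F (z + lat k) = phase \<eta> k * F z) \<and> (\<forall>z. z \<notin> \<Omega> \<longrightarrow> F z = 0)}"

definition cell_part :: "(complex \<Rightarrow> complex) \<Rightarrow> complex \<Rightarrow> complex" where
  "cell_part F z = (if z \<in> W then F z else 0)"

lemma cell_part_in_bergman_ext:
  assumes F: "F \<in> quasi_periodic \<eta>" and L: "cell_part F \<in> L2 W"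
  shows "cell_part F \<in> bergman_ext W \<eta>"
proof -
  have hol: "F holomorphic_on \<Omega>" and qp: "\<And>z k. F (z + lat k) = phase \<eta> k * F z"
    using F by (auto simp: quasi_periodic_def)
  have "cell_part F holomorphic_on W"
    by (rule holomorphic_transform[OF holomorphic_on_subset[OF hol W_sub]]) (simp add: cell_part_def)
  then have "cell_part F \<in> bergman W" using L by (simp add: bergman_def cell_part_def)
  moreover have "F (Complex 1 y) = exp (\<i> * complex_of_real (fst \<eta>)) * F (Complex 0 y)" for y
  proof -
    have "Complex 1 y = Complex 0 y + lat (1, 0)" by (simp add: lat_def complex_eq_iff)
    then show ?thesis using qp[of "Complex 0 y" "(1, 0)"] by (simp add: phase_def cis_conv_exp mult.commute)
  qed
  moreover have "F (Complex x 1) = exp (\<i> * complex_of_real (snd \<eta>)) * F (Complex x 0)" for x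
  proof -
    have "Complex x 1 = Complex x 0 + lat (0, 1)" by (simp add: lat_def complex_eq_iff)
    then show ?thesis using qp[of "Complex x 0" "(0, 1)"] by (simp add: phase_def cis_conv_exp mult.commute)
  qed
  ultimately show ?thesis
    unfolding bergman_ext_def \<Omega>_def[symmetric]
    using hol open_\<Omega> by (auto simp: cell_part_def intro!: exI[of _ \<Omega>] exI[of _ F])
qed

text \<open>The extension \<open>g\<close> lives near \<open>closure W \<inter> \<Omega>\<close>
  only. The boundary conditions on the open edges spread by the identity theorem to neighbourhoods
  of all edge points, corners included, so the functions
  \<open>phase \<eta> k * g (z - lat k)\<close> agree where they overlap and can be glued.\<close>

lemma bergman_ext_quasi_periodic:
  assumes f: "f \<in> bergman_ext W \<eta>"
  obtains F where "F \<in> quasi_periodic \<eta>" "f = cell_part F"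
proof -
  obtain U g where U: "open U" "closure W \<inter> \<Omega> \<subseteq> U" "U \<subseteq> \<Omega>"
    and g: "g holomorphic_on U" and gf: "\<And>z. z \<in> W \<Longrightarrow> g z = f z"
    and bc1: "\<And>y. y \<in> {0<..<1} \<Longrightarrow> g (Complex 1 y) = exp (\<i> * complex_of_real (fst \<eta>)) * g (Complex 0 y)"
    and bc2: "\<And>x. x \<in> {0<..<1} \<Longrightarrow> g (Complex x 1) = exp (\<i> * complex_of_real (snd \<eta>)) * g (Complex x 0)"
    using f unfolding bergman_ext_def \<Omega>_def[symmetric] by blast
  have fb: "f \<in> bergman W" using f by (simp add: bergman_ext_def)
  \<comment> \<open>Quasi-periodicity as an identity of germs at \<open>z\<close>. In this form it
    can be composed and inverted, and it determines the glued function on a full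
    neighbourhood.\<close>
  define E where "E z k \<longleftrightarrow> (\<forall>\<^sub>F w in nhds z. g (w + lat k) = phase \<eta> k * g w)" for z k
  have E0: "E z 0" for z by (simp add: E_def)
  have E_trans: "E z (k + l)" if "E z k" "E (z + lat k) l" for z k l
  proof -
    have "\<forall>\<^sub>F w in nhds z. g (w + lat k + lat l) = phase \<eta> l * g (w + lat k)"
      using that(2) unfolding E_def eventually_nhds_translate .
    with that(1) show ?thesis
      unfolding E_def by eventually_elim (simp add: phase_add lat_add add.assoc)
  qed
  have E_sym: "E (z + lat k) (- k)" if "E z k" for z k
    using that unfolding E_def eventually_nhds_translate
    by eventually_elim (simp add: lat_minus phase_minus mult.assoc[symmetric])
  have edge: "E z k" if z: "z \<in> \<Omega>" "t \<in> {0..1}" "z = \<gamma> t" and iso: "\<And>s s'. dist (\<gamma> s) (\<gamma> s') = \<bar>s - s'\<bar>"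
    and fr: "z \<in> closure W" "z + lat k \<in> closure W"
    and bc: "\<And>s. s \<in> {0<..<1} \<Longrightarrow> g (\<gamma> s + lat k) = phase \<eta> k * g (\<gamma> s)" for z t \<gamma> k
  proof -
    have "z \<in> U" "z + lat k \<in> U" using z fr U(2) by auto
    then obtain r1 r2 where r: "r1 > 0" "ball z r1 \<subseteq> U" "r2 > 0" "ball (z + lat k) r2 \<subseteq> U"
      using U(1) by (meson open_contains_ball)
    define r where "r = min r1 r2"
    have "r > 0" using r by (simp add: r_def)
    have sub: "w \<in> U" "w + lat k \<in> U" if "w \<in> ball z r" for w
      using that r by (auto simp: r_def subset_iff dist_norm)
    have gk: "(\<lambda>w. g (w + lat k)) holomorphic_on ball z r"
      by (rule holomorphic_on_compose_gen[OF _ g, unfolded o_def]) (use sub in \<open>auto intro!: holomorphic_intros\<close>)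
    have hh: "(\<lambda>w. g (w + lat k) - phase \<eta> k * g w) holomorphic_on ball z r"
      by (intro holomorphic_intros gk holomorphic_on_subset[OF g]) (use sub in auto)
    have "g (w + lat k) - phase \<eta> k * g w = 0" if "w \<in> ball z r" for w
      by (rule vanishing_on_segment[OF hh \<open>r > 0\<close> z(2,3) iso _ that]) (simp add: bc)
    then have "\<forall>w\<in>ball z r. g (w + lat k) = phase \<eta> k * g w" by simp
    then show ?thesis
      unfolding E_def eventually_nhds using \<open>r > 0\<close> by (intro exI[of _ "ball z r"]) auto
  qed
  have frW: "z \<in> closure W" if "z \<in> closure unit_cell" "z \<notin> unit_cell" for z
  proof -
    have "z \<in> frontier unit_cell" using that interior_subset unfolding frontier_def by blast
    then show ?thesis using frontier_cell unfolding frontier_def by blast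
  qed
  have E1: "E z (1, 0)" if z: "z \<in> \<Omega>" "z \<in> closure unit_cell" "z + lat (1, 0) \<in> closure unit_cell" for z
  proof -
    have Re: "Re z = 0" using z by (auto simp: closure_unit_cell lat_def)
    show ?thesis
    proof (rule edge[OF z(1), where t = "Im z" and \<gamma> = "\<lambda>y. Complex 0 y"])
      show "z \<in> closure W" "z + lat (1, 0) \<in> closure W"
        using z Re by (auto intro!: frW simp: unit_cell_def lat_def)
      show "g (Complex 0 s + lat (1, 0)) = phase \<eta> (1, 0) * g (Complex 0 s)" if "s \<in> {0<..<1}" for s
      proof -
        have "Complex 0 s + lat (1, 0) = Complex 1 s" by (simp add: lat_def complex_eq_iff)
        then show ?thesis using bc1[OF that] by (simp add: phase_def cis_conv_exp)
      qed
    qed (use z Re in \<open>auto simp: closure_unit_cell complex_eq_iff dist_complex_def complex_diff cmod_def\<close>)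
  qed
  have E2: "E z (0, 1)" if z: "z \<in> \<Omega>" "z \<in> closure unit_cell" "z + lat (0, 1) \<in> closure unit_cell" for z
  proof -
    have Im: "Im z = 0" using z by (auto simp: closure_unit_cell lat_def)
    show ?thesis
    proof (rule edge[OF z(1), where t = "Re z" and \<gamma> = "\<lambda>x. Complex x 0"])
      show "z \<in> closure W" "z + lat (0, 1) \<in> closure W"
        using z Im by (auto intro!: frW simp: unit_cell_def lat_def)
      show "g (Complex s 0 + lat (0, 1)) = phase \<eta> (0, 1) * g (Complex s 0)" if "s \<in> {0<..<1}" for s
      proof -
        have "Complex s 0 + lat (0, 1) = Complex s 1" by (simp add: lat_def complex_eq_iff)
        then show ?thesis using bc2[OF that] by (simp add: phase_def cis_conv_exp)
      qed
    qed (use z Im in \<open>auto simp: closure_unit_cell complex_eq_iff dist_complex_def complex_diff cmod_def\<close>)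
  qed
  have E_pm: "E z k" if z: "z \<in> \<Omega>" "z \<in> closure unit_cell" "z + lat k \<in> closure unit_cell"
    and k: "k = k0 \<or> k = - k0 \<or> k = 0"
    and base: "\<And>z. z \<in> \<Omega> \<Longrightarrow> z \<in> closure unit_cell \<Longrightarrow> z + lat k0 \<in> closure unit_cell \<Longrightarrow> E z k0" for z k k0
    using k
  proof (elim disjE)
    assume "k = - k0"
    then have "E (z - lat k0) k0" using base[of "z - lat k0"] z by (simp add: lat_minus)
    from E_sym[OF this] show ?thesis using \<open>k = - k0\<close> by simp
  qed (use base z E0 in auto)
  have E_all: "E z k" if z: "z \<in> \<Omega>" "z \<in> closure unit_cell" "z + lat k \<in> closure unit_cell" for z k
  proof -
    obtain i j where ij: "k = (i, j)" by (cases k)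
    have ran: "0 \<le> Re z" "Re z \<le> 1" "0 \<le> Im z" "Im z \<le> 1" "0 \<le> Re z + of_int i" "Re z + of_int i \<le> 1"
        "0 \<le> Im z + of_int j" "Im z + of_int j \<le> 1"
      using z(2,3) unfolding closure_unit_cell ij by (auto simp: lat_def)
    then have "-1 \<le> i" "i \<le> 1" "-1 \<le> j" "j \<le> 1" by linarith+
    then have cases: "i = 1 \<or> i = -1 \<or> i = 0" "j = 1 \<or> j = -1 \<or> j = 0" by auto
    \<comment> \<open>The entries of \<open>k\<close> lie between \<open>-1\<close> and
      \<open>1\<close>. The horizontal part alone keeps the point in the closed cell, so
      \<open>k\<close> is a composition of two edge identifications; the intermediate point is in
      \<open>\<Omega>\<close> by periodicity.\<close>
    have mid: "z + lat (i, 0) \<in> closure unit_cell"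
      unfolding closure_unit_cell using ran by (simp add: lat_def)
    have "E z (i, 0)"
      by (rule E_pm[OF z(1,2) mid, where ?k0.0 = "(1, 0)"]) (use cases E1 in \<open>auto simp: zero_prod_def\<close>)
    moreover have "E (z + lat (i, 0)) (0, j)"
    proof (rule E_pm[OF _ mid, where ?k0.0 = "(0, 1)"])
      have "z + lat (i, 0) + lat (0, j) = z + lat k" by (simp add: ij lat_def complex_eq_iff)
      then show "z + lat (i, 0) + lat (0, j) \<in> closure unit_cell" using z(3) by (simp only:)
    qed (use z(1) cases E2 in \<open>auto simp: zero_prod_def\<close>)
    ultimately have "E z ((i, 0) + (0, j))" by (rule E_trans)
    then show ?thesis by (simp add: ij)
  qed
  define F where "F z = (if z \<in> \<Omega> then let k = SOME k. z - lat k \<in> closure W in phase \<eta> k * g (z - lat k) else 0)" for z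
  \<comment> \<open>Independence of the choice in \<open>F\<close>, on a neighbourhood of
    \<open>z\<close>: only the finitely many \<open>l\<close> in \<open>N\<close> can be chosen
    there. Those with \<open>z - lat l\<close> in \<open>closure W\<close> give the same germ by
    \<open>E_all\<close>, and the others are excluded near \<open>z\<close> because
    \<open>closure W\<close> is closed.\<close>
  have F_near: "\<forall>\<^sub>F w in nhds z. F w = phase \<eta> k * g (w - lat k)"
    if z: "z \<in> \<Omega>" and k: "z - lat k \<in> closure W" for z k
  proof -
    define N where "N = {l. cmod (lat l - z) \<le> 4}"
    have finN: "finite N" unfolding N_def by (rule finite_lat_ball)
    have "\<forall>\<^sub>F w in nhds z. w - lat l \<in> closure W \<longrightarrow> phase \<eta> l * g (w - lat l) = phase \<eta> k * g (w - lat k)" for l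
    proof (cases "z - lat l \<in> closure W")
      case True
      have "E (z - lat l) (l - k)"
      proof (rule E_all)
        show "z - lat l \<in> \<Omega>" "z - lat l \<in> closure unit_cell" using z True closure_W_cell by auto
        show "z - lat l + lat (l - k) \<in> closure unit_cell" using k closure_W_cell by (auto simp: lat_diff)
      qed
      then have "\<forall>\<^sub>F w in nhds z. g (w - lat l + lat (l - k)) = phase \<eta> (l - k) * g (w - lat l)"
        unfolding E_def using eventually_nhds_translate[of _ z "- lat l"] by simp
      then show ?thesis
      proof eventually_elim
        case (elim w)
        have "phase \<eta> l = phase \<eta> k * phase \<eta> (l - k)" using phase_add[of \<eta> k "l - k"] by simp
        then show ?case using elim by (simp add: lat_diff)
      qed
    next
      case False
      have "open {w. w - lat l \<notin> closure W}"
      proof -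
        have "{w. w - lat l \<notin> closure W} = (\<lambda>w. w - lat l) -` (- closure W)" by auto
        then show ?thesis by (simp add: open_vimage continuous_intros)
      qed
      then have "\<forall>\<^sub>F w in nhds z. w - lat l \<notin> closure W"
        using False unfolding eventually_nhds by blast
      then show ?thesis by eventually_elim simp
    qed
    then have "\<forall>\<^sub>F w in nhds z. \<forall>l\<in>N. w - lat l \<in> closure W \<longrightarrow> phase \<eta> l * g (w - lat l) = phase \<eta> k * g (w - lat k)"
      using finN by (simp add: eventually_ball_finite)
    moreover have "\<forall>\<^sub>F w in nhds z. w \<in> \<Omega>" by (rule eventually_nhds_in_open) (use z in auto)
    moreover have "\<forall>\<^sub>F w in nhds z. w \<in> ball z 1" by (rule eventually_nhds_in_open) auto
    ultimately show ?thesis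
    proof eventually_elim
      case (elim w)
      define l where "l = (SOME k. w - lat k \<in> closure W)"
      have l: "w - lat l \<in> closure W" unfolding l_def using someI_ex[OF \<Omega>_cover[OF elim(2)]] .
      have "l \<in> N"
      proof -
        have "w - lat l \<in> closure unit_cell" using l closure_W_cell by blast
        then have "cmod (w - lat l) \<le> 2" using cmod_le[of "w - lat l"] by (auto simp: closure_unit_cell)
        moreover have "lat l - z = (w - z) - (w - lat l)" by simp
        then have "cmod (lat l - z) \<le> cmod (w - z) + cmod (w - lat l)" by (metis norm_triangle_ineq4)
        ultimately show ?thesis using elim(3) by (simp add: N_def dist_norm norm_minus_commute)
      qed
      then show ?case using elim l by (simp add: F_def Let_def l_def)
    qed
  qed
  have F_at: "F z = phase \<eta> k * g (z - lat k)" if "z \<in> \<Omega>" "z - lat k \<in> closure W" for z k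
    using eventually_nhds_x_imp_x[OF F_near[OF that]] .
  have "F holomorphic_on \<Omega>"
  proof -
    have "F analytic_on {z}" if z: "z \<in> \<Omega>" for z
    proof -
      obtain k where k: "z - lat k \<in> closure W" using \<Omega>_cover[OF z] by blast
      have "z - lat k \<in> U" using k z U(2) by auto
      then have "g analytic_on {z - lat k}" using g U(1) by (auto simp: analytic_at)
      then have "(\<lambda>w. phase \<eta> k * g (w - lat k)) analytic_on {z}"
        by (intro analytic_intros analytic_on_compose_gen[of "\<lambda>w. w - lat k" "{z}" g "{z - lat k}", unfolded o_def]) auto
      then show ?thesis using analytic_at_cong[OF F_near[OF z k] refl] by simp
    qed
    then have "F analytic_on \<Omega>" by (subst analytic_on_analytic_at) blast
    then show ?thesis by (rule analytic_imp_holomorphic)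
  qed
  moreover have "F (z + lat m) = phase \<eta> m * F z" for z m
  proof (cases "z \<in> \<Omega>")
    case True
    then obtain k where k: "z - lat k \<in> closure W" using \<Omega>_cover by blast
    have "F (z + lat m) = phase \<eta> (k + m) * g (z + lat m - lat (k + m))"
      by (rule F_at) (use True k in \<open>auto simp: lat_add algebra_simps\<close>)
    then show ?thesis using F_at[OF True k] by (simp add: lat_add phase_add algebra_simps)
  qed (simp add: F_def)
  moreover have "F z = 0" if "z \<notin> \<Omega>" for z using that by (simp add: F_def)
  ultimately have "F \<in> quasi_periodic \<eta>" by (simp add: quasi_periodic_def)
  moreover have "f = cell_part F"
  proof
    fix z show "f z = cell_part F z"
    proof (cases "z \<in> W")
      case True
      then show ?thesis using F_at[of z 0] gf[OF True] subsetD[OF W_sub True] subsetD[OF closure_subset True]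
        by (simp add: cell_part_def)
    qed (use fb in \<open>simp add: cell_part_def bergman_def\<close>)
  qed
  ultimately show ?thesis using that by blast
qed

section \<open>Linear structure and completeness of the quasi-periodic Bergman spaces\<close>

lemma bergman_ext_eq: "bergman_ext W \<eta> = {cell_part F |F. F \<in> quasi_periodic \<eta> \<and> cell_part F \<in> L2 W}"
proof (intro equalityI subsetI)
  fix f assume f: "f \<in> bergman_ext W \<eta>"
  obtain F where "F \<in> quasi_periodic \<eta>" "f = cell_part F" using bergman_ext_quasi_periodic[OF f] .
  moreover have "f \<in> L2 W" using f by (simp add: bergman_ext_def bergman_def)
  ultimately show "f \<in> {cell_part F |F. F \<in> quasi_periodic \<eta> \<and> cell_part F \<in> L2 W}" by blast
qed (use cell_part_in_bergman_ext in blast)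

lemma bergman_ext_add:
  assumes "f \<in> bergman_ext W \<eta>" "g \<in> bergman_ext W \<eta>"
  shows "(\<lambda>z. f z + g z) \<in> bergman_ext W \<eta>"
proof -
  obtain F G where F: "F \<in> quasi_periodic \<eta>" "f = cell_part F" "cell_part F \<in> L2 W"
    and G: "G \<in> quasi_periodic \<eta>" "g = cell_part G" "cell_part G \<in> L2 W"
    using assms unfolding bergman_ext_eq by blast
  have eq: "(\<lambda>z. f z + g z) = cell_part (\<lambda>z. F z + G z)" using F G by (auto simp: cell_part_def)
  have "(\<lambda>z. F z + G z) \<in> quasi_periodic \<eta>"
    using F(1) G(1) by (auto simp: quasi_periodic_def algebra_simps intro!: holomorphic_intros)
  moreover have "cell_part (\<lambda>z. F z + G z) \<in> L2 W"
    using L2_add[OF F(3) G(3)] eq F G by simp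
  ultimately show ?thesis unfolding bergman_ext_eq eq by blast
qed

lemma bergman_ext_scale:
  assumes "f \<in> bergman_ext W \<eta>"
  shows "(\<lambda>z. c * f z) \<in> bergman_ext W \<eta>"
proof -
  obtain F where F: "F \<in> quasi_periodic \<eta>" "f = cell_part F" "cell_part F \<in> L2 W"
    using assms unfolding bergman_ext_eq by blast
  have eq: "(\<lambda>z. c * f z) = cell_part (\<lambda>z. c * F z)" using F by (auto simp: cell_part_def)
  have "(\<lambda>z. c * F z) \<in> quasi_periodic \<eta>"
    using F(1) by (auto simp: quasi_periodic_def intro!: holomorphic_intros)
  moreover have "cell_part (\<lambda>z. c * F z) \<in> L2 W" using L2_scale[OF F(3), of c] eq F by simp
  ultimately show ?thesis unfolding bergman_ext_eq eq by blast
qed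

lemma bergman_ext_zero: "(\<lambda>z. 0) \<in> bergman_ext W \<eta>"
proof -
  have "(\<lambda>z. 0) = cell_part (\<lambda>z. 0)" "(\<lambda>z. 0) \<in> quasi_periodic \<eta>" by (auto simp: cell_part_def quasi_periodic_def)
  then show ?thesis unfolding bergman_ext_eq by force
qed

lemma bergman_ext_subset: "bergman_ext W \<eta> \<subseteq> bergman_eta W \<eta>"
proof
  fix f assume f: "f \<in> bergman_ext W \<eta>"
  then have "\<exists>g\<in>bergman_ext W \<eta>. L2_norm W (\<lambda>z. f z - g z) < e" if "e > 0" for e
    using that by (intro bexI[of _ f]) auto
  then show "f \<in> bergman_eta W \<eta>" using f by (auto simp: bergman_eta_def bergman_ext_def)
qed

lemma bergman_eta_dense:
  assumes "f \<in> bergman_eta W \<eta>" "e > 0"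
  obtains g where "g \<in> bergman_ext W \<eta>" "L2_norm W (\<lambda>z. f z - g z) < e"
  using assms by (auto simp: bergman_eta_def)

lemma hilbert_bergman_eta: "hilbert_fun W (bergman_eta W \<eta>)"
proof -
  interpret W: hilbert_fun W "bergman W" by (rule hilbert_bergman) simp
  have sub: "bergman_ext W \<eta> \<subseteq> bergman W" by (auto simp: bergman_ext_def)
  have L: "f \<in> L2 W" if "f \<in> bergman_ext W \<eta>" for f using that sub W.in_L2 by blast
  have L': "f \<in> L2 W" "f \<in> bergman W" if "f \<in> bergman_eta W \<eta>" for f
    using that W.in_L2 by (auto simp: bergman_eta_def)
  show ?thesis
  proof (rule W.closed_subspace)
    show "bergman_eta W \<eta> \<subseteq> bergman W" using L' by blast
    show "(\<lambda>z. 0) \<in> bergman_eta W \<eta>" using bergman_ext_zero bergman_ext_subset by blast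
    show "(\<lambda>z. f z + g z) \<in> bergman_eta W \<eta>" if f: "f \<in> bergman_eta W \<eta>" and g: "g \<in> bergman_eta W \<eta>" for f g
    proof -
      have "\<exists>h\<in>bergman_ext W \<eta>. L2_norm W (\<lambda>z. f z + g z - h z) < e" if e: "e > 0" for e
      proof -
        obtain f' where f': "f' \<in> bergman_ext W \<eta>" "L2_norm W (\<lambda>z. f z - f' z) < e / 2"
          using bergman_eta_dense[OF f, of "e / 2"] e by auto
        obtain g' where g': "g' \<in> bergman_ext W \<eta>" "L2_norm W (\<lambda>z. g z - g' z) < e / 2"
          using bergman_eta_dense[OF g, of "e / 2"] e by auto
        have "L2_norm W (\<lambda>z. (f z - f' z) + (g z - g' z)) \<le> L2_norm W (\<lambda>z. f z - f' z) + L2_norm W (\<lambda>z. g z - g' z)"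
          by (rule L2_norm_triangle) (use L' L f g f' g' in \<open>auto intro: L2_diff\<close>)
        moreover have "(\<lambda>z. (f z - f' z) + (g z - g' z)) = (\<lambda>z. f z + g z - (f' z + g' z))" by auto
        ultimately have "L2_norm W (\<lambda>z. f z + g z - (f' z + g' z)) < e" using f'(2) g'(2) by simp
        then show ?thesis using bergman_ext_add[OF f'(1) g'(1)] by (intro bexI[of _ "\<lambda>z. f' z + g' z"])
      qed
      then show ?thesis using W.add[OF L'(2)[OF f] L'(2)[OF g]] unfolding bergman_eta_def by blast
    qed
    show "(\<lambda>z. c * f z) \<in> bergman_eta W \<eta>" if f: "f \<in> bergman_eta W \<eta>" for c f
    proof -
      have "\<exists>h\<in>bergman_ext W \<eta>. L2_norm W (\<lambda>z. c * f z - h z) < e" if e: "e > 0" for e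
      proof -
        have pos: "cmod c + 1 > 0" by (simp add: add_nonneg_pos)
        obtain f' where f': "f' \<in> bergman_ext W \<eta>" "L2_norm W (\<lambda>z. f z - f' z) < e / (cmod c + 1)"
          using bergman_eta_dense[OF f, of "e / (cmod c + 1)"] e pos by auto
        have "(\<lambda>z. c * f z - c * f' z) = (\<lambda>z. c * (f z - f' z))" by (auto simp: algebra_simps)
        then have "L2_norm W (\<lambda>z. c * f z - c * f' z) = cmod c * L2_norm W (\<lambda>z. f z - f' z)"
          by (simp only: L2_norm_scale)
        also have "\<dots> \<le> (cmod c + 1) * L2_norm W (\<lambda>z. f z - f' z)" by (intro mult_right_mono) auto
        also have "\<dots> < (cmod c + 1) * (e / (cmod c + 1))" by (intro mult_strict_left_mono f' pos)
        finally have "L2_norm W (\<lambda>z. c * f z - c * f' z) < e" using pos by simp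
        then show ?thesis using bergman_ext_scale[OF f'(1), of c] by (intro bexI[of _ "\<lambda>z. c * f' z"])
      qed
      then show ?thesis using W.scale[OF L'(2)[OF f]] unfolding bergman_eta_def by blast
    qed
    show "h \<in> bergman_eta W \<eta>" if h: "h \<in> bergman W"
      and cl: "\<And>e. e > 0 \<Longrightarrow> \<exists>f\<in>bergman_eta W \<eta>. L2_norm W (\<lambda>z. f z - h z) < e" for h
    proof -
      have "\<exists>g\<in>bergman_ext W \<eta>. L2_norm W (\<lambda>z. h z - g z) < e" if e: "e > 0" for e
      proof -
        obtain f where f: "f \<in> bergman_eta W \<eta>" "L2_norm W (\<lambda>z. f z - h z) < e / 2" using cl[of "e / 2"] e by auto
        obtain g where g: "g \<in> bergman_ext W \<eta>" "L2_norm W (\<lambda>z. f z - g z) < e / 2"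
          using bergman_eta_dense[OF f(1), of "e / 2"] e by auto
        have "L2_norm W (\<lambda>z. h z - g z) \<le> L2_norm W (\<lambda>z. h z - f z) + L2_norm W (\<lambda>z. f z - g z)"
          by (rule L2_norm_triangle_diff) (use W.in_L2 h L' L f g in auto)
        then show ?thesis using f(2) g by (intro bexI[of _ g]) (simp_all add: L2_norm_minus[of W h f])
      qed
      then show ?thesis using h unfolding bergman_eta_def by blast
    qed
  qed
qed

end

section \<open>Sums over the lattice\<close>

abbreviation latsum :: "(int \<times> int \<Rightarrow> ennreal) \<Rightarrow> ennreal" where
  "latsum f \<equiv> \<integral>\<^sup>+k. f k \<partial>count_space UNIV"

lemma latsum_cmult: "latsum (\<lambda>k. c * f k) = c * latsum f"
  by (rule nn_integral_cmult) simp

lemma latsum_add: "latsum (\<lambda>k. f k + g k) = latsum f + latsum g"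
  by (rule nn_integral_add) simp_all

lemma latsum_mono: "(\<And>k. f k \<le> g k) \<Longrightarrow> latsum f \<le> latsum g"
  by (rule nn_integral_mono) simp

lemma latsum_shift: "latsum (\<lambda>k. f (k + l)) = latsum f"
  by (rule nn_integral_bij_count_space[where g = "\<lambda>k. k + l"])
    (auto intro!: bij_betwI[where g = "\<lambda>k. k - l"])

lemma latsum_shift': "latsum (\<lambda>k. f (k - l)) = latsum f"
  using latsum_shift[of f "- l"] by simp

lemma latsum_reflect: "latsum (\<lambda>k. f (l - k)) = latsum f"
  by (rule nn_integral_bij_count_space[where g = "\<lambda>k. l - k"])
    (auto intro!: bij_betwI[where g = "\<lambda>k. l - k"])

lemma latsum_swap: "latsum (\<lambda>k. latsum (\<lambda>l. f k l)) = latsum (\<lambda>l. latsum (\<lambda>k. f k l))"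
  by (rule nn_integral_count_space_nn_integral) auto

lemma latsum_nn_integral:
  "(\<And>k. f k \<in> borel_measurable M) \<Longrightarrow>
   (\<integral>\<^sup>+z. latsum (\<lambda>k. f k z) \<partial>M) = latsum (\<lambda>k. \<integral>\<^sup>+z. f k z \<partial>M)"
  by (rule nn_integral_count_space_nn_integral) auto

lemma borel_measurable_latsum:
  assumes "\<And>k. f k \<in> borel_measurable M"
  shows "(\<lambda>z. latsum (\<lambda>k. f k z)) \<in> borel_measurable M"
proof -
  interpret C: sigma_finite_measure "count_space (UNIV :: (int \<times> int) set)"
    by (rule sigma_finite_measure_count_space_countable) simp
  have "(\<lambda>p. f k (fst p)) \<in> borel_measurable (M \<Otimes>\<^sub>M count_space UNIV)" for k
    by (rule measurable_compose[OF measurable_fst assms])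
  then have "(\<lambda>p. f (snd p) (fst p)) \<in> borel_measurable (M \<Otimes>\<^sub>M count_space UNIV)"
    by (rule measurable_compose_countable'[where I = UNIV and g = snd and f = "\<lambda>k p. f k (fst p)"]) auto
  from C.borel_measurable_nn_integral_fst[OF this] show ?thesis by simp
qed

lemma integrable_count_spaceI:
  fixes f :: "int \<times> int \<Rightarrow> complex"
  assumes "h summable_on UNIV" "\<And>k. cmod (f k) \<le> h k"
  shows "integrable (count_space UNIV) f" "infsum f UNIV = (LINT k|count_space UNIV. f k)"
proof -
  have "(\<lambda>k. norm (f k)) summable_on UNIV"
    by (rule summable_on_comparison_test[OF assms(1)]) (use assms(2) in auto)
  then have abs: "Infinite_Set_Sum.abs_summable_on f UNIV" using abs_summable_equivalent by blast
  then show "integrable (count_space UNIV) f" by (simp add: Infinite_Set_Sum.abs_summable_on_def)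
  show "infsum f UNIV = (LINT k|count_space UNIV. f k)"
    using infsetsum_infsum[OF abs] by (simp add: infsetsum_def)
qed

lemma latsum_summable:
  assumes "h summable_on UNIV" "\<And>k. 0 \<le> h k"
  shows "latsum (\<lambda>k. ennreal (h k)) = ennreal (infsum h UNIV)"
proof -
  have "(\<lambda>k. norm (h k)) summable_on UNIV" using assms by simp
  then have abs: "Infinite_Set_Sum.abs_summable_on h UNIV" using abs_summable_equivalent by blast
  then have int: "integrable (count_space UNIV) h" by (simp add: Infinite_Set_Sum.abs_summable_on_def)
  show ?thesis
    using nn_integral_eq_integral[OF int] infsetsum_infsum[OF abs] assms(2) by (simp add: infsetsum_def)
qed

lemma norm_count_integral_le:
  fixes f :: "int \<times> int \<Rightarrow> complex"
  assumes "\<And>k. ennreal (cmod (f k)) \<le> y k"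
  shows "ennreal (cmod (LINT k|count_space UNIV. f k)) \<le> latsum y"
proof (cases "integrable (count_space UNIV) f")
  case True
  have "ennreal (cmod (LINT k|count_space UNIV. f k)) \<le> latsum (\<lambda>k. ennreal (cmod (f k)))"
    by (rule integral_norm_bound_ennreal[OF True])
  also have "\<dots> \<le> latsum y" by (rule latsum_mono[OF assms])
  finally show ?thesis .
qed (simp add: not_integrable_integral_eq)

text \<open>The weight is split into two factors \<open>sqrt (h k)\<close>, so that it survives
  linearly in the squared sum and can be summed once more over the lattice.\<close>

lemma latsum_Cauchy_Schwarz:
  assumes "\<And>k. 0 \<le> h k"
  shows "(latsum (\<lambda>k. ennreal (h k) * y k))\<^sup>2 \<le> latsum (\<lambda>k. ennreal (h k)) * latsum (\<lambda>k. ennreal (h k) * (y k)\<^sup>2)"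
proof -
  have s: "ennreal (sqrt (h k)) * ennreal (sqrt (h k)) = ennreal (h k)" for k
    using assms by (simp flip: ennreal_mult)
  have 1: "(\<lambda>k. ennreal (h k) * y k) = (\<lambda>k. ennreal (sqrt (h k)) * (ennreal (sqrt (h k)) * y k))"
    by (simp add: mult.assoc[symmetric] s)
  have 2: "(ennreal (sqrt (h k)))\<^sup>2 = ennreal (h k)" for k
    by (simp add: power2_eq_square s)
  show ?thesis
    unfolding 1 using Cauchy_Schwarz_nn_integral[of "\<lambda>k. ennreal (sqrt (h k))" "count_space UNIV" "\<lambda>k. ennreal (sqrt (h k)) * y k"]
    by (simp add: power_mult_distrib 2)
qed

lemma ennreal_cmod_sq_add: "ennreal ((cmod (x + y))\<^sup>2) \<le> 2 * ennreal ((cmod x)\<^sup>2) + 2 * ennreal ((cmod y)\<^sup>2)"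
proof -
  have "ennreal ((cmod (x + y))\<^sup>2) \<le> ennreal (2 * (cmod x)\<^sup>2 + 2 * (cmod y)\<^sup>2)"
    by (rule ennreal_leI[OF cmod_add_sq_le])
  then show ?thesis by (simp add: ennreal_plus ennreal_mult')
qed

lemma ennreal_cmod_sq_mult: "ennreal ((cmod (x * y))\<^sup>2) = ennreal ((cmod x)\<^sup>2) * ennreal ((cmod y)\<^sup>2)"
  by (simp add: norm_mult power_mult_distrib ennreal_mult')

lemma sqint_add:
  assumes "f \<in> borel_measurable (lebesgue_on D)" "g \<in> borel_measurable (lebesgue_on D)"
  shows "sqint D (\<lambda>z. f z + g z) \<le> 2 * sqint D f + 2 * sqint D g"
proof -
  have "sqint D (\<lambda>z. f z + g z) \<le> (\<integral>\<^sup>+z. 2 * ennreal ((cmod (f z))\<^sup>2) + 2 * ennreal ((cmod (g z))\<^sup>2) \<partial>lebesgue_on D)"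
    unfolding sqint_def by (intro nn_integral_mono ennreal_cmod_sq_add)
  also have "\<dots> = 2 * sqint D f + 2 * sqint D g"
    unfolding sqint_def using assms by (subst nn_integral_add) (auto simp: nn_integral_cmult)
  finally show ?thesis .
qed

lemma sqint_minus: "sqint D (\<lambda>z. f z - g z) = sqint D (\<lambda>z. g z - f z)"
  by (simp add: sqint_def norm_minus_commute)

lemma sqint_scale:
  "f \<in> borel_measurable (lebesgue_on D) \<Longrightarrow> sqint D (\<lambda>z. c * f z) = ennreal ((cmod c)\<^sup>2) * sqint D f"
  unfolding sqint_def ennreal_cmod_sq_mult by (subst nn_integral_cmult) auto

section \<open>Translation, periodization and localization\<close>

definition shift :: "int \<times> int \<Rightarrow> (complex \<Rightarrow> complex) \<Rightarrow> complex \<Rightarrow> complex" where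
  "shift k f z = f (z + lat k)"

lemma shift_shift: "shift k (shift l f) = shift (k + l) f"
  by (auto simp: shift_def lat_add add.assoc)

lemma shift_0 [simp]: "shift 0 f = f"
  by (auto simp: shift_def)

context periodic_setting
begin

lemma sqint_\<Omega>:
  assumes "f \<in> borel_measurable (lebesgue_on \<Omega>)"
  shows "sqint \<Omega> f = latsum (\<lambda>k. sqint W (shift k f))"
proof -
  have "(\<lambda>z. ennreal ((cmod (f z))\<^sup>2)) \<in> borel_measurable (lebesgue_on \<Omega>)" using assms by measurable
  from nn_fold[OF this] show ?thesis by (simp add: sqint_def shift_def)
qed

lemma measurable_shift: "f \<in> borel_measurable (lebesgue_on \<Omega>) \<Longrightarrow> shift k f \<in> borel_measurable (lebesgue_on \<Omega>)"
  unfolding shift_def[abs_def] by (rule shift_measurable)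

lemma measurable_W: "f \<in> borel_measurable (lebesgue_on \<Omega>) \<Longrightarrow> f \<in> borel_measurable (lebesgue_on W)"
  by (rule measurable_restrict_mono[OF _ W_sub])

lemma sqint_shift: "f \<in> borel_measurable (lebesgue_on \<Omega>) \<Longrightarrow> sqint \<Omega> (shift k f) = sqint \<Omega> f"
proof -
  assume f: "f \<in> borel_measurable (lebesgue_on \<Omega>)"
  then have "(\<lambda>z. ennreal ((cmod (f z))\<^sup>2)) \<in> borel_measurable (lebesgue_on \<Omega>)" by measurable
  from nn_integral_\<Omega>_shift[OF this, of k] show ?thesis by (simp add: sqint_def shift_def)
qed

lemma L2_shift: "f \<in> L2 \<Omega> \<Longrightarrow> shift k f \<in> L2 \<Omega>"
  using sqint_shift[of f k] measurable_shift[of f k] by (simp add: L2_iff_sqint)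

lemma L2_norm_shift: "f \<in> L2 \<Omega> \<Longrightarrow> L2_norm \<Omega> (shift k f) = L2_norm \<Omega> f"
proof -
  assume f: "f \<in> L2 \<Omega>"
  have "ennreal ((L2_norm \<Omega> (shift k f))\<^sup>2) = ennreal ((L2_norm \<Omega> f)\<^sup>2)"
    using sqint_shift[OF L2_measurable[OF f], of k] sqint_eq_L2_norm[OF f] sqint_eq_L2_norm[OF L2_shift[OF f]] by simp
  then show ?thesis by (simp add: ennreal_inj)
qed

lemma holomorphic_shift:
  assumes "f holomorphic_on \<Omega>"
  shows "shift k f holomorphic_on \<Omega>"
proof -
  have "(\<lambda>z. f (z + lat k)) holomorphic_on \<Omega>"
    by (rule holomorphic_on_compose_gen[OF _ assms, unfolded o_def]) (auto intro!: holomorphic_intros)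
  then show ?thesis by (simp add: shift_def[abs_def])
qed

lemma bergman_shift: "f \<in> bergman \<Omega> \<Longrightarrow> shift k f \<in> bergman \<Omega>"
  by (auto simp: bergman_def L2_shift holomorphic_shift) (simp add: shift_def)

sublocale A: hilbert_fun \<Omega> "bergman \<Omega>"
  by (rule hilbert_bergman) simp

sublocale A_eta: hilbert_fun W "bergman_eta W \<eta>" for \<eta>
  by (rule hilbert_bergman_eta)

lemma bergman_holomorphic: "f \<in> bergman \<Omega> \<Longrightarrow> f holomorphic_on \<Omega>"
  unfolding bergman_def by blast

lemma bergman_meas: "f \<in> bergman \<Omega> \<Longrightarrow> f \<in> borel_measurable (lebesgue_on \<Omega>)"
  using A.in_L2 L2_measurable by blast

lemma sqint_cell_part: "sqint W (cell_part f) = sqint W f"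
  unfolding sqint_def by (intro nn_integral_cong) (auto simp: cell_part_def)

lemma L2_cell_part: "f \<in> L2 W \<Longrightarrow> cell_part f \<in> L2 W"
proof -
  assume f: "f \<in> L2 W"
  have "cell_part f \<in> borel_measurable (lebesgue_on W)"
    using L2_measurable[OF f] by (rule measurable_cong[THEN iffD1, rotated]) (simp add: cell_part_def)
  then show ?thesis using f by (simp add: L2_iff_sqint sqint_cell_part)
qed

lemma L2_inner_cong_W:
  "(\<And>z. z \<in> W \<Longrightarrow> f z = f' z) \<Longrightarrow> (\<And>z. z \<in> W \<Longrightarrow> g z = g' z) \<Longrightarrow> L2_inner W f g = L2_inner W f' g'"
  unfolding L2_inner_def by (rule Bochner_Integration.integral_cong) auto

end

section \<open>Periodization and localization by the analytic cutoff\<close>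

locale cutoff_setting = periodic_setting +
  fixes \<theta> :: "complex \<Rightarrow> complex" and h :: "int \<times> int \<Rightarrow> real"
  assumes \<theta>_hol: "\<theta> holomorphic_on \<Omega>"
    and \<theta>_dom: "\<And>R. \<exists>h. (\<forall>k. 0 \<le> h k) \<and> h summable_on UNIV \<and>
        (\<forall>z\<in>\<Omega>. cmod z \<le> R \<longrightarrow> (\<forall>k. cmod (\<theta> (z + lat k)) \<le> h k))"
    and \<theta>_sum: "\<And>z. z \<in> \<Omega> \<Longrightarrow> ((\<lambda>k. \<theta> (z + lat k)) has_sum 1) UNIV"
    and h_nonneg: "\<And>k. 0 \<le> h k" and h_summable: "h summable_on UNIV"
    and \<theta>_h: "\<And>z k. z \<in> W \<Longrightarrow> cmod (\<theta> (z + lat k)) \<le> h k"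
begin

text \<open>The total mass of the majorant \<open>h\<close> of the cutoff on the cell; through the
  weighted Cauchy-Schwarz inequality it becomes the constant of the estimates below.\<close>

definition h_total :: real where "h_total = infsum h UNIV"

lemma h_total_nonneg: "0 \<le> h_total"
  unfolding h_total_def by (rule infsum_nonneg) (simp add: h_nonneg)

lemma latsum_h: "latsum (\<lambda>k. ennreal (h k)) = ennreal h_total"
  unfolding h_total_def by (rule latsum_summable[OF h_summable h_nonneg])

lemma h_le_total: "h k \<le> h_total"
proof -
  have "infsum h {k} \<le> infsum h UNIV"
    by (rule infsum_mono2) (use h_summable h_nonneg in auto)
  then show ?thesis by (simp add: h_total_def)
qed

lemma \<theta>_integrable: "z \<in> W \<Longrightarrow> integrable (count_space UNIV) (\<lambda>k. \<theta> (z + lat k))"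
  and \<theta>_integral: "z \<in> W \<Longrightarrow> (LINT k|count_space UNIV. \<theta> (z + lat k)) = 1"
proof -
  assume z: "z \<in> W"
  show "integrable (count_space UNIV) (\<lambda>k. \<theta> (z + lat k))"
    by (rule integrable_count_spaceI(1)[OF h_summable \<theta>_h[OF z]])
  have "(LINT k|count_space UNIV. \<theta> (z + lat k)) = infsum (\<lambda>k. \<theta> (z + lat k)) UNIV"
    by (rule integrable_count_spaceI(2)[OF h_summable \<theta>_h[OF z], symmetric])
  also have "\<dots> = 1" using \<theta>_sum[of z] z W_sub by (intro infsumI) auto
  finally show "(LINT k|count_space UNIV. \<theta> (z + lat k)) = 1" .
qed

text \<open>A twisted lattice sum of \<open>\<theta> w\<close>. If the translates of
  \<open>w\<close> were exactly \<open>phase \<eta> k * w\<close>, the twist would cancel and the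
  sum of the translates of \<open>\<theta>\<close> would return \<open>w\<close>; for an approximate
  eigenfunction of the translations it is close to \<open>w\<close>.\<close>

definition periodize :: "real \<times> real \<Rightarrow> (complex \<Rightarrow> complex) \<Rightarrow> complex \<Rightarrow> complex" where
  "periodize \<eta> w z = (if z \<in> \<Omega> then infsum (\<lambda>k. \<theta> (z + lat k) * phase \<eta> (- k) * w (z + lat k)) UNIV else 0)"

text \<open>A Weierstrass majorant near \<open>z0\<close>: the translates of \<open>w\<close> have
  equal norm and are therefore bounded near \<open>z0\<close> by one constant, while the translates
  of \<open>\<theta>\<close> are dominated by a summable sequence.\<close>

lemma periodize_local:
  assumes w: "w \<in> bergman \<Omega>" and z: "z0 \<in> \<Omega>"
  obtains r M where "r > 0" "cball z0 r \<subseteq> \<Omega>" "M summable_on UNIV"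
    "\<And>k z. z \<in> cball z0 r \<Longrightarrow> cmod (\<theta> (z + lat k) * phase \<eta> (- k) * w (z + lat k)) \<le> M k"
proof -
  obtain r K where r: "r > 0" "K > 0" "cball z0 r \<subseteq> \<Omega>"
    and K: "\<And>f z. f \<in> L2 \<Omega> \<Longrightarrow> f holomorphic_on \<Omega> \<Longrightarrow> z \<in> cball z0 r \<Longrightarrow> cmod (f z) \<le> K * L2_norm \<Omega> f"
    using bergman_bounds[OF open_\<Omega> z] by metis
  obtain h' where h': "\<And>k. 0 \<le> h' k" "h' summable_on UNIV"
    "\<And>z k. z \<in> \<Omega> \<Longrightarrow> cmod z \<le> cmod z0 + r \<Longrightarrow> cmod (\<theta> (z + lat k)) \<le> h' k"
    using \<theta>_dom[of "cmod z0 + r"] by blast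
  have wL: "w \<in> L2 \<Omega>" "w holomorphic_on \<Omega>" using w by (simp_all add: bergman_holomorphic)
  have "cmod (\<theta> (z + lat k) * phase \<eta> (- k) * w (z + lat k)) \<le> h' k * (K * L2_norm \<Omega> w)"
    if zc: "z \<in> cball z0 r" for z k
  proof -
    have "cmod z \<le> cmod z0 + r" using zc norm_triangle_sub[of z z0] by (simp add: dist_norm norm_minus_commute)
    moreover have "z \<in> \<Omega>" using zc r(3) by blast
    ultimately have "cmod (\<theta> (z + lat k)) \<le> h' k" using h'(3) by blast
    moreover have "cmod (w (z + lat k)) \<le> K * L2_norm \<Omega> w"
      using K[OF L2_shift[OF wL(1)] holomorphic_shift[OF wL(2)] zc, of k] L2_norm_shift[OF wL(1), of k]
      by (simp add: shift_def)
    ultimately show ?thesis by (simp add: norm_mult) (intro mult_mono h'(1), auto)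
  qed
  moreover have "(\<lambda>k. h' k * (K * L2_norm \<Omega> w)) summable_on UNIV"
    by (rule summable_on_cmult_left[OF h'(2)])
  ultimately show ?thesis using that r by blast
qed

lemma periodize_holomorphic:
  assumes w: "w \<in> bergman \<Omega>"
  shows "periodize \<eta> w holomorphic_on \<Omega>"
proof -
  have "\<exists>r>0. ball z0 r \<subseteq> \<Omega> \<and> periodize \<eta> w holomorphic_on ball z0 r" if z0: "z0 \<in> \<Omega>" for z0
  proof -
    obtain r M where r: "r > 0" "cball z0 r \<subseteq> \<Omega>" and M: "M summable_on UNIV"
      "\<And>k z. z \<in> cball z0 r \<Longrightarrow> cmod (\<theta> (z + lat k) * phase \<eta> (- k) * w (z + lat k)) \<le> M k"
      using periodize_local[OF w z0] by metis
    let ?S = "\<lambda>X z. \<Sum>k\<in>X. \<theta> (z + lat k) * phase \<eta> (- k) * w (z + lat k)"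
    let ?g = "\<lambda>z. infsum (\<lambda>k. \<theta> (z + lat k) * phase \<eta> (- k) * w (z + lat k)) UNIV"
    have lim: "uniform_limit (cball z0 r) ?S ?g (finite_subsets_at_top UNIV)"
      by (rule Weierstrass_m_test_general[OF M(2) M(1)]) auto
    have hol: "?S X holomorphic_on \<Omega>" for X
    proof (intro holomorphic_intros)
      show "(\<lambda>z. \<theta> (z + lat k)) holomorphic_on \<Omega>" for k
        using holomorphic_shift[OF \<theta>_hol, of k] by (simp add: shift_def[abs_def])
      show "(\<lambda>z. w (z + lat k)) holomorphic_on \<Omega>" for k
        using holomorphic_shift[OF bergman_holomorphic[OF w], of k] by (simp add: shift_def[abs_def])
    qed
    have "\<forall>\<^sub>F X in finite_subsets_at_top UNIV. continuous_on (cball z0 r) (?S X) \<and> ?S X holomorphic_on ball z0 r"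
    proof (intro always_eventually allI conjI)
      show "continuous_on (cball z0 r) (?S X)" for X
        by (rule holomorphic_on_imp_continuous_on[OF holomorphic_on_subset[OF hol r(2)]])
      show "?S X holomorphic_on ball z0 r" for X
        by (rule holomorphic_on_subset[OF hol]) (use r(2) in auto)
    qed
    then have "?g holomorphic_on ball z0 r"
      by (rule holomorphic_uniform_limit[OF _ lim]) simp
    moreover have sub: "ball z0 r \<subseteq> \<Omega>" using r(2) by auto
    ultimately have "periodize \<eta> w holomorphic_on ball z0 r"
      by (elim holomorphic_transform) (auto simp: periodize_def)
    then show ?thesis using r(1) sub by blast
  qed
  then have "periodize \<eta> w analytic_on \<Omega>"
    unfolding analytic_on_def by blast
  then show ?thesis by (rule analytic_imp_holomorphic)
qed

lemma periodize_quasi_periodic: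
  assumes w: "w \<in> bergman \<Omega>"
  shows "periodize \<eta> w \<in> quasi_periodic \<eta>"
proof -
  have "periodize \<eta> w (z + lat m) = phase \<eta> m * periodize \<eta> w z" for z m
  proof (cases "z \<in> \<Omega>")
    case True
    have "infsum (\<lambda>k. \<theta> (z + lat m + lat k) * phase \<eta> (- k) * w (z + lat m + lat k)) UNIV
        = infsum (\<lambda>k. phase \<eta> m * (\<theta> (z + lat (k + m)) * phase \<eta> (- (k + m)) * w (z + lat (k + m)))) UNIV"
    proof (rule infsum_cong)
      fix k
      have "phase \<eta> (- k) = phase \<eta> m * phase \<eta> (- (k + m))"
        using phase_add[of \<eta> m "- (k + m)"] by simp
      then show "\<theta> (z + lat m + lat k) * phase \<eta> (- k) * w (z + lat m + lat k) =
         phase \<eta> m * (\<theta> (z + lat (k + m)) * phase \<eta> (- (k + m)) * w (z + lat (k + m)))"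
        by (simp add: lat_add add_ac mult_ac)
    qed
    also have "\<dots> = infsum (\<lambda>k. phase \<eta> m * (\<theta> (z + lat k) * phase \<eta> (- k) * w (z + lat k))) UNIV"
      by (rule infsum_reindex_bij_betw[of "\<lambda>k. k + m"]) (auto intro!: bij_betwI[where g = "\<lambda>k. k - m"])
    also have "\<dots> = phase \<eta> m * infsum (\<lambda>k. \<theta> (z + lat k) * phase \<eta> (- k) * w (z + lat k)) UNIV"
      by (rule infsum_cmult_right')
    finally show ?thesis using True by (simp add: periodize_def)
  qed (simp add: periodize_def)
  then show ?thesis
    using periodize_holomorphic[OF w] by (auto simp: quasi_periodic_def periodize_def)
qed

lemma
  assumes w: "w \<in> bergman \<Omega>" and z: "z \<in> W"
  shows periodize_integrable: "integrable (count_space UNIV) (\<lambda>k. \<theta> (z + lat k) * phase \<eta> (- k) * w (z + lat k))"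
    and periodize_eq: "periodize \<eta> w z = (LINT k|count_space UNIV. \<theta> (z + lat k) * phase \<eta> (- k) * w (z + lat k))"
proof -
  have z\<Omega>: "z \<in> \<Omega>" using z W_sub by blast
  obtain r M where r: "r > 0" and M: "M summable_on UNIV"
      "\<And>k z'. z' \<in> cball z r \<Longrightarrow> cmod (\<theta> (z' + lat k) * phase \<eta> (- k) * w (z' + lat k)) \<le> M k"
    using periodize_local[OF w z\<Omega>] by metis
  have *: "\<And>k. cmod (\<theta> (z + lat k) * phase \<eta> (- k) * w (z + lat k)) \<le> M k" by (rule M(2)) (use r in simp)
  show "integrable (count_space UNIV) (\<lambda>k. \<theta> (z + lat k) * phase \<eta> (- k) * w (z + lat k))"
    by (rule integrable_count_spaceI(1)[OF M(1) *])
  show "periodize \<eta> w z = (LINT k|count_space UNIV. \<theta> (z + lat k) * phase \<eta> (- k) * w (z + lat k))"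
    using integrable_count_spaceI(2)[OF M(1) *] z\<Omega> by (simp add: periodize_def)
qed

lemma quasi_periodic_lat: "F \<in> quasi_periodic \<eta> \<Longrightarrow> F (z + lat k) = phase \<eta> k * F z"
  unfolding quasi_periodic_def by blast

lemma quasi_periodic_meas: "F \<in> quasi_periodic \<eta> \<Longrightarrow> F \<in> borel_measurable (lebesgue_on \<Omega>)"
  by (auto simp: quasi_periodic_def intro: holomorphic_imp_measurable_lebesgue_on)

text \<open>Writing \<open>w z\<close> as the sum of \<open>\<theta> (z + lat k) * w z\<close> shows
  the difference as a \<open>\<theta>\<close>-weighted sum of the translation defects of
  \<open>w\<close>; the weighted Cauchy-Schwarz inequality keeps the weights
  \<open>h\<close>.\<close>

lemma sqint_periodize_diff:
  assumes w: "w \<in> bergman \<Omega>"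
  shows "sqint W (\<lambda>z. periodize \<eta> w z - w z) \<le>
    ennreal h_total * latsum (\<lambda>k. ennreal (h k) * sqint W (\<lambda>z. shift k w z - phase \<eta> k * w z))"
proof -
  have wm: "w \<in> borel_measurable (lebesgue_on W)" "shift k w \<in> borel_measurable (lebesgue_on W)" for k
    using bergman_meas[OF w] measurable_shift measurable_W by blast+
  have m: "(\<lambda>z. ennreal (h k) * ennreal ((cmod (shift k w z - phase \<eta> k * w z))\<^sup>2)) \<in> borel_measurable (lebesgue_on W)" for k
    using wm by measurable
  have pt: "ennreal ((cmod (periodize \<eta> w z - w z))\<^sup>2) \<le>
      ennreal h_total * latsum (\<lambda>k. ennreal (h k) * ennreal ((cmod (shift k w z - phase \<eta> k * w z))\<^sup>2))" if z: "z \<in> W" for z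
  proof -
    have "periodize \<eta> w z - w z = (LINT k|count_space UNIV. \<theta> (z + lat k) * phase \<eta> (- k) * w (z + lat k)) -
        (LINT k|count_space UNIV. \<theta> (z + lat k) * w z)"
      using \<theta>_integral[OF z] by (simp add: periodize_eq[OF w z])
    also have "\<dots> = (LINT k|count_space UNIV. \<theta> (z + lat k) * phase \<eta> (- k) * w (z + lat k) - \<theta> (z + lat k) * w z)"
      by (rule Bochner_Integration.integral_diff[symmetric])
        (use periodize_integrable[OF w z] \<theta>_integrable[OF z] in auto)
    finally have "ennreal (cmod (periodize \<eta> w z - w z)) \<le> latsum (\<lambda>k. ennreal (h k) * ennreal (cmod (shift k w z - phase \<eta> k * w z)))"
    proof (elim ssubst, intro norm_count_integral_le)
      fix k
      have "\<theta> (z + lat k) * phase \<eta> (- k) * w (z + lat k) - \<theta> (z + lat k) * w z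
          = \<theta> (z + lat k) * (phase \<eta> (- k) * (shift k w z - phase \<eta> k * w z))"
        by (simp add: shift_def algebra_simps phase_minus)
      then have "cmod (\<theta> (z + lat k) * phase \<eta> (- k) * w (z + lat k) - \<theta> (z + lat k) * w z) \<le> h k * cmod (shift k w z - phase \<eta> k * w z)"
        using \<theta>_h[OF z, of k] by (simp add: norm_mult mult_right_mono)
      then show "ennreal (cmod (\<theta> (z + lat k) * phase \<eta> (- k) * w (z + lat k) - \<theta> (z + lat k) * w z)) \<le>
          ennreal (h k) * ennreal (cmod (shift k w z - phase \<eta> k * w z))"
        unfolding ennreal_mult'[OF h_nonneg, symmetric] by (rule ennreal_leI)
    qed
    then have "(ennreal (cmod (periodize \<eta> w z - w z)))\<^sup>2 \<le> (latsum (\<lambda>k. ennreal (h k) * ennreal (cmod (shift k w z - phase \<eta> k * w z))))\<^sup>2"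
      by (rule power_mono) simp
    also have "\<dots> \<le> ennreal h_total * latsum (\<lambda>k. ennreal (h k) * (ennreal (cmod (shift k w z - phase \<eta> k * w z)))\<^sup>2)"
      using latsum_Cauchy_Schwarz[of h, OF h_nonneg] by (simp add: latsum_h)
    finally show ?thesis by (simp add: ennreal_power)
  qed
  have "sqint W (\<lambda>z. periodize \<eta> w z - w z) \<le>
    (\<integral>\<^sup>+z. ennreal h_total * latsum (\<lambda>k. ennreal (h k) * ennreal ((cmod (shift k w z - phase \<eta> k * w z))\<^sup>2)) \<partial>lebesgue_on W)"
    unfolding sqint_def by (intro nn_integral_mono pt) simp
  also have "\<dots> = ennreal h_total * (\<integral>\<^sup>+z. latsum (\<lambda>k. ennreal (h k) * ennreal ((cmod (shift k w z - phase \<eta> k * w z))\<^sup>2)) \<partial>lebesgue_on W)"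
    by (rule nn_integral_cmult[OF borel_measurable_latsum[OF m]])
  also have "(\<integral>\<^sup>+z. latsum (\<lambda>k. ennreal (h k) * ennreal ((cmod (shift k w z - phase \<eta> k * w z))\<^sup>2)) \<partial>lebesgue_on W) =
      latsum (\<lambda>k. \<integral>\<^sup>+z. ennreal (h k) * ennreal ((cmod (shift k w z - phase \<eta> k * w z))\<^sup>2) \<partial>lebesgue_on W)"
    by (rule latsum_nn_integral[OF m])
  also have "\<dots> = latsum (\<lambda>k. ennreal (h k) * sqint W (\<lambda>z. shift k w z - phase \<eta> k * w z))"
    unfolding sqint_def using wm by (subst nn_integral_cmult) auto
  finally show ?thesis .
qed

lemma periodize_L2:
  assumes w: "w \<in> bergman \<Omega>"
  shows "periodize \<eta> w \<in> L2 W"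
proof -
  have wm: "w \<in> borel_measurable (lebesgue_on W)" "shift k w \<in> borel_measurable (lebesgue_on W)" for k
    using bergman_meas[OF w] measurable_shift measurable_W by blast+
  have pm: "periodize \<eta> w \<in> borel_measurable (lebesgue_on W)"
    using quasi_periodic_meas[OF periodize_quasi_periodic[OF w]] measurable_W by blast
  have fin: "sqint \<Omega> w < \<infinity>" using A.in_L2[OF w] L2_iff_sqint by blast
  have le: "sqint W (shift k w) \<le> sqint \<Omega> w" for k
  proof -
    have "sqint W (shift k w) = latsum (\<lambda>l. sqint W (shift l w) * indicator {k} l)"
      by simp
    also have "\<dots> \<le> sqint \<Omega> w"
      unfolding sqint_\<Omega>[OF bergman_meas[OF w]] by (rule latsum_mono) (simp add: indicator_def)
    finally show ?thesis .
  qed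
  have *: "sqint W (\<lambda>z. shift k w z - phase \<eta> k * w z) \<le> 4 * sqint \<Omega> w" for k
  proof -
    have "sqint W (\<lambda>z. shift k w z + (- phase \<eta> k) * w z) \<le> 2 * sqint W (shift k w) + 2 * sqint W (\<lambda>z. (- phase \<eta> k) * w z)"
      by (rule sqint_add) (use wm in auto)
    also have "\<dots> = 2 * sqint W (shift k w) + 2 * sqint W (shift 0 w)"
      using wm by (subst sqint_scale) auto
    also have "\<dots> \<le> 2 * sqint \<Omega> w + 2 * sqint \<Omega> w"
      by (intro add_mono mult_left_mono le) auto
    also have "\<dots> = (2 + 2) * sqint \<Omega> w" by (rule distrib_right[symmetric])
    finally show ?thesis by simp
  qed
  have "sqint W (\<lambda>z. periodize \<eta> w z - w z) \<le> ennreal h_total * latsum (\<lambda>k. ennreal (h k) * (4 * sqint \<Omega> w))"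
    by (rule order_trans[OF sqint_periodize_diff[OF w]]) (intro mult_left_mono latsum_mono *, auto)
  also have "\<dots> = ennreal h_total * (latsum (\<lambda>k. ennreal (h k)) * (4 * sqint \<Omega> w))"
    by (subst nn_integral_multc) auto
  also have "\<dots> < \<infinity>"
    unfolding latsum_h using fin by (auto simp: ennreal_mult_less_top ennreal_mult_eq_top_iff less_top[symmetric])
  finally have "(\<lambda>z. periodize \<eta> w z - w z) \<in> L2 W"
    using pm wm unfolding L2_iff_sqint by auto
  moreover have "w \<in> L2 W" by (rule L2_subset[OF A.in_L2[OF w] W_sub]) auto
  ultimately have "(\<lambda>z. (periodize \<eta> w z - w z) + w z) \<in> L2 W" by (rule L2_add)
  then show ?thesis by simp
qed

lemma periodize_ext: "w \<in> bergman \<Omega> \<Longrightarrow> cell_part (periodize \<eta> w) \<in> bergman_ext W \<eta>"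
  by (rule cell_part_in_bergman_ext[OF periodize_quasi_periodic L2_cell_part[OF periodize_L2]])

text \<open>Translation does not change the modulus of \<open>F\<close>, so integrability over
  \<open>\<Omega>\<close> comes from the cutoff alone: its square on the translate \<open>k\<close>
  of the cell is at most \<open>h_total * h (k - p)\<close>, which is summable.\<close>

lemma localize_in:
  assumes F: "F \<in> quasi_periodic \<eta>" "F \<in> L2 W"
  shows "(\<lambda>z. \<theta> (z - lat p) * F z) \<in> bergman \<Omega>"
proof -
  let ?v = "\<lambda>z. \<theta> (z - lat p) * F z"
  have "(\<lambda>z. \<theta> (z - lat p)) holomorphic_on \<Omega>"
    using holomorphic_shift[OF \<theta>_hol, of "- p"] by (simp add: shift_def[abs_def] lat_minus)
  moreover have "F holomorphic_on \<Omega>" using F(1) by (simp add: quasi_periodic_def)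
  ultimately have hol: "?v holomorphic_on \<Omega>" by (rule holomorphic_on_mult)
  have vm: "?v \<in> borel_measurable (lebesgue_on \<Omega>)"
    by (rule holomorphic_imp_measurable_lebesgue_on[OF open_\<Omega> hol])
  have "sqint W (shift k ?v) \<le> ennreal h_total * ennreal (h (k - p)) * sqint W F" for k
  proof -
    have "sqint W (shift k ?v) \<le> (\<integral>\<^sup>+z. ennreal h_total * ennreal (h (k - p)) * ennreal ((cmod (F z))\<^sup>2) \<partial>lebesgue_on W)"
      unfolding sqint_def
    proof (rule nn_integral_mono)
      fix z assume "z \<in> space (lebesgue_on W)"
      then have z: "z \<in> W" by simp
      have "z + lat k - lat p = z + lat (k - p)" by (simp add: lat_diff)
      then have "shift k ?v z = \<theta> (z + lat (k - p)) * (phase \<eta> k * F z)"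
        unfolding shift_def quasi_periodic_lat[OF F(1)] by (rule arg_cong)
      moreover have "(cmod (\<theta> (z + lat (k - p))))\<^sup>2 \<le> h_total * h (k - p)"
        unfolding power2_eq_square
        using \<theta>_h[OF z, of "k - p"] h_le_total[of "k - p"] h_nonneg h_total_nonneg by (intro mult_mono) auto
      ultimately have "(cmod (shift k ?v z))\<^sup>2 \<le> (h_total * h (k - p)) * (cmod (F z))\<^sup>2"
        by (simp add: norm_mult power_mult_distrib mult_right_mono)
      then show "ennreal ((cmod (shift k ?v z))\<^sup>2) \<le> ennreal h_total * ennreal (h (k - p)) * ennreal ((cmod (F z))\<^sup>2)"
        using h_total_nonneg h_nonneg by (simp add: ennreal_mult[symmetric] ennreal_leI)
    qed
    also have "\<dots> = ennreal h_total * ennreal (h (k - p)) * sqint W F"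
      unfolding sqint_def using L2_measurable[OF F(2)] by (subst nn_integral_cmult) auto
    finally show ?thesis .
  qed
  then have "sqint \<Omega> ?v \<le> latsum (\<lambda>k. ennreal h_total * ennreal (h (k - p)) * sqint W F)"
    unfolding sqint_\<Omega>[OF vm] by (rule latsum_mono)
  also have "\<dots> = ennreal h_total * latsum (\<lambda>k. ennreal (h (k - p))) * sqint W F"
    by (simp add: nn_integral_multc nn_integral_cmult)
  also have "\<dots> < \<infinity>"
    using latsum_shift'[of "\<lambda>k. ennreal (h k)" p] F(2) unfolding latsum_h L2_iff_sqint
    by (auto simp: ennreal_mult_less_top less_top[symmetric] ennreal_mult_eq_top_iff)
  finally have "?v \<in> L2 \<Omega>" using vm L2_iff_sqint by blast
  moreover have "?v z = 0" if "z \<notin> \<Omega>" for z using F(1) that by (simp add: quasi_periodic_def)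
  ultimately show ?thesis using hol unfolding bergman_def by blast
qed

end

section \<open>Toeplitz operators on the domain and on the cell\<close>

lemma ennreal_two_mult_le: "2 * (x * y) \<le> x\<^sup>2 + (y::ennreal)\<^sup>2"
proof (cases "x = top \<or> y = top")
  case True
  then show ?thesis by (auto simp: power2_eq_square ennreal_top_mult ennreal_mult_top)
next
  case False
  then obtain r s where rs: "x = ennreal r" "y = ennreal s" "r \<ge> 0" "s \<ge> 0"
    by (cases x; cases y) auto
  have "2 * (r * s) \<le> r\<^sup>2 + s\<^sup>2"
    using zero_le_power2[of "r - s"] by (simp add: power2_eq_square algebra_simps)
  then have "ennreal (2 * (r * s)) \<le> ennreal (r\<^sup>2 + s\<^sup>2)" by (rule ennreal_leI)
  then show ?thesis unfolding rs(1,2) using rs(3,4)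
    by (simp add: ennreal_mult ennreal_plus ennreal_power)
qed

lemma ennreal_sq_add_le: "0 \<le> x \<Longrightarrow> 0 \<le> y \<Longrightarrow> (ennreal (x + y))\<^sup>2 \<le> 2 * ennreal (x\<^sup>2) + 2 * ennreal (y\<^sup>2)"
proof -
  assume xy: "0 \<le> x" "0 \<le> y"
  have "(x + y)\<^sup>2 \<le> 2 * x\<^sup>2 + 2 * y\<^sup>2"
    using zero_le_power2[of "x - y"] by (simp add: power2_eq_square algebra_simps)
  then have "ennreal ((x + y)\<^sup>2) \<le> ennreal (2 * x\<^sup>2 + 2 * y\<^sup>2)" by (rule ennreal_leI)
  then show ?thesis
    unfolding ennreal_power[OF add_nonneg_nonneg[OF xy]] by (simp add: ennreal_plus ennreal_mult')
qed

text \<open>Formally \<open>u = q\<close> is inserted, which turns the hypothesis into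
  \<open>2 * n\<^sup>2 \<le> n\<^sup>2 + A\<close>. The estimate is available only on a dense set
  \<open>E\<close>, so \<open>u\<close> approximates \<open>q\<close> and the error
  \<open>4 * n * e + e\<^sup>2\<close> tends to zero.\<close>

lemma (in hilbert_fun) norm_sq_le_by_density:
  assumes q: "q \<in> H" and E: "\<And>e. e > 0 \<Longrightarrow> \<exists>u\<in>E. L2_norm D (\<lambda>z. q z - u z) < e" "E \<subseteq> H"
    and le: "\<And>u. u \<in> E \<Longrightarrow> 2 * cmod (L2_inner D q u) \<le> (L2_norm D u)\<^sup>2 + A"
  shows "(L2_norm D q)\<^sup>2 \<le> A"
proof -
  define n where "n = L2_norm D q"
  have key: "n\<^sup>2 - A \<le> 4 * n * e + e\<^sup>2" if e: "e > 0" for e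
  proof -
    obtain u where u: "u \<in> E" "L2_norm D (\<lambda>z. q z - u z) < e" using E(1)[OF e] by blast
    have uH: "u \<in> H" using u E(2) by blast
    have qq: "L2_inner D q q = L2_inner D q u + L2_inner D q (\<lambda>z. q z - u z)"
      using L2_inner_diff_right[OF in_L2[OF q] in_L2[OF uH] in_L2[OF q]] by simp
    have "cmod (L2_inner D q q) \<le> cmod (L2_inner D q u) + cmod (L2_inner D q (\<lambda>z. q z - u z))"
      unfolding qq by (rule norm_triangle_ineq)
    then have "n\<^sup>2 \<le> cmod (L2_inner D q u) + cmod (L2_inner D q (\<lambda>z. q z - u z))"
      by (simp add: n_def L2_inner_self norm_power)
    moreover have "cmod (L2_inner D q (\<lambda>z. q z - u z)) \<le> n * e"
    proof -
      have "cmod (L2_inner D q (\<lambda>z. q z - u z)) \<le> n * L2_norm D (\<lambda>z. q z - u z)"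
        unfolding n_def by (rule L2_Cauchy_Schwarz) (use q uH in \<open>auto intro: L2_diff\<close>)
      also have "\<dots> \<le> n * e" using u(2) by (intro mult_left_mono) (auto simp: n_def)
      finally show ?thesis .
    qed
    moreover have "L2_norm D u \<le> n + e"
      using L2_norm_le_add_diff[OF in_L2[OF uH] in_L2[OF q]] u(2) L2_norm_minus[of D u q] by (simp add: n_def)
    then have "(L2_norm D u)\<^sup>2 \<le> (n + e)\<^sup>2" by (intro power_mono) auto
    ultimately have "2 * n\<^sup>2 \<le> (n + e)\<^sup>2 + A + 2 * (n * e)" using le[OF u(1)] by linarith
    then show ?thesis by (simp add: power2_eq_square algebra_simps)
  qed
  have "((\<lambda>e. 4 * n * e + e\<^sup>2) \<longlongrightarrow> 4 * n * 0 + 0\<^sup>2) (at_right 0)"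
    by (intro tendsto_intros)
  moreover have "\<forall>\<^sub>F e in at_right 0. n\<^sup>2 - A \<le> 4 * n * e + e\<^sup>2"
    using eventually_at_right_less[of "0::real"] by eventually_elim (rule key)
  ultimately have "n\<^sup>2 - A \<le> 4 * n * 0 + 0\<^sup>2" by (rule tendsto_lowerbound) simp
  then show ?thesis by (simp add: n_def)
qed

context periodic_setting
begin

lemma distr_\<Omega>_shift: "distr (lebesgue_on \<Omega>) (lebesgue_on \<Omega>) (\<lambda>z. z + lat k) = lebesgue_on \<Omega>"
  and measurable_\<Omega>_shift: "(\<lambda>z. z + lat k) \<in> lebesgue_on \<Omega> \<rightarrow>\<^sub>M lebesgue_on \<Omega>"
proof -
  show T: "(\<lambda>z. z + lat k) \<in> lebesgue_on \<Omega> \<rightarrow>\<^sub>M lebesgue_on \<Omega>"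
  proof (rule measurable_restrict_space3)
    show "(\<lambda>z. z + lat k) \<in> lebesgue \<rightarrow>\<^sub>M lebesgue"
      using measurable_lebesgue_translation[of "lat k"] by (simp add: add.commute)
  qed auto
  show "distr (lebesgue_on \<Omega>) (lebesgue_on \<Omega>) (\<lambda>z. z + lat k) = lebesgue_on \<Omega>"
  proof (rule measure_eqI)
    fix A assume "A \<in> sets (distr (lebesgue_on \<Omega>) (lebesgue_on \<Omega>) (\<lambda>z. z + lat k))"
    then have A: "A \<in> sets (lebesgue_on \<Omega>)" by simp
    have ind: "(indicator A :: complex \<Rightarrow> ennreal) \<in> borel_measurable (lebesgue_on \<Omega>)" using A by simp
    have "emeasure (distr (lebesgue_on \<Omega>) (lebesgue_on \<Omega>) (\<lambda>z. z + lat k)) A =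
        (\<integral>\<^sup>+z. indicator A z \<partial>distr (lebesgue_on \<Omega>) (lebesgue_on \<Omega>) (\<lambda>z. z + lat k))"
      using A by simp
    also have "\<dots> = (\<integral>\<^sup>+z. indicator A (z + lat k) \<partial>lebesgue_on \<Omega>)"
      by (rule nn_integral_distr[OF T]) (use ind in simp)
    also have "\<dots> = (\<integral>\<^sup>+z. indicator A z \<partial>lebesgue_on \<Omega>)" by (rule nn_integral_\<Omega>_shift[OF ind])
    finally show "emeasure (distr (lebesgue_on \<Omega>) (lebesgue_on \<Omega>) (\<lambda>z. z + lat k)) A = emeasure (lebesgue_on \<Omega>) A"
      using A by simp
  qed simp
qed

lemma L2_inner_shift:
  assumes "f \<in> L2 \<Omega>" "g \<in> L2 \<Omega>"
  shows "L2_inner \<Omega> (shift k f) (shift k g) = L2_inner \<Omega> f g"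
proof -
  have m: "(\<lambda>z. f z * cnj (g z)) \<in> borel_measurable (lebesgue_on \<Omega>)"
    using borel_measurable_integrable[OF L2_inner_integrable[OF assms]] .
  show ?thesis
    unfolding L2_inner_def using integral_distr[OF measurable_\<Omega>_shift m, of k]
    by (simp add: distr_\<Omega>_shift shift_def)
qed

end

text \<open>The symbol is bounded and periodic at every point; a symbol with these properties almost
  everywhere is replaced by such a representative at the end. The spectral parameter is part of the
  locale, so that the conjugate data form a second instance.\<close>

locale toeplitz_setting = cutoff_setting +
  fixes a :: "complex \<Rightarrow> complex" and \<beta> :: real and \<mu> :: complex
  assumes a_meas: "a \<in> borel_measurable (lebesgue_on \<Omega>)" and a_bound: "\<And>z. cmod (a z) \<le> \<beta>"
    and a_periodic: "\<And>z k. a (z + lat k) = a z"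
begin

sublocale TA: toeplitz_fun \<Omega> "bergman \<Omega>" a \<beta>
  by (intro toeplitz_fun.intro A.hilbert_fun_axioms toeplitz_fun_axioms.intro a_meas a_bound)

sublocale TE: toeplitz_fun W "bergman_eta W \<eta>" a \<beta> for \<eta>
  by (intro toeplitz_fun.intro hilbert_bergman_eta toeplitz_fun_axioms.intro a_bound measurable_W a_meas)

definition V :: "(complex \<Rightarrow> complex) \<Rightarrow> complex \<Rightarrow> complex" where
  "V = shifted (toeplitz \<Omega> (bergman \<Omega>) a) \<mu>"

definition V_eta :: "real \<times> real \<Rightarrow> (complex \<Rightarrow> complex) \<Rightarrow> complex \<Rightarrow> complex" where
  "V_eta \<eta> = shifted (toeplitz W (bergman_eta W \<eta>) a) \<mu>"

definition \<gamma> :: real where "\<gamma> = \<beta> + cmod \<mu>"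

lemma a_sub_bound: "cmod (a z - \<mu>) \<le> \<gamma>"
  using norm_triangle_ineq4[of "a z" \<mu>] a_bound[of z] by (simp add: \<gamma>_def)

lemma \<gamma>_nonneg: "0 \<le> \<gamma>"
  using a_sub_bound[of 0] norm_ge_zero order_trans by blast

lemma a_sub_meas: "(\<lambda>z. a z - \<mu>) \<in> borel_measurable (lebesgue_on \<Omega>)"
  "(\<lambda>z. a z - \<mu>) \<in> borel_measurable (lebesgue_on W)"
  using a_meas measurable_W[OF a_meas] by measurable

lemma V_in: "f \<in> bergman \<Omega> \<Longrightarrow> V f \<in> bergman \<Omega>"
  unfolding V_def by (rule TA.shifted_in)

lemma V_eta_in: "f \<in> bergman_eta W \<eta> \<Longrightarrow> V_eta \<eta> f \<in> bergman_eta W \<eta>"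
  unfolding V_eta_def by (rule TE.shifted_in)

lemma V_inner: "f \<in> bergman \<Omega> \<Longrightarrow> k \<in> bergman \<Omega> \<Longrightarrow> L2_inner \<Omega> (V f) k = L2_inner \<Omega> (\<lambda>z. (a z - \<mu>) * f z) k"
  unfolding V_def by (rule TA.shifted_inner)

lemma V_eta_inner: "f \<in> bergman_eta W \<eta> \<Longrightarrow> k \<in> bergman_eta W \<eta> \<Longrightarrow>
    L2_inner W (V_eta \<eta> f) k = L2_inner W (\<lambda>z. (a z - \<mu>) * f z) k"
  unfolding V_eta_def by (rule TE.shifted_inner)

lemma L2_a_sub: "f \<in> L2 \<Omega> \<Longrightarrow> (\<lambda>z. (a z - \<mu>) * f z) \<in> L2 \<Omega>" "f \<in> L2 W \<Longrightarrow> (\<lambda>z. (a z - \<mu>) * f z) \<in> L2 W"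
  by (auto intro: L2_mult_bounded[OF _ _ a_sub_bound] a_sub_meas)

lemma V_shift:
  assumes f: "f \<in> bergman \<Omega>"
  shows "V (shift k f) = shift k (V f)"
proof (rule A.inner_eqI)
  fix g assume g: "g \<in> bergman \<Omega>"
  have fL: "f \<in> L2 \<Omega>" "V f \<in> L2 \<Omega>" using A.in_L2[OF f] A.in_L2[OF V_in[OF f]] by auto
  have g': "shift (- k) g \<in> bergman \<Omega>" "shift (- k) g \<in> L2 \<Omega>"
    using bergman_shift[OF g, of "- k"] A.in_L2 by blast+
  have gg: "shift k (shift (- k) g) = g" by (simp add: shift_shift)
  have "L2_inner \<Omega> (V (shift k f)) g = L2_inner \<Omega> (\<lambda>z. (a z - \<mu>) * shift k f z) g"
    by (rule V_inner[OF bergman_shift[OF f] g])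
  also have "\<dots> = L2_inner \<Omega> (shift k (\<lambda>z. (a z - \<mu>) * f z)) (shift k (shift (- k) g))"
    unfolding gg by (simp add: shift_def[abs_def] a_periodic)
  also have "\<dots> = L2_inner \<Omega> (\<lambda>z. (a z - \<mu>) * f z) (shift (- k) g)"
    by (rule L2_inner_shift[OF L2_a_sub(1)[OF fL(1)] g'(2)])
  also have "\<dots> = L2_inner \<Omega> (V f) (shift (- k) g)" by (rule V_inner[OF f g'(1), symmetric])
  also have "\<dots> = L2_inner \<Omega> (shift k (V f)) (shift k (shift (- k) g))"
    by (rule L2_inner_shift[OF fL(2) g'(2), symmetric])
  finally show "L2_inner \<Omega> (V (shift k f)) g = L2_inner \<Omega> (shift k (V f)) g" by (simp only: gg)
qed (use f in \<open>auto intro: V_in bergman_shift\<close>)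

lemma L2_of_cell_part: "cell_part F \<in> L2 W \<Longrightarrow> F \<in> L2 W"
proof -
  assume f: "cell_part F \<in> L2 W"
  have "F \<in> borel_measurable (lebesgue_on W)"
    using L2_measurable[OF f] by (rule measurable_cong[THEN iffD1, rotated]) (simp add: cell_part_def)
  then show ?thesis using f by (simp add: L2_iff_sqint sqint_cell_part)
qed

text \<open>The localization \<open>\<theta> F\<close> of the quasi-periodic \<open>F\<close> lies in the Bergman space of \<open>\<Omega>\<close>, hence is
  orthogonal to \<open>(a - \<mu>) g - V g\<close>; folding this relation over the lattice gives the bound.\<close>

lemma eta_test:
  assumes g: "g \<in> bergman \<Omega>" and F: "F \<in> quasi_periodic \<eta>" "F \<in> L2 W"
  defines "G \<equiv> periodize \<eta> g"
  shows "ennreal (cmod (L2_inner W (\<lambda>z. (a z - \<mu>) * G z) F)) \<le>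
    (\<integral>\<^sup>+z. ennreal (cmod (F z)) * latsum (\<lambda>k. ennreal (h k) *
        ennreal (\<gamma> * cmod (phase \<eta> k * G z - shift k g z) + cmod (shift k (V g) z))) \<partial>lebesgue_on W)"
proof -
  define v where "v z = \<theta> z * F z" for z
  define e where "e z = (a z - \<mu>) * g z - V g z" for z
  have v: "v \<in> bergman \<Omega>" unfolding v_def using localize_in[OF F, of 0] by simp
  have gL: "g \<in> L2 \<Omega>" "V g \<in> L2 \<Omega>" "v \<in> L2 \<Omega>" using A.in_L2 g V_in[OF g] v by auto
  have eL: "e \<in> L2 \<Omega>" unfolding e_def by (intro L2_diff L2_a_sub gL)
  have "L2_inner \<Omega> e v = 0"
    unfolding e_def L2_inner_diff_left[OF L2_a_sub(1)[OF gL(1)] gL(2,3)] using V_inner[OF g v] by simp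
  moreover have int: "integrable (lebesgue_on \<Omega>) (\<lambda>z. e z * cnj (v z))"
    by (rule L2_inner_integrable[OF eL gL(3)])
  define J where "J z = (LINT k|count_space UNIV. e (z + lat k) * cnj (v (z + lat k)))" for z
  ultimately have J0: "(LINT z|lebesgue_on W. J z) = 0"
    unfolding J_def using integral_fold[OF int] by (simp add: L2_inner_def)
  have Jint: "integrable (lebesgue_on W) J"
    using integrable_fold[OF int] by (simp add: J_def[abs_def])
  have GL: "G \<in> L2 W" unfolding G_def by (rule periodize_L2[OF g])
  have I: "integrable (lebesgue_on W) (\<lambda>z. (a z - \<mu>) * G z * cnj (F z))"
    by (rule L2_inner_integrable[OF L2_a_sub(2)[OF GL] F(2)])
  have pt: "ennreal (cmod ((a z - \<mu>) * G z * cnj (F z) - J z)) \<le>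
      ennreal (cmod (F z)) * latsum (\<lambda>k. ennreal (h k) * ennreal (\<gamma> * cmod (phase \<eta> k * G z - shift k g z) + cmod (shift k (V g) z)))"
    if z: "z \<in> W" and zi: "integrable (count_space UNIV) (\<lambda>k. e (z + lat k) * cnj (v (z + lat k)))" for z
  proof -
    have "(LINT k|count_space UNIV. cnj (\<theta> (z + lat k)) * ((a z - \<mu>) * G z * cnj (F z))) = (a z - \<mu>) * G z * cnj (F z)"
      using \<theta>_integral[OF z] by (simp add: Bochner_Integration.integral_cnj)
    moreover have "integrable (count_space UNIV) (\<lambda>k. cnj (\<theta> (z + lat k)) * ((a z - \<mu>) * G z * cnj (F z)))"
      using \<theta>_integrable[OF z] by simp
    \<comment> \<open>As the translates of \<open>\<theta>\<close> sum to \<open>1\<close>, the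
      integrand on the cell is itself a lattice sum and can be compared with \<open>J\<close> term
      by term.\<close>
    ultimately have eq: "(a z - \<mu>) * G z * cnj (F z) - J z = (LINT k|count_space UNIV.
        cnj (\<theta> (z + lat k)) * ((a z - \<mu>) * G z * cnj (F z)) - e (z + lat k) * cnj (v (z + lat k)))"
      unfolding J_def using zi by simp
    have "ennreal (cmod ((a z - \<mu>) * G z * cnj (F z) - J z)) \<le> latsum (\<lambda>k. ennreal (cmod (F z)) * (ennreal (h k) *
        ennreal (\<gamma> * cmod (phase \<eta> k * G z - shift k g z) + cmod (shift k (V g) z))))"
      unfolding eq
    proof (rule norm_count_integral_le)
      fix k
      have "cnj (\<theta> (z + lat k)) * ((a z - \<mu>) * G z * cnj (F z)) - e (z + lat k) * cnj (v (z + lat k)) =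
          cnj (\<theta> (z + lat k)) * cnj (F z) * (cnj (phase \<eta> k) * ((a z - \<mu>) * (phase \<eta> k * G z - shift k g z) + shift k (V g) z))"
      proof -
        have 1: "v (z + lat k) = \<theta> (z + lat k) * (phase \<eta> k * F z)"
          unfolding v_def quasi_periodic_lat[OF F(1)] ..
        have 2: "e (z + lat k) = (a z - \<mu>) * shift k g z - shift k (V g) z"
          by (simp add: e_def a_periodic shift_def)
        have 3: "cnj (phase \<eta> k) * ((a z - \<mu>) * (phase \<eta> k * G z - shift k g z) + shift k (V g) z) =
            (cnj (phase \<eta> k) * phase \<eta> k) * ((a z - \<mu>) * G z) - cnj (phase \<eta> k) * ((a z - \<mu>) * shift k g z - shift k (V g) z)"
          by (simp only: algebra_simps)
        show ?thesis unfolding 1 2 3 by (simp add: algebra_simps)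
      qed
      then have "cmod (cnj (\<theta> (z + lat k)) * ((a z - \<mu>) * G z * cnj (F z)) - e (z + lat k) * cnj (v (z + lat k))) =
          cmod (\<theta> (z + lat k)) * cmod (F z) * cmod ((a z - \<mu>) * (phase \<eta> k * G z - shift k g z) + shift k (V g) z)"
        by (simp add: norm_mult)
      also have "\<dots> \<le> h k * cmod (F z) * (\<gamma> * cmod (phase \<eta> k * G z - shift k g z) + cmod (shift k (V g) z))"
      proof (intro mult_mono \<theta>_h[OF z])
        have "cmod ((a z - \<mu>) * (phase \<eta> k * G z - shift k g z)) \<le> \<gamma> * cmod (phase \<eta> k * G z - shift k g z)"
          unfolding norm_mult by (intro mult_right_mono a_sub_bound) simp
        then show "cmod ((a z - \<mu>) * (phase \<eta> k * G z - shift k g z) + shift k (V g) z) \<le>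
            \<gamma> * cmod (phase \<eta> k * G z - shift k g z) + cmod (shift k (V g) z)"
          using norm_triangle_ineq order_trans add_right_mono by blast
      qed (auto simp: h_nonneg)
      finally have "cmod (cnj (\<theta> (z + lat k)) * ((a z - \<mu>) * G z * cnj (F z)) - e (z + lat k) * cnj (v (z + lat k)))
          \<le> cmod (F z) * (h k * (\<gamma> * cmod (phase \<eta> k * G z - shift k g z) + cmod (shift k (V g) z)))"
        by (simp add: mult_ac)
      then have "ennreal (cmod (cnj (\<theta> (z + lat k)) * ((a z - \<mu>) * G z * cnj (F z)) - e (z + lat k) * cnj (v (z + lat k)))) \<le>
          ennreal (cmod (F z) * (h k * (\<gamma> * cmod (phase \<eta> k * G z - shift k g z) + cmod (shift k (V g) z))))"
        by (rule ennreal_leI)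
      then show "ennreal (cmod (cnj (\<theta> (z + lat k)) * ((a z - \<mu>) * G z * cnj (F z)) - e (z + lat k) * cnj (v (z + lat k)))) \<le>
         ennreal (cmod (F z)) * (ennreal (h k) * ennreal (\<gamma> * cmod (phase \<eta> k * G z - shift k g z) + cmod (shift k (V g) z)))"
        by (simp add: ennreal_mult' h_nonneg)
    qed
    then show ?thesis by (simp only: latsum_cmult)
  qed
  have eq: "L2_inner W (\<lambda>z. (a z - \<mu>) * G z) F = (LINT z|lebesgue_on W. (a z - \<mu>) * G z * cnj (F z) - J z)"
    unfolding L2_inner_def using I Jint J0 by simp
  have "ennreal (cmod (L2_inner W (\<lambda>z. (a z - \<mu>) * G z) F)) \<le> (\<integral>\<^sup>+z. ennreal (cmod ((a z - \<mu>) * G z * cnj (F z) - J z)) \<partial>lebesgue_on W)"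
    unfolding eq by (rule integral_norm_bound_ennreal) (use I Jint in simp)
  also have "\<dots> \<le> (\<integral>\<^sup>+z. ennreal (cmod (F z)) * latsum (\<lambda>k. ennreal (h k) *
        ennreal (\<gamma> * cmod (phase \<eta> k * G z - shift k g z) + cmod (shift k (V g) z))) \<partial>lebesgue_on W)"
  proof (rule nn_integral_mono_AE)
    show "AE z in lebesgue_on W. ennreal (cmod ((a z - \<mu>) * G z * cnj (F z) - J z)) \<le>
      ennreal (cmod (F z)) * latsum (\<lambda>k. ennreal (h k) * ennreal (\<gamma> * cmod (phase \<eta> k * G z - shift k g z) + cmod (shift k (V g) z)))"
      using fold_AE_integrable[OF int] AE_space
    proof eventually_elim
      case (elim z) then show ?case using pt[of z] by simp
    qed
  qed
  finally show ?thesis .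
qed

text \<open>The norm of \<open>V_eta \<eta> (cell_part G)\<close> is found by testing against cell
  parts of quasi-periodic \<open>F\<close>, which are dense. Twice the product of the modulus of
  \<open>F\<close> with the lattice sum \<open>S\<close> is bounded pointwise by the sum of their
  squares, so \<open>norm_sq_le_by_density\<close> applies with \<open>A\<close> the integral of the
  square of \<open>S\<close>.\<close>

lemma eta_estimate:
  fixes \<eta> :: "real \<times> real"
  assumes g: "g \<in> bergman \<Omega>"
  defines "G \<equiv> periodize \<eta> g"
  shows "sqint W (V_eta \<eta> (cell_part G)) \<le> ennreal h_total * latsum (\<lambda>k. ennreal (h k) *
    (2 * (ennreal (\<gamma>\<^sup>2) * sqint W (\<lambda>z. phase \<eta> k * G z - shift k g z)) + 2 * sqint W (shift k (V g))))" (is "_ \<le> ?A'")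
proof -
  define y where "y k z = ennreal (\<gamma> * cmod (phase \<eta> k * G z - shift k g z) + cmod (shift k (V g) z))" for k z
  define S where "S z = latsum (\<lambda>k. ennreal (h k) * y k z)" for z
  define A where "A = (\<integral>\<^sup>+z. (S z)\<^sup>2 \<partial>lebesgue_on W)"
  have Gm: "G \<in> borel_measurable (lebesgue_on W)" unfolding G_def using L2_measurable[OF periodize_L2[OF g]] .
  have gm: "shift k g \<in> borel_measurable (lebesgue_on W)" "shift k (V g) \<in> borel_measurable (lebesgue_on W)" for k
    using measurable_W measurable_shift bergman_meas g V_in[OF g] by blast+
  have dm: "(\<lambda>z. phase \<eta> k * G z - shift k g z) \<in> borel_measurable (lebesgue_on W)" for k
    using Gm gm by measurable
  have ym: "y k \<in> borel_measurable (lebesgue_on W)" for k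
    unfolding y_def using dm[of k] gm[of k] by measurable
  have Sm: "S \<in> borel_measurable (lebesgue_on W)"
    unfolding S_def by (rule borel_measurable_latsum) (use ym in measurable)
  have AA: "A \<le> ?A'"
  proof -
    have "(S z)\<^sup>2 \<le> ennreal h_total * latsum (\<lambda>k. ennreal (h k) *
        (2 * (ennreal (\<gamma>\<^sup>2) * ennreal ((cmod (phase \<eta> k * G z - shift k g z))\<^sup>2)) + 2 * ennreal ((cmod (shift k (V g) z))\<^sup>2)))" for z
    proof -
      have "(S z)\<^sup>2 \<le> ennreal h_total * latsum (\<lambda>k. ennreal (h k) * (y k z)\<^sup>2)"
        unfolding S_def using latsum_Cauchy_Schwarz[of h, OF h_nonneg] by (simp add: latsum_h)
      also have "\<dots> \<le> ennreal h_total * latsum (\<lambda>k. ennreal (h k) *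
        (2 * (ennreal (\<gamma>\<^sup>2) * ennreal ((cmod (phase \<eta> k * G z - shift k g z))\<^sup>2)) + 2 * ennreal ((cmod (shift k (V g) z))\<^sup>2)))"
      proof (intro mult_left_mono latsum_mono)
        fix k
        show "(y k z)\<^sup>2 \<le> 2 * (ennreal (\<gamma>\<^sup>2) * ennreal ((cmod (phase \<eta> k * G z - shift k g z))\<^sup>2)) + 2 * ennreal ((cmod (shift k (V g) z))\<^sup>2)"
          using ennreal_sq_add_le[of "\<gamma> * cmod (phase \<eta> k * G z - shift k g z)" "cmod (shift k (V g) z)"] \<gamma>_nonneg
          by (simp add: y_def power_mult_distrib ennreal_mult')
      qed simp_all
      finally show ?thesis .
    qed
    then have "A \<le> (\<integral>\<^sup>+z. ennreal h_total * latsum (\<lambda>k. ennreal (h k) *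
        (2 * (ennreal (\<gamma>\<^sup>2) * ennreal ((cmod (phase \<eta> k * G z - shift k g z))\<^sup>2)) + 2 * ennreal ((cmod (shift k (V g) z))\<^sup>2))) \<partial>lebesgue_on W)"
      unfolding A_def by (rule nn_integral_mono)
    also have "\<dots> = ennreal h_total * latsum (\<lambda>k. \<integral>\<^sup>+z. ennreal (h k) *
        (2 * (ennreal (\<gamma>\<^sup>2) * ennreal ((cmod (phase \<eta> k * G z - shift k g z))\<^sup>2)) + 2 * ennreal ((cmod (shift k (V g) z))\<^sup>2)) \<partial>lebesgue_on W)"
    proof (subst nn_integral_cmult)
      have m: "(\<lambda>z. ennreal (h k) * (2 * (ennreal (\<gamma>\<^sup>2) * ennreal ((cmod (phase \<eta> k * G z - shift k g z))\<^sup>2)) + 2 * ennreal ((cmod (shift k (V g) z))\<^sup>2)))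
          \<in> borel_measurable (lebesgue_on W)" for k
        using dm[of k] gm[of k] by measurable
      show "(\<lambda>z. latsum (\<lambda>k. ennreal (h k) * (2 * (ennreal (\<gamma>\<^sup>2) * ennreal ((cmod (phase \<eta> k * G z - shift k g z))\<^sup>2)) + 2 * ennreal ((cmod (shift k (V g) z))\<^sup>2))))
          \<in> borel_measurable (lebesgue_on W)" by (rule borel_measurable_latsum[OF m])
    qed (subst latsum_nn_integral, use dm gm in measurable)
    also have "\<dots> = ?A'"
    proof -
      have "(\<integral>\<^sup>+z. ennreal (h k) * (2 * (ennreal (\<gamma>\<^sup>2) * ennreal ((cmod (phase \<eta> k * G z - shift k g z))\<^sup>2)) + 2 * ennreal ((cmod (shift k (V g) z))\<^sup>2)) \<partial>lebesgue_on W) =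
        ennreal (h k) * (2 * (ennreal (\<gamma>\<^sup>2) * sqint W (\<lambda>z. phase \<eta> k * G z - shift k g z)) + 2 * sqint W (shift k (V g)))" for k
      proof -
        have m1: "(\<lambda>z. ennreal ((cmod (phase \<eta> k * G z - shift k g z))\<^sup>2)) \<in> borel_measurable (lebesgue_on W)"
          using dm[of k] by measurable
        have m2: "(\<lambda>z. ennreal ((cmod (shift k (V g) z))\<^sup>2)) \<in> borel_measurable (lebesgue_on W)"
          using gm(2)[of k] by measurable
        show ?thesis unfolding sqint_def using m1 m2
          by (simp add: nn_integral_cmult nn_integral_add)
      qed
      then show ?thesis by simp
    qed
    finally show ?thesis .
  qed
  have cG: "cell_part G \<in> bergman_eta W \<eta>"
    unfolding G_def using periodize_ext[OF g] bergman_ext_subset by blast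
  define q where "q = V_eta \<eta> (cell_part G)"
  have q: "q \<in> bergman_eta W \<eta>" unfolding q_def by (rule V_eta_in[OF cG])
  have qA: "sqint W q \<le> A"
  proof (cases "A = top")
    case False
    then obtain A' where A': "A = ennreal A'" "A' \<ge> 0" by (cases A) auto
    have "(L2_norm W q)\<^sup>2 \<le> A'"
    proof (rule A_eta.norm_sq_le_by_density[OF q])
      show "\<exists>u\<in>bergman_ext W \<eta>. L2_norm W (\<lambda>z. q z - u z) < e" if "e > 0" for e
        using q \<open>e > 0\<close> by (auto simp: bergman_eta_def)
      show "bergman_ext W \<eta> \<subseteq> bergman_eta W \<eta>" by (rule bergman_ext_subset)
      fix u assume u: "u \<in> bergman_ext W \<eta>"
      then obtain F where F: "F \<in> quasi_periodic \<eta>" "u = cell_part F" "cell_part F \<in> L2 W"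
        unfolding bergman_ext_eq by blast
      have FL: "F \<in> L2 W" by (rule L2_of_cell_part[OF F(3)])
      have "L2_inner W q u = L2_inner W (\<lambda>z. (a z - \<mu>) * cell_part G z) u"
        unfolding q_def by (rule V_eta_inner[OF cG]) (use u bergman_ext_subset in blast)
      also have "\<dots> = L2_inner W (\<lambda>z. (a z - \<mu>) * G z) F"
        by (rule L2_inner_cong_W) (auto simp: F(2) cell_part_def)
      finally have "ennreal (cmod (L2_inner W q u)) \<le> (\<integral>\<^sup>+z. ennreal (cmod (F z)) * S z \<partial>lebesgue_on W)"
        using eta_test[OF g F(1) FL] by (simp add: S_def y_def G_def)
      then have "2 * ennreal (cmod (L2_inner W q u)) \<le> 2 * (\<integral>\<^sup>+z. ennreal (cmod (F z)) * S z \<partial>lebesgue_on W)"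
        by (intro mult_left_mono) auto
      also have "\<dots> = (\<integral>\<^sup>+z. 2 * (ennreal (cmod (F z)) * S z) \<partial>lebesgue_on W)"
        using Sm L2_measurable[OF FL] by (intro nn_integral_cmult[symmetric]) measurable
      also have "\<dots> \<le> (\<integral>\<^sup>+z. (ennreal (cmod (F z)))\<^sup>2 + (S z)\<^sup>2 \<partial>lebesgue_on W)"
        by (intro nn_integral_mono ennreal_two_mult_le)
      also have "\<dots> = sqint W F + A"
        unfolding A_def sqint_def using Sm L2_measurable[OF FL]
        by (subst nn_integral_add) (auto simp: ennreal_power)
      also have "\<dots> = ennreal ((L2_norm W u)\<^sup>2 + A')"
        using sqint_eq_L2_norm[OF F(3)] sqint_cell_part[of F] A' by (simp add: F(2) ennreal_plus)
      finally have "ennreal (2 * cmod (L2_inner W q u)) \<le> ennreal ((L2_norm W u)\<^sup>2 + A')"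
        by (simp add: ennreal_mult')
      then show "2 * cmod (L2_inner W q u) \<le> (L2_norm W u)\<^sup>2 + A'" using ennreal_le_iff[of "(L2_norm W u)\<^sup>2 + A'" "2 * cmod (L2_inner W q u)"] A'(2) by (simp del: ennreal_plus)
    qed
    then show ?thesis unfolding sqint_eq_L2_norm[OF A_eta.in_L2[OF q]] A'(1) by (rule ennreal_leI)
  qed simp
  show ?thesis using order_trans[OF qA AA] by (simp add: q_def)
qed

end

lemma
  fixes f :: "int \<times> int \<Rightarrow> complex"
  shows count_integrable_shift: "integrable (count_space UNIV) (\<lambda>n. f (n - p)) \<longleftrightarrow> integrable (count_space UNIV) f"
    and count_integral_shift: "(LINT n|count_space UNIV. f (n - p)) = (LINT n|count_space UNIV. f n)"
proof -
  have bij: "bij_betw (\<lambda>n. n - p) UNIV UNIV" by (auto intro!: bij_betwI[where g = "\<lambda>k. k + p"])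
  show "integrable (count_space UNIV) (\<lambda>n. f (n - p)) \<longleftrightarrow> integrable (count_space UNIV) f"
    by (rule integrable_bij_count_space[OF bij])
  show "(LINT n|count_space UNIV. f (n - p)) = (LINT n|count_space UNIV. f n)"
    by (rule integral_bij_count_space[OF bij])
qed

section \<open>From the domain to the cell: quasi-periodic functions in a window\<close>

context toeplitz_setting
begin

text \<open>An analytic approximation to the indicator of the union of the cells with index in
  \<open>B\<close>.\<close>

definition window :: "(int \<times> int) set \<Rightarrow> complex \<Rightarrow> complex" where
  "window B z = (\<Sum>p\<in>B. \<theta> (z - lat p))"

lemma window_mult_in:
  assumes F: "F \<in> quasi_periodic \<eta>" "F \<in> L2 W"
  shows "(\<lambda>z. window B z * F z) \<in> bergman \<Omega>"
proof -
  have "(\<lambda>z. \<Sum>p\<in>B. 1 * (\<theta> (z - lat p) * F z)) \<in> bergman \<Omega>"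
    by (rule A.sum_in[OF localize_in[OF F]])
  then show ?thesis by (simp add: window_def sum_distrib_right)
qed

text \<open>Regrouping by the absolute position \<open>n = k + p\<close> collects the cutoffs of the
  translates \<open>p\<close> in \<open>B\<close> into the window. A finite combination of
  periodizations, which belongs to the quasi-periodic space, thus becomes a window-weighted sum of
  \<open>w\<close>.\<close>

lemma window_periodize:
  assumes w: "w \<in> bergman \<Omega>" and z: "z \<in> W"
  shows "integrable (count_space UNIV) (\<lambda>n. phase \<eta> (- n) * window B (z + lat n) * w (z + lat n))" (is ?int)
    and "(\<Sum>p\<in>B. phase \<eta> (- p) * periodize \<eta> (shift p w) z) =
      (LINT n|count_space UNIV. phase \<eta> (- n) * window B (z + lat n) * w (z + lat n))" (is ?eq)
proof -
  let ?f = "\<lambda>p k. phase \<eta> (- p) * (\<theta> (z + lat k) * phase \<eta> (- k) * shift p w (z + lat k))"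
  have f: "?f p (n - p) = phase \<eta> (- n) * \<theta> (z + lat n - lat p) * w (z + lat n)" for p n
  proof -
    have 1: "phase \<eta> (- p) * phase \<eta> (- (n - p)) = phase \<eta> (- n)" using phase_add[of \<eta> "- p" "- (n - p)"] by simp
    have 2: "shift p w (z + lat (n - p)) = w (z + lat n)" by (simp add: shift_def lat_diff)
    have 3: "z + lat (n - p) = z + lat n - lat p" by (simp add: lat_diff)
    have "?f p (n - p) = (phase \<eta> (- p) * phase \<eta> (- (n - p))) * \<theta> (z + lat (n - p)) * shift p w (z + lat (n - p))"
      by (simp only: mult_ac)
    then show ?thesis unfolding 1 2 unfolding 3 .
  qed
  have int: "integrable (count_space UNIV) (?f p)" for p
    using periodize_integrable[OF bergman_shift[OF w] z, of \<eta> p] by (intro integrable_mult_right) auto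
  have int': "integrable (count_space UNIV) (\<lambda>n. phase \<eta> (- n) * \<theta> (z + lat n - lat p) * w (z + lat n))" for p
    using count_integrable_shift[of "?f p" p] int[of p] unfolding f by blast
  have val: "phase \<eta> (- p) * periodize \<eta> (shift p w) z =
      (LINT n|count_space UNIV. phase \<eta> (- n) * \<theta> (z + lat n - lat p) * w (z + lat n))" for p
  proof -
    have "phase \<eta> (- p) * periodize \<eta> (shift p w) z = (LINT k|count_space UNIV. ?f p k)"
      unfolding periodize_eq[OF bergman_shift[OF w] z] by simp
    also have "\<dots> = (LINT n|count_space UNIV. ?f p (n - p))" by (rule count_integral_shift[symmetric])
    finally show ?thesis unfolding f .
  qed
  have w: "phase \<eta> (- n) * window B (z + lat n) * w (z + lat n) =
      (\<Sum>p\<in>B. phase \<eta> (- n) * \<theta> (z + lat n - lat p) * w (z + lat n))" for n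
    by (simp add: window_def sum_distrib_left sum_distrib_right)
  show ?int unfolding w by (rule Bochner_Integration.integrable_sum) (rule int')
  show ?eq unfolding w val by (rule Bochner_Integration.integral_sum[symmetric]) (rule int')
qed

text \<open>With \<open>w = V g\<close>, the squared norm of \<open>w\<close> is the inner product
  of \<open>(a - \<mu>) g\<close> with \<open>w\<close>, folded over the lattice. It is compared
  with the inner product of \<open>(a - \<mu>) F - u\<close> with \<open>Y\<close> on the cell,
  which vanishes because \<open>Y\<close> belongs to \<open>bergman_eta W \<eta>\<close>. The window
  enters the first expression as it is and the second through its conjugate; since the indicator of
  \<open>B\<close> is real, the difference of the two is at most twice the distance of the window
  from that indicator, which explains the factor \<open>2 * \<gamma>\<close>.\<close>

lemma weyl_test:
  fixes B :: "(int \<times> int) set"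
  assumes F: "F \<in> quasi_periodic \<eta>" "cell_part F \<in> L2 W"
  defines "g \<equiv> \<lambda>z. window B z * F z"
  defines "u \<equiv> V_eta \<eta> (cell_part F)"
  shows "sqint \<Omega> (V g) \<le> (\<integral>\<^sup>+z. latsum (\<lambda>n. ennreal (cmod (V g (z + lat n))) *
    ennreal (2 * \<gamma> * cmod (F z) * cmod (window B (z + lat n) - indicator B n) + cmod (u z) * cmod (window B (z + lat n)))) \<partial>lebesgue_on W)"
proof -
  have FL: "F \<in> L2 W" by (rule L2_of_cell_part[OF F(2)])
  have g: "g \<in> bergman \<Omega>" unfolding g_def by (rule window_mult_in[OF F(1) FL])
  define w where "w = V g"
  have w: "w \<in> bergman \<Omega>" unfolding w_def by (rule V_in[OF g])
  have L: "g \<in> L2 \<Omega>" "w \<in> L2 \<Omega>" using A.in_L2 g w by auto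
  have cF: "cell_part F \<in> bergman_eta W \<eta>" using cell_part_in_bergman_ext[OF F] bergman_ext_subset by blast
  have u: "u \<in> bergman_eta W \<eta>" unfolding u_def by (rule V_eta_in[OF cF])
  have uL: "u \<in> L2 W" using A_eta.in_L2[OF u] .
  define Y where "Y z = (\<Sum>p\<in>B. phase \<eta> (- p) * cell_part (periodize \<eta> (shift p w)) z)" for z
  have Y: "Y \<in> bergman_eta W \<eta>"
    unfolding Y_def by (rule A_eta.sum_in) (use periodize_ext[OF bergman_shift[OF w]] bergman_ext_subset in blast)
  have YL: "Y \<in> L2 W" using A_eta.in_L2[OF Y] .
  have Y_eq: "Y z = (LINT n|count_space UNIV. phase \<eta> (- n) * window B (z + lat n) * w (z + lat n))" if "z \<in> W" for z
    using window_periodize(2)[OF w that, of \<eta> B] that by (simp add: Y_def cell_part_def)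
  have int: "integrable (lebesgue_on \<Omega>) (\<lambda>z. (a z - \<mu>) * g z * cnj (w z))"
    by (rule L2_inner_integrable[OF L2_a_sub(1)[OF L(1)] L(2)])
  define J where "J z = (LINT n|count_space UNIV. (a (z + lat n) - \<mu>) * g (z + lat n) * cnj (w (z + lat n)))" for z
  have Jint: "integrable (lebesgue_on W) J" unfolding J_def[abs_def] by (rule integrable_fold[OF int])
  have J1: "(LINT z|lebesgue_on W. J z) = of_real ((L2_norm \<Omega> w)\<^sup>2)"
  proof -
    have "(LINT z|lebesgue_on W. J z) = L2_inner \<Omega> (\<lambda>z. (a z - \<mu>) * g z) w"
      unfolding J_def L2_inner_def by (rule integral_fold[OF int])
    also have "\<dots> = L2_inner \<Omega> w w" using V_inner[OF g w] by (simp add: w_def)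
    finally show ?thesis by (simp add: L2_inner_self)
  qed
  have bL: "(\<lambda>z. (a z - \<mu>) * F z - u z) \<in> L2 W" by (intro L2_diff L2_a_sub FL uL)
  have I: "integrable (lebesgue_on W) (\<lambda>z. ((a z - \<mu>) * F z - u z) * cnj (Y z))"
    by (rule L2_inner_integrable[OF bL YL])
  have I0: "(LINT z|lebesgue_on W. ((a z - \<mu>) * F z - u z) * cnj (Y z)) = 0"
  proof -
    have "L2_inner W (\<lambda>z. (a z - \<mu>) * F z - u z) Y = L2_inner W (\<lambda>z. (a z - \<mu>) * F z) Y - L2_inner W u Y"
      by (rule L2_inner_diff_left[OF L2_a_sub(2)[OF FL] uL YL])
    also have "L2_inner W (\<lambda>z. (a z - \<mu>) * F z) Y = L2_inner W (\<lambda>z. (a z - \<mu>) * cell_part F z) Y"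
      by (rule L2_inner_cong_W) (auto simp: cell_part_def)
    also have "\<dots> = L2_inner W u Y" unfolding u_def by (rule V_eta_inner[OF cF Y, symmetric])
    finally show ?thesis by (simp add: L2_inner_def)
  qed
  have pt: "ennreal (cmod (J z - ((a z - \<mu>) * F z - u z) * cnj (Y z))) \<le> latsum (\<lambda>n. ennreal (cmod (w (z + lat n))) *
    ennreal (2 * \<gamma> * cmod (F z) * cmod (window B (z + lat n) - indicator B n) + cmod (u z) * cmod (window B (z + lat n))))"
    if z: "z \<in> W" and zi: "integrable (count_space UNIV) (\<lambda>n. (a (z + lat n) - \<mu>) * g (z + lat n) * cnj (w (z + lat n)))" for z
  proof -
    let ?X = "\<lambda>n. window B (z + lat n)"
    let ?b = "(a z - \<mu>) * F z"
    have "integrable (count_space UNIV) (\<lambda>n. cnj (phase \<eta> (- n) * ?X n * w (z + lat n)))"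
      using window_periodize(1)[OF w z] by (simp only: complex_integrable_cnj)
    then have ci: "integrable (count_space UNIV) (\<lambda>n. (?b - u z) * cnj (phase \<eta> (- n) * ?X n * w (z + lat n)))"
      by (intro integrable_mult_right) auto
    have "cnj (Y z) = (LINT n|count_space UNIV. cnj (phase \<eta> (- n) * ?X n * w (z + lat n)))"
      unfolding Y_eq[OF z] by (rule Bochner_Integration.integral_cnj[symmetric])
    then have "(?b - u z) * cnj (Y z) = (LINT n|count_space UNIV. (?b - u z) * cnj (phase \<eta> (- n) * ?X n * w (z + lat n)))"
      by simp
    then have eq: "J z - (?b - u z) * cnj (Y z) = (LINT n|count_space UNIV.
        (a (z + lat n) - \<mu>) * g (z + lat n) * cnj (w (z + lat n)) - (?b - u z) * cnj (phase \<eta> (- n) * ?X n * w (z + lat n)))"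
      unfolding J_def using zi ci by (simp only: Bochner_Integration.integral_diff)
    show ?thesis
      unfolding eq
    proof (rule norm_count_integral_le)
      fix n
      have "(a (z + lat n) - \<mu>) * g (z + lat n) * cnj (w (z + lat n)) - (?b - u z) * cnj (phase \<eta> (- n) * ?X n * w (z + lat n))
          = phase \<eta> n * cnj (w (z + lat n)) * (?b * (?X n - cnj (?X n)) + u z * cnj (?X n))"
      proof -
        have 1: "g (z + lat n) = ?X n * (phase \<eta> n * F z)" unfolding g_def quasi_periodic_lat[OF F(1)] ..
        have 2: "cnj (phase \<eta> (- n)) = phase \<eta> n" by (simp add: phase_minus)
        show ?thesis unfolding 1 complex_cnj_mult 2 a_periodic by (simp add: algebra_simps)
      qed
      then have "cmod ((a (z + lat n) - \<mu>) * g (z + lat n) * cnj (w (z + lat n)) - (?b - u z) * cnj (phase \<eta> (- n) * ?X n * w (z + lat n)))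
          = cmod (w (z + lat n)) * cmod (?b * (?X n - cnj (?X n)) + u z * cnj (?X n))"
        by (simp add: norm_mult)
      also have "\<dots> \<le> cmod (w (z + lat n)) * (2 * \<gamma> * cmod (F z) * cmod (?X n - indicator B n) + cmod (u z) * cmod (?X n))"
      proof (rule mult_left_mono)
        have "?X n - cnj (?X n) = (?X n - indicator B n) - cnj (?X n - indicator B n)"
          by (simp add: indicator_def)
        then have "cmod (?X n - cnj (?X n)) \<le> cmod (?X n - indicator B n) + cmod (cnj (?X n - indicator B n))"
          by (metis norm_triangle_ineq4)
        then have 1: "cmod (?X n - cnj (?X n)) \<le> 2 * cmod (?X n - indicator B n)" unfolding complex_mod_cnj by simp
        have "cmod (?b * (?X n - cnj (?X n))) \<le> (\<gamma> * cmod (F z)) * (2 * cmod (?X n - indicator B n))"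
          unfolding norm_mult by (intro mult_mono 1 mult_right_mono a_sub_bound) (auto simp: \<gamma>_nonneg)
        moreover have "cmod (u z * cnj (?X n)) = cmod (u z) * cmod (?X n)" by (simp add: norm_mult)
        ultimately show "cmod (?b * (?X n - cnj (?X n)) + u z * cnj (?X n)) \<le>
            2 * \<gamma> * cmod (F z) * cmod (?X n - indicator B n) + cmod (u z) * cmod (?X n)"
          using norm_triangle_ineq[of "?b * (?X n - cnj (?X n))" "u z * cnj (?X n)"] by (simp add: mult_ac)
      qed simp
      finally have "ennreal (cmod ((a (z + lat n) - \<mu>) * g (z + lat n) * cnj (w (z + lat n)) - (?b - u z) * cnj (phase \<eta> (- n) * ?X n * w (z + lat n))))
        \<le> ennreal (cmod (w (z + lat n)) * (2 * \<gamma> * cmod (F z) * cmod (?X n - indicator B n) + cmod (u z) * cmod (?X n)))"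
        by (rule ennreal_leI)
      then show "ennreal (cmod ((a (z + lat n) - \<mu>) * g (z + lat n) * cnj (w (z + lat n)) - (?b - u z) * cnj (phase \<eta> (- n) * ?X n * w (z + lat n))))
        \<le> ennreal (cmod (w (z + lat n))) * ennreal (2 * \<gamma> * cmod (F z) * cmod (?X n - indicator B n) + cmod (u z) * cmod (?X n))"
        unfolding ennreal_mult'[OF norm_ge_zero] .
    qed
  qed
  have eq: "complex_of_real ((L2_norm \<Omega> w)\<^sup>2) = (LINT z|lebesgue_on W. J z - ((a z - \<mu>) * F z - u z) * cnj (Y z))"
    using I Jint I0 J1 by simp
  have "sqint \<Omega> w = ennreal (cmod (complex_of_real ((L2_norm \<Omega> w)\<^sup>2)))"
    unfolding sqint_eq_L2_norm[OF L(2)] norm_of_real by simp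
  also have "\<dots> \<le> (\<integral>\<^sup>+z. ennreal (cmod (J z - ((a z - \<mu>) * F z - u z) * cnj (Y z))) \<partial>lebesgue_on W)"
    unfolding eq by (rule integral_norm_bound_ennreal) (use I Jint in simp)
  also have "\<dots> \<le> (\<integral>\<^sup>+z. latsum (\<lambda>n. ennreal (cmod (w (z + lat n))) *
    ennreal (2 * \<gamma> * cmod (F z) * cmod (window B (z + lat n) - indicator B n) + cmod (u z) * cmod (window B (z + lat n)))) \<partial>lebesgue_on W)"
  proof (rule nn_integral_mono_AE)
    show "AE z in lebesgue_on W. ennreal (cmod (J z - ((a z - \<mu>) * F z - u z) * cnj (Y z))) \<le> latsum (\<lambda>n. ennreal (cmod (w (z + lat n))) *
      ennreal (2 * \<gamma> * cmod (F z) * cmod (window B (z + lat n) - indicator B n) + cmod (u z) * cmod (window B (z + lat n))))"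
      using fold_AE_integrable[OF int] AE_space
    proof eventually_elim
      case (elim z) then show ?case using pt[of z] by simp
    qed
  qed
  finally show ?thesis unfolding w_def .
qed

text \<open>Here \<open>d\<close> bounds the squared window error per lattice point of
  \<open>B\<close>. For small \<open>d\<close> the trial function \<open>g\<close> carries a fixed
  fraction of the mass \<open>card B * sqint W F\<close>, while \<open>V g\<close> is controlled by
  \<open>card B\<close> copies of the image on the cell; \<open>card B\<close> cancels when the two
  are combined.\<close>

lemma weyl_estimate:
  assumes F: "F \<in> quasi_periodic \<eta>" "cell_part F \<in> L2 W" and B: "finite B"
    and d: "\<And>z. z \<in> W \<Longrightarrow> latsum (\<lambda>n. ennreal ((cmod (window B (z + lat n) - indicator B n))\<^sup>2)) \<le> d * of_nat (card B)"
  defines "g \<equiv> \<lambda>z. window B z * F z"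
  shows "sqint \<Omega> (V g) \<le> of_nat (card B) * (8 * ennreal (\<gamma>\<^sup>2) * d * sqint W F + (4 * d + 4) * sqint W (V_eta \<eta> (cell_part F)))"
    and "of_nat (card B) * sqint W F \<le> 2 * sqint \<Omega> g + 2 * d * of_nat (card B) * sqint W F"
proof -
  define u where "u = V_eta \<eta> (cell_part F)"
  define X where "X n z = window B (z + lat n)" for n z
  define E where "E n z = ennreal ((cmod (X n z - indicator B n))\<^sup>2)" for n z
  have FL: "F \<in> L2 W" by (rule L2_of_cell_part[OF F(2)])
  have Fm: "F \<in> borel_measurable (lebesgue_on W)" using L2_measurable[OF FL] .
  have cF: "cell_part F \<in> bergman_eta W \<eta>" using cell_part_in_bergman_ext[OF F] bergman_ext_subset by blast
  have um: "u \<in> borel_measurable (lebesgue_on W)"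
    using L2_measurable[OF A_eta.in_L2[OF V_eta_in[OF cF]]] by (simp add: u_def)
  have g: "g \<in> bergman \<Omega>" unfolding g_def by (rule window_mult_in[OF F(1) FL])
  have gm: "g \<in> borel_measurable (lebesgue_on \<Omega>)" by (rule bergman_meas[OF g])
  define w where "w = V g"
  have wm: "w \<in> borel_measurable (lebesgue_on \<Omega>)" unfolding w_def by (rule bergman_meas[OF V_in[OF g]])
  have Xm: "X n \<in> borel_measurable (lebesgue_on W)" for n
  proof -
    have "window B holomorphic_on \<Omega>" unfolding window_def
      using holomorphic_shift[OF \<theta>_hol, of "- p" for p] by (intro holomorphic_on_sum) (simp add: shift_def[abs_def] lat_minus)
    then have "shift n (window B) \<in> borel_measurable (lebesgue_on W)"
      using measurable_W measurable_shift holomorphic_imp_measurable_lebesgue_on[OF open_\<Omega>] by blast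
    then show ?thesis by (simp add: X_def[abs_def] shift_def[abs_def])
  qed
  have Em: "E n \<in> borel_measurable (lebesgue_on W)" for n unfolding E_def using Xm[of n] by measurable
  have Esum: "latsum (\<lambda>n. E n z) \<le> d * of_nat (card B)" if "z \<in> W" for z
    using d[OF that] by (simp add: E_def X_def)
  have ind: "latsum (\<lambda>n. indicator B n) = of_nat (card B)" using B by simp
  have Xsq: "ennreal ((cmod (X n z))\<^sup>2) \<le> 2 * E n z + 2 * indicator B n" for n z
    using ennreal_cmod_sq_add[of "X n z - indicator B n" "indicator B n"]
    by (cases "n \<in> B") (simp_all add: E_def)
  have Xsum: "latsum (\<lambda>n. ennreal ((cmod (X n z))\<^sup>2)) \<le> (2 * d + 2) * of_nat (card B)" if z: "z \<in> W" for z
  proof -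
    have "latsum (\<lambda>n. ennreal ((cmod (X n z))\<^sup>2)) \<le> latsum (\<lambda>n. 2 * E n z + 2 * indicator B n)"
      by (rule latsum_mono[OF Xsq])
    also have "\<dots> = 2 * latsum (\<lambda>n. E n z) + 2 * of_nat (card B)"
      by (simp only: latsum_add latsum_cmult ind)
    also have "\<dots> \<le> 2 * (d * of_nat (card B)) + 2 * of_nat (card B)"
      by (intro add_mono mult_left_mono Esum z) auto
    finally show ?thesis by (simp add: distrib_right mult.assoc)
  qed
  define y where "y n z = 2 * \<gamma> * cmod (F z) * cmod (X n z - indicator B n) + cmod (u z) * cmod (X n z)" for n z
  have ysq: "(ennreal (y n z))\<^sup>2 \<le> (8 * ennreal (\<gamma>\<^sup>2) * ennreal ((cmod (F z))\<^sup>2)) * E n z +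
      (2 * ennreal ((cmod (u z))\<^sup>2)) * ennreal ((cmod (X n z))\<^sup>2)" for n z
  proof -
    have "(ennreal (y n z))\<^sup>2 \<le> 2 * ennreal ((2 * \<gamma> * cmod (F z) * cmod (X n z - indicator B n))\<^sup>2) + 2 * ennreal ((cmod (u z) * cmod (X n z))\<^sup>2)"
      unfolding y_def by (rule ennreal_sq_add_le) (auto simp: \<gamma>_nonneg)
    also have "(2 * \<gamma> * cmod (F z) * cmod (X n z - indicator B n))\<^sup>2 = 4 * \<gamma>\<^sup>2 * (cmod (F z))\<^sup>2 * (cmod (X n z - indicator B n))\<^sup>2"
      by (simp add: power_mult_distrib)
    also have "2 * ennreal (4 * \<gamma>\<^sup>2 * (cmod (F z))\<^sup>2 * (cmod (X n z - indicator B n))\<^sup>2) = (8 * ennreal (\<gamma>\<^sup>2) * ennreal ((cmod (F z))\<^sup>2)) * E n z"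
      unfolding E_def by (simp add: ennreal_mult' mult.assoc[symmetric])
    finally show ?thesis by (simp add: power_mult_distrib ennreal_mult' mult.assoc)
  qed
  have ysum: "latsum (\<lambda>n. (ennreal (y n z))\<^sup>2) \<le> of_nat (card B) * (8 * ennreal (\<gamma>\<^sup>2) * d * ennreal ((cmod (F z))\<^sup>2) + (4 * d + 4) * ennreal ((cmod (u z))\<^sup>2))"
    if z: "z \<in> W" for z
  proof -
    have "latsum (\<lambda>n. (ennreal (y n z))\<^sup>2) \<le> latsum (\<lambda>n. (8 * ennreal (\<gamma>\<^sup>2) * ennreal ((cmod (F z))\<^sup>2)) * E n z +
      (2 * ennreal ((cmod (u z))\<^sup>2)) * ennreal ((cmod (X n z))\<^sup>2))" by (rule latsum_mono[OF ysq])
    also have "\<dots> = (8 * ennreal (\<gamma>\<^sup>2) * ennreal ((cmod (F z))\<^sup>2)) * latsum (\<lambda>n. E n z) +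
        (2 * ennreal ((cmod (u z))\<^sup>2)) * latsum (\<lambda>n. ennreal ((cmod (X n z))\<^sup>2))"
      by (simp only: latsum_add latsum_cmult)
    also have "\<dots> \<le> (8 * ennreal (\<gamma>\<^sup>2) * ennreal ((cmod (F z))\<^sup>2)) * (d * of_nat (card B)) +
        (2 * ennreal ((cmod (u z))\<^sup>2)) * ((2 * d + 2) * of_nat (card B))"
      by (intro add_mono mult_left_mono Esum Xsum z) auto
    also have "\<dots> = of_nat (card B) * (8 * ennreal (\<gamma>\<^sup>2) * d * ennreal ((cmod (F z))\<^sup>2) + (4 * d + 4) * ennreal ((cmod (u z))\<^sup>2))"
    proof -
      have four: "2 * (2 * U) = 4 * (U::ennreal)" for U by (simp add: mult.assoc[symmetric])
      show ?thesis by (simp only: distrib_left distrib_right mult_ac) (simp only: four)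
    qed
    finally show ?thesis .
  qed
  have wf: "sqint \<Omega> w < \<infinity>" unfolding w_def using A.in_L2[OF V_in[OF g]] L2_iff_sqint by blast
  have "2 * sqint \<Omega> w \<le> 2 * (\<integral>\<^sup>+z. latsum (\<lambda>n. ennreal (cmod (w (z + lat n))) * ennreal (y n z)) \<partial>lebesgue_on W)"
    using weyl_test[OF F, of B] by (intro mult_left_mono) (simp_all add: w_def g_def y_def X_def u_def)
  also have "\<dots> = (\<integral>\<^sup>+z. 2 * latsum (\<lambda>n. ennreal (cmod (w (z + lat n))) * ennreal (y n z)) \<partial>lebesgue_on W)"
  proof (rule nn_integral_cmult[symmetric], rule borel_measurable_latsum)
    fix n
    have "shift n w \<in> borel_measurable (lebesgue_on W)" using measurable_W measurable_shift wm by blast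
    then show "(\<lambda>z. ennreal (cmod (w (z + lat n))) * ennreal (y n z)) \<in> borel_measurable (lebesgue_on W)"
      unfolding y_def shift_def[abs_def] using Fm um Xm[of n] by measurable
  qed
  also have "\<dots> \<le> (\<integral>\<^sup>+z. latsum (\<lambda>n. (ennreal (cmod (w (z + lat n))))\<^sup>2) +
      of_nat (card B) * (8 * ennreal (\<gamma>\<^sup>2) * d * ennreal ((cmod (F z))\<^sup>2) + (4 * d + 4) * ennreal ((cmod (u z))\<^sup>2)) \<partial>lebesgue_on W)"
  proof (rule nn_integral_mono)
    fix z assume "z \<in> space (lebesgue_on W)"
    then have z: "z \<in> W" by simp
    have "2 * latsum (\<lambda>n. ennreal (cmod (w (z + lat n))) * ennreal (y n z)) \<le>
        latsum (\<lambda>n. (ennreal (cmod (w (z + lat n))))\<^sup>2 + (ennreal (y n z))\<^sup>2)"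
      unfolding latsum_cmult[symmetric] by (intro latsum_mono ennreal_two_mult_le)
    also have "\<dots> = latsum (\<lambda>n. (ennreal (cmod (w (z + lat n))))\<^sup>2) + latsum (\<lambda>n. (ennreal (y n z))\<^sup>2)"
      by (rule latsum_add)
    also have "\<dots> \<le> latsum (\<lambda>n. (ennreal (cmod (w (z + lat n))))\<^sup>2) +
      of_nat (card B) * (8 * ennreal (\<gamma>\<^sup>2) * d * ennreal ((cmod (F z))\<^sup>2) + (4 * d + 4) * ennreal ((cmod (u z))\<^sup>2))"
      by (intro add_left_mono ysum z)
    finally show "2 * latsum (\<lambda>n. ennreal (cmod (w (z + lat n))) * ennreal (y n z)) \<le> \<dots>" .
  qed
  also have "\<dots> = sqint \<Omega> w + of_nat (card B) * (8 * ennreal (\<gamma>\<^sup>2) * d * sqint W F + (4 * d + 4) * sqint W u)"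
  proof -
    have m: "(\<lambda>z. (ennreal (cmod (w z)))\<^sup>2) \<in> borel_measurable (lebesgue_on \<Omega>)" using wm by measurable
    have "(\<integral>\<^sup>+z. latsum (\<lambda>n. (ennreal (cmod (w (z + lat n))))\<^sup>2) \<partial>lebesgue_on W) = sqint \<Omega> w"
      using nn_fold'[OF m] by (simp add: sqint_def ennreal_power)
    moreover have "(\<lambda>z. latsum (\<lambda>n. (ennreal (cmod (w (z + lat n))))\<^sup>2)) \<in> borel_measurable (lebesgue_on W)"
      by (rule borel_measurable_latsum) (rule measurable_compose[OF measurable_shift_cell m])
    moreover have "(\<lambda>z. ennreal ((cmod (F z))\<^sup>2)) \<in> borel_measurable (lebesgue_on W)"
      "(\<lambda>z. ennreal ((cmod (u z))\<^sup>2)) \<in> borel_measurable (lebesgue_on W)" using Fm um by measurable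
    ultimately show ?thesis unfolding sqint_def by (simp add: nn_integral_add nn_integral_cmult)
  qed
  \<comment> \<open>The inequality between product and squares returns one copy of
    \<open>sqint \<Omega> w\<close> on the right; it is finite and cancels.\<close>
  finally have "sqint \<Omega> w + sqint \<Omega> w \<le> sqint \<Omega> w + of_nat (card B) * (8 * ennreal (\<gamma>\<^sup>2) * d * sqint W F + (4 * d + 4) * sqint W u)"
    by (simp add: mult_2)
  then show "sqint \<Omega> (V g) \<le> of_nat (card B) * (8 * ennreal (\<gamma>\<^sup>2) * d * sqint W F + (4 * d + 4) * sqint W (V_eta \<eta> (cell_part F)))"
    using wf unfolding ennreal_add_left_cancel_le by (auto simp: w_def u_def)
  have "of_nat (card B) * ennreal ((cmod (F z))\<^sup>2) \<le> 2 * latsum (\<lambda>n. ennreal ((cmod (g (z + lat n)))\<^sup>2)) + 2 * d * of_nat (card B) * ennreal ((cmod (F z))\<^sup>2)"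
    if z: "z \<in> W" for z
  proof -
    have gX: "ennreal ((cmod (g (z + lat n)))\<^sup>2) = ennreal ((cmod (F z))\<^sup>2) * ennreal ((cmod (X n z))\<^sup>2)" for n
      unfolding g_def quasi_periodic_lat[OF F(1)] X_def
      by (simp add: norm_mult power_mult_distrib ennreal_mult' mult.commute)
    have "indicator B n \<le> 2 * ennreal ((cmod (X n z))\<^sup>2) + 2 * E n z" for n
    proof -
      have "(indicator B n :: ennreal) = ennreal ((cmod (indicator B n))\<^sup>2)" by (simp add: indicator_def)
      also have "\<dots> \<le> 2 * ennreal ((cmod (X n z))\<^sup>2) + 2 * ennreal ((cmod (indicator B n - X n z))\<^sup>2)"
        using ennreal_cmod_sq_add[of "X n z" "indicator B n - X n z"] by simp
      finally show ?thesis by (simp add: E_def norm_minus_commute)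
    qed
    then have "latsum (\<lambda>n. indicator B n) \<le> latsum (\<lambda>n. 2 * ennreal ((cmod (X n z))\<^sup>2) + 2 * E n z)"
      by (rule latsum_mono)
    then have "of_nat (card B) \<le> 2 * latsum (\<lambda>n. ennreal ((cmod (X n z))\<^sup>2)) + 2 * latsum (\<lambda>n. E n z)"
      unfolding ind by (simp only: latsum_add latsum_cmult)
    also have "\<dots> \<le> 2 * latsum (\<lambda>n. ennreal ((cmod (X n z))\<^sup>2)) + 2 * (d * of_nat (card B))"
      by (intro add_left_mono mult_left_mono Esum z) auto
    finally have "of_nat (card B) * ennreal ((cmod (F z))\<^sup>2) \<le>
        (2 * latsum (\<lambda>n. ennreal ((cmod (X n z))\<^sup>2)) + 2 * (d * of_nat (card B))) * ennreal ((cmod (F z))\<^sup>2)"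
      by (rule mult_right_mono) simp
    also have "\<dots> = 2 * latsum (\<lambda>n. ennreal ((cmod (g (z + lat n)))\<^sup>2)) + 2 * d * of_nat (card B) * ennreal ((cmod (F z))\<^sup>2)"
      unfolding gX latsum_cmult by (simp only: distrib_right distrib_left mult_ac)
    finally show ?thesis .
  qed
  then have "(\<integral>\<^sup>+z. of_nat (card B) * ennreal ((cmod (F z))\<^sup>2) \<partial>lebesgue_on W) \<le>
      (\<integral>\<^sup>+z. 2 * latsum (\<lambda>n. ennreal ((cmod (g (z + lat n)))\<^sup>2)) + 2 * d * of_nat (card B) * ennreal ((cmod (F z))\<^sup>2) \<partial>lebesgue_on W)"
    by (intro nn_integral_mono) simp
  also have "\<dots> = 2 * sqint \<Omega> g + 2 * d * of_nat (card B) * sqint W F"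
  proof -
    have m: "(\<lambda>z. ennreal ((cmod (g z))\<^sup>2)) \<in> borel_measurable (lebesgue_on \<Omega>)" using gm by measurable
    have "(\<integral>\<^sup>+z. latsum (\<lambda>n. ennreal ((cmod (g (z + lat n)))\<^sup>2)) \<partial>lebesgue_on W) = sqint \<Omega> g"
      using nn_fold'[OF m] by (simp add: sqint_def)
    moreover have "(\<lambda>z. latsum (\<lambda>n. ennreal ((cmod (g (z + lat n)))\<^sup>2))) \<in> borel_measurable (lebesgue_on W)"
      by (rule borel_measurable_latsum) (rule measurable_compose[OF measurable_shift_cell m])
    moreover have "(\<lambda>z. ennreal ((cmod (F z))\<^sup>2)) \<in> borel_measurable (lebesgue_on W)" using Fm by measurable
    ultimately show ?thesis unfolding sqint_def by (simp add: nn_integral_add nn_integral_cmult)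
  qed
  also have "(\<integral>\<^sup>+z. of_nat (card B) * ennreal ((cmod (F z))\<^sup>2) \<partial>lebesgue_on W) = of_nat (card B) * sqint W F"
    unfolding sqint_def using Fm by (intro nn_integral_cmult) measurable
  finally show "of_nat (card B) * sqint W F \<le> 2 * sqint \<Omega> g + 2 * d * of_nat (card B) * sqint W F" .
qed

end

text \<open>Trial functions exist only for elements of \<open>bergman_ext\<close>; boundedness of
  \<open>V\<close> carries the lower bound, with the same constant, to the closure.\<close>

lemma (in adjoint_pair) bounded_below_dense:
  assumes E: "E \<subseteq> H" "\<And>f e. f \<in> H \<Longrightarrow> e > 0 \<Longrightarrow> \<exists>g\<in>E. L2_norm D (\<lambda>z. f z - g z) < e"
    and \<kappa>: "\<kappa> > 0" "\<And>f. f \<in> E \<Longrightarrow> \<kappa> * L2_norm D f \<le> L2_norm D (V f)"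
  shows "bounded_below_on H (L2_norm D) V"
proof -
  obtain C0 where C0: "\<And>f. f \<in> H \<Longrightarrow> L2_norm D (V f) \<le> C0 * L2_norm D f" using bounded by blast
  define C where "C = max C0 0"
  have C: "C \<ge> 0" "L2_norm D (V f) \<le> C * L2_norm D f" if "f \<in> H" for f
    using order_trans[OF C0[OF that] mult_right_mono[of C0 C "L2_norm D f"]] by (simp_all add: C_def)
  have "\<kappa> * L2_norm D f \<le> L2_norm D (V f)" if f: "f \<in> H" for f
  proof (rule field_le_epsilon)
    fix e :: real assume e: "e > 0"
    define e' where "e' = e / (\<kappa> + C)"
    have e': "e' > 0" using e \<kappa>(1) C(1)[OF zero] by (simp add: e'_def)
    obtain g where g: "g \<in> E" "L2_norm D (\<lambda>z. f z - g z) < e'" using E(2)[OF f e'] by blast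
    have gH: "g \<in> H" using g E(1) by blast
    have "L2_norm D f \<le> L2_norm D g + L2_norm D (\<lambda>z. f z - g z)" by (rule L2_norm_le_add_diff) (use f gH in auto)
    then have "L2_norm D f \<le> L2_norm D g + e'" using g(2) by simp
    then have "\<kappa> * L2_norm D f \<le> \<kappa> * (L2_norm D g + e')" using \<kappa>(1) by (intro mult_left_mono) auto
    moreover have "L2_norm D (V g) \<le> L2_norm D (V f) + L2_norm D (\<lambda>z. V g z - V f z)"
      by (rule L2_norm_le_add_diff) (use V_in f gH in auto)
    moreover have "L2_norm D (\<lambda>z. V g z - V f z) \<le> C * e'"
    proof -
      have "L2_norm D (\<lambda>z. V g z - V f z) = L2_norm D (V (\<lambda>z. f z - g z))"
        by (simp add: V_diff f gH L2_norm_minus[of D "V g"])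
      also have "\<dots> \<le> C * L2_norm D (\<lambda>z. f z - g z)" by (rule C(2)[OF diff[OF f gH]])
      also have "\<dots> \<le> C * e'" using g(2) C(1)[OF zero] by (intro mult_left_mono) auto
      finally show ?thesis .
    qed
    ultimately have "\<kappa> * L2_norm D f \<le> L2_norm D (V f) + (\<kappa> + C) * e'"
      using \<kappa>(2)[OF g(1)] by (simp add: distrib_left distrib_right)
    also have "(\<kappa> + C) * e' = e" using \<kappa>(1) C(1)[OF zero] by (simp add: e'_def)
    finally show "\<kappa> * L2_norm D f \<le> L2_norm D (V f) + e" .
  qed
  then show ?thesis using \<kappa>(1) unfolding bounded_below_on_def by blast
qed

section \<open>Small weighted sums and large squares of the lattice\<close>

context cutoff_setting
begin

lemma latsum_tail:
  assumes "e > 0"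
  obtains K where "finite K" "latsum (\<lambda>k. ennreal (h k) * indicator (- K) k) \<le> ennreal e"
proof -
  have "(h has_sum h_total) UNIV" unfolding h_total_def using h_summable by (rule has_sum_infsum)
  from has_sum_finite_approximation[OF this assms] obtain K where K: "finite K" "dist (sum h K) h_total \<le> e" by blast
  let ?T = "latsum (\<lambda>k. ennreal (h k) * indicator (- K) k)"
  have "latsum (\<lambda>k. ennreal (h k) * indicator K k) = (\<Sum>k\<in>K. ennreal (h k) * indicator K k)"
    by (rule nn_integral_count_space') (use K(1) in auto)
  also have "\<dots> = ennreal (sum h K)" using h_nonneg by (simp add: sum_ennreal)
  finally have 1: "latsum (\<lambda>k. ennreal (h k) * indicator K k) = ennreal (sum h K)" .
  have "(\<lambda>k. ennreal (h k)) = (\<lambda>k. ennreal (h k) * indicator K k + ennreal (h k) * indicator (- K) k)"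
    by (auto simp: indicator_def)
  then have "ennreal h_total = latsum (\<lambda>k. ennreal (h k) * indicator K k + ennreal (h k) * indicator (- K) k)"
    using latsum_h by simp
  then have "ennreal h_total = ennreal (sum h K) + ?T" unfolding latsum_add 1 .
  moreover have "h_total \<le> sum h K + e" using K(2) by (simp add: dist_real_def)
  then have "ennreal h_total \<le> ennreal (sum h K) + ennreal e"
    using assms h_nonneg by (simp add: sum_nonneg ennreal_leI flip: ennreal_plus)
  ultimately have "ennreal (sum h K) + ?T \<le> ennreal (sum h K) + ennreal e" by simp
  then have "?T \<le> ennreal e" unfolding ennreal_add_left_cancel_le by simp
  then show ?thesis using that K(1) by blast
qed

text \<open>The finite set \<open>K\<close> and \<open>\<delta>\<close> do not depend on
  \<open>c\<close> and \<open>s\<close>: outside \<open>K\<close> the small tail of \<open>h\<close>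
  offsets the crude bound \<open>C\<close>, inside \<open>K\<close> the smallness
  \<open>\<delta>\<close> offsets the total mass. The result serves twice, for boundary counts of
  squares and for translation defects.\<close>

lemma latsum_small:
  assumes "e > 0" "C \<ge> 0"
  shows "\<exists>K \<delta>. finite K \<and> 0 < \<delta> \<and> (\<forall>c s. (\<forall>k. c k \<le> ennreal C * s) \<longrightarrow> (\<forall>k\<in>K. c k \<le> ennreal \<delta> * s) \<longrightarrow>
       latsum (\<lambda>k. ennreal (h k) * c k) \<le> ennreal e * s)"
proof -
  define t where "t = e / (2 * (C + 1))"
  define \<delta> where "\<delta> = e / (2 * (h_total + 1))"
  have t: "t > 0" "C * t \<le> e / 2" using assms by (auto simp: t_def field_simps)
  have \<delta>: "\<delta> > 0" "h_total * \<delta> \<le> e / 2" using assms(1) h_total_nonneg by (auto simp: \<delta>_def field_simps)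
  obtain K where K: "finite K" "latsum (\<lambda>k. ennreal (h k) * indicator (- K) k) \<le> ennreal t"
    using latsum_tail[OF t(1)] .
  have "latsum (\<lambda>k. ennreal (h k) * c k) \<le> ennreal e * s"
    if c: "\<And>k. c k \<le> ennreal C * s" "\<And>k. k \<in> K \<Longrightarrow> c k \<le> ennreal \<delta> * s" for c s
  proof -
    have "ennreal (h k) * c k \<le> (ennreal \<delta> * s) * ennreal (h k) + (ennreal C * s) * (ennreal (h k) * indicator (- K) k)" for k
    proof (cases "k \<in> K")
      case True
      have "ennreal (h k) * c k \<le> ennreal (h k) * (ennreal \<delta> * s)" by (intro mult_left_mono c True) simp
      then show ?thesis using True by (simp add: mult.commute)
    next
      case False
      have "ennreal (h k) * c k \<le> ennreal (h k) * (ennreal C * s)" by (intro mult_left_mono c) simp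
      also have "\<dots> \<le> (ennreal \<delta> * s) * ennreal (h k) + (ennreal C * s) * ennreal (h k)"
        by (subst mult.commute) (rule add_increasing, simp_all)
      finally show ?thesis using False by simp
    qed
    then have "latsum (\<lambda>k. ennreal (h k) * c k) \<le>
        latsum (\<lambda>k. (ennreal \<delta> * s) * ennreal (h k) + (ennreal C * s) * (ennreal (h k) * indicator (- K) k))"
      by (rule latsum_mono)
    also have "\<dots> = (ennreal \<delta> * s) * ennreal h_total + (ennreal C * s) * latsum (\<lambda>k. ennreal (h k) * indicator (- K) k)"
      by (simp only: latsum_add latsum_cmult latsum_h)
    also have "\<dots> \<le> (ennreal \<delta> * s) * ennreal h_total + (ennreal C * s) * ennreal t"
      by (intro add_left_mono mult_left_mono K) simp
    also have "\<dots> = (ennreal (h_total * \<delta>) + ennreal (C * t)) * s"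
      using assms(2) h_total_nonneg less_imp_le[OF \<delta>(1)] less_imp_le[OF t(1)] by (simp add: ennreal_mult distrib_left distrib_right mult_ac)
    also have "\<dots> \<le> (ennreal (e / 2) + ennreal (e / 2)) * s"
      by (intro mult_right_mono add_mono ennreal_leI t \<delta>) simp
    also have "ennreal (e / 2) + ennreal (e / 2) = ennreal e"
      using assms(1) by (simp flip: ennreal_plus)
    finally show ?thesis .
  qed
  then show ?thesis using K(1) \<delta>(1) by (intro exI[of _ K] exI[of _ \<delta>]) blast
qed

end

text \<open>The points that leave the square under a translation fill at most
  \<open>\<bar>fst k\<bar>\<close> columns and \<open>\<bar>snd k\<bar>\<close> rows of length
  \<open>N\<close>, which is of lower order than the area.\<close>

lemma card_square_diff:
  fixes N :: int and k :: "int \<times> int"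
  assumes "N \<ge> 0"
  defines "B \<equiv> {0..<N} \<times> {0..<N}"
  shows "card {n \<in> B. n - k \<notin> B} \<le> nat N * nat (\<bar>fst k\<bar> + \<bar>snd k\<bar>)"
proof -
  define I where "I i = {x \<in> {0..<N}. x - i \<notin> {0..<N}}" for i
  have fin_I: "finite (I i)" for i
    by (rule finite_subset[of _ "{0..<N}"]) (auto simp: I_def)
  have card_I: "card (I i) \<le> nat \<bar>i\<bar>" for i
  proof (cases "i \<ge> 0")
    case True
    have "card (I i) \<le> card {0..<i}" by (rule card_mono) (use True in \<open>auto simp: I_def\<close>)
    then show ?thesis using True by simp
  next
    case False
    have "card (I i) \<le> card {N + i..<N}" by (rule card_mono) (use False in \<open>auto simp: I_def\<close>)
    then show ?thesis using False by simp
  qed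
  have "{n \<in> B. n - k \<notin> B} \<subseteq> I (fst k) \<times> {0..<N} \<union> {0..<N} \<times> I (snd k)"
    by (auto simp: B_def I_def mem_Times_iff)
  then have "card {n \<in> B. n - k \<notin> B} \<le> card (I (fst k) \<times> {0..<N} \<union> {0..<N} \<times> I (snd k))"
    by (rule card_mono[rotated]) (simp add: fin_I)
  also have "\<dots> \<le> card (I (fst k) \<times> {0..<N}) + card ({0..<N} \<times> I (snd k))" by (rule card_Un_le)
  also have "\<dots> = nat N * (card (I (fst k)) + card (I (snd k)))" by (simp add: card_cartesian_product algebra_simps)
  also have "\<dots> \<le> nat N * (nat \<bar>fst k\<bar> + nat \<bar>snd k\<bar>)" by (intro mult_left_mono add_mono card_I) simp
  also have "nat \<bar>fst k\<bar> + nat \<bar>snd k\<bar> = nat (\<bar>fst k\<bar> + \<bar>snd k\<bar>)" by (simp add: nat_add_distrib)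
  finally show ?thesis .
qed

context toeplitz_setting
begin

text \<open>Since the translates of \<open>\<theta>\<close> sum to \<open>1\<close>, the error at
  \<open>n\<close> is a sum of \<open>\<theta>\<close> over those \<open>p\<close> at which the
  indicator of \<open>B\<close> differs from its value at \<open>n\<close>. For fixed
  \<open>k = n - p\<close>, the number of such \<open>n\<close> is the size of the boundary of
  \<open>B\<close> in the directions \<open>k\<close> and \<open>- k\<close>. One factor of the
  square is bounded by \<open>h_total\<close>.\<close>

lemma window_error:
  assumes B: "finite B" and z: "z \<in> W"
  shows "latsum (\<lambda>n. ennreal ((cmod (window B (z + lat n) - indicator B n))\<^sup>2)) \<le>
    ennreal h_total * latsum (\<lambda>k. ennreal (h k) * of_nat (card {n \<in> B. n - k \<notin> B} + card {n \<in> B. n - (- k) \<notin> B}))"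
proof -
  define d where "d n k = (if n \<in> B \<longleftrightarrow> n - k \<in> B then 0 else 1 :: ennreal)" for n k :: "int \<times> int"
  define x where "x n = latsum (\<lambda>k. ennreal (h k) * d n k)" for n
  have err: "ennreal (cmod (window B (z + lat n) - indicator B n)) \<le> x n" for n
  proof -
    define f where "f p = \<theta> (z + lat (n - p))" for p
    have bij: "bij_betw (\<lambda>p. n - p) UNIV UNIV" by (auto intro!: bij_betwI[where g = "\<lambda>k. n - k"])
    have f: "integrable (count_space UNIV) f" "(LINT p|count_space UNIV. f p) = 1"
      unfolding f_def using integrable_bij_count_space[OF bij, of "\<lambda>k. \<theta> (z + lat k)"] \<theta>_integrable[OF z]
        integral_bij_count_space[OF bij, of "\<lambda>k. \<theta> (z + lat k)"] \<theta>_integral[OF z] by auto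
    have ind: "(LINT p|count_space UNIV. indicator B p * f p) = (\<Sum>p\<in>B. f p)"
      "integrable (count_space UNIV) (\<lambda>p. indicator B p * f p)"
    proof -
      have sup: "{p. indicator B p * f p \<noteq> 0} \<subseteq> B" by (auto simp: indicator_def split: if_splits)
      then have fin: "finite {p \<in> UNIV. indicator B p * f p \<noteq> 0}" using B finite_subset by auto
      have "(LINT p|count_space UNIV. indicator B p * f p) = (\<Sum>p | p \<in> UNIV \<and> indicator B p * f p \<noteq> 0. indicator B p * f p)"
        by (rule lebesgue_integral_count_space_finite_support) (use fin in simp)
      also have "\<dots> = (\<Sum>p\<in>B. indicator B p * f p)"
        by (rule sum.mono_neutral_left) (use B sup in auto)
      also have "\<dots> = (\<Sum>p\<in>B. f p)" by simp
      finally show "(LINT p|count_space UNIV. indicator B p * f p) = (\<Sum>p\<in>B. f p)" .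
      show "integrable (count_space UNIV) (\<lambda>p. indicator B p * f p)"
        by (rule Bochner_Integration.integrable_bound[OF f(1)]) (auto simp: indicator_def)
    qed
    have "window B (z + lat n) = (\<Sum>p\<in>B. f p)" by (simp add: window_def f_def lat_diff add_diff_eq)
    then have "window B (z + lat n) - indicator B n = (LINT p|count_space UNIV. indicator B p * f p - indicator B n * f p)"
      using f ind by simp
    then have "ennreal (cmod (window B (z + lat n) - indicator B n)) =
        ennreal (cmod (LINT p|count_space UNIV. indicator B p * f p - indicator B n * f p))" by simp
    also have "\<dots> \<le> latsum (\<lambda>p. ennreal (h (n - p)) * d n (n - p))"
    proof (rule norm_count_integral_le)
      fix p show "ennreal (cmod (indicator B p * f p - indicator B n * f p)) \<le> ennreal (h (n - p)) * d n (n - p)"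
        using \<theta>_h[OF z, of "n - p"] by (auto simp: f_def d_def indicator_def ennreal_leI)
    qed
    also have "\<dots> = x n" unfolding x_def by (rule latsum_reflect)
    finally show ?thesis .
  qed
  have x_le: "x n \<le> ennreal h_total" for n
    unfolding x_def latsum_h[symmetric] by (rule latsum_mono) (simp add: d_def)
  have "ennreal ((cmod (window B (z + lat n) - indicator B n))\<^sup>2) \<le> ennreal h_total * x n" for n
  proof -
    have "ennreal ((cmod (window B (z + lat n) - indicator B n))\<^sup>2) = ennreal (cmod (window B (z + lat n) - indicator B n)) * ennreal (cmod (window B (z + lat n) - indicator B n))"
      by (simp add: power2_eq_square ennreal_mult')
    also have "\<dots> \<le> ennreal h_total * x n" by (intro mult_mono order_trans[OF err x_le] err) auto
    finally show ?thesis .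
  qed
  then have "latsum (\<lambda>n. ennreal ((cmod (window B (z + lat n) - indicator B n))\<^sup>2)) \<le> latsum (\<lambda>n. ennreal h_total * x n)"
    by (rule latsum_mono)
  also have "\<dots> = ennreal h_total * latsum (\<lambda>k. latsum (\<lambda>n. ennreal (h k) * d n k))"
    unfolding x_def by (simp only: latsum_cmult latsum_swap[of "\<lambda>n k. ennreal (h k) * d n k"])
  also have "\<dots> = ennreal h_total * latsum (\<lambda>k. ennreal (h k) * of_nat (card {n \<in> B. n - k \<notin> B} + card {n \<in> B. n - (- k) \<notin> B}))"
  proof -
    have "latsum (\<lambda>n. d n k) = of_nat (card {n \<in> B. n - k \<notin> B} + card {n \<in> B. n - (- k) \<notin> B})" for k
    proof -
      have "d n k = indicator {n \<in> B. n - k \<notin> B} n + indicator {n \<in> B. n - (- k) \<notin> B} (n - k)" for n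
        by (simp add: d_def indicator_def)
      then have "latsum (\<lambda>n. d n k) = latsum (\<lambda>n. indicator {n \<in> B. n - k \<notin> B} n) + latsum (\<lambda>n. indicator {n \<in> B. n - (- k) \<notin> B} (n - k))"
        by (simp only: latsum_add)
      also have "latsum (\<lambda>n. indicator {n \<in> B. n - (- k) \<notin> B} (n - k)) = latsum (\<lambda>n. indicator {n \<in> B. n - (- k) \<notin> B} n)"
        by (rule latsum_shift')
      finally show ?thesis using B by simp
    qed
    then show ?thesis by (simp only: latsum_cmult)
  qed
  finally show ?thesis .
qed

text \<open>Large squares are Folner sets: for each of the finitely many translations in
  \<open>K\<close> the boundary has order \<open>N\<close> against the area of order
  \<open>N * N\<close>, and for all other translations the trivial bound \<open>2 * card B\<close>
  suffices.\<close>

lemma folner: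
  assumes "e > 0"
  shows "\<exists>B. finite B \<and> B \<noteq> {} \<and> (\<forall>z\<in>W. latsum (\<lambda>n. ennreal ((cmod (window B (z + lat n) - indicator B n))\<^sup>2)) \<le> ennreal e * of_nat (card B))"
proof -
  define e' where "e' = e / (h_total + 1)"
  have e': "e' > 0" "h_total * e' \<le> e" using assms h_total_nonneg by (auto simp: e'_def field_simps)
  have two: "(0::real) \<le> 2" by simp
  obtain K \<delta> where K': "finite K \<and> 0 < \<delta> \<and> (\<forall>c s. (\<forall>k. c k \<le> ennreal 2 * s) \<longrightarrow> (\<forall>k\<in>K. c k \<le> ennreal \<delta> * s) \<longrightarrow>
       latsum (\<lambda>k. ennreal (h k) * c k) \<le> ennreal e' * s)"
    using latsum_small[OF e'(1) two] by (elim exE) (rule that)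
  note K = K'[THEN conjunct1] K'[THEN conjunct2, THEN conjunct1] K'[THEN conjunct2, THEN conjunct2]
  define L where "L = (\<Sum>k\<in>K. nat (\<bar>fst k\<bar> + \<bar>snd k\<bar>))"
  obtain N0 :: nat where N0: "2 * real L / \<delta> < real N0" using reals_Archimedean2 by blast
  define N where "N = int N0 + 1"
  have N: "N > 0" "2 * real L \<le> \<delta> * real_of_int N"
    using N0 K(2) by (auto simp: N_def field_simps)
  define B where "B = {0..<N} \<times> {0..<N}"
  have B: "finite B" "B \<noteq> {}" using N(1) by (auto simp: B_def)
  have cB: "card B = nat N * nat N" by (simp add: B_def card_cartesian_product)
  define c :: "int \<times> int \<Rightarrow> ennreal" where "c k = of_nat (card {n \<in> B. n - k \<notin> B} + card {n \<in> B. n - (- k) \<notin> B})" for k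
  have c1: "c k \<le> ennreal 2 * of_nat (card B)" for k
  proof -
    have "card {n \<in> B. n - k \<notin> B} + card {n \<in> B. n - (- k) \<notin> B} \<le> card B + card B"
      by (intro add_mono card_mono B) auto
    then have "c k \<le> of_nat (2 * card B)" unfolding c_def by (intro of_nat_mono) simp
    then show ?thesis by simp
  qed
  have c2: "c k \<le> ennreal \<delta> * of_nat (card B)" if k: "k \<in> K" for k
  proof -
    have "nat (\<bar>fst k\<bar> + \<bar>snd k\<bar>) \<le> L" unfolding L_def by (rule member_le_sum) (use k K(1) in auto)
    then have NL: "nat N * nat (\<bar>fst k\<bar> + \<bar>snd k\<bar>) \<le> nat N * L" by (rule mult_left_mono) simp
    have "card {n \<in> B. n - k \<notin> B} \<le> nat N * L" "card {n \<in> B. n - (- k) \<notin> B} \<le> nat N * L"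
      using order_trans[OF card_square_diff[of N k] NL] order_trans[OF card_square_diff[of N "- k"]] NL N(1)
      unfolding B_def by simp_all
    then have le: "card {n \<in> B. n - k \<notin> B} + card {n \<in> B. n - (- k) \<notin> B} \<le> 2 * (nat N * L)" by linarith
    have "real (card {n \<in> B. n - k \<notin> B} + card {n \<in> B. n - (- k) \<notin> B}) \<le> real (2 * (nat N * L))"
      using le by (simp only: of_nat_le_iff)
    also have "\<dots> = real_of_int N * (2 * real L)" using N(1) by simp
    also have "\<dots> \<le> real_of_int N * (\<delta> * real_of_int N)" using N by (intro mult_left_mono) auto
    also have "\<dots> = \<delta> * real (card B)" using N(1) by (simp add: cB)
    finally have "ennreal (real (card {n \<in> B. n - k \<notin> B} + card {n \<in> B. n - (- k) \<notin> B})) \<le> ennreal (\<delta> * real (card B))"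
      by (rule ennreal_leI)
    then show ?thesis unfolding c_def using K(2) by (simp add: ennreal_mult' ennreal_of_nat_eq_real_of_nat)
  qed
  have "latsum (\<lambda>n. ennreal ((cmod (window B (z + lat n) - indicator B n))\<^sup>2)) \<le> ennreal e * of_nat (card B)" if z: "z \<in> W" for z
  proof -
    have "latsum (\<lambda>n. ennreal ((cmod (window B (z + lat n) - indicator B n))\<^sup>2)) \<le> ennreal h_total * latsum (\<lambda>k. ennreal (h k) * c k)"
      unfolding c_def by (rule window_error[OF B(1) z])
    also have "\<dots> \<le> ennreal h_total * (ennreal e' * of_nat (card B))"
      by (intro mult_left_mono K(3)[rule_format] c1 c2) auto
    also have "\<dots> = ennreal (h_total * e') * of_nat (card B)"
      using h_total_nonneg by (simp add: ennreal_mult' mult.assoc)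
    also have "\<dots> \<le> ennreal e * of_nat (card B)" by (intro mult_right_mono ennreal_leI e') simp
    finally show ?thesis .
  qed
  then show ?thesis using B by blast
qed

sublocale TA_pair: adjoint_pair \<Omega> "bergman \<Omega>" V "shifted (toeplitz \<Omega> (bergman \<Omega>) (\<lambda>z. cnj (a z))) (cnj \<mu>)"
  unfolding V_def by (rule TA.adjoint_pair_toeplitz)

sublocale TE_pair: adjoint_pair W "bergman_eta W \<eta>" "V_eta \<eta>"
  "shifted (toeplitz W (bergman_eta W \<eta>) (\<lambda>z. cnj (a z))) (cnj \<mu>)" for \<eta>
  unfolding V_eta_def by (rule TE.adjoint_pair_toeplitz)

text \<open>The windowed function \<open>g\<close> is inserted into the lower bound on
  \<open>\<Omega>\<close>, and the two parts of \<open>weyl_estimate\<close> bound its norm from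
  below and the norm of \<open>V g\<close> from above.\<close>

lemma eta_bounded_below:
  assumes "bounded_below_on (bergman \<Omega>) (L2_norm \<Omega>) V"
  shows "bounded_below_on (bergman_eta W \<eta>) (L2_norm W) (V_eta \<eta>)"
proof -
  obtain \<kappa> where \<kappa>: "\<kappa> > 0" "\<And>g. g \<in> bergman \<Omega> \<Longrightarrow> \<kappa> * L2_norm \<Omega> g \<le> L2_norm \<Omega> (V g)"
    using assms by (auto simp: bounded_below_on_def)
  \<comment> \<open>The bound \<open>1 / 4\<close> makes the window error cost at most half of the
    mass in the second part of \<open>weyl_estimate\<close>; the other bound gives
    \<open>32 * \<gamma>\<^sup>2 * d \<le> \<kappa>\<^sup>2 / 2\<close>, so that the error term of
    the first part is absorbed on the left.\<close>
  define d where "d = min (1 / 4) (\<kappa>\<^sup>2 / (64 * (\<gamma>\<^sup>2 + 1)))"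
  have pos: "64 * (\<gamma>\<^sup>2 + 1) > 0" by (simp add: add_nonneg_pos)
  have d: "d > 0" "d \<le> 1 / 4" using \<kappa>(1) pos unfolding d_def by (simp_all only: min.cobounded1 min_less_iff_conj, simp)
  have d\<gamma>: "16 * \<gamma>\<^sup>2 * d \<le> \<kappa>\<^sup>2 / 4"
  proof -
    have "d \<le> \<kappa>\<^sup>2 / (64 * (\<gamma>\<^sup>2 + 1))" by (simp add: d_def)
    then have "d * (64 * (\<gamma>\<^sup>2 + 1)) \<le> \<kappa>\<^sup>2" using pos by (simp add: pos_le_divide_eq)
    then show ?thesis using d(1) by (simp add: algebra_simps)
  qed
  obtain B where B: "finite B" "B \<noteq> {}"
    "\<And>z. z \<in> W \<Longrightarrow> latsum (\<lambda>n. ennreal ((cmod (window B (z + lat n) - indicator B n))\<^sup>2)) \<le> ennreal d * of_nat (card B)"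
    using folner[OF d(1)] by blast
  define M where "M = real (card B)"
  have M: "M > 0" using B by (simp add: M_def card_gt_0_iff)
  have Mn: "of_nat (card B) = ennreal M" by (simp add: M_def ennreal_of_nat_eq_real_of_nat)
  \<comment> \<open>The absorption ends with \<open>\<kappa>\<^sup>2 * n2 \<le> 40 * u2\<close>, and
    \<open>49\<close> is the next square.\<close>
  have "\<kappa> / 7 * L2_norm W f \<le> L2_norm W (V_eta \<eta> f)" if fE: "f \<in> bergman_ext W \<eta>" for f
  proof -
    obtain F where F: "F \<in> quasi_periodic \<eta>" "f = cell_part F" "cell_part F \<in> L2 W" using fE unfolding bergman_ext_eq by blast
    have FL: "F \<in> L2 W" by (rule L2_of_cell_part[OF F(3)])
    define g where "g = (\<lambda>z. window B z * F z)"
    have g: "g \<in> bergman \<Omega>" unfolding g_def by (rule window_mult_in[OF F(1) FL])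
    define n2 u2 g2 w2 where "n2 = (L2_norm W f)\<^sup>2" and "u2 = (L2_norm W (V_eta \<eta> f))\<^sup>2"
      and "g2 = (L2_norm \<Omega> g)\<^sup>2" and "w2 = (L2_norm \<Omega> (V g))\<^sup>2"
    have fe: "f \<in> bergman_eta W \<eta>" using fE bergman_ext_subset by blast
    have s: "sqint W F = ennreal n2" "sqint W (V_eta \<eta> (cell_part F)) = ennreal u2"
      "sqint \<Omega> g = ennreal g2" "sqint \<Omega> (V g) = ennreal w2"
      using sqint_eq_L2_norm[OF F(3)] sqint_cell_part[of F] sqint_eq_L2_norm[OF A_eta.in_L2[OF V_eta_in[OF fe]]]
        sqint_eq_L2_norm[OF A.in_L2[OF g]] sqint_eq_L2_norm[OF A.in_L2[OF V_in[OF g]]]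
      by (auto simp: n2_def u2_def g2_def w2_def F(2))
    have nn: "n2 \<ge> 0" "u2 \<ge> 0" "g2 \<ge> 0" "w2 \<ge> 0" by (auto simp: n2_def u2_def g2_def w2_def)
    have "ennreal w2 \<le> ennreal M * (8 * ennreal (\<gamma>\<^sup>2) * ennreal d * ennreal n2 + (4 * ennreal d + 4) * ennreal u2)"
      using weyl_estimate(1)[OF F(1,3) B(1,3)] unfolding g_def[symmetric] s Mn .
    also have "\<dots> = ennreal (M * (8 * \<gamma>\<^sup>2 * d * n2 + (4 * d + 4) * u2))"
      using M d nn by (simp add: ennreal_mult ennreal_plus)
    finally have 1: "w2 \<le> M * (8 * \<gamma>\<^sup>2 * d * n2 + (4 * d + 4) * u2)"
      using M d nn by (subst (asm) ennreal_le_iff) auto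
    have "ennreal M * ennreal n2 \<le> 2 * ennreal g2 + 2 * ennreal d * ennreal M * ennreal n2"
      using weyl_estimate(2)[OF F(1,3) B(1,3)] unfolding g_def[symmetric] s Mn .
    also have "\<dots> = ennreal (2 * g2 + 2 * d * M * n2)"
      using M d nn by (simp add: ennreal_mult ennreal_plus)
    finally have 2: "M * n2 \<le> 2 * g2 + 2 * d * M * n2"
      using M d nn by (subst (asm) ennreal_mult[symmetric], simp, simp, subst (asm) ennreal_le_iff) auto
    have 3: "\<kappa>\<^sup>2 * g2 \<le> w2"
      unfolding g2_def w2_def power_mult_distrib[symmetric] using \<kappa> g by (intro power_mono) auto
    have "M * n2 * (1 / 2) \<le> M * n2 * (1 - 2 * d)" using d M nn by (intro mult_left_mono) auto
    then have "M * n2 \<le> 4 * g2" using 2 by (simp add: algebra_simps)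
    then have "\<kappa>\<^sup>2 * (M * n2) \<le> \<kappa>\<^sup>2 * (4 * g2)" by (intro mult_left_mono) auto
    also have "\<dots> \<le> 4 * (M * (8 * \<gamma>\<^sup>2 * d * n2 + (4 * d + 4) * u2))" using 1 3 by simp
    finally have "M * (\<kappa>\<^sup>2 * n2) \<le> M * (32 * \<gamma>\<^sup>2 * d * n2 + (16 * d + 16) * u2)" by (simp add: algebra_simps)
    then have "\<kappa>\<^sup>2 * n2 \<le> 32 * \<gamma>\<^sup>2 * d * n2 + (16 * d + 16) * u2" using M by simp
    moreover have "32 * \<gamma>\<^sup>2 * d * n2 \<le> \<kappa>\<^sup>2 / 2 * n2" using d\<gamma> nn by (intro mult_right_mono) auto
    moreover have "(16 * d + 16) * u2 \<le> 20 * u2" using d nn by (intro mult_right_mono) auto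
    ultimately have "\<kappa>\<^sup>2 * n2 \<le> 40 * u2" by simp
    then have "\<kappa>\<^sup>2 * n2 \<le> 49 * u2" using nn by linarith
    then have "(\<kappa> / 7 * L2_norm W f)\<^sup>2 \<le> (L2_norm W (V_eta \<eta> f))\<^sup>2"
      by (simp add: n2_def u2_def power_mult_distrib power_divide)
    then show ?thesis by (rule power2_le_imp_le) simp
  qed
  then show ?thesis
    using \<kappa>(1) bergman_ext_subset bergman_eta_dense
    by (intro TE_pair.bounded_below_dense[where E = "bergman_ext W \<eta>" and \<kappa> = "\<kappa> / 7"]) (auto simp: bergman_eta_def)
qed

end

section \<open>Approximate eigenfunctions\<close>

text \<open>A geometric sum over powers of a root of unity. The offset \<open>- pi\<close>, which
  places the frequencies in \<open>{-pi..pi}\<close>, contributes only the constant factor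
  \<open>cis (pi * of_int m)\<close>.\<close>

lemma sum_cis_zero:
  fixes m :: int and N :: nat
  assumes "m \<noteq> 0" "\<bar>m\<bar> < int N"
  shows "(\<Sum>j<N. cis (- ((2 * pi * real j / real N - pi) * of_int m))) = 0"
proof -
  have N: "real N > 0" using assms by linarith
  define \<zeta> where "\<zeta> = cis (- (2 * pi * of_int m / real N))"
  have "\<zeta> \<noteq> 1"
  proof
    assume "\<zeta> = 1"
    then have "cos (2 * pi * of_int m / real N) = 1" by (simp add: \<zeta>_def complex_eq_iff)
    then obtain n :: int where "2 * pi * of_int m / real N = of_int n * 2 * pi"
      by (auto simp: cos_one_2pi_int)
    then have "of_int m = of_int n * real N" using N by (simp add: field_simps)
    then have "m = n * int N" by (simp flip: of_int_eq_iff[where 'a = real])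
    then have "n \<noteq> 0" "\<bar>m\<bar> = \<bar>n\<bar> * int N" using assms(1) by (auto simp: abs_mult)
    moreover from this have "1 * int N \<le> \<bar>n\<bar> * int N" by (intro mult_right_mono) auto
    ultimately show False using assms(2) by linarith
  qed
  moreover have "\<zeta> ^ N = 1"
  proof -
    have "\<zeta> ^ N = cis (real N * (- (2 * pi * of_int m / real N)))" unfolding \<zeta>_def by (rule Complex.DeMoivre)
    also have "\<dots> = cis (2 * pi * of_int (- m))" using N by (simp add: field_simps)
    also have "\<dots> = 1" by (rule cis_multiple_2pi) simp
    finally show ?thesis .
  qed
  ultimately have "(\<Sum>j<N. \<zeta> ^ j) = 0" by (simp add: geometric_sum)
  moreover have "cis (- ((2 * pi * real j / real N - pi) * of_int m)) = cis (pi * of_int m) * \<zeta> ^ j" for j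
  proof -
    have "\<zeta> ^ j = cis (real j * (- (2 * pi * of_int m / real N)))" unfolding \<zeta>_def by (rule Complex.DeMoivre)
    then show ?thesis by (simp add: cis_mult field_simps)
  qed
  ultimately show ?thesis by (simp add: sum_distrib_left[symmetric])
qed

lemma finite_Parseval:
  fixes x :: "nat \<Rightarrow> complex"
  shows "(\<Sum>j<N. (cmod (\<Sum>k<N. cis (- ((2 * pi * real j / real N - pi) * real k)) * x k))\<^sup>2) = real N * (\<Sum>k<N. (cmod (x k))\<^sup>2)"
proof -
  define \<omega> where "\<omega> j = 2 * pi * real j / real N - pi" for j
  have orth: "(\<Sum>j<N. cis (- (\<omega> j * real k)) * cnj (cis (- (\<omega> j * real l)))) = (if k = l then of_nat N else 0)"
    if "k < N" "l < N" for k l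
  proof -
    have "cis (- (\<omega> j * real k)) * cnj (cis (- (\<omega> j * real l))) = cis (- (\<omega> j * of_int (int k - int l)))" for j
      by (simp add: cis_cnj cis_mult algebra_simps)
    then show ?thesis using sum_cis_zero[of "int k - int l" N] that by (auto simp: \<omega>_def)
  qed
  have "complex_of_real (\<Sum>j<N. (cmod (\<Sum>k<N. cis (- (\<omega> j * real k)) * x k))\<^sup>2) =
      (\<Sum>j<N. (\<Sum>k<N. cis (- (\<omega> j * real k)) * x k) * cnj (\<Sum>l<N. cis (- (\<omega> j * real l)) * x l))"
    by (simp only: of_real_sum complex_norm_square)
  also have "\<dots> = (\<Sum>j<N. \<Sum>k<N. \<Sum>l<N. (cis (- (\<omega> j * real k)) * cnj (cis (- (\<omega> j * real l)))) * (x k * cnj (x l)))"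
    by (simp add: sum_product cnj_sum mult_ac)
  also have "\<dots> = (\<Sum>k<N. \<Sum>l<N. \<Sum>j<N. (cis (- (\<omega> j * real k)) * cnj (cis (- (\<omega> j * real l)))) * (x k * cnj (x l)))"
    by (subst sum.swap) (intro sum.cong refl sum.swap)
  also have "\<dots> = (\<Sum>k<N. \<Sum>l<N. (if k = l then of_nat N else 0) * (x k * cnj (x l)))"
    by (intro sum.cong refl) (simp only: sum_distrib_right[symmetric] orth lessThan_iff)
  also have "\<dots> = (\<Sum>k<N. \<Sum>l<N. if l = k then of_nat N * (x k * cnj (x k)) else 0)"
    by (intro sum.cong refl) auto
  also have "\<dots> = (\<Sum>k<N. of_nat N * (x k * cnj (x k)))"
    by (intro sum.cong refl) (simp add: sum.delta)
  also have "\<dots> = complex_of_real (real N * (\<Sum>k<N. (cmod (x k))\<^sup>2))"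
    by (simp add: sum_distrib_left complex_norm_square[symmetric])
  finally show ?thesis unfolding \<omega>_def of_real_eq_iff .
qed

text \<open>If \<open>A j\<close> exceeded \<open>B j\<close> wherever \<open>B j\<close> is
  positive, the sum of \<open>A\<close> would be strictly larger: indices with
  \<open>B j = 0\<close> contribute zero to both sums, and at least one \<open>B j\<close> is
  positive.\<close>

lemma pigeonhole_sum:
  fixes A B :: "nat \<Rightarrow> real"
  assumes "sum A {..<N} \<le> sum B {..<N}" "sum B {..<N} > 0" "\<And>j. B j \<ge> 0" "\<And>j. B j = 0 \<Longrightarrow> A j = 0"
  shows "\<exists>j<N. B j > 0 \<and> A j \<le> B j"
proof (rule ccontr)
  assume neg: "\<not> ?thesis"
  have lt: "B j < A j" if "j < N" "B j > 0" for j using neg that by force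
  have "B j \<le> A j" if "j < N" for j
    using lt[OF that] assms(3,4)[of j] by (cases "B j = 0") (auto simp: less_le)
  moreover obtain j where "j < N" "B j > 0"
  proof -
    have "\<not> (\<forall>j\<in>{..<N}. B j = 0)" using assms(2) by (metis less_irrefl sum.neutral)
    then show ?thesis using that assms(3) by (metis lessThan_iff less_le)
  qed
  ultimately have "sum B {..<N} < sum A {..<N}" using lt by (intro sum_strict_mono_ex1) auto
  then show False using assms(1) by simp
qed

section \<open>Finite Fourier sums of translates\<close>

context periodic_setting
begin

text \<open>A discrete substitute for the Floquet transform in the direction \<open>e\<close>, at
  the frequency \<open>2 * pi * real j / real N - pi\<close>. It stays in the Bergman space, and the
  division by \<open>N\<close> makes the squared norms of the \<open>N\<close> components add up to
  that of \<open>F\<close>.\<close>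

definition dft :: "int \<times> int \<Rightarrow> nat \<Rightarrow> nat \<Rightarrow> (complex \<Rightarrow> complex) \<Rightarrow> complex \<Rightarrow> complex" where
  "dft e N j F z = (\<Sum>k<N. (cis (- ((2 * pi * real j / real N - pi) * real k)) / of_nat N) *
      shift (int k * fst e, int k * snd e) F z)"

lemma dft_in: "f \<in> bergman \<Omega> \<Longrightarrow> dft e N j f \<in> bergman \<Omega>"
  unfolding dft_def[abs_def] by (rule A.sum_in) (rule bergman_shift)

lemma dft_L2: "F \<in> L2 \<Omega> \<Longrightarrow> dft e N j F \<in> L2 \<Omega>"
proof -
  assume F: "F \<in> L2 \<Omega>"
  have "(\<lambda>z. \<Sum>k<n. c k * shift (s k) F z) \<in> L2 \<Omega>" for c s and n :: nat
  proof (induction n)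
    case (Suc n)
    show ?case using L2_add[OF Suc L2_scale[OF L2_shift[OF F]]] by simp
  qed simp
  then show ?thesis unfolding dft_def[abs_def] .
qed

lemma dft_Parseval:
  assumes F: "F \<in> L2 \<Omega>" and N: "N > 0"
  shows "(\<Sum>j<N. (L2_norm \<Omega> (dft e N j F))\<^sup>2) = (L2_norm \<Omega> F)\<^sup>2"
proof -
  have i: "integrable (lebesgue_on \<Omega>) (\<lambda>z. (cmod (shift k F z))\<^sup>2)" for k by (rule L2_integrable[OF L2_shift[OF F]])
  have "(\<Sum>j<N. (L2_norm \<Omega> (dft e N j F))\<^sup>2) = (LINT z|lebesgue_on \<Omega>. (\<Sum>j<N. (cmod (dft e N j F z))\<^sup>2))"
    unfolding L2_norm_sq by (rule Bochner_Integration.integral_sum[symmetric]) (rule L2_integrable[OF dft_L2[OF F]])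
  also have "\<dots> = (LINT z|lebesgue_on \<Omega>. (\<Sum>k<N. (1 / real N) * (cmod (shift (int k * fst e, int k * snd e) F z))\<^sup>2))"
  proof (rule Bochner_Integration.integral_cong[OF refl])
    fix z
    have "dft e N j F z = (1 / of_nat N) * (\<Sum>k<N. cis (- ((2 * pi * real j / real N - pi) * real k)) * shift (int k * fst e, int k * snd e) F z)" for j
      by (simp add: dft_def sum_distrib_left sum_divide_distrib)
    then have "(cmod (dft e N j F z))\<^sup>2 = (1 / real N)\<^sup>2 * (cmod (\<Sum>k<N. cis (- ((2 * pi * real j / real N - pi) * real k)) * shift (int k * fst e, int k * snd e) F z))\<^sup>2" for j
      by (simp add: norm_mult norm_divide power_divide)
    then have "(\<Sum>j<N. (cmod (dft e N j F z))\<^sup>2) = (1 / real N)\<^sup>2 * (real N * (\<Sum>k<N. (cmod (shift (int k * fst e, int k * snd e) F z))\<^sup>2))"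
      using finite_Parseval[of N "\<lambda>k. shift (int k * fst e, int k * snd e) F z"] by (simp add: sum_distrib_left[symmetric])
    also have "\<dots> = (\<Sum>k<N. (1 / real N) * (cmod (shift (int k * fst e, int k * snd e) F z))\<^sup>2)"
      using N by (simp add: sum_distrib_left power2_eq_square)
    finally show "(\<Sum>j<N. (cmod (dft e N j F z))\<^sup>2) = \<dots>" .
  qed
  also have "\<dots> = (\<Sum>k<N. (1 / real N) * (L2_norm \<Omega> (shift (int k * fst e, int k * snd e) F))\<^sup>2)"
    unfolding L2_norm_sq using i by (simp add: Bochner_Integration.integral_sum)
  also have "\<dots> = (L2_norm \<Omega> F)\<^sup>2" using N by (simp add: L2_norm_shift[OF F])
  finally show ?thesis .
qed

text \<open>Translation by \<open>e\<close> followed by removal of the phase moves the summation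
  index by one, so the difference telescopes to two end terms, each of norm
  \<open>L2_norm \<Omega> F / N\<close>.\<close>

lemma dft_boundary:
  assumes F: "F \<in> L2 \<Omega>" and N: "N > 0"
  shows "(L2_norm \<Omega> (\<lambda>z. shift e (dft e N j F) z - cis (2 * pi * real j / real N - pi) * dft e N j F z))\<^sup>2 \<le>
    4 / (real N)\<^sup>2 * (L2_norm \<Omega> F)\<^sup>2"
proof -
  define \<omega> where "\<omega> = 2 * pi * real j / real N - pi"
  define y where "y k z = cis (- (\<omega> * real k)) * shift (int k * fst e, int k * snd e) F z" for k z
  have d: "dft e N j F z = (\<Sum>k<N. y k z) / of_nat N" for z
    by (simp add: dft_def y_def \<omega>_def sum_divide_distrib)
  have sy: "shift e (y k) z = cis \<omega> * y (Suc k) z" for k z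
  proof -
    have "shift e (shift (int k * fst e, int k * snd e) F) = shift (int (Suc k) * fst e, int (Suc k) * snd e) F"
      unfolding shift_shift by (rule arg_cong[of _ _ "\<lambda>k. shift k F"]) (simp add: prod_eq_iff algebra_simps)
    then have "shift e (y k) z = cis (- (\<omega> * real k)) * shift (int (Suc k) * fst e, int (Suc k) * snd e) F z"
      by (simp add: shift_def y_def fun_eq_iff)
    also have "cis (- (\<omega> * real k)) = cis \<omega> * cis (- (\<omega> * real (Suc k)))" by (simp add: cis_mult algebra_simps)
    finally show ?thesis unfolding y_def[of "Suc k" z] by (simp only: mult.assoc)
  qed
  have "shift e (dft e N j F) z - cis \<omega> * dft e N j F z = (cis \<omega> / of_nat N) * (y N z - y 0 z)" for z
  proof -
    have "shift e (dft e N j F) z = (\<Sum>k<N. shift e (y k) z) / of_nat N" by (simp add: shift_def d)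
    also have "\<dots> = cis \<omega> * (\<Sum>k<N. y (Suc k) z) / of_nat N" by (simp add: sy sum_distrib_left)
    finally have "shift e (dft e N j F) z - cis \<omega> * dft e N j F z = (cis \<omega> / of_nat N) * ((\<Sum>k<N. y (Suc k) z) - (\<Sum>k<N. y k z))"
      by (simp add: d right_diff_distrib diff_divide_distrib)
    also have "(\<Sum>k<N. y (Suc k) z) - (\<Sum>k<N. y k z) = y N z - y 0 z"
      unfolding sum_subtractf[symmetric] by (rule sum_lessThan_telescope)
    finally show ?thesis .
  qed
  then have "L2_norm \<Omega> (\<lambda>z. shift e (dft e N j F) z - cis \<omega> * dft e N j F z) = L2_norm \<Omega> (\<lambda>z. (cis \<omega> / of_nat N) * (y N z - y 0 z))" by simp
  also have "\<dots> = 1 / real N * L2_norm \<Omega> (\<lambda>z. y N z - y 0 z)" unfolding L2_norm_scale by (simp add: norm_divide)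
  also have "\<dots> \<le> 1 / real N * (2 * L2_norm \<Omega> F)"
  proof (rule mult_left_mono)
    have yL: "y k \<in> L2 \<Omega>" "L2_norm \<Omega> (y k) = L2_norm \<Omega> F" for k
      unfolding y_def using L2_scale[OF L2_shift[OF F]] by (auto simp: L2_norm_scale L2_norm_shift[OF F])
    have "L2_norm \<Omega> (\<lambda>z. y N z - y 0 z) \<le> L2_norm \<Omega> (\<lambda>z. y N z - 0) + L2_norm \<Omega> (\<lambda>z. 0 - y 0 z)"
      by (rule L2_norm_triangle_diff) (use yL in auto)
    then show "L2_norm \<Omega> (\<lambda>z. y N z - y 0 z) \<le> 2 * L2_norm \<Omega> F"
      using yL(2)[of N] yL(2)[of 0] L2_norm_minus[of \<Omega> "\<lambda>z. 0" "y 0"] by simp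
  qed simp
  finally have "(L2_norm \<Omega> (\<lambda>z. shift e (dft e N j F) z - cis \<omega> * dft e N j F z))\<^sup>2 \<le> (1 / real N * (2 * L2_norm \<Omega> F))\<^sup>2"
    by (rule power_mono) simp
  then show ?thesis by (simp add: \<omega>_def power_mult_distrib power_divide)
qed

text \<open>The quantity \<open>q\<close> splits over the frequencies like a squared norm. Averaged
  over all frequencies, \<open>q\<close> and the translation defect are both under control, so one
  frequency is good for both: the ratio of \<open>q\<close> to the squared norm at most doubles, and
  the new defect is of order \<open>1 / N\<close>.\<close>

lemma dft_step:
  assumes q0: "\<And>f. q f \<ge> (0::real)" "q (\<lambda>z. 0) = 0"
    and qP: "\<And>f N. f \<in> bergman \<Omega> \<Longrightarrow> N > 0 \<Longrightarrow> (\<Sum>j<N. q (dft e N j f)) = q f"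
    and f: "f \<in> bergman \<Omega>" "L2_norm \<Omega> f > 0" "q f \<le> c * (L2_norm \<Omega> f)\<^sup>2"
    and pos: "c > 0" "\<epsilon> > 0"
  shows "\<exists>\<omega>\<in>{-pi..pi}. \<exists>f'\<in>bergman \<Omega>. L2_norm \<Omega> f' > 0 \<and> q f' \<le> 2 * c * (L2_norm \<Omega> f')\<^sup>2 \<and>
     (L2_norm \<Omega> (\<lambda>z. shift e f' z - cis \<omega> * f' z))\<^sup>2 \<le> \<epsilon> * (L2_norm \<Omega> f')\<^sup>2"
proof -
  \<comment> \<open>The selected frequency satisfies \<open>N / 4\<close> times the defect at most
    twice the squared norm, hence the defect ratio is at most \<open>8 / N\<close>.\<close>
  obtain N :: nat where N8: "8 / \<epsilon> < real N" using reals_Archimedean2 by blast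
  have "0 < 8 / \<epsilon>" using pos by simp
  then have N: "N > 0" "8 / real N \<le> \<epsilon>" 
  proof -
    have "real N > 0" using \<open>0 < 8 / \<epsilon>\<close> N8 by linarith
    then show "N > 0" "8 / real N \<le> \<epsilon>" using N8 pos by (auto simp: field_simps)
  qed
  define n2 where "n2 g = (L2_norm \<Omega> g)\<^sup>2" for g
  define b where "b j = (\<lambda>z. shift e (dft e N j f) z - cis (2 * pi * real j / real N - pi) * dft e N j f z)" for j
  have fL: "f \<in> L2 \<Omega>" by (rule A.in_L2[OF f(1)])
  \<comment> \<open>The weights \<open>1 / c\<close> and \<open>real N / 4\<close> are chosen so
    that each of the two parts of \<open>A\<close> sums to at most \<open>n2 f\<close> over all
    frequencies.\<close>
  define A where "A j = q (dft e N j f) / c + real N / 4 * n2 (b j)" for j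
  define B where "B j = 2 * n2 (dft e N j f)" for j
  have P: "(\<Sum>j<N. n2 (dft e N j f)) = n2 f" unfolding n2_def by (rule dft_Parseval[OF fL N(1)])
  have "(\<Sum>j<N. n2 (b j)) \<le> (\<Sum>j<N. 4 / (real N)\<^sup>2 * n2 f)"
    unfolding n2_def b_def by (intro sum_mono dft_boundary[OF fL N(1)])
  also have "\<dots> = 4 / real N * n2 f" using N(1) by (simp add: power2_eq_square)
  finally have "real N / 4 * (\<Sum>j<N. n2 (b j)) \<le> real N / 4 * (4 / real N * n2 f)" by (intro mult_left_mono) auto
  then have b: "real N / 4 * (\<Sum>j<N. n2 (b j)) \<le> n2 f" using N(1) by simp
  have "sum A {..<N} = (\<Sum>j<N. q (dft e N j f)) / c + real N / 4 * (\<Sum>j<N. n2 (b j))"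
    by (simp add: A_def sum.distrib sum_divide_distrib sum_distrib_left)
  also have "\<dots> \<le> n2 f + n2 f"
    using f(3) pos b qP[OF f(1) N(1)] by (intro add_mono) (auto simp: n2_def field_simps)
  also have "\<dots> = sum B {..<N}" using P by (simp add: B_def sum_distrib_left[symmetric])
  finally have "sum A {..<N} \<le> sum B {..<N}" .
  moreover have "sum B {..<N} > 0" using P f(2) by (simp add: B_def sum_distrib_left[symmetric] n2_def)
  moreover have "A j = 0" if "B j = 0" for j
  proof -
    have "L2_norm \<Omega> (dft e N j f) = 0" using that by (simp add: B_def n2_def)
    then have "dft e N j f = (\<lambda>z. 0)" using A.definite[OF dft_in[OF f(1)]] by blast
    then show ?thesis by (simp add: A_def b_def n2_def q0 shift_def)
  qed
  ultimately obtain j where j: "j < N" "B j > 0" "A j \<le> B j"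
    using pigeonhole_sum[of A N B] by (auto simp: B_def n2_def)
  define \<omega> where "\<omega> = 2 * pi * real j / real N - pi"
  have "real j / real N \<le> 1" using j(1) N(1) by simp
  then have "2 * pi * (real j / real N) \<le> 2 * pi * 1" by (intro mult_left_mono) auto
  then have "\<omega> \<in> {-pi..pi}" by (simp add: \<omega>_def)
  moreover have "q (dft e N j f) \<le> 2 * c * n2 (dft e N j f)"
  proof -
    have "q (dft e N j f) / c \<le> B j" using j(3) N(1) by (simp add: A_def n2_def) (smt (verit) zero_le_power2 mult_nonneg_nonneg divide_nonneg_nonneg of_nat_0_le_iff)
    then show ?thesis using pos(1) by (simp add: B_def field_simps)
  qed
  moreover have "n2 (b j) \<le> \<epsilon> * n2 (dft e N j f)"
  proof -
    have "q (dft e N j f) / c \<ge> 0" using q0(1) pos(1) by simp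
    then have "real N / 4 * n2 (b j) \<le> B j" using j(3) unfolding A_def by linarith
    then have "n2 (b j) \<le> 8 / real N * n2 (dft e N j f)" using N(1) by (simp add: B_def field_simps)
    also have "\<dots> \<le> \<epsilon> * n2 (dft e N j f)" by (rule mult_right_mono[OF N(2)]) (simp add: n2_def)
    finally show ?thesis .
  qed
  moreover have "L2_norm \<Omega> (dft e N j f) > 0"
    using j(2) by (simp add: B_def n2_def less_le)
  ultimately show ?thesis
    using dft_in[OF f(1), of e N j] unfolding n2_def b_def \<omega>_def by blast
qed

end

context toeplitz_setting
begin

lemma V_sum:
  fixes F :: "nat \<Rightarrow> complex \<Rightarrow> complex"
  shows "(\<And>i. i < n \<Longrightarrow> F i \<in> bergman \<Omega>) \<Longrightarrow> V (\<lambda>z. \<Sum>i<n. c i * F i z) = (\<lambda>z. \<Sum>i<n. c i * V (F i) z)"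
proof (induction n)
  case 0
  then show ?case using TA_pair.V_zero by simp
next
  case (Suc n)
  have 1: "(\<lambda>z. \<Sum>i<n. c i * F i z) \<in> bergman \<Omega>" by (rule A.sum_in) (use Suc.prems in auto)
  have 2: "F n \<in> bergman \<Omega>" using Suc.prems by simp
  show ?case
    using TA_pair.V_add[OF 1 A.scale[OF 2]] TA_pair.V_scale[OF 2] Suc by simp
qed

lemma V_dft: "f \<in> bergman \<Omega> \<Longrightarrow> V (dft e N j f) = dft e N j (V f)"
  unfolding dft_def[abs_def] by (subst V_sum) (auto simp: bergman_shift V_shift)

definition approximate_eigen :: "real \<times> real \<Rightarrow> bool" where
  "approximate_eigen \<eta> \<longleftrightarrow> (\<forall>\<epsilon>>0. \<exists>f\<in>bergman \<Omega>. L2_norm \<Omega> f > 0 \<and>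
     (L2_norm \<Omega> (V f))\<^sup>2 \<le> \<epsilon> * (L2_norm \<Omega> f)\<^sup>2 \<and>
     (\<forall>e\<in>{(1, 0), (0, 1)}. (L2_norm \<Omega> (\<lambda>z. shift e f z - phase \<eta> e * f z))\<^sup>2 \<le> \<epsilon> * (L2_norm \<Omega> f)\<^sup>2))"

text \<open>One Fourier step in each lattice direction. The second must preserve what the first
  achieved, so the defect in the direction \<open>(1, 0)\<close> is added to the quadratic quantity;
  it commutes with the second Fourier sum. Starting from \<open>\<epsilon> / 8\<close>, the first
  step leaves \<open>\<epsilon> / 4\<close> for each of the two parts, together
  \<open>\<epsilon> / 2\<close>, and the second step doubles this to
  \<open>\<epsilon>\<close>.\<close>

lemma joint_approximate_eigenfunctions:
  assumes nb: "\<not> bounded_below_on (bergman \<Omega>) (L2_norm \<Omega>) V" and \<epsilon>: "\<epsilon> > 0"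
  shows "\<exists>\<eta>\<in>{-pi..pi} \<times> {-pi..pi}. \<exists>f\<in>bergman \<Omega>. L2_norm \<Omega> f > 0 \<and>
     (L2_norm \<Omega> (V f))\<^sup>2 \<le> \<epsilon> * (L2_norm \<Omega> f)\<^sup>2 \<and>
     (\<forall>e\<in>{(1, 0), (0, 1)}. (L2_norm \<Omega> (\<lambda>z. shift e f z - phase \<eta> e * f z))\<^sup>2 \<le> \<epsilon> * (L2_norm \<Omega> f)\<^sup>2)"
proof -
  define n2 where "n2 f = (L2_norm \<Omega> f)\<^sup>2" for f
  have "\<not> (\<forall>f\<in>bergman \<Omega>. sqrt (\<epsilon> / 8) * L2_norm \<Omega> f \<le> L2_norm \<Omega> (V f))"
    using nb \<epsilon> unfolding bounded_below_on_def by auto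
  then obtain f0 where f0: "f0 \<in> bergman \<Omega>" "L2_norm \<Omega> (V f0) < sqrt (\<epsilon> / 8) * L2_norm \<Omega> f0" by (auto simp: not_le)
  have f0p: "L2_norm \<Omega> f0 > 0"
    using f0(2) L2_norm_nonneg[of \<Omega> "V f0"] L2_norm_nonneg[of \<Omega> f0] by (cases "L2_norm \<Omega> f0 = 0") (auto simp: less_le)
  have "n2 (V f0) \<le> (sqrt (\<epsilon> / 8) * L2_norm \<Omega> f0)\<^sup>2" unfolding n2_def using f0(2) by (intro power_mono) auto
  then have f0q: "n2 (V f0) \<le> \<epsilon> / 8 * n2 f0" using \<epsilon> by (simp add: n2_def power_mult_distrib)
  have V0: "V (\<lambda>z. 0) = (\<lambda>z. 0)" by (rule TA_pair.V_zero)
  have VP: "(\<Sum>j<N. n2 (V (dft e N j f))) = n2 (V f)" if "f \<in> bergman \<Omega>" "N > 0" for f N e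
    unfolding V_dft[OF that(1)] n2_def by (rule dft_Parseval[OF A.in_L2[OF V_in[OF that(1)]] that(2)])
  have "\<exists>\<omega>\<in>{-pi..pi}. \<exists>f'\<in>bergman \<Omega>. L2_norm \<Omega> f' > 0 \<and> n2 (V f') \<le> 2 * (\<epsilon> / 8) * (L2_norm \<Omega> f')\<^sup>2 \<and>
     (L2_norm \<Omega> (\<lambda>z. shift (1, 0) f' z - cis \<omega> * f' z))\<^sup>2 \<le> (\<epsilon> / 4) * (L2_norm \<Omega> f')\<^sup>2"
    by (rule dft_step[where f = f0]) (use f0(1) f0p f0q \<epsilon> VP V0 in \<open>auto simp: n2_def\<close>)
  then obtain \<omega>1 f1 where f1: "\<omega>1 \<in> {-pi..pi}" "f1 \<in> bergman \<Omega>" "L2_norm \<Omega> f1 > 0" "n2 (V f1) \<le> \<epsilon> / 4 * n2 f1"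
    "n2 (\<lambda>z. shift (1, 0) f1 z - cis \<omega>1 * f1 z) \<le> \<epsilon> / 4 * n2 f1" by (auto simp: n2_def)
  define d where "d f = (\<lambda>z. shift (1, 0) f z - cis \<omega>1 * f z)" for f
  have dP: "(\<Sum>j<N. n2 (d (dft e N j f))) = n2 (d f)" if "f \<in> bergman \<Omega>" "N > 0" for f N e
  proof -
    have "d (dft e N j f) = dft e N j (d f)" for j
      by (auto simp: d_def dft_def shift_def sum_subtractf sum_distrib_left right_diff_distrib mult_ac add_ac)
    moreover have "d f \<in> L2 \<Omega>"
      unfolding d_def using A.in_L2[OF that(1)] by (intro L2_diff L2_shift L2_scale)
    ultimately show ?thesis unfolding n2_def using dft_Parseval[OF _ that(2)] by simp
  qed
  have "\<exists>\<omega>\<in>{-pi..pi}. \<exists>f'\<in>bergman \<Omega>. L2_norm \<Omega> f' > 0 \<and> n2 (V f') + n2 (d f') \<le> 2 * (\<epsilon> / 2) * (L2_norm \<Omega> f')\<^sup>2 \<and>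
     (L2_norm \<Omega> (\<lambda>z. shift (0, 1) f' z - cis \<omega> * f' z))\<^sup>2 \<le> \<epsilon> * (L2_norm \<Omega> f')\<^sup>2"
  proof (rule dft_step[where f = f1 and q = "\<lambda>f. n2 (V f) + n2 (d f)"])
    show "n2 (V f) + n2 (d f) \<ge> 0" for f by (simp add: n2_def)
    show "n2 (V (\<lambda>z. 0)) + n2 (d (\<lambda>z. 0)) = 0" by (simp add: V0 d_def shift_def n2_def)
    show "(\<Sum>j<N. n2 (V (dft (0, 1) N j f)) + n2 (d (dft (0, 1) N j f))) = n2 (V f) + n2 (d f)"
      if "f \<in> bergman \<Omega>" "N > 0" for f N
      using VP[OF that] dP[OF that] by (simp add: sum.distrib)
    show "n2 (V f1) + n2 (d f1) \<le> \<epsilon> / 2 * (L2_norm \<Omega> f1)\<^sup>2" using f1(4,5) by (simp add: d_def n2_def)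
  qed (use f1 \<epsilon> in auto)
  then obtain \<omega>2 f2 where f2: "\<omega>2 \<in> {-pi..pi}" "f2 \<in> bergman \<Omega>" "L2_norm \<Omega> f2 > 0" "n2 (V f2) + n2 (d f2) \<le> \<epsilon> * n2 f2"
    "n2 (\<lambda>z. shift (0, 1) f2 z - cis \<omega>2 * f2 z) \<le> \<epsilon> * n2 f2" by (auto simp: n2_def)
  have "n2 (V f2) \<ge> 0" "n2 (d f2) \<ge> 0" by (auto simp: n2_def)
  then have "n2 (V f2) \<le> \<epsilon> * n2 f2" "n2 (d f2) \<le> \<epsilon> * n2 f2" using f2(4) by linarith+
  moreover have "phase (\<omega>1, \<omega>2) (1, 0) = cis \<omega>1" "phase (\<omega>1, \<omega>2) (0, 1) = cis \<omega>2" by (auto simp: phase_def)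
  ultimately show ?thesis
    using f1(1) f2 by (intro bexI[of _ "(\<omega>1, \<omega>2)"] bexI[of _ f2]) (auto simp: n2_def d_def)
qed

text \<open>The quasi-momentum found for accuracy \<open>1 / Suc m\<close> depends on
  \<open>m\<close>. Along a convergent subsequence it is replaced by the limit: the phases of the
  two generators depend continuously on \<open>\<eta>\<close>, and the change adds a small multiple
  of the function to each defect.\<close>

lemma approximate_eigen_exists:
  assumes nb: "\<not> bounded_below_on (bergman \<Omega>) (L2_norm \<Omega>) V"
  shows "\<exists>\<eta>\<in>{-pi..pi} \<times> {-pi..pi}. approximate_eigen \<eta>"
proof -
  define P where "P \<epsilon> \<eta> f \<longleftrightarrow> f \<in> bergman \<Omega> \<and> L2_norm \<Omega> f > 0 \<and>
     (L2_norm \<Omega> (V f))\<^sup>2 \<le> \<epsilon> * (L2_norm \<Omega> f)\<^sup>2 \<and>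
     (\<forall>e\<in>{(1, 0), (0, 1)}. (L2_norm \<Omega> (\<lambda>z. shift e f z - phase \<eta> e * f z))\<^sup>2 \<le> \<epsilon> * (L2_norm \<Omega> f)\<^sup>2)" for \<epsilon> \<eta> f
  have "\<forall>m::nat. \<exists>\<eta> f. \<eta> \<in> {-pi..pi} \<times> {-pi..pi} \<and> P (1 / real (Suc m)) \<eta> f"
  proof
    fix m :: nat
    have "1 / real (Suc m) > 0" by simp
    from joint_approximate_eigenfunctions[OF nb this]
    show "\<exists>\<eta> f. \<eta> \<in> {-pi..pi} \<times> {-pi..pi} \<and> P (1 / real (Suc m)) \<eta> f" unfolding P_def by blast
  qed
  then obtain \<eta> f where \<eta>: "\<And>m. \<eta> m \<in> {-pi..pi} \<times> {-pi..pi}" and f: "\<And>m. P (1 / real (Suc m)) (\<eta> m) (f m)" by metis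
  have "seq_compact ({-pi..pi} \<times> {-pi..pi})"
    by (intro compact_imp_seq_compact compact_Times) auto
  then obtain l r where l: "l \<in> {-pi..pi} \<times> {-pi..pi}" "strict_mono (r :: nat \<Rightarrow> nat)" "(\<eta> \<circ> r) \<longlonglongrightarrow> l"
    using \<eta> unfolding seq_compact_def by metis
  have "approximate_eigen l"
    unfolding approximate_eigen_def
  proof (intro allI impI)
    fix \<epsilon> :: real assume \<epsilon>: "\<epsilon> > 0"
    have ph: "(\<lambda>m. phase (\<eta> (r m)) e) \<longlonglongrightarrow> phase l e" for e
      unfolding phase_def using l(3) by (intro tendsto_cis tendsto_add tendsto_mult tendsto_const tendsto_fst tendsto_snd) (simp_all add: o_def)
    have ev: "\<forall>\<^sub>F m in sequentially. dist (phase (\<eta> (r m)) e) (phase l e) < sqrt (\<epsilon> / 4)" for e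
      using tendstoD[OF ph, of "sqrt (\<epsilon> / 4)"] \<epsilon> by simp
    have "\<forall>\<^sub>F m in sequentially. inverse (real (Suc m)) < \<epsilon> / 4"
      using order_tendstoD(2)[OF LIMSEQ_inverse_real_of_nat, of "\<epsilon> / 4"] \<epsilon> by simp
    from eventually_conj[OF this eventually_conj[OF ev[of "(1, 0)"] ev[of "(0, 1)"]]]
    obtain m where m: "inverse (real (Suc m)) < \<epsilon> / 4" "\<forall>e\<in>{(1, 0), (0, 1)}. dist (phase (\<eta> (r m)) e) (phase l e) < sqrt (\<epsilon> / 4)"
      by (auto simp: eventually_sequentially)
    define g where "g = f (r m)"
    define \<delta> where "\<delta> = 1 / real (Suc (r m))"
    have "m \<le> r m" using l(2) by (rule seq_suble)
    then have "\<delta> \<le> inverse (real (Suc m))" unfolding \<delta>_def by (simp add: inverse_eq_divide frac_le)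
    then have \<delta>: "\<delta> \<le> \<epsilon> / 4" using m(1) by simp
    have g: "P \<delta> (\<eta> (r m)) g" unfolding g_def \<delta>_def by (rule f)
    then have gb: "g \<in> bergman \<Omega>" "L2_norm \<Omega> g > 0" "(L2_norm \<Omega> (V g))\<^sup>2 \<le> \<delta> * (L2_norm \<Omega> g)\<^sup>2"
      "\<And>e. e \<in> {(1, 0), (0, 1)} \<Longrightarrow> (L2_norm \<Omega> (\<lambda>z. shift e g z - phase (\<eta> (r m)) e * g z))\<^sup>2 \<le> \<delta> * (L2_norm \<Omega> g)\<^sup>2"
      unfolding P_def by blast+
    have gL: "g \<in> L2 \<Omega>" by (rule A.in_L2[OF gb(1)])
    have n: "(L2_norm \<Omega> (\<lambda>z. shift e g z - phase l e * g z))\<^sup>2 \<le> \<epsilon> * (L2_norm \<Omega> g)\<^sup>2" if e: "e \<in> {(1, 0), (0, 1)}" for e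
    proof -
      define u v where "u = (\<lambda>z. shift e g z - phase (\<eta> (r m)) e * g z)" and "v = (\<lambda>z. (phase (\<eta> (r m)) e - phase l e) * g z)"
      have uv: "u \<in> L2 \<Omega>" "v \<in> L2 \<Omega>" unfolding u_def v_def by (intro L2_diff L2_shift L2_scale gL)+
      have "(\<lambda>z. shift e g z - phase l e * g z) = (\<lambda>z. u z + v z)" by (auto simp: u_def v_def algebra_simps)
      then have "L2_norm \<Omega> (\<lambda>z. shift e g z - phase l e * g z) \<le> L2_norm \<Omega> u + L2_norm \<Omega> v"
        using L2_norm_triangle[OF uv] by simp
      then have "(L2_norm \<Omega> (\<lambda>z. shift e g z - phase l e * g z))\<^sup>2 \<le> (L2_norm \<Omega> u + L2_norm \<Omega> v)\<^sup>2"
        by (rule power_mono) simp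
      also have "\<dots> \<le> 2 * (L2_norm \<Omega> u)\<^sup>2 + 2 * (L2_norm \<Omega> v)\<^sup>2"
        using zero_le_power2[of "L2_norm \<Omega> u - L2_norm \<Omega> v"] by (simp add: power2_eq_square algebra_simps)
      finally have 1: "(L2_norm \<Omega> (\<lambda>z. shift e g z - phase l e * g z))\<^sup>2 \<le> 2 * (L2_norm \<Omega> u)\<^sup>2 + 2 * (L2_norm \<Omega> v)\<^sup>2" .
      have "(L2_norm \<Omega> u)\<^sup>2 \<le> \<delta> * (L2_norm \<Omega> g)\<^sup>2" unfolding u_def by (rule gb(4)[OF e])
      also have "\<dots> \<le> \<epsilon> / 4 * (L2_norm \<Omega> g)\<^sup>2" by (intro mult_right_mono \<delta>) simp
      finally have 2: "(L2_norm \<Omega> u)\<^sup>2 \<le> \<epsilon> / 4 * (L2_norm \<Omega> g)\<^sup>2" .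
      have "cmod (phase (\<eta> (r m)) e - phase l e) < sqrt (\<epsilon> / 4)" using m(2) e by (simp only: dist_norm)
      then have "(cmod (phase (\<eta> (r m)) e - phase l e))\<^sup>2 \<le> (sqrt (\<epsilon> / 4))\<^sup>2" by (intro power_mono) auto
      then have "(cmod (phase (\<eta> (r m)) e - phase l e))\<^sup>2 \<le> \<epsilon> / 4" using \<epsilon> by simp
      then have 3: "(L2_norm \<Omega> v)\<^sup>2 \<le> \<epsilon> / 4 * (L2_norm \<Omega> g)\<^sup>2"
        unfolding v_def L2_norm_scale power_mult_distrib by (intro mult_right_mono) auto
      show ?thesis using 1 2 3 by simp
    qed
    have "(L2_norm \<Omega> (V g))\<^sup>2 \<le> \<epsilon> * (L2_norm \<Omega> g)\<^sup>2"
      by (rule order_trans[OF gb(3) mult_right_mono]) (use \<delta> \<epsilon> in auto)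
    then show "\<exists>f\<in>bergman \<Omega>. L2_norm \<Omega> f > 0 \<and> (L2_norm \<Omega> (V f))\<^sup>2 \<le> \<epsilon> * (L2_norm \<Omega> f)\<^sup>2 \<and>
     (\<forall>e\<in>{(1, 0), (0, 1)}. (L2_norm \<Omega> (\<lambda>z. shift e f z - phase l e * f z))\<^sup>2 \<le> \<epsilon> * (L2_norm \<Omega> f)\<^sup>2)"
      using gb(1,2) n by blast
  qed
  then show ?thesis using l(1) by blast
qed

end

text \<open>Every lattice vector is a sum of generators and their negatives. Applied to the norms of
  the translation defects, it controls the finitely many \<open>k\<close> that matter by the two
  generators.\<close>

lemma subadditive_bound:
  fixes N :: "int \<times> int \<Rightarrow> real"
  assumes sub: "\<And>k l. N (k + l) \<le> N k + N l" and sym: "\<And>k. N (- k) = N k" and zero: "N 0 = 0"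
  shows "N k \<le> real_of_int \<bar>fst k\<bar> * N (1, 0) + real_of_int \<bar>snd k\<bar> * N (0, 1)"
proof -
  have nat: "N (int n * fst e, int n * snd e) \<le> real n * N e" for n e
  proof (induction n)
    case 0
    then show ?case using zero by (simp add: zero_prod_def)
  next
    case (Suc n)
    have "(int (Suc n) * fst e, int (Suc n) * snd e) = (int n * fst e, int n * snd e) + e"
      by (simp add: prod_eq_iff algebra_simps)
    then show ?case using sub[of "(int n * fst e, int n * snd e)" e] Suc by (simp add: algebra_simps)
  qed
  have int: "N (i * fst e, i * snd e) \<le> real_of_int \<bar>i\<bar> * N e" for i e
  proof (cases "i \<ge> 0")
    case True
    then show ?thesis using nat[of "nat i" e] by simp
  next
    case False
    have "(i * fst e, i * snd e) = - (int (nat (- i)) * fst e, int (nat (- i)) * snd e)"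
      using False by (simp add: prod_eq_iff)
    then show ?thesis using nat[of "nat (- i)" e] sym[of "(i * fst e, i * snd e)"] False by simp
  qed
  have "N (fst k, 0) \<le> real_of_int \<bar>fst k\<bar> * N (1, 0)" "N (0, snd k) \<le> real_of_int \<bar>snd k\<bar> * N (0, 1)"
    using int[of "fst k" "(1, 0)"] int[of "snd k" "(0, 1)"] by simp_all
  moreover have "N k \<le> N (fst k, 0) + N (0, snd k)" using sub[of "(fst k, 0)" "(0, snd k)"] by simp
  ultimately show ?thesis by linarith
qed

section \<open>From the cell to the domain: exclusion of approximate eigenfunctions\<close>

context toeplitz_setting
begin

text \<open>The lower bound is applied to the periodization \<open>G\<close> of \<open>w\<close>,
  and \<open>eta_estimate\<close> bounds its image. Passing between \<open>G\<close> and
  \<open>w\<close> on the cell costs the weighted translation defect \<open>E\<close>, while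
  \<open>T\<close> collects \<open>V w\<close> on all cells with weights \<open>h\<close>. Both
  remain lattice sums, so that the estimate can be summed over all translates of
  \<open>w\<close>.\<close>

lemma cell_estimate:
  assumes \<kappa>: "\<kappa> > 0" "\<And>f. f \<in> bergman_eta W \<eta> \<Longrightarrow> \<kappa> * L2_norm W f \<le> L2_norm W (V_eta \<eta> f)"
    and w: "w \<in> bergman \<Omega>"
  defines "k2 \<equiv> ennreal (\<kappa>\<^sup>2)" and "c \<equiv> ennreal (\<gamma>\<^sup>2)" and "Hh \<equiv> ennreal h_total"
    and "E \<equiv> latsum (\<lambda>k. ennreal (h k) * sqint W (\<lambda>z. shift k w z - phase \<eta> k * w z))"
    and "T \<equiv> latsum (\<lambda>k. ennreal (h k) * sqint W (shift k (V w)))"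
  shows "k2 * sqint W w \<le> 2 * (Hh * (4 * c * (Hh * Hh) * E + 4 * c * E + 2 * T)) + 2 * (k2 * (Hh * E))"
proof -
  define G where "G = periodize \<eta> w"
  define d where "d = sqint W (\<lambda>z. G z - w z)"
  define e where "e k = sqint W (\<lambda>z. shift k w z - phase \<eta> k * w z)" for k
  define t where "t k = sqint W (shift k (V w))" for k
  define s where "s k = sqint W (\<lambda>z. phase \<eta> k * G z - shift k w z)" for k
  have GL: "G \<in> L2 W" unfolding G_def by (rule periodize_L2[OF w])
  have Gm: "G \<in> borel_measurable (lebesgue_on W)" by (rule L2_measurable[OF GL])
  have wm: "w \<in> borel_measurable (lebesgue_on W)" by (rule measurable_W[OF bergman_meas[OF w]])
  have swm: "shift k w \<in> borel_measurable (lebesgue_on W)" for k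
    by (rule measurable_W[OF measurable_shift[OF bergman_meas[OF w]]])
  have a: "d \<le> Hh * E" unfolding d_def G_def Hh_def E_def by (rule sqint_periodize_diff[OF w])
  have sk: "s k \<le> 2 * d + 2 * e k" for k
  proof -
    have "s k = sqint W (\<lambda>z. phase \<eta> k * (G z - w z) + (phase \<eta> k * w z - shift k w z))"
      unfolding s_def by (rule arg_cong[of _ _ "sqint W"]) (auto simp: algebra_simps)
    also have "\<dots> \<le> 2 * sqint W (\<lambda>z. phase \<eta> k * (G z - w z)) + 2 * sqint W (\<lambda>z. phase \<eta> k * w z - shift k w z)"
      by (intro sqint_add borel_measurable_times borel_measurable_diff borel_measurable_const Gm wm swm)
    also have "sqint W (\<lambda>z. phase \<eta> k * (G z - w z)) = d"
      using Gm wm by (subst sqint_scale) (auto simp: d_def)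
    also have "sqint W (\<lambda>z. phase \<eta> k * w z - shift k w z) = e k" unfolding e_def by (rule sqint_minus)
    finally show ?thesis .
  qed
  have cG: "cell_part G \<in> bergman_eta W \<eta>"
    unfolding G_def using periodize_ext[OF w] bergman_ext_subset by blast
  have "k2 * sqint W G \<le> sqint W (V_eta \<eta> (cell_part G))"
  proof -
    have "(\<kappa> * L2_norm W (cell_part G))\<^sup>2 \<le> (L2_norm W (V_eta \<eta> (cell_part G)))\<^sup>2"
      using \<kappa>(1) \<kappa>(2)[OF cG] by (intro power_mono) auto
    then have "ennreal (\<kappa>\<^sup>2 * (L2_norm W (cell_part G))\<^sup>2) \<le> ennreal ((L2_norm W (V_eta \<eta> (cell_part G)))\<^sup>2)"
      by (intro ennreal_leI) (simp add: power_mult_distrib)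
    then show ?thesis
      using sqint_eq_L2_norm[OF A_eta.in_L2[OF cG]] sqint_eq_L2_norm[OF A_eta.in_L2[OF V_eta_in[OF cG]]]
      by (simp add: k2_def ennreal_mult sqint_cell_part)
  qed
  also have "\<dots> \<le> Hh * latsum (\<lambda>k. ennreal (h k) * (2 * (c * s k) + 2 * t k))"
    using eta_estimate[OF w, of \<eta>] unfolding G_def Hh_def c_def s_def t_def .
  also have "\<dots> \<le> Hh * latsum (\<lambda>k. ennreal (h k) * (2 * (c * (2 * d + 2 * e k)) + 2 * t k))"
    by (intro mult_left_mono latsum_mono add_mono sk) auto
  also have "(\<lambda>k. ennreal (h k) * (2 * (c * (2 * d + 2 * e k)) + 2 * t k)) =
      (\<lambda>k. (4 * c * d) * ennreal (h k) + (4 * c) * (ennreal (h k) * e k) + 2 * (ennreal (h k) * t k))"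
    by (rule ext) (simp add: algebra_simps flip: mult_2)
  also have "latsum \<dots> = 4 * c * d * Hh + 4 * c * E + 2 * T"
    by (simp only: latsum_add latsum_cmult latsum_h E_def T_def Hh_def e_def t_def)
  also have "Hh * \<dots> \<le> Hh * (4 * c * (Hh * E) * Hh + 4 * c * E + 2 * T)"
    by (intro mult_left_mono add_mono mult_right_mono a) auto
  also have "4 * c * (Hh * E) * Hh = 4 * c * (Hh * Hh) * E" by (simp only: mult_ac)
  finally have b: "k2 * sqint W G \<le> Hh * (4 * c * (Hh * Hh) * E + 4 * c * E + 2 * T)" .
  have "sqint W w = sqint W (\<lambda>z. G z + (w z - G z))" by simp
  also have "\<dots> \<le> 2 * sqint W G + 2 * sqint W (\<lambda>z. w z - G z)"
    by (intro sqint_add borel_measurable_diff Gm wm)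
  also have "sqint W (\<lambda>z. w z - G z) = d" unfolding d_def by (rule sqint_minus)
  finally have "k2 * sqint W w \<le> k2 * (2 * sqint W G + 2 * d)" by (rule mult_left_mono) simp
  also have "\<dots> = 2 * (k2 * sqint W G) + 2 * (k2 * d)" by (simp only: distrib_left mult.left_commute)
  also have "\<dots> \<le> 2 * (Hh * (4 * c * (Hh * Hh) * E + 4 * c * E + 2 * T)) + 2 * (k2 * (Hh * E))"
    by (intro mult_left_mono add_mono a b) auto
  finally show ?thesis .
qed

text \<open>The sum of \<open>cell_estimate\<close> over all translates \<open>shift p g\<close>.
  Interchanging the lattice sums assembles the cell norms into norms on \<open>\<Omega>\<close>, and
  since \<open>V\<close> commutes with translations the sum of the weights in \<open>T\<close>
  contributes the factor \<open>h_total\<close>.\<close>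

lemma domain_estimate:
  assumes \<kappa>: "\<kappa> > 0" "\<And>f. f \<in> bergman_eta W \<eta> \<Longrightarrow> \<kappa> * L2_norm W f \<le> L2_norm W (V_eta \<eta> f)"
    and g: "g \<in> bergman \<Omega>"
  defines "k2 \<equiv> ennreal (\<kappa>\<^sup>2)" and "c \<equiv> ennreal (\<gamma>\<^sup>2)" and "Hh \<equiv> ennreal h_total"
    and "E \<equiv> latsum (\<lambda>k. ennreal (h k) * sqint \<Omega> (\<lambda>z. shift k g z - phase \<eta> k * g z))"
  shows "k2 * sqint \<Omega> g \<le> 2 * (Hh * (4 * c * (Hh * Hh) * E + 4 * c * E + 2 * (Hh * sqint \<Omega> (V g)))) + 2 * (k2 * (Hh * E))"
proof -
  define Ep where "Ep p = latsum (\<lambda>k. ennreal (h k) * sqint W (\<lambda>z. shift k (shift p g) z - phase \<eta> k * shift p g z))" for p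
  define Tp where "Tp p = latsum (\<lambda>k. ennreal (h k) * sqint W (shift k (V (shift p g))))" for p
  have gm: "g \<in> borel_measurable (lebesgue_on \<Omega>)" by (rule bergman_meas[OF g])
  have Vm: "V g \<in> borel_measurable (lebesgue_on \<Omega>)" by (rule bergman_meas[OF V_in[OF g]])
  have E: "latsum Ep = E"
  proof -
    have dm: "(\<lambda>z. shift k g z - phase \<eta> k * g z) \<in> borel_measurable (lebesgue_on \<Omega>)" for k
      using gm measurable_shift[OF gm, of k] by measurable
    have sh: "(\<lambda>z. shift k (shift p g) z - phase \<eta> k * shift p g z) = shift p (\<lambda>z. shift k g z - phase \<eta> k * g z)" for k p
      by (simp add: shift_def fun_eq_iff add_ac)
    have "latsum Ep = latsum (\<lambda>k. latsum (\<lambda>p. ennreal (h k) * sqint W (shift p (\<lambda>z. shift k g z - phase \<eta> k * g z))))"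
      unfolding Ep_def sh by (rule latsum_swap)
    then show ?thesis unfolding E_def latsum_cmult sqint_\<Omega>[OF dm] .
  qed
  have T: "latsum Tp = Hh * sqint \<Omega> (V g)"
  proof -
    have "latsum Tp = latsum (\<lambda>k. latsum (\<lambda>p. ennreal (h k) * sqint W (shift (p + k) (V g))))"
      unfolding Tp_def V_shift[OF g] shift_shift by (subst latsum_swap) (simp only: add.commute)
    also have "\<dots> = latsum (\<lambda>k. ennreal (h k) * sqint \<Omega> (V g))"
      unfolding latsum_cmult sqint_\<Omega>[OF Vm] latsum_shift[of "\<lambda>p. sqint W (shift p (V g))"] ..
    also have "\<dots> = latsum (\<lambda>k. sqint \<Omega> (V g) * ennreal (h k))" by (simp only: mult.commute)
    finally show ?thesis unfolding latsum_cmult latsum_h Hh_def by (simp only: mult.commute)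
  qed
  have "k2 * sqint \<Omega> g = latsum (\<lambda>p. k2 * sqint W (shift p g))" unfolding sqint_\<Omega>[OF gm] latsum_cmult ..
  also have "\<dots> \<le> latsum (\<lambda>p. 2 * (Hh * (4 * c * (Hh * Hh) * Ep p + 4 * c * Ep p + 2 * Tp p)) + 2 * (k2 * (Hh * Ep p)))"
    unfolding k2_def c_def Hh_def Ep_def Tp_def
    by (intro latsum_mono cell_estimate[OF \<kappa> bergman_shift[OF g]])
  also have "\<dots> = 2 * (Hh * (4 * c * (Hh * Hh) * E + 4 * c * E + 2 * (Hh * sqint \<Omega> (V g)))) + 2 * (k2 * (Hh * E))"
    by (simp only: latsum_add latsum_cmult E T)
  finally show ?thesis .
qed

text \<open>The defects satisfy the cocycle identity
  \<open>d (k + l) = phase \<eta> l * d k + shift k (d l)\<close>, and translations are isometric,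
  so their norms are subadditive and even in \<open>k\<close>.\<close>

lemma shift_defect:
  assumes f: "f \<in> bergman \<Omega>"
  shows "L2_norm \<Omega> (\<lambda>z. shift k f z - phase \<eta> k * f z) \<le>
    real_of_int \<bar>fst k\<bar> * L2_norm \<Omega> (\<lambda>z. shift (1, 0) f z - phase \<eta> (1, 0) * f z) +
    real_of_int \<bar>snd k\<bar> * L2_norm \<Omega> (\<lambda>z. shift (0, 1) f z - phase \<eta> (0, 1) * f z)"
proof (rule subadditive_bound)
  have fL: "f \<in> L2 \<Omega>" by (rule A.in_L2[OF f])
  define d where "d k = (\<lambda>z. shift k f z - phase \<eta> k * f z)" for k
  have dL: "d k \<in> L2 \<Omega>" for k unfolding d_def by (intro L2_diff L2_shift L2_scale fL)
  have d: "L2_norm \<Omega> (d (k + l)) \<le> L2_norm \<Omega> (d k) + L2_norm \<Omega> (d l)" for k l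
  proof -
    have "d (k + l) = (\<lambda>z. phase \<eta> l * d k z + shift k (d l) z)"
      by (simp add: d_def shift_def phase_add lat_add fun_eq_iff algebra_simps)
    then have "L2_norm \<Omega> (d (k + l)) \<le> L2_norm \<Omega> (\<lambda>z. phase \<eta> l * d k z) + L2_norm \<Omega> (shift k (d l))"
      using L2_norm_triangle[OF L2_scale[OF dL] L2_shift[OF dL]] by simp
    then show ?thesis by (simp add: L2_norm_scale L2_norm_shift[OF dL])
  qed
  then show "L2_norm \<Omega> (\<lambda>z. shift (k + l) f z - phase \<eta> (k + l) * f z) \<le>
    L2_norm \<Omega> (\<lambda>z. shift k f z - phase \<eta> k * f z) + L2_norm \<Omega> (\<lambda>z. shift l f z - phase \<eta> l * f z)" for k l
    unfolding d_def .
  show "L2_norm \<Omega> (\<lambda>z. shift (- k) f z - phase \<eta> (- k) * f z) = L2_norm \<Omega> (\<lambda>z. shift k f z - phase \<eta> k * f z)" for k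
  proof -
    have "phase \<eta> (- k) * phase \<eta> k = 1" using phase_add[of \<eta> "- k" k] by simp
    then have "d (- k) = (\<lambda>z. - phase \<eta> (- k) * shift (- k) (d k) z)"
      by (simp add: d_def shift_def lat_minus fun_eq_iff right_diff_distrib mult.assoc[symmetric])
    then show ?thesis unfolding d_def[symmetric] by (simp only: L2_norm_scale L2_norm_shift[OF dL] norm_minus_cancel norm_phase mult_1)
  qed
qed simp

text \<open>The weighted defect \<open>E\<close> is small: the finitely many translations in
  \<open>K\<close> are controlled by the two generators, all others by the trivial bound
  \<open>2 * n\<close>. Then \<open>domain_estimate\<close> bounds
  \<open>\<kappa>\<^sup>2 * n\<^sup>2\<close> by half of itself.\<close>

lemma no_approximate_eigen:
  assumes "bounded_below_on (bergman_eta W \<eta>) (L2_norm W) (V_eta \<eta>)"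
  shows "\<not> approximate_eigen \<eta>"
proof
  assume ap: "approximate_eigen \<eta>"
  obtain \<kappa> where \<kappa>: "\<kappa> > 0" "\<And>f. f \<in> bergman_eta W \<eta> \<Longrightarrow> \<kappa> * L2_norm W f \<le> L2_norm W (V_eta \<eta> f)"
    using assms by (auto simp: bounded_below_on_def)
  define c Hh where "c = \<gamma>\<^sup>2" and "Hh = h_total"
  have nn: "c \<ge> 0" "Hh \<ge> 0" "\<kappa>\<^sup>2 > 0" using h_total_nonneg \<kappa>(1) by (auto simp: c_def Hh_def)
  \<comment> \<open>The constants \<open>Q\<close> and \<open>R\<close> are the coefficients of
    \<open>E\<close> and of \<open>sqint \<Omega> (V f)\<close> in \<open>domain_estimate\<close>;
    \<open>e\<close> and \<open>\<epsilon>\<close> are chosen to make \<open>Q * e\<close> and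
    \<open>R * \<epsilon>\<close> at most \<open>\<kappa>\<^sup>2 / 4\<close> each.\<close>
  define Q where "Q = 2 * (Hh * (4 * c * (Hh * Hh) + 4 * c)) + 2 * (\<kappa>\<^sup>2 * Hh)"
  define R where "R = 4 * (Hh * Hh)"
  have QR: "Q \<ge> 0" "R \<ge> 0" unfolding Q_def R_def using nn by auto
  define e where "e = \<kappa>\<^sup>2 / (4 * (Q + 1))"
  have e: "e > 0" "Q * e \<le> \<kappa>\<^sup>2 / 4" using nn QR by (auto simp: e_def field_simps)
  have small: "\<exists>K \<delta>. finite K \<and> 0 < \<delta> \<and> (\<forall>b s. (\<forall>k. b k \<le> ennreal 4 * s) \<longrightarrow> (\<forall>k\<in>K. b k \<le> ennreal \<delta> * s) \<longrightarrow>
       latsum (\<lambda>k. ennreal (h k) * b k) \<le> ennreal e * s)" by (rule latsum_small) (use e in auto)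
  obtain K \<delta> where K: "finite K" "0 < \<delta>"
    "\<And>b s. \<lbrakk>\<forall>k. b k \<le> ennreal 4 * s; \<forall>k\<in>K. b k \<le> ennreal \<delta> * s\<rbrakk> \<Longrightarrow> latsum (\<lambda>k. ennreal (h k) * b k) \<le> ennreal e * s"
    using small by blast
  define M where "M = (\<Sum>k\<in>K. real_of_int (\<bar>fst k\<bar> + \<bar>snd k\<bar>))"
  have M0: "M \<ge> 0" unfolding M_def by (intro sum_nonneg) auto
  have M: "real_of_int \<bar>fst k\<bar> + real_of_int \<bar>snd k\<bar> \<le> M" if "k \<in> K" for k
    using member_le_sum[of k K "\<lambda>k. real_of_int (\<bar>fst k\<bar> + \<bar>snd k\<bar>)"] that K(1) by (simp add: M_def)
  define \<epsilon> where "\<epsilon> = min (\<delta> / (M + 1)\<^sup>2) (\<kappa>\<^sup>2 / (4 * (R + 1)))"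
  have "\<epsilon> > 0" using K(2) M0 nn QR by (simp add: \<epsilon>_def)
  have \<epsilon>1: "M\<^sup>2 * \<epsilon> \<le> \<delta>"
  proof -
    have "\<epsilon> \<le> \<delta> / (M + 1)\<^sup>2" by (simp add: \<epsilon>_def)
    then have "\<epsilon> * (M + 1)\<^sup>2 \<le> \<delta>" using M0 by (subst (asm) pos_le_divide_eq) auto
    moreover have "M\<^sup>2 * \<epsilon> \<le> (M + 1)\<^sup>2 * \<epsilon>" using M0 \<open>\<epsilon> > 0\<close> by (intro mult_right_mono power_mono) auto
    ultimately show ?thesis by (simp add: mult.commute)
  qed
  have \<epsilon>2: "R * \<epsilon> \<le> \<kappa>\<^sup>2 / 4"
  proof -
    have "\<epsilon> \<le> \<kappa>\<^sup>2 / (4 * (R + 1))" by (simp add: \<epsilon>_def)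
    then have "\<epsilon> * (4 * (R + 1)) \<le> \<kappa>\<^sup>2" using QR by (subst (asm) pos_le_divide_eq) auto
    then show ?thesis using \<open>\<epsilon> > 0\<close> by (simp add: algebra_simps)
  qed
  obtain f where f: "f \<in> bergman \<Omega>" "L2_norm \<Omega> f > 0" "(L2_norm \<Omega> (V f))\<^sup>2 \<le> \<epsilon> * (L2_norm \<Omega> f)\<^sup>2"
    "\<And>e. e \<in> {(1, 0), (0, 1)} \<Longrightarrow> (L2_norm \<Omega> (\<lambda>z. shift e f z - phase \<eta> e * f z))\<^sup>2 \<le> \<epsilon> * (L2_norm \<Omega> f)\<^sup>2"
    using ap \<open>\<epsilon> > 0\<close> unfolding approximate_eigen_def by blast
  define n where "n = L2_norm \<Omega> f"
  have fL: "f \<in> L2 \<Omega>" by (rule A.in_L2[OF f(1)])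
  define N where "N k = L2_norm \<Omega> (\<lambda>z. shift k f z - phase \<eta> k * f z)" for k
  have Nsq: "sqint \<Omega> (\<lambda>z. shift k f z - phase \<eta> k * f z) = ennreal ((N k)\<^sup>2)" for k
    unfolding N_def by (rule sqint_eq_L2_norm) (intro L2_diff L2_shift L2_scale fL)
  have N2: "N k \<le> 2 * n" for k
  proof -
    have "N k \<le> L2_norm \<Omega> (\<lambda>z. shift k f z - 0) + L2_norm \<Omega> (\<lambda>z. 0 - phase \<eta> k * f z)"
      unfolding N_def by (rule L2_norm_triangle_diff) (use L2_shift[OF fL] L2_scale[OF fL] in auto)
    also have "L2_norm \<Omega> (\<lambda>z. 0 - phase \<eta> k * f z) = n"
      using L2_norm_scale[of \<Omega> "- phase \<eta> k" f] by (simp add: n_def)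
    finally show ?thesis by (simp add: n_def L2_norm_shift[OF fL])
  qed
  have N1: "N e \<le> sqrt \<epsilon> * n" if "e \<in> {(1, 0), (0, 1)}" for e
  proof -
    have "(N e)\<^sup>2 \<le> (sqrt \<epsilon> * n)\<^sup>2" using f(4)[OF that] \<open>\<epsilon> > 0\<close> by (simp add: N_def n_def power_mult_distrib)
    then show ?thesis by (rule power2_le_imp_le) (use \<open>\<epsilon> > 0\<close> f(2) in \<open>auto simp: n_def\<close>)
  qed
  have NK: "(N k)\<^sup>2 \<le> \<delta> * n\<^sup>2" if "k \<in> K" for k
  proof -
    have "N k \<le> real_of_int \<bar>fst k\<bar> * N (1, 0) + real_of_int \<bar>snd k\<bar> * N (0, 1)"
      unfolding N_def by (rule shift_defect[OF f(1)])
    also have "\<dots> \<le> real_of_int \<bar>fst k\<bar> * (sqrt \<epsilon> * n) + real_of_int \<bar>snd k\<bar> * (sqrt \<epsilon> * n)"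
      by (intro add_mono mult_left_mono N1) auto
    also have "\<dots> = (real_of_int \<bar>fst k\<bar> + real_of_int \<bar>snd k\<bar>) * (sqrt \<epsilon> * n)" by (simp only: distrib_right)
    also have "\<dots> \<le> M * (sqrt \<epsilon> * n)"
      using \<open>\<epsilon> > 0\<close> f(2) by (intro mult_right_mono M that) (simp add: n_def)
    finally have "(N k)\<^sup>2 \<le> (M * (sqrt \<epsilon> * n))\<^sup>2" by (rule power_mono) (simp add: N_def)
    also have "\<dots> = (M\<^sup>2 * \<epsilon>) * n\<^sup>2" using \<open>\<epsilon> > 0\<close> by (simp add: power_mult_distrib)
    also have "\<dots> \<le> \<delta> * n\<^sup>2" by (intro mult_right_mono \<epsilon>1) simp
    finally show ?thesis .
  qed
  define E where "E = latsum (\<lambda>k. ennreal (h k) * sqint \<Omega> (\<lambda>z. shift k f z - phase \<eta> k * f z))"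
  have E: "E \<le> ennreal (e * n\<^sup>2)"
  proof -
    have "(N k)\<^sup>2 \<le> 4 * n\<^sup>2" for k
      using power_mono[OF N2[of k], of 2] by (simp add: N_def power_mult_distrib)
    then have "E \<le> ennreal e * ennreal (n\<^sup>2)"
      unfolding E_def Nsq using NK K(2)
      by (intro K(3)) (simp_all add: ennreal_leI del: ennreal_numeral flip: ennreal_mult)
    then show ?thesis using e by (simp add: ennreal_mult)
  qed
  have T: "sqint \<Omega> (V f) \<le> ennreal (\<epsilon> * n\<^sup>2)"
    using f(3) sqint_eq_L2_norm[OF A.in_L2[OF V_in[OF f(1)]]] by (simp add: n_def ennreal_leI)
  have "ennreal (\<kappa>\<^sup>2 * n\<^sup>2) = ennreal (\<kappa>\<^sup>2) * sqint \<Omega> f"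
    using sqint_eq_L2_norm[OF fL] by (simp add: ennreal_mult n_def)
  also have "\<dots> \<le> 2 * (ennreal Hh * (4 * ennreal c * (ennreal Hh * ennreal Hh) * E + 4 * ennreal c * E + 2 * (ennreal Hh * sqint \<Omega> (V f))))
      + 2 * (ennreal (\<kappa>\<^sup>2) * (ennreal Hh * E))"
    unfolding E_def c_def Hh_def by (rule domain_estimate[OF \<kappa> f(1)])
  also have "\<dots> \<le> 2 * (ennreal Hh * (4 * ennreal c * (ennreal Hh * ennreal Hh) * ennreal (e * n\<^sup>2) + 4 * ennreal c * ennreal (e * n\<^sup>2) + 2 * (ennreal Hh * ennreal (\<epsilon> * n\<^sup>2))))
      + 2 * (ennreal (\<kappa>\<^sup>2) * (ennreal Hh * ennreal (e * n\<^sup>2)))"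
    by (intro mult_left_mono add_mono E T) auto
  also have "\<dots> = ennreal (2 * (Hh * (4 * c * (Hh * Hh) * (e * n\<^sup>2) + 4 * c * (e * n\<^sup>2) + 2 * (Hh * (\<epsilon> * n\<^sup>2)))) + 2 * (\<kappa>\<^sup>2 * (Hh * (e * n\<^sup>2))))"
    using nn e \<open>\<epsilon> > 0\<close> by (simp add: ennreal_mult ennreal_plus)
  also have "\<dots> = ennreal ((Q * e + R * \<epsilon>) * n\<^sup>2)"
    by (rule arg_cong[of _ _ ennreal]) (simp add: Q_def R_def algebra_simps)
  also have "\<dots> \<le> ennreal ((\<kappa>\<^sup>2 / 2) * n\<^sup>2)"
    using e(2) \<epsilon>2 by (intro ennreal_leI mult_right_mono) auto
  finally have "\<kappa>\<^sup>2 * n\<^sup>2 \<le> \<kappa>\<^sup>2 / 2 * n\<^sup>2" by (subst (asm) ennreal_le_iff) auto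
  moreover have "\<kappa>\<^sup>2 * n\<^sup>2 > 0" using \<kappa>(1) f(2) by (simp add: n_def)
  ultimately show False by simp
qed

lemma bounded_below_iff:
  "bounded_below_on (bergman \<Omega>) (L2_norm \<Omega>) V \<longleftrightarrow>
   (\<forall>\<eta>\<in>{-pi..pi} \<times> {-pi..pi}. bounded_below_on (bergman_eta W \<eta>) (L2_norm W) (V_eta \<eta>))"
  using eta_bounded_below no_approximate_eigen approximate_eigen_exists by blast

end

section \<open>Functions annihilated by a polynomial in a shift\<close>

text \<open>The polynomial \<open>p\<close> evaluated at the shift operator and applied to the
  two-sided sequence \<open>y\<close>.\<close>

definition recurrence :: "complex poly \<Rightarrow> (int \<Rightarrow> complex) \<Rightarrow> int \<Rightarrow> complex" where
  "recurrence p y i = (\<Sum>k\<le>degree p. coeff p k * y (i + int k))"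

lemma recurrence_eq: "degree p \<le> n \<Longrightarrow> recurrence p y i = (\<Sum>k\<le>n. coeff p k * y (i + int k))"
  unfolding recurrence_def by (rule sum.mono_neutral_left) (auto simp: coeff_eq_0)

text \<open>Evaluation at the shift is multiplicative; only a linear factor is split off at a
  time.\<close>

lemma recurrence_linear_factor:
  "recurrence ([:- r, 1:] * q) y i = recurrence q (\<lambda>i. y (i + 1) - r * y i) i"
proof -
  let ?n = "degree q"
  have d: "degree ([:- r, 1:] * q) \<le> Suc ?n"
    using degree_mult_le[of "[:- r, 1:]" q] by simp
  have c: "coeff ([:- r, 1:] * q) k = coeff (pCons 0 q) k - r * coeff q k" for k by simp
  have 1: "(\<Sum>k\<le>Suc ?n. coeff (pCons 0 q) k * y (i + int k)) = (\<Sum>k\<le>?n. coeff q k * y (i + int k + 1))"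
    by (subst sum.atMost_Suc_shift) (simp add: add_ac)
  have 2: "(\<Sum>k\<le>Suc ?n. r * coeff q k * y (i + int k)) = (\<Sum>k\<le>?n. coeff q k * (r * y (i + int k)))"
    by (simp add: coeff_eq_0 mult_ac)
  have "recurrence ([:- r, 1:] * q) y i =
      (\<Sum>k\<le>Suc ?n. coeff (pCons 0 q) k * y (i + int k)) - (\<Sum>k\<le>Suc ?n. r * coeff q k * y (i + int k))"
    unfolding recurrence_eq[OF d] c by (simp only: left_diff_distrib sum_subtractf)
  also have "\<dots> = recurrence q (\<lambda>i. y (i + 1) - r * y i) i"
    unfolding 1 2 recurrence_def by (simp only: right_diff_distrib sum_subtractf)
  finally show ?thesis .
qed

text \<open>The third assumption expresses decay at both ends. With
  \<open>p = [:- r, 1:] * q\<close>, the sequence \<open>w\<close> still decays and is annihilated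
  by \<open>q\<close>, so it is zero by induction. Then \<open>y\<close> is a two-sided geometric
  sequence with ratio \<open>r\<close>, which fails to decay forwards if
  \<open>cmod r \<ge> 1\<close> and backwards otherwise, unless it is zero.\<close>

lemma recurrence_decay:
  assumes "p \<noteq> 0" "\<And>i. recurrence p y i = 0" "\<And>\<epsilon>. \<epsilon> > 0 \<Longrightarrow> finite {i. \<epsilon> \<le> cmod (y i)}"
  shows "y i = 0"
  using assms
proof (induction "degree p" arbitrary: p y i)
  case 0
  have "coeff p 0 \<noteq> 0" using leading_coeff_neq_0[OF \<open>p \<noteq> 0\<close>] 0(1) by simp
  then show ?case using 0(3)[of i] 0(1) by (simp add: recurrence_def)
next
  case (Suc n)
  have "\<exists>i\<in>{1..degree p}. coeff p i \<noteq> 0"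
    using Suc.hyps(2) Suc.prems(1) by (intro bexI[of _ "degree p"]) auto
  then obtain r where "(\<Sum>i\<le>degree p. coeff p i * r ^ i) = 0"
    using fundamental_theorem_of_algebra[of "coeff p" "degree p"] by blast
  then have "poly p r = 0" by (simp add: poly_altdef)
  then obtain q where q: "p = [:- r, 1:] * q" unfolding poly_eq_0_iff_dvd by (rule dvdE)
  have q0: "q \<noteq> 0" using Suc.prems(1) q by auto
  have "degree p = degree [:- r, 1:] + degree q" unfolding q by (rule degree_mult_eq) (use q0 in auto)
  then have dq: "n = degree q" using Suc.hyps(2) by simp
  define w where "w i = y (i + 1) - r * y i" for i
  have "finite {i. \<epsilon> \<le> cmod (w i)}" if \<epsilon>: "\<epsilon> > 0" for \<epsilon>
  proof (rule finite_subset)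
    define \<delta> where "\<delta> = \<epsilon> / 2 / (cmod r + 1)"
    have rp: "cmod r + 1 > 0" by (simp add: add_nonneg_pos)
    show "{i. \<epsilon> \<le> cmod (w i)} \<subseteq> (\<lambda>i. i - 1) ` {i. \<epsilon> / 2 \<le> cmod (y i)} \<union> {i. \<delta> \<le> cmod (y i)}"
    proof
      fix i assume "i \<in> {i. \<epsilon> \<le> cmod (w i)}"
      then have "\<epsilon> \<le> cmod (y (i + 1)) + cmod r * cmod (y i)"
        using norm_triangle_ineq4[of "y (i + 1)" "r * y i"] by (simp add: w_def norm_mult)
      moreover have "cmod r * cmod (y i) \<le> (cmod r + 1) * cmod (y i)" by (simp add: distrib_right)
      ultimately have "\<epsilon> / 2 \<le> cmod (y (i + 1)) \<or> \<epsilon> / 2 \<le> (cmod r + 1) * cmod (y i)" by linarith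
      moreover have "\<delta> \<le> cmod (y i)" if "\<epsilon> / 2 \<le> (cmod r + 1) * cmod (y i)"
        using that rp by (simp add: \<delta>_def pos_divide_le_eq algebra_simps)
      moreover have "i \<in> (\<lambda>i. i - 1) ` {i. \<epsilon> / 2 \<le> cmod (y i)}" if "\<epsilon> / 2 \<le> cmod (y (i + 1))"
        by (rule image_eqI[of _ _ "i + 1"]) (use that in auto)
      ultimately show "i \<in> (\<lambda>i. i - 1) ` {i. \<epsilon> / 2 \<le> cmod (y i)} \<union> {i. \<delta> \<le> cmod (y i)}" by blast
    qed
    have "\<delta> > 0" using \<epsilon> rp by (simp add: \<delta>_def)
    then show "finite ((\<lambda>i. i - 1) ` {i. \<epsilon> / 2 \<le> cmod (y i)} \<union> {i. \<delta> \<le> cmod (y i)})"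
      using Suc.prems(3)[of \<delta>] Suc.prems(3)[of "\<epsilon> / 2"] \<epsilon> by (intro finite_UnI finite_imageI) auto
  qed
  moreover have "recurrence q w i = 0" for i
    using Suc.prems(2)[of i] unfolding q recurrence_linear_factor w_def .
  ultimately have w: "w i = 0" for i using Suc.hyps(1)[OF dq q0, of w] by blast
  then have step: "y (j + 1) = r * y j" for j by (simp add: w_def)
  have pw: "y (j + int m) = r ^ m * y j" for j m
    by (induction m) (use step in \<open>auto simp: add.assoc[symmetric] add.commute[of 1]\<close>)
  show "y i = 0"
  proof (rule ccontr)
    assume nz: "y i \<noteq> 0"
    have fin: "finite {j. cmod (y i) \<le> cmod (y j)}" using Suc.prems(3) nz by simp
    show False
    proof (cases "cmod r \<ge> 1")
      case True
      have "cmod (y i) \<le> cmod (y (i + int m))" for m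
        using mult_right_mono[OF one_le_power[OF True, of m], of "cmod (y i)"] by (simp add: pw norm_mult norm_power)
      then have "range (\<lambda>m. i + int m) \<subseteq> {j. cmod (y i) \<le> cmod (y j)}" by auto
      then have "finite (range (\<lambda>m. i + int m))" using fin by (rule finite_subset)
      then show False by (subst (asm) finite_image_iff) (auto simp: inj_on_def)
    next
      case False
      have "cmod (y i) \<le> cmod (y (i - int m))" for m
        using mult_right_mono[OF power_le_one[of "cmod r" m], of "cmod (y (i - int m))"] pw[of "i - int m" m] False
        by (simp add: norm_mult norm_power)
      then have "range (\<lambda>m. i - int m) \<subseteq> {j. cmod (y i) \<le> cmod (y j)}" by auto
      then have "finite (range (\<lambda>m. i - int m))" using fin by (rule finite_subset)
      then show False by (subst (asm) finite_image_iff) (auto simp: inj_on_def)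
    qed
  qed
qed

lemma latsum_finite_decay:
  assumes "latsum (\<lambda>k. ennreal ((cmod (F k))\<^sup>2)) < top" "\<epsilon> > 0"
  shows "finite {k. \<epsilon> \<le> cmod (F k)}"
proof (rule ccontr)
  let ?S = "{k. \<epsilon> \<le> cmod (F k)}"
  assume "infinite ?S"
  then have "top = ennreal (\<epsilon>\<^sup>2) * emeasure (count_space UNIV) ?S" using assms(2) by (simp add: ennreal_mult_top)
  also have "\<dots> = latsum (\<lambda>k. ennreal (\<epsilon>\<^sup>2) * indicator ?S k)" by (subst nn_integral_cmult_indicator) auto
  also have "\<dots> \<le> latsum (\<lambda>k. ennreal ((cmod (F k))\<^sup>2))"
    using assms(2) by (intro latsum_mono) (auto split: split_indicator intro!: ennreal_leI power_mono)
  finally show False using assms(1) by simp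
qed

context periodic_setting
begin

text \<open>For almost every \<open>z\<close> in the cell the values of \<open>f\<close> on the
  orbit of \<open>z\<close> are square summable by folding, and along each horizontal row of the
  orbit they satisfy the recurrence with the polynomial whose coefficients are the
  \<open>x i\<close>.\<close>

lemma shift_free:
  assumes f: "f \<in> bergman \<Omega>" and x: "\<exists>i<n. x i \<noteq> 0"
    and eq: "(\<lambda>z. \<Sum>i<n. x i * (shift (1, 0) ^^ i) f z) = (\<lambda>z. 0)"
  shows "f = (\<lambda>z. 0)"
proof -
  have U: "(shift (1, 0) ^^ i) f = shift (int i, 0) f" for i
  proof (induction i)
    case (Suc i)
    then show ?case by (simp add: shift_shift)
  qed (simp flip: zero_prod_def)
  define p where "p = Poly (map x [0..<n])"
  have c: "coeff p k = (if k < n then x k else 0)" for k by (simp add: p_def coeff_Poly_eq nth_default_def)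
  have p0: "p \<noteq> 0" using x c by (metis coeff_0)
  have dp: "degree p \<le> n" by (rule degree_le) (auto simp: c)
  have rec: "recurrence p (\<lambda>m. f (z + lat (m, j))) i = 0" for z j i
  proof -
    have "recurrence p (\<lambda>m. f (z + lat (m, j))) i = (\<Sum>k<n. x k * f (z + lat (i + int k, j)))"
      unfolding recurrence_eq[OF dp] by (rule sum.mono_neutral_cong_right) (auto simp: c)
    also have "\<dots> = (\<Sum>k<n. x k * (shift (1, 0) ^^ k) f (z + lat (i, j)))"
      unfolding U shift_def by (intro sum.cong refl arg_cong2[of _ _ _ _ "(*)"] arg_cong[of _ _ f])
        (simp flip: lat_add add: add.assoc)
    also have "\<dots> = 0" using fun_cong[OF eq] .
    finally show ?thesis .
  qed
  have fm: "f \<in> borel_measurable (lebesgue_on \<Omega>)" by (rule bergman_meas[OF f])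
  have fm2: "(\<lambda>z. ennreal ((cmod (f z))\<^sup>2)) \<in> borel_measurable (lebesgue_on \<Omega>)" using fm by measurable
  define S where "S z = latsum (\<lambda>k. ennreal ((cmod (f (z + lat k)))\<^sup>2))" for z
  have fold: "sqint \<Omega> f = (\<integral>\<^sup>+z. S z \<partial>lebesgue_on W)"
    unfolding sqint_def S_def by (rule nn_fold'[OF fm2])
  have fm3: "(\<lambda>z. ennreal ((cmod (f (z + lat k)))\<^sup>2)) \<in> borel_measurable (lebesgue_on W)" for k
    using measurable_compose[OF measurable_shift_cell fm2] .
  have Sm: "S \<in> borel_measurable (lebesgue_on W)"
    unfolding S_def by (rule borel_measurable_latsum[OF fm3])
  have "(\<integral>\<^sup>+z. S z \<partial>lebesgue_on W) \<noteq> \<infinity>"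
    unfolding fold[symmetric] sqint_eq_L2_norm[OF A.in_L2[OF f]] by simp
  then have "AE z in lebesgue_on W. S z \<noteq> \<infinity>" by (rule nn_integral_noteq_infinite[OF Sm])
  then have "AE z in lebesgue_on W. S z = 0"
  proof (rule AE_mp, intro AE_I2 impI)
    fix z assume "S z \<noteq> \<infinity>"
    then have S: "S z < top" by (simp add: top.not_eq_extremum)
    have "f (z + lat (i, j)) = 0" for i j
    proof (rule recurrence_decay[OF p0 rec, where i = i])
      fix \<epsilon> :: real assume "\<epsilon> > 0"
      then have "finite {k. \<epsilon> \<le> cmod (f (z + lat k))}" using S unfolding S_def by (intro latsum_finite_decay)
      then have "finite (fst ` {k. \<epsilon> \<le> cmod (f (z + lat k))})" by (rule finite_imageI)
      then show "finite {i. \<epsilon> \<le> cmod (f (z + lat (i, j)))}" by (rule rev_finite_subset) force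
    qed
    then show "S z = 0" unfolding S_def by (auto simp: nn_integral_0_iff_AE AE_count_space)
  qed
  then have "sqint \<Omega> f = 0" unfolding fold using Sm by (simp add: nn_integral_0_iff_AE)
  then have "L2_norm \<Omega> f = 0" using sqint_eq_L2_norm[OF A.in_L2[OF f]] by (simp add: ennreal_eq_0_iff)
  then show ?thesis using A.definite[OF f] by blast
qed

end

section \<open>The spectra\<close>

lemma spectrum_on_cong:
  assumes "\<And>f. f \<in> H \<Longrightarrow> T f = T' f"
  shows "spectrum_on H N T = spectrum_on H N T'"
proof -
  have "(\<forall>f\<in>H. S (shifted T \<mu> f) = f \<and> shifted T \<mu> (S f) = f) \<longleftrightarrow>
    (\<forall>f\<in>H. S (shifted T' \<mu> f) = f \<and> shifted T' \<mu> (S f) = f)" if "bounded_operator_on H N S" for S \<mu>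
  proof (rule ball_cong[OF refl])
    fix f assume f: "f \<in> H"
    then have "S f \<in> H" using that by (auto simp: bounded_operator_on_def)
    then show "(S (shifted T \<mu> f) = f \<and> shifted T \<mu> (S f) = f) \<longleftrightarrow> (S (shifted T' \<mu> f) = f \<and> shifted T' \<mu> (S f) = f)"
      using f assms by (simp add: shifted_def)
  qed
  then show ?thesis unfolding spectrum_on_def by blast
qed

lemma ess_spectrum_on_cong:
  assumes "\<And>f. f \<in> H \<Longrightarrow> T f = T' f"
  shows "ess_spectrum_on H N T = ess_spectrum_on H N T'"
proof -
  have s: "shifted T \<mu> f = shifted T' \<mu> f" if "f \<in> H" for f \<mu> using assms[OF that] by (simp add: shifted_def)
  have i: "shifted T \<mu> ` H = shifted T' \<mu> ` H" for \<mu> by (rule image_cong[OF refl s])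
  have "fredholm_on H N (shifted T \<mu>) = fredholm_on H N (shifted T' \<mu>)" for \<mu>
    unfolding fredholm_on_def i by (simp only: s cong: ball_cong bex_cong)
  then show ?thesis by (simp add: ess_spectrum_on_def)
qed

lemma toeplitz_cong_AE:
  assumes H: "H \<subseteq> L2 D" and f: "f \<in> L2 D"
    and a: "a \<in> borel_measurable (lebesgue_on D)" "a' \<in> borel_measurable (lebesgue_on D)"
    and eq: "AE z in lebesgue_on D. a z = a' z"
  shows "toeplitz D H a f = toeplitz D H a' f"
proof -
  have "L2_inner D (\<lambda>z. a z * f z - g z) k = L2_inner D (\<lambda>z. a' z * f z - g z) k" if "g \<in> H" "k \<in> H" for g k
  proof -
    have m: "f \<in> borel_measurable (lebesgue_on D)" "g \<in> borel_measurable (lebesgue_on D)" "k \<in> borel_measurable (lebesgue_on D)"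
      using H f that L2_measurable by blast+
    have c: "(\<lambda>z. cnj (k z)) \<in> borel_measurable (lebesgue_on D)"
      using m(3) by (intro borel_measurable_continuous_on[where f = cnj] continuous_intros)
    show ?thesis unfolding L2_inner_def
    proof (rule integral_cong_AE)
      show "AE z in lebesgue_on D. (a z * f z - g z) * cnj (k z) = (a' z * f z - g z) * cnj (k z)"
        using eq by eventually_elim simp
    qed (intro borel_measurable_times borel_measurable_diff m a c)+
  qed
  then have "(\<lambda>g. g \<in> H \<and> (\<forall>k\<in>H. L2_inner D (\<lambda>z. a z * f z - g z) k = 0)) =
      (\<lambda>g. g \<in> H \<and> (\<forall>k\<in>H. L2_inner D (\<lambda>z. a' z * f z - g z) k = 0))"
    by (intro ext) auto
  then show ?thesis unfolding toeplitz_def orth_proj_def by simp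
qed

lemma lat_invariant:
  assumes "\<And>k. F (k + (1, 0)) = F k" "\<And>k. F (k + (0, 1)) = (F k :: 'a)"
  shows "F k = F (0 :: int \<times> int)"
proof -
  have "F (i, j) = F (0, j)" for i j
  proof (induction i rule: int_induct[where k = 0])
    case (step1 i)
    then show ?case using assms(1)[of "(i, j)"] by simp
  next
    case (step2 i)
    then show ?case using assms(1)[of "(i - 1, j)"] by simp
  qed simp
  moreover have "F (0, j) = F (0, 0)" for j
  proof (induction j rule: int_induct[where k = 0])
    case (step1 j)
    then show ?case using assms(2)[of "(0, j)"] by simp
  next
    case (step2 j)
    then show ?case using assms(2)[of "(0, j - 1)"] by simp
  qed simp
  ultimately show ?thesis by (cases k) (metis zero_prod_def)
qed

section \<open>Replacement of the symbol by a periodic representative\<close>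

context periodic_setting
begin

text \<open>The set \<open>G\<close> of points all of whose translates are good for \<open>a\<close>
  is lattice invariant, and it has full measure as a countable intersection. Setting
  \<open>a\<close> to zero off \<open>G\<close> makes boundedness and periodicity hold at every
  point.\<close>

lemma periodic_representative:
  assumes a: "a \<in> Linfty \<Omega>" "AE z in lebesgue_on \<Omega>. a z = a (z + 1) \<and> a z = a (z + \<i>)"
  shows "\<exists>a' \<beta>. a' \<in> borel_measurable (lebesgue_on \<Omega>) \<and> (\<forall>z. cmod (a' z) \<le> \<beta>) \<and>
    (\<forall>z k. a' (z + lat k) = a' z) \<and> (AE z in lebesgue_on \<Omega>. a z = a' z)"
proof -
  obtain C where am: "a \<in> borel_measurable (lebesgue_on \<Omega>)" and C: "AE z in lebesgue_on \<Omega>. cmod (a z) \<le> C"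
    using a(1) by (auto simp: Linfty_def)
  have l1: "lat (1, 0) = 1" "lat (0, 1) = \<i>" by (simp_all add: lat_def complex_eq_iff)
  define P where "P z \<longleftrightarrow> cmod (a z) \<le> C \<and> a (z + lat (1, 0)) = a z \<and> a (z + lat (0, 1)) = a z" for z
  define G where "G = {z \<in> \<Omega>. \<forall>k. P (z + lat k)}"
  define a' where "a' z = (if z \<in> G then a z else 0)" for z
  have P: "AE z in lebesgue_on \<Omega>. P z"
    using a(2) C by eventually_elim (metis P_def l1)
  have "AE z in lebesgue_on \<Omega>. P (z + lat k)" for k
    using AE_distrD[OF measurable_\<Omega>_shift, of P k] P unfolding distr_\<Omega>_shift by blast
  then have "AE z in lebesgue_on \<Omega>. \<forall>k. P (z + lat k)" by (simp add: AE_all_countable)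
  then have eq: "AE z in lebesgue_on \<Omega>. a z = a' z"
    by (rule AE_mp) (auto simp: a'_def G_def intro!: AE_I2)
  have sm: "(\<lambda>z. a (z + lat k)) \<in> borel_measurable (lebesgue_on \<Omega>)" for k by (rule shift_measurable[OF am])
  have "{z \<in> space (lebesgue_on \<Omega>). P (z + lat k)} \<in> sets (lebesgue_on \<Omega>)" for k
    unfolding P_def add.assoc lat_add[symmetric] using sm by measurable
  then have "{z \<in> space (lebesgue_on \<Omega>). \<forall>k. P (z + lat k)} \<in> sets (lebesgue_on \<Omega>)"
    by (rule sets.sets_Collect_countable_All)
  then have Gs: "G \<in> sets (lebesgue_on \<Omega>)" by (simp add: G_def)
  have a'm: "a' \<in> borel_measurable (lebesgue_on \<Omega>)"
    unfolding a'_def[abs_def] using am Gs by (intro measurable_If_set) auto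
  have G: "z + lat k \<in> G \<longleftrightarrow> z \<in> G" for z k
  proof -
    have "(\<forall>l. P (z + lat k + lat l)) \<longleftrightarrow> (\<forall>l. P (z + lat l))"
    proof
      assume "\<forall>l. P (z + lat k + lat l)"
      then have "P (z + lat k + lat (l - k))" for l by blast
      then show "\<forall>l. P (z + lat l)" by (simp add: add.assoc flip: lat_add)
    next
      assume "\<forall>l. P (z + lat l)"
      then have "P (z + lat (k + l))" for l by blast
      then show "\<forall>l. P (z + lat k + lat l)" by (simp add: lat_add add.assoc)
    qed
    then show ?thesis by (simp add: G_def)
  qed
  have "a (z + lat k) = a z" if "z \<in> G" for z k
  proof -
    have P: "P (z + lat k)" for k using that unfolding G_def by blast
    have "a (z + lat k) = a (z + lat 0)"
    proof (rule lat_invariant)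
      show "a (z + lat (k + (1, 0))) = a (z + lat k)" "a (z + lat (k + (0, 1))) = a (z + lat k)" for k
        using P[of k] unfolding P_def lat_add add.assoc by auto
    qed
    then show ?thesis by simp
  qed
  then have per: "a' (z + lat k) = a' z" for z k by (simp add: a'_def G)
  have "cmod (a' z) \<le> \<bar>C\<bar>" for z
  proof (cases "z \<in> G")
    case True
    then have "P (z + lat 0)" unfolding G_def by blast
    then show ?thesis using abs_ge_self[of C] by (simp add: a'_def P_def True)
  qed (simp add: a'_def)
  then show ?thesis using a'm per eq by blast
qed

end

context toeplitz_setting
begin

text \<open>The locale is instantiated a second time with the conjugate symbol and the conjugate
  spectral parameter, so the equivalence of lower bounds between domain and cell is available for
  the operators and for their adjoints.\<close>

lemma
  shows spectrum_decomposition: "\<mu> \<notin> spectrum_on (bergman \<Omega>) (L2_norm \<Omega>) (toeplitz \<Omega> (bergman \<Omega>) a) \<longleftrightarrow>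
      (\<forall>\<eta>\<in>{-pi..pi} \<times> {-pi..pi}. \<mu> \<notin> spectrum_on (bergman_eta W \<eta>) (L2_norm W) (toeplitz W (bergman_eta W \<eta>) a))"
    and fredholm_iff_not_spectrum: "fredholm_on (bergman \<Omega>) (L2_norm \<Omega>) V \<longleftrightarrow>
      \<mu> \<notin> spectrum_on (bergman \<Omega>) (L2_norm \<Omega>) (toeplitz \<Omega> (bergman \<Omega>) a)"
proof -
  have cm: "(\<lambda>z. cnj (a z)) \<in> borel_measurable (lebesgue_on \<Omega>)"
    using a_meas by (intro borel_measurable_continuous_on[where f = cnj] continuous_intros)
  interpret C: toeplitz_setting W \<Omega> \<theta> h "\<lambda>z. cnj (a z)" \<beta> "cnj \<mu>"
    by unfold_locales (use cm a_bound a_periodic in auto)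
  have C: "C.V = shifted (toeplitz \<Omega> (bergman \<Omega>) (\<lambda>z. cnj (a z))) (cnj \<mu>)" by (rule C.V_def)
  show "\<mu> \<notin> spectrum_on (bergman \<Omega>) (L2_norm \<Omega>) (toeplitz \<Omega> (bergman \<Omega>) a) \<longleftrightarrow>
      (\<forall>\<eta>\<in>{-pi..pi} \<times> {-pi..pi}. \<mu> \<notin> spectrum_on (bergman_eta W \<eta>) (L2_norm W) (toeplitz W (bergman_eta W \<eta>) a))"
    unfolding TA.not_in_spectrum_iff TE.not_in_spectrum_iff
    using bounded_below_iff C.bounded_below_iff unfolding V_def C.V_def V_eta_def C.V_eta_def by blast
  show "fredholm_on (bergman \<Omega>) (L2_norm \<Omega>) V \<longleftrightarrow>
      \<mu> \<notin> spectrum_on (bergman \<Omega>) (L2_norm \<Omega>) (toeplitz \<Omega> (bergman \<Omega>) a)"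
  proof
    assume "fredholm_on (bergman \<Omega>) (L2_norm \<Omega>) V"
    then have "bounded_below_on (bergman \<Omega>) (L2_norm \<Omega>) V \<and> bounded_below_on (bergman \<Omega>) (L2_norm \<Omega>) C.V"
      unfolding C
    proof (rule TA_pair.fredholm_imp_bounded_below[where U = "shift (1, 0)"])
      show "shift (1, 0) (\<lambda>z. 0) = (\<lambda>z. 0)" by (simp add: shift_def fun_eq_iff)
      show "f = (\<lambda>z. 0)" if "f \<in> bergman \<Omega>" "\<exists>i<n. x i \<noteq> 0" "(\<lambda>z. \<Sum>i<n. x i * (shift (1, 0) ^^ i) f z) = (\<lambda>z. 0)" for f n x
        by (rule shift_free[OF that])
      show "shifted (toeplitz \<Omega> (bergman \<Omega>) (\<lambda>z. cnj (a z))) (cnj \<mu>) (shift (1, 0) f) =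
        shift (1, 0) (shifted (toeplitz \<Omega> (bergman \<Omega>) (\<lambda>z. cnj (a z))) (cnj \<mu>) f)" if "f \<in> bergman \<Omega>" for f
        using C.V_shift[OF that] unfolding C .
    qed (simp_all only: bergman_shift V_shift)
    then show "\<mu> \<notin> spectrum_on (bergman \<Omega>) (L2_norm \<Omega>) (toeplitz \<Omega> (bergman \<Omega>) a)"
      unfolding TA.not_in_spectrum_iff V_def C.V_def .
  next
    assume "\<mu> \<notin> spectrum_on (bergman \<Omega>) (L2_norm \<Omega>) (toeplitz \<Omega> (bergman \<Omega>) a)"
    then obtain S where "bounded_operator_on (bergman \<Omega>) (L2_norm \<Omega>) S" "\<And>f. f \<in> bergman \<Omega> \<Longrightarrow> S (V f) = f \<and> V (S f) = f"
      unfolding spectrum_on_def V_def by blast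
    then show "fredholm_on (bergman \<Omega>) (L2_norm \<Omega>) V" by (rule TA_pair.inverse_imp_fredholm)
  qed
qed

end

theorem theorem5p1:
  fixes W \<Omega> :: "complex set" and a :: "complex \<Rightarrow> complex"
  assumes "periodic_cell W"
    and "\<Omega> = periodic_domain W"
    and "assumption_A W"
    and "negligible (frontier W \<inter> \<Omega>)"
    and "a \<in> Linfty \<Omega>"
    and "AE z in lebesgue_on \<Omega>. a z = a (z + 1) \<and> a z = a (z + \<i>)"
  shows "toeplitz_ess_spectrum \<Omega> a = (\<Union>\<eta>\<in>{-pi..pi} \<times> {-pi..pi}. toeplitz_eta_spectrum W \<eta> a) \<and>
         toeplitz_spectrum \<Omega> a = toeplitz_ess_spectrum \<Omega> a"
proof -
  interpret periodic_setting W \<Omega> by (rule periodic_setting.intro) (use assms in auto)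
  obtain \<theta> where \<theta>: "\<theta> holomorphic_on \<Omega>"
    "\<And>R. \<exists>h. (\<forall>k. 0 \<le> h k) \<and> h summable_on UNIV \<and> (\<forall>z\<in>\<Omega>. cmod z \<le> R \<longrightarrow> (\<forall>k. cmod (\<theta> (z + lat k)) \<le> h k))"
    "\<And>z. z \<in> \<Omega> \<Longrightarrow> ((\<lambda>k. \<theta> (z + lat k)) has_sum 1) UNIV"
    using analytic_cutoff[OF assms(3)] by blast
  obtain h where h: "\<forall>k. 0 \<le> h k" "h summable_on UNIV" "\<forall>z\<in>\<Omega>. cmod z \<le> 2 \<longrightarrow> (\<forall>k. cmod (\<theta> (z + lat k)) \<le> h k)"
    using \<theta>(2)[of 2] by blast
  have W2: "cmod z \<le> 2" if "z \<in> W" for z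
  proof -
    have "0 < Re z" "Re z < 1" "0 < Im z" "Im z < 1" using that W_cell by (auto simp: unit_cell_def)
    then show ?thesis using cmod_le[of z] by linarith
  qed
  have hW: "cmod (\<theta> (z + lat k)) \<le> h k" if "z \<in> W" for z k using h(3) W_sub W2[OF that] that by blast
  obtain a' \<beta> where a': "a' \<in> borel_measurable (lebesgue_on \<Omega>)" "\<And>z. cmod (a' z) \<le> \<beta>"
    "\<And>z k. a' (z + lat k) = a' z" and eq: "AE z in lebesgue_on \<Omega>. a z = a' z"
    using periodic_representative[OF assms(5,6)] by blast
  have am: "a \<in> borel_measurable (lebesgue_on \<Omega>)" using assms(5) by (simp add: Linfty_def)
  have eqW: "AE z in lebesgue_on W. a z = a' z"
    using eq W_sub by (auto simp: AE_restrict_space_iff elim!: AE_mp)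
  have T: "toeplitz \<Omega> (bergman \<Omega>) a f = toeplitz \<Omega> (bergman \<Omega>) a' f" if "f \<in> bergman \<Omega>" for f
    by (rule toeplitz_cong_AE[OF A.sub A.in_L2[OF that] am a'(1) eq])
  have T_eta: "toeplitz W (bergman_eta W \<eta>) a f = toeplitz W (bergman_eta W \<eta>) a' f" if "f \<in> bergman_eta W \<eta>" for \<eta> f
    by (rule toeplitz_cong_AE[OF A_eta.sub A_eta.in_L2[OF that] measurable_W[OF am] measurable_W[OF a'(1)] eqW])
  have s: "toeplitz_spectrum \<Omega> a = spectrum_on (bergman \<Omega>) (L2_norm \<Omega>) (toeplitz \<Omega> (bergman \<Omega>) a')"
    unfolding toeplitz_spectrum_def by (rule spectrum_on_cong[OF T])
  have e: "toeplitz_ess_spectrum \<Omega> a = ess_spectrum_on (bergman \<Omega>) (L2_norm \<Omega>) (toeplitz \<Omega> (bergman \<Omega>) a')"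
    unfolding toeplitz_ess_spectrum_def by (rule ess_spectrum_on_cong[OF T])
  have s_eta: "toeplitz_eta_spectrum W \<eta> a = spectrum_on (bergman_eta W \<eta>) (L2_norm W) (toeplitz W (bergman_eta W \<eta>) a')" for \<eta>
    unfolding toeplitz_eta_spectrum_def by (rule spectrum_on_cong[OF T_eta])
  have "(\<mu> \<notin> toeplitz_spectrum \<Omega> a \<longleftrightarrow> (\<forall>\<eta>\<in>{-pi..pi} \<times> {-pi..pi}. \<mu> \<notin> toeplitz_eta_spectrum W \<eta> a)) \<and>
    (\<mu> \<notin> toeplitz_ess_spectrum \<Omega> a \<longleftrightarrow> \<mu> \<notin> toeplitz_spectrum \<Omega> a)" for \<mu>
  proof -
    interpret cutoff_setting W \<Omega> \<theta> h by unfold_locales (use \<theta> h hW in auto)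
    \<comment> \<open>The spectral value is a parameter of the locale, hence one interpretation for
      each \<open>\<mu>\<close>, while the cutoff and the symbol \<open>a'\<close> are fixed in
      advance.\<close>
    interpret toeplitz_setting W \<Omega> \<theta> h a' \<beta> \<mu> by unfold_locales (use a' in auto)
    show ?thesis
      using spectrum_decomposition fredholm_iff_not_spectrum unfolding s e s_eta V_def ess_spectrum_on_def by blast
  qed
  then show ?thesis by blast
qed

end
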